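(* Let $E$ be a sequentially complete locally convex Hausdorff space over $\mathbb{C}$. (a) For every $f\in\mathcal{O}^{exp}(\overline{\mathbb{C}}\setminus\overline{\mathbb{R}},E)$ the nets $(R_{t,t'}(f))$, $(R^+_t(f))$ and $(R^-_t(f))$ converge to $R(f)$, $R^+(f)$ and $R^-(f)$, respectively, in $L_b(\mathcal{P}_*(\overline{\mathbb{R}}),E)$ (as $t,t'\searrow0$, resp. $t\searrow0$), and $$R(f)=R^+(f)-R^-(f)=-H_{\overline{\mathbb{R}}}([f]).$$ (b) The map $[f]\mapsto R(f)$ from $\mathcal{O}^{exp}(\overline{\mathbb{C}}\setminus\overline{\mathbb{R}},E)/\mathcal{O}^{exp}(\overline{\mathbb{C}},E)$ to $L_b(\mathcal{P}_*(\overline{\mathbb{R}}),E)$ is a topological isomorphism.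
   Context: $(p_\alpha)_{\alpha\in\mathfrak{A}}$ is a directed fundamental system of seminorms of $E$. $\overline{\mathbb{R}}=\mathbb{R}\cup\{\pm\infty\}$, $\overline{\mathbb{C}}=\overline{\mathbb{R}}+\mathrm{i}\mathbb{R}$. $\mathcal{O}^{exp}(\overline{\mathbb{C}}\setminus\overline{\mathbb{R}},E)$ is the space of holomorphic $f\colon\mathbb{C}\setminus\mathbb{R}\to E$ with $|f|_{\overline{\mathbb{R}},n,\alpha}=\sup_{1/n<|\operatorname{Im}z|<n}p_\alpha(f(z))e^{-|\operatorname{Re}z|/n}<\infty$ for all integers $n\ge2$ and all $\alpha$, topologized by these seminorms. $\mathcal{O}^{exp}(\overline{\mathbb{C}},E)$ is the space of holomorphic $f\colon\mathbb{C}\to E$ with $\sup_{|\operatorname{Im}z|<n}p_\alpha(f(z))e^{-|\operatorname{Re}z|/n}<\infty$ for all $n\ge2$, $\alpha$. The quotient carries the quotient topology. $U_n(\overline{\mathbb{R}})=\{z\in\mathbb{C}\mid|\operatorname{Im}z|<1/n\}$; $\mathcal{O}_n(\overline{U_n(\overline{\mathbb{R}})})$ is the Banach space of scalar functions $\varphi$ holomorphic on $U_n(\overline{\mathbb{R}})$, continuous on its closure, with $\|\varphi\|_{\overline{\mathbb{R}},n}=\sup_{|\operatorname{Im}z|\le1/n}|\varphi(z)|e^{|\operatorname{Re}z|/n}<\infty$; $\mathcal{P}_*(\overline{\mathbb{R}})=\varinjlim_n\mathcal{O}_n(\overline{U_n(\overline{\mathbb{R}})})$ (locally convex inductive limit along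 restrictions, a DFS-space). $L_b(F,E)$ is the space of continuous linear maps $F\to E$ with the topology of uniform convergence on bounded sets. For $f\in\mathcal{O}^{exp}(\overline{\mathbb{C}}\setminus\overline{\mathbb{R}},E)$, $\varphi\in\mathcal{P}_*(\overline{\mathbb{R}})$, $t,t'>0$ define by Pettis integrals $$\langle R_{t,t'}(f),\varphi\rangle=\int_{\mathbb{R}}(f(x+\mathrm{i}t)-f(x-\mathrm{i}t'))\varphi(x)\,dx,\qquad\langle R^{\pm}_t(f),\varphi\rangle=\int_{\mathbb{R}}f(x\pm\mathrm{i}t)\varphi(x)\,dx,$$ and $\langle R(f),\varphi\rangle=\lim_{t,t'\searrow0}\langle R_{t,t'}(f),\varphi\rangle$, $\langle R^\pm(f),\varphi\rangle=\lim_{t\searrow0}\langle R^\pm_t(f),\varphi\rangle$, if the limits exist in $E$. $H_{\overline{\mathbb{R}}}\colon\mathcal{O}^{exp}(\overline{\mathbb{C}}\setminus\overline{\mathbb{R}},E)/\mathcal{O}^{exp}(\overline{\mathbb{C}},E)\to L_b(\mathcal{P}_*(\overline{\mathbb{R}}),E)$ is the map $H_{\overline{\mathbb{R}}}([f])(\varphi)=\int_\gamma f(\zeta)\varphi(\zeta)\,d\zeta$ (Pettis integral), where for $\varphi\in\mathcal{O}_n(\overline{U_n(\overline{\mathbb{R}})})$ the path $\gamma$ consists of the line $\mathbb{R}-\mathrm{i}t$ traversed from left to right and the line $\mathbb{R}+\mathrm{i}t$ traversed from right to left, $0<t<\frac1n$; i.e. $H_{\overline{\mathbb{R}}}([f])(\varphi)=\int_{\mathbb{R}}f(x-\mathrm{i}t)\varphi(x-\mathrm{i}t)\,dx-\int_{\mathbb{R}}f(x+\mathrm{i}t)\varphi(x+\mathrm{i}t)\,dx$,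 independently of $t$. *)

theory Defs
  imports
    "HOL-Analysis.Analysis"
    "HOL-Library.Function_Algebras"
    "HOL-Library.Set_Algebras"
begin

section \<open>Locally convex spaces\<close>

text \<open>
  A locally convex Hausdorff space over the complex numbers is a type \<open>'e\<close> of sort
  \<open>{ab_group_add,t2_space}\<close> with a scalar multiplication \<open>sc\<close> such that \<open>vector_space sc\<close> holds, and
  with a directed fundamental system \<open>p\<close> of seminorms for the topology of the type.
\<close>

definition seminorm :: "(complex \<Rightarrow> 'v \<Rightarrow> 'v) \<Rightarrow> ('v::ab_group_add \<Rightarrow> real) \<Rightarrow> bool" where
  "seminorm sc q \<longleftrightarrow>
     (\<forall>x y. q (x + y) \<le> q x + q y) \<and> (\<forall>c x. q (sc c x) = cmod c * q x)"

definition directed_fundamental_system ::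
  "(complex \<Rightarrow> 'e \<Rightarrow> 'e) \<Rightarrow> ('i \<Rightarrow> 'e::{ab_group_add,topological_space} \<Rightarrow> real) \<Rightarrow> bool" where
  "directed_fundamental_system sc p \<longleftrightarrow>
     (\<forall>\<alpha>. seminorm sc (p \<alpha>)) \<and>
     (\<forall>\<alpha> \<beta>. \<exists>\<gamma> C. \<forall>x. max (p \<alpha> x) (p \<beta> x) \<le> C * p \<gamma> x) \<and>
     (\<forall>U. open U \<longleftrightarrow> (\<forall>x\<in>U. \<exists>\<alpha>. \<exists>\<epsilon>>0. {y. p \<alpha> (y - x) < \<epsilon>} \<subseteq> U))"

definition sequentially_complete :: "'e::{ab_group_add,topological_space} itself \<Rightarrow> bool" where
  "sequentially_complete _ \<longleftrightarrow>
     (\<forall>X :: nat \<Rightarrow> 'e.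
        (\<forall>U. open U \<and> 0 \<in> U \<longrightarrow> (\<exists>N. \<forall>m\<ge>N. \<forall>n\<ge>N. X m - X n \<in> U)) \<longrightarrow> convergent X)"

definition tvs_bounded ::
  "(complex \<Rightarrow> 'v \<Rightarrow> 'v) \<Rightarrow> 'v::{ab_group_add,topological_space} set \<Rightarrow> bool" where
  "tvs_bounded sc B \<longleftrightarrow>
     (\<forall>U. open U \<and> 0 \<in> U \<longrightarrow> (\<exists>r>0. \<forall>c. cmod c \<ge> r \<longrightarrow> B \<subseteq> sc c ` U))"

definition continuous_linear_maps ::
  "(complex \<Rightarrow> 'v \<Rightarrow> 'v) \<Rightarrow> (complex \<Rightarrow> 'w \<Rightarrow> 'w) \<Rightarrow>
   ('v::{ab_group_add,topological_space} \<Rightarrow> 'w::{ab_group_add,topological_space}) set" where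
  "continuous_linear_maps s1 s2 = {T. Vector_Spaces.linear s1 s2 T \<and> continuous_on UNIV T}"

text \<open>
  The topology on a linear subspace \<open>V\<close> of an ambient type that is generated by a (not necessarily
  directed) family \<open>P\<close> of seminorms on \<open>V\<close>.
\<close>

definition seminorm_topology :: "'v::ab_group_add set \<Rightarrow> ('v \<Rightarrow> real) set \<Rightarrow> 'v topology" where
  "seminorm_topology V P = topology (\<lambda>U. U \<subseteq> V \<and>
     (\<forall>x\<in>U. \<exists>F \<epsilon>. finite F \<and> F \<subseteq> P \<and> \<epsilon> > 0 \<and> {y\<in>V. \<forall>q\<in>F. q (y - x) < \<epsilon>} \<subseteq> U))"

lemma openin_seminorm_topology:
  "openin (seminorm_topology V P) U \<longleftrightarrow> U \<subseteq> V \<and>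
     (\<forall>x\<in>U. \<exists>F \<epsilon>. finite F \<and> F \<subseteq> P \<and> \<epsilon> > 0 \<and> {y\<in>V. \<forall>q\<in>F. q (y - x) < \<epsilon>} \<subseteq> U)"
proof -
  define N where
    "N = (\<lambda>x U. \<exists>F \<epsilon>. finite F \<and> F \<subseteq> P \<and> \<epsilon> > 0 \<and> {y\<in>V. \<forall>q\<in>F. q (y - x) < \<epsilon>} \<subseteq> U)"
  have N_mono: "N x T" if "N x S" "S \<subseteq> T" for x S T
    using that unfolding N_def by (meson order_trans)
  have N_Int: "N x (S \<inter> T)" if "N x S" "N x T" for x S T
  proof -
    obtain F e where F: "finite F" "F \<subseteq> P" "e > 0" "{y\<in>V. \<forall>q\<in>F. q (y - x) < e} \<subseteq> S"
      using \<open>N x S\<close> unfolding N_def by (elim exE conjE)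
    obtain G d where G: "finite G" "G \<subseteq> P" "d > 0" "{y\<in>V. \<forall>q\<in>G. q (y - x) < d} \<subseteq> T"
      using \<open>N x T\<close> unfolding N_def by (elim exE conjE)
    have "{y\<in>V. \<forall>q\<in>F \<union> G. q (y - x) < min e d} \<subseteq>
        {y\<in>V. \<forall>q\<in>F. q (y - x) < e} \<inter> {y\<in>V. \<forall>q\<in>G. q (y - x) < d}"
      by auto
    also have "\<dots> \<subseteq> S \<inter> T"
      by (rule Int_mono[OF F(4) G(4)])
    finally show ?thesis
      unfolding N_def using F(1-3) G(1-3)
      by (intro exI[of _ "F \<union> G"] exI[of _ "min e d"]) simp
  qed
  have "istopology (\<lambda>U. U \<subseteq> V \<and> (\<forall>x\<in>U. N x U))"
    unfolding istopology_def
  proof (rule conjI; intro allI impI)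
    fix S T assume S: "S \<subseteq> V \<and> (\<forall>x\<in>S. N x S)" and T: "T \<subseteq> V \<and> (\<forall>x\<in>T. N x T)"
    show "S \<inter> T \<subseteq> V \<and> (\<forall>x\<in>S \<inter> T. N x (S \<inter> T))"
    proof (intro conjI ballI)
      show "S \<inter> T \<subseteq> V" using S by blast
      show "N x (S \<inter> T)" if "x \<in> S \<inter> T" for x
        using that S T by (intro N_Int) simp_all
    qed
  next
    fix K assume K: "\<forall>S\<in>K. S \<subseteq> V \<and> (\<forall>x\<in>S. N x S)"
    show "\<Union>K \<subseteq> V \<and> (\<forall>x\<in>\<Union>K. N x (\<Union>K))"
    proof (intro conjI ballI)
      show "\<Union>K \<subseteq> V" using K by blast
      fix x assume "x \<in> \<Union>K"
      then obtain S where "S \<in> K" "x \<in> S" by (rule UnionE)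
      then show "N x (\<Union>K)" using K by (intro N_mono[of x S "\<Union>K"] Union_upper) simp_all
    qed
  qed
  then show ?thesis
    unfolding seminorm_topology_def N_def by simp
qed

lemma topspace_seminorm_topology [simp]: "topspace (seminorm_topology V P) = V"
proof (rule antisym)
  show "topspace (seminorm_topology V P) \<subseteq> V"
    using openin_topspace[of "seminorm_topology V P"]
    unfolding openin_seminorm_topology by (rule conjunct1)
  have "openin (seminorm_topology V P) V"
    unfolding openin_seminorm_topology
    by (intro conjI ballI exI[of _ "{}"] exI[of _ "1::real"]) simp_all
  then show "V \<subseteq> topspace (seminorm_topology V P)" by (rule openin_subset)
qed

text \<open>The finest topology on the image \<open>h ` topspace X\<close> making \<open>h\<close> continuous.\<close>

definition quotient_topology :: "'a topology \<Rightarrow> ('a \<Rightarrow> 'b) \<Rightarrow> 'b topology" where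
  "quotient_topology X h =
     topology (\<lambda>U. U \<subseteq> h ` topspace X \<and> openin X {x \<in> topspace X. h x \<in> U})"

lemma openin_quotient_topology:
  "openin (quotient_topology X h) U \<longleftrightarrow>
     U \<subseteq> h ` topspace X \<and> openin X {x \<in> topspace X. h x \<in> U}"
proof -
  have "istopology (\<lambda>U. U \<subseteq> h ` topspace X \<and> openin X {x \<in> topspace X. h x \<in> U})"
    unfolding istopology_def
  proof (rule conjI; intro allI impI)
    fix S T
    assume "S \<subseteq> h ` topspace X \<and> openin X {x \<in> topspace X. h x \<in> S}"
      and "T \<subseteq> h ` topspace X \<and> openin X {x \<in> topspace X. h x \<in> T}"
    moreover have "{x \<in> topspace X. h x \<in> S \<inter> T} =
        {x \<in> topspace X. h x \<in> S} \<inter> {x \<in> topspace X. h x \<in> T}" by blast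
    ultimately show "S \<inter> T \<subseteq> h ` topspace X \<and> openin X {x \<in> topspace X. h x \<in> S \<inter> T}"
      by (simp only: openin_Int le_infI1 simp_thms)
  next
    fix K
    assume K: "\<forall>S\<in>K. S \<subseteq> h ` topspace X \<and> openin X {x \<in> topspace X. h x \<in> S}"
    have eq: "{x \<in> topspace X. h x \<in> \<Union>K} = (\<Union>S\<in>K. {x \<in> topspace X. h x \<in> S})" by auto
    have "openin X {x \<in> topspace X. h x \<in> \<Union>K}"
      unfolding eq using K by (intro openin_clauses(3)) simp
    moreover have "\<Union>K \<subseteq> h ` topspace X"
      using K by (intro Union_least) simp
    ultimately show "\<Union>K \<subseteq> h ` topspace X \<and> openin X {x \<in> topspace X. h x \<in> \<Union>K}" by simp
  qed
  then show ?thesis by (simp add: quotient_topology_def)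
qed

lemma quotient_map_quotient_topology: "quotient_map X (quotient_topology X h) h"
proof -
  have "{x \<in> topspace X. h x \<in> h ` topspace X} = topspace X" by blast
  then have "openin (quotient_topology X h) (h ` topspace X)"
    by (simp add: openin_quotient_topology)
  moreover have "topspace (quotient_topology X h) \<subseteq> h ` topspace X"
    using openin_topspace[of "quotient_topology X h"]
    unfolding openin_quotient_topology by (rule conjunct1)
  ultimately have "topspace (quotient_topology X h) = h ` topspace X"
    by (intro antisym openin_subset)
  then show ?thesis
    unfolding quotient_map_def openin_quotient_topology by simp
qed


section \<open>Pettis integrals and vector-valued holomorphic functions\<close>

definition has_pettis_integral ::
  "(complex \<Rightarrow> 'e \<Rightarrow> 'e) \<Rightarrow> (real \<Rightarrow> 'e::{ab_group_add,topological_space}) \<Rightarrow> 'e \<Rightarrow> bool" where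
  "has_pettis_integral sc g e \<longleftrightarrow>
     (\<forall>u \<in> continuous_linear_maps sc ((*) :: complex \<Rightarrow> complex \<Rightarrow> complex).
        integrable lebesgue (\<lambda>x. u (g x)) \<and> integral\<^sup>L lebesgue (\<lambda>x. u (g x)) = u e)"

definition pettis_integrable ::
  "(complex \<Rightarrow> 'e \<Rightarrow> 'e) \<Rightarrow> (real \<Rightarrow> 'e::{ab_group_add,topological_space}) \<Rightarrow> bool" where
  "pettis_integrable sc g \<longleftrightarrow> (\<exists>e. has_pettis_integral sc g e)"

definition pettis_integral ::
  "(complex \<Rightarrow> 'e \<Rightarrow> 'e) \<Rightarrow> (real \<Rightarrow> 'e::{ab_group_add,topological_space}) \<Rightarrow> 'e" where
  "pettis_integral sc g = (THE e. has_pettis_integral sc g e)"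

definition vholomorphic_on ::
  "(complex \<Rightarrow> 'e \<Rightarrow> 'e) \<Rightarrow> (complex \<Rightarrow> 'e::{ab_group_add,topological_space}) \<Rightarrow>
   complex set \<Rightarrow> bool" where
  "vholomorphic_on sc f S \<longleftrightarrow>
     (\<forall>z\<in>S. \<exists>d. ((\<lambda>h. sc (inverse h) (f (z + h) - f z)) \<longlongrightarrow> d) (at 0))"


section \<open>Exponentially growing holomorphic functions\<close>

text \<open>
  A function on the complement of the real line is represented by the total function extending it by
  \<open>0\<close>, so that equality of functions is equality of the represented objects.
\<close>

definition Oexp_slit ::
  "(complex \<Rightarrow> 'e \<Rightarrow> 'e) \<Rightarrow> ('i \<Rightarrow> 'e::{ab_group_add,topological_space} \<Rightarrow> real) \<Rightarrow>
   (complex \<Rightarrow> 'e) set" where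
  "Oexp_slit sc p = {f. (\<forall>z. Im z = 0 \<longrightarrow> f z = 0) \<and> vholomorphic_on sc f {z. Im z \<noteq> 0} \<and>
     (\<forall>n::nat. \<forall>\<alpha>. n \<ge> 2 \<longrightarrow>
        bdd_above ((\<lambda>z. p \<alpha> (f z) * exp (- \<bar>Re z\<bar> / n)) ` {z. 1 / n < \<bar>Im z\<bar> \<and> \<bar>Im z\<bar> < n}))}"

definition Oexp_norm ::
  "('i \<Rightarrow> 'e \<Rightarrow> real) \<Rightarrow> nat \<Rightarrow> 'i \<Rightarrow> (complex \<Rightarrow> 'e) \<Rightarrow> real" where
  "Oexp_norm p n \<alpha> f =
     (SUP z \<in> {z. 1 / n < \<bar>Im z\<bar> \<and> \<bar>Im z\<bar> < n}. p \<alpha> (f z) * exp (- \<bar>Re z\<bar> / n))"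

definition Oexp_topology ::
  "(complex \<Rightarrow> 'e \<Rightarrow> 'e) \<Rightarrow> ('i \<Rightarrow> 'e::{ab_group_add,topological_space} \<Rightarrow> real) \<Rightarrow>
   (complex \<Rightarrow> 'e) topology" where
  "Oexp_topology sc p =
     seminorm_topology (Oexp_slit sc p) {Oexp_norm p n \<alpha> | n \<alpha>. n \<ge> 2}"

definition Oexp_entire ::
  "(complex \<Rightarrow> 'e \<Rightarrow> 'e) \<Rightarrow> ('i \<Rightarrow> 'e::{ab_group_add,topological_space} \<Rightarrow> real) \<Rightarrow>
   (complex \<Rightarrow> 'e) set" where
  "Oexp_entire sc p = {f. vholomorphic_on sc f UNIV \<and>
     (\<forall>n::nat. \<forall>\<alpha>. n \<ge> 2 \<longrightarrow>
        bdd_above ((\<lambda>z. p \<alpha> (f z) * exp (- \<bar>Re z\<bar> / n)) ` {z. \<bar>Im z\<bar> < n}))}"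

text \<open>
  The subspace by which \<^term>\<open>Oexp_slit sc p\<close> is divided: the restrictions of the functions in
  \<^term>\<open>Oexp_entire sc p\<close> to the complement of the real line.
\<close>

definition Oexp_null ::
  "(complex \<Rightarrow> 'e \<Rightarrow> 'e) \<Rightarrow> ('i \<Rightarrow> 'e::{ab_group_add,topological_space} \<Rightarrow> real) \<Rightarrow>
   (complex \<Rightarrow> 'e) set" where
  "Oexp_null sc p = (\<lambda>f z. if Im z = 0 then 0 else f z) ` Oexp_entire sc p"

definition Oexp_class ::
  "(complex \<Rightarrow> 'e \<Rightarrow> 'e) \<Rightarrow> ('i \<Rightarrow> 'e::{ab_group_add,topological_space} \<Rightarrow> real) \<Rightarrow>
   (complex \<Rightarrow> 'e) \<Rightarrow> (complex \<Rightarrow> 'e) set" where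
  "Oexp_class sc p f = f +o Oexp_null sc p"

definition Oexp_quotient ::
  "(complex \<Rightarrow> 'e \<Rightarrow> 'e) \<Rightarrow> ('i \<Rightarrow> 'e::{ab_group_add,topological_space} \<Rightarrow> real) \<Rightarrow>
   (complex \<Rightarrow> 'e) set set" where
  "Oexp_quotient sc p = Oexp_class sc p ` Oexp_slit sc p"

text \<open>
  The sum of two classes is their elementwise sum \<open>A + B\<close>. Adding the null space in the scalar
  multiple is needed only for the scalar \<open>0\<close>.
\<close>

definition Oexp_quotient_scale ::
  "(complex \<Rightarrow> 'e \<Rightarrow> 'e) \<Rightarrow> ('i \<Rightarrow> 'e::{ab_group_add,topological_space} \<Rightarrow> real) \<Rightarrow>
   complex \<Rightarrow> (complex \<Rightarrow> 'e) set \<Rightarrow> (complex \<Rightarrow> 'e) set" where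
  "Oexp_quotient_scale sc p c A = (\<lambda>f z. sc c (f z)) ` A + Oexp_null sc p"

definition Oexp_quotient_topology ::
  "(complex \<Rightarrow> 'e \<Rightarrow> 'e) \<Rightarrow> ('i \<Rightarrow> 'e::{ab_group_add,topological_space} \<Rightarrow> real) \<Rightarrow>
   (complex \<Rightarrow> 'e) set topology" where
  "Oexp_quotient_topology sc p = quotient_topology (Oexp_topology sc p) (Oexp_class sc p)"


section \<open>The space of test functions\<close>

definition strip :: "nat \<Rightarrow> complex set" where
  "strip n = {z. \<bar>Im z\<bar> < 1 / n}"

text \<open>
  The values of a total function outside the closed strip play no role; functions that agree on the
  closed strip represent the same element.
\<close>

definition O_strip :: "nat \<Rightarrow> (complex \<Rightarrow> complex) set" where
  "O_strip n = {\<phi>. \<phi> holomorphic_on strip n \<and> continuous_on (closure (strip n)) \<phi> \<and>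
     bdd_above ((\<lambda>z. cmod (\<phi> z) * exp (\<bar>Re z\<bar> / n)) ` {z. \<bar>Im z\<bar> \<le> 1 / n})}"

definition O_strip_norm :: "nat \<Rightarrow> (complex \<Rightarrow> complex) \<Rightarrow> real" where
  "O_strip_norm n \<phi> = (SUP z \<in> {z. \<bar>Im z\<bar> \<le> 1 / n}. cmod (\<phi> z) * exp (\<bar>Re z\<bar> / n))"

lemma closure_strip:
  assumes "n \<ge> 1"
  shows "closure (strip n) = {z. \<bar>Im z\<bar> \<le> 1 / n}"
proof -
  have "strip n = {z. Im z < 1 / n} \<inter> {z. Im z > - (1 / n)}"
    by (auto simp: strip_def abs_less_iff)
  moreover have "convex {z. Im z < 1 / n}" "convex {z. Im z > - (1 / n)}"
    by (rule convex_halfspace_Im_lt convex_halfspace_Im_gt)+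
  ultimately have "convex (strip n)"
    by (simp add: convex_Int)
  moreover have "closed {z. \<bar>Im z\<bar> \<le> 1 / n}"
    by (intro closed_Collect_le continuous_intros)
  moreover have "strip n \<subseteq> {z. \<bar>Im z\<bar> \<le> 1 / n}"
    by (auto simp: strip_def)
  ultimately have 1: "closure (strip n) \<subseteq> {z. \<bar>Im z\<bar> \<le> 1 / n}"
    by (simp add: closure_minimal)
  have "z \<in> closure (strip n)" if z: "\<bar>Im z\<bar> \<le> 1 / n" for z
  proof -
    let ?w = "\<lambda>k::nat. Complex (Re z) ((1 - inverse (real (Suc k))) * Im z)"
    have "?w k \<in> strip n" for k
    proof -
      have a: "\<bar>1 - inverse (real (Suc k))\<bar> < 1" "0 \<le> 1 - inverse (real (Suc k))"
        by (auto simp: field_simps)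
      have "\<bar>1 - inverse (real (Suc k))\<bar> * \<bar>Im z\<bar> < 1 / n"
      proof (cases "Im z = 0")
        case True
        then show ?thesis using assms by simp
      next
        case False
        then have "\<bar>1 - inverse (real (Suc k))\<bar> * \<bar>Im z\<bar> < 1 * \<bar>Im z\<bar>"
          using a by (intro mult_strict_right_mono) auto
        then show ?thesis using z by simp
      qed
      then show ?thesis by (simp add: strip_def abs_mult)
    qed
    moreover have "?w \<longlonglongrightarrow> Complex (Re z) ((1 - 0) * Im z)"
      by (intro tendsto_Complex tendsto_intros LIMSEQ_inverse_real_of_nat)
    ultimately show ?thesis
      unfolding closure_sequential by (intro exI[of _ ?w]) auto
  qed
  with 1 show ?thesis by blast
qed

lemma strip_mono: "1 \<le> n \<Longrightarrow> n \<le> m \<Longrightarrow> strip m \<subseteq> strip n"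
proof (clarsimp simp: strip_def)
  fix z assume *: "Suc 0 \<le> n" "n \<le> m" "\<bar>Im z\<bar> < 1 / m"
  have "1 / real m \<le> 1 / real n" using * by (intro divide_left_mono) auto
  then show "\<bar>Im z\<bar> < 1 / n" using * by linarith
qed

lemma O_strip_mono:
  assumes "1 \<le> n" "n \<le> m"
  shows "O_strip n \<subseteq> O_strip m"
proof
  fix \<phi> assume \<phi>: "\<phi> \<in> O_strip n"
  have le: "1 / real m \<le> 1 / real n" using assms by (intro divide_left_mono) auto
  obtain M where M: "\<And>z. \<bar>Im z\<bar> \<le> 1 / n \<Longrightarrow> cmod (\<phi> z) * exp (\<bar>Re z\<bar> / n) \<le> M"
    using \<phi> by (auto simp: O_strip_def bdd_above_def)
  have "cmod (\<phi> z) * exp (\<bar>Re z\<bar> / m) \<le> M" if "\<bar>Im z\<bar> \<le> 1 / m" for z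
  proof -
    have "\<bar>Re z\<bar> / m \<le> \<bar>Re z\<bar> / n"
      using assms by (intro divide_left_mono) auto
    then have "cmod (\<phi> z) * exp (\<bar>Re z\<bar> / m) \<le> cmod (\<phi> z) * exp (\<bar>Re z\<bar> / n)"
      by (intro mult_left_mono) auto
    also have "\<dots> \<le> M" using M that le by force
    finally show ?thesis .
  qed
  then have "bdd_above ((\<lambda>z. cmod (\<phi> z) * exp (\<bar>Re z\<bar> / m)) ` {z. \<bar>Im z\<bar> \<le> 1 / m})"
    by (auto simp: bdd_above_def)
  moreover have "\<phi> holomorphic_on strip m" "continuous_on (closure (strip m)) \<phi>"
    using \<phi> strip_mono[OF assms] closure_mono[OF strip_mono[OF assms]]
    by (auto simp: O_strip_def intro: holomorphic_on_subset continuous_on_subset)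
  ultimately show "\<phi> \<in> O_strip m" by (simp add: O_strip_def)
qed

lemma O_strip_zero: "(\<lambda>_. 0) \<in> O_strip n"
  by (auto simp: O_strip_def bdd_above_def)

lemma O_strip_add:
  assumes "\<phi> \<in> O_strip n" "\<psi> \<in> O_strip n"
  shows "(\<lambda>z. \<phi> z + \<psi> z) \<in> O_strip n"
proof -
  obtain M where M: "\<And>z. \<bar>Im z\<bar> \<le> 1 / n \<Longrightarrow> cmod (\<phi> z) * exp (\<bar>Re z\<bar> / n) \<le> M"
    using assms(1) by (auto simp: O_strip_def bdd_above_def)
  obtain K where K: "\<And>z. \<bar>Im z\<bar> \<le> 1 / n \<Longrightarrow> cmod (\<psi> z) * exp (\<bar>Re z\<bar> / n) \<le> K"
    using assms(2) by (auto simp: O_strip_def bdd_above_def)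
  have "cmod (\<phi> z + \<psi> z) * exp (\<bar>Re z\<bar> / n) \<le> M + K" if "\<bar>Im z\<bar> \<le> 1 / n" for z
  proof -
    have "cmod (\<phi> z + \<psi> z) * exp (\<bar>Re z\<bar> / n) \<le> (cmod (\<phi> z) + cmod (\<psi> z)) * exp (\<bar>Re z\<bar> / n)"
      by (intro mult_right_mono norm_triangle_ineq) auto
    also have "\<dots> \<le> M + K" using M[OF that] K[OF that] by (simp add: ring_distribs)
    finally show ?thesis .
  qed
  then have "bdd_above ((\<lambda>z. cmod (\<phi> z + \<psi> z) * exp (\<bar>Re z\<bar> / n)) ` {z. \<bar>Im z\<bar> \<le> 1 / n})"
    by (auto simp: bdd_above_def)
  moreover have "(\<lambda>z. \<phi> z + \<psi> z) holomorphic_on strip n"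
    "continuous_on (closure (strip n)) (\<lambda>z. \<phi> z + \<psi> z)"
    using assms unfolding O_strip_def
    by (simp_all add: holomorphic_on_add continuous_on_add)
  ultimately show ?thesis by (simp add: O_strip_def)
qed

lemma O_strip_scale:
  assumes "\<phi> \<in> O_strip n"
  shows "(\<lambda>z. c * \<phi> z) \<in> O_strip n"
proof -
  obtain M where M: "\<And>z. \<bar>Im z\<bar> \<le> 1 / n \<Longrightarrow> cmod (\<phi> z) * exp (\<bar>Re z\<bar> / n) \<le> M"
    using assms(1) by (auto simp: O_strip_def bdd_above_def)
  have "cmod (c * \<phi> z) * exp (\<bar>Re z\<bar> / n) \<le> cmod c * M" if "\<bar>Im z\<bar> \<le> 1 / n" for z
    using mult_left_mono[OF M[OF that], of "cmod c"] by (simp add: norm_mult mult.assoc)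
  then have "bdd_above ((\<lambda>z. cmod (c * \<phi> z) * exp (\<bar>Re z\<bar> / n)) ` {z. \<bar>Im z\<bar> \<le> 1 / n})"
    by (auto simp: bdd_above_def)
  moreover have "(\<lambda>z. c * \<phi> z) holomorphic_on strip n"
    "continuous_on (closure (strip n)) (\<lambda>z. c * \<phi> z)"
    using assms unfolding O_strip_def
    by (simp_all add: holomorphic_on_mult continuous_on_mult)
  ultimately show ?thesis by (simp add: O_strip_def)
qed

text \<open>
  The algebraic inductive limit of the spaces \<^term>\<open>O_strip n\<close>, \<open>n \<ge> 1\<close>, along restriction: two
  functions are identified iff their restrictions to some smaller closed strip coincide. The
  canonical map of \<^term>\<open>O_strip n\<close> into the limit is \<open>abs_test\<close> restricted to \<^term>\<open>O_strip n\<close>.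
\<close>

definition test_rel :: "(complex \<Rightarrow> complex) \<Rightarrow> (complex \<Rightarrow> complex) \<Rightarrow> bool" where
  "test_rel \<phi> \<psi> \<longleftrightarrow>
     (\<exists>n\<ge>1. \<phi> \<in> O_strip n \<and> \<psi> \<in> O_strip n \<and> (\<forall>z \<in> closure (strip n). \<phi> z = \<psi> z))"

lemma test_relE2:
  assumes "test_rel \<phi> \<phi>'" "test_rel \<psi> \<psi>'"
  obtains n where "n \<ge> 1" "\<phi> \<in> O_strip n" "\<phi>' \<in> O_strip n" "\<psi> \<in> O_strip n" "\<psi>' \<in> O_strip n"
    "\<And>z. z \<in> closure (strip n) \<Longrightarrow> \<phi> z = \<phi>' z" "\<And>z. z \<in> closure (strip n) \<Longrightarrow> \<psi> z = \<psi>' z"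
proof -
  obtain n where n: "n \<ge> 1" "\<phi> \<in> O_strip n" "\<phi>' \<in> O_strip n" "\<forall>z \<in> closure (strip n). \<phi> z = \<phi>' z"
    using assms(1) by (auto simp: test_rel_def)
  obtain m where m: "m \<ge> 1" "\<psi> \<in> O_strip m" "\<psi>' \<in> O_strip m" "\<forall>z \<in> closure (strip m). \<psi> z = \<psi>' z"
    using assms(2) by (auto simp: test_rel_def)
  show ?thesis
  proof (rule that[of "max n m"])
    show "\<phi> \<in> O_strip (max n m)" "\<phi>' \<in> O_strip (max n m)"
      using O_strip_mono[of n "max n m"] n by auto
    show "\<psi> \<in> O_strip (max n m)" "\<psi>' \<in> O_strip (max n m)"
      using O_strip_mono[of m "max n m"] m by auto
    show "\<phi> z = \<phi>' z" if "z \<in> closure (strip (max n m))" for z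
      using closure_mono[OF strip_mono[of n "max n m"]] n that by auto
    show "\<psi> z = \<psi>' z" if "z \<in> closure (strip (max n m))" for z
      using closure_mono[OF strip_mono[of m "max n m"]] m that by auto
  qed (use n in auto)
qed

quotient_type test = "complex \<Rightarrow> complex" / partial: test_rel
proof (rule part_equivpI)
  have "test_rel (\<lambda>_. 0) (\<lambda>_. 0)"
    unfolding test_rel_def using O_strip_zero[of 1] by blast
  then show "\<exists>x. test_rel x x" by blast
  show "symp test_rel" by (rule sympI) (auto simp: test_rel_def)
  show "transp test_rel"
  proof (rule transpI)
    fix x y z assume "test_rel x y" "test_rel y z"
    then show "test_rel x z"
      by (rule test_relE2) (auto simp: test_rel_def)
  qed
qed

instantiation test :: ab_group_add
begin

lift_definition zero_test :: test is "\<lambda>_. 0"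
  unfolding test_rel_def using O_strip_zero[of 1] by blast

lift_definition plus_test :: "test \<Rightarrow> test \<Rightarrow> test" is "\<lambda>\<phi> \<psi> z. \<phi> z + \<psi> z"
proof -
  fix \<phi> \<phi>' \<psi> \<psi>' assume "test_rel \<phi> \<phi>'" "test_rel \<psi> \<psi>'"
  then obtain n where n: "n \<ge> 1" "\<phi> \<in> O_strip n" "\<phi>' \<in> O_strip n" "\<psi> \<in> O_strip n" "\<psi>' \<in> O_strip n"
    "\<And>z. z \<in> closure (strip n) \<Longrightarrow> \<phi> z = \<phi>' z" "\<And>z. z \<in> closure (strip n) \<Longrightarrow> \<psi> z = \<psi>' z"
    by (rule test_relE2) blast
  then show "test_rel (\<lambda>z. \<phi> z + \<psi> z) (\<lambda>z. \<phi>' z + \<psi>' z)"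
    unfolding test_rel_def by (intro exI[of _ n]) (simp add: O_strip_add)
qed

lift_definition uminus_test :: "test \<Rightarrow> test" is "\<lambda>\<phi> z. - \<phi> z"
proof -
  fix \<phi> \<psi> assume "test_rel \<phi> \<psi>"
  then obtain n where "n \<ge> 1" "\<phi> \<in> O_strip n" "\<psi> \<in> O_strip n" "\<forall>z \<in> closure (strip n). \<phi> z = \<psi> z"
    unfolding test_rel_def by blast
  then show "test_rel (\<lambda>z. - \<phi> z) (\<lambda>z. - \<psi> z)"
    unfolding test_rel_def using O_strip_scale[of \<phi> n "-1"] O_strip_scale[of \<psi> n "-1"]
    by (intro exI[of _ n]) simp
qed

definition minus_test :: "test \<Rightarrow> test \<Rightarrow> test" where
  "minus_test \<phi> \<psi> = \<phi> + - \<psi>"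

instance
proof
  show "a + b + c = a + (b + c)" for a b c :: test
  proof (transfer)
    fix a b c assume *: "test_rel a a" "test_rel b b" "test_rel c c"
    obtain n where n: "n \<ge> 1" "a \<in> O_strip n" "b \<in> O_strip n"
      using *(1,2) by (rule test_relE2)
    obtain m where m: "m \<ge> 1" "c \<in> O_strip m" using *(3) by (auto simp: test_rel_def)
    have "a \<in> O_strip (max n m)" "b \<in> O_strip (max n m)" "c \<in> O_strip (max n m)"
      using O_strip_mono[of n "max n m"] O_strip_mono[of m "max n m"] n m by auto
    then have "(\<lambda>z. a z + b z + c z) \<in> O_strip (max n m)"
      by (intro O_strip_add)
    then show "test_rel (\<lambda>z. a z + b z + c z) (\<lambda>z. a z + (b z + c z))"
      unfolding test_rel_def using n by (intro exI[of _ "max n m"]) (auto simp: add.assoc)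
  qed
  show "a + b = b + a" for a b :: test
  proof transfer
    fix a b assume "test_rel a a" "test_rel b b"
    then obtain n where "n \<ge> 1" "a \<in> O_strip n" "b \<in> O_strip n" by (rule test_relE2)
    then show "test_rel (\<lambda>z. a z + b z) (\<lambda>z. b z + a z)"
      unfolding test_rel_def by (intro exI[of _ n]) (auto intro: O_strip_add)
  qed
  show "0 + a = a" for a :: test
    by transfer simp
  show "- a + a = 0" for a :: test
  proof transfer
    fix a assume "test_rel a a"
    then obtain n where "n \<ge> 1" "a \<in> O_strip n" by (auto simp: test_rel_def)
    then show "test_rel (\<lambda>z. - a z + a z) (\<lambda>_. 0)"
      unfolding test_rel_def by (intro exI[of _ n]) (auto simp: O_strip_zero)
  qed
  show "a - b = a + - b" for a b :: test
    by (simp add: minus_test_def)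
qed

end

lift_definition test_scale :: "complex \<Rightarrow> test \<Rightarrow> test" is "\<lambda>c \<phi> z. c * \<phi> z"
proof -
  fix c \<phi> \<psi> assume "test_rel \<phi> \<psi>"
  then obtain n where "n \<ge> 1" "\<phi> \<in> O_strip n" "\<psi> \<in> O_strip n" "\<forall>z \<in> closure (strip n). \<phi> z = \<psi> z"
    unfolding test_rel_def by blast
  then show "test_rel (\<lambda>z. c * \<phi> z) (\<lambda>z. c * \<psi> z)"
    unfolding test_rel_def by (intro exI[of _ n]) (simp add: O_strip_scale)
qed

lemma vector_space_test_scale: "vector_space test_scale"
proof
  fix a b :: complex and x y :: test
  show "test_scale a (x + y) = test_scale a x + test_scale a y"
  proof transfer
    fix a x y assume "test_rel x x" "test_rel y y"
    then obtain n where "n \<ge> 1" "x \<in> O_strip n" "y \<in> O_strip n" by (rule test_relE2)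
    then show "test_rel (\<lambda>z. a * (x z + y z)) (\<lambda>z. a * x z + a * y z)"
      unfolding test_rel_def
      by (intro exI[of _ n]) (auto simp: ring_distribs intro!: O_strip_add O_strip_scale)
  qed
  show "test_scale (a + b) x = test_scale a x + test_scale b x"
  proof transfer
    fix a b x assume "test_rel x x"
    then obtain n where "n \<ge> 1" "x \<in> O_strip n" by (auto simp: test_rel_def)
    then show "test_rel (\<lambda>z. (a + b) * x z) (\<lambda>z. a * x z + b * x z)"
      unfolding test_rel_def
      by (intro exI[of _ n]) (auto simp: ring_distribs intro!: O_strip_add O_strip_scale)
  qed
  show "test_scale a (test_scale b x) = test_scale (a * b) x"
  proof transfer
    fix a b x assume "test_rel x x"
    then obtain n where "n \<ge> 1" "x \<in> O_strip n" by (auto simp: test_rel_def)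
    then show "test_rel (\<lambda>z. a * (b * x z)) (\<lambda>z. a * b * x z)"
      unfolding test_rel_def
      by (intro exI[of _ n]) (auto simp: mult.assoc intro!: O_strip_scale)
  qed
  show "test_scale 1 x = x"
    by transfer simp
qed

lift_definition test_on_real :: "test \<Rightarrow> real \<Rightarrow> complex" is "\<lambda>\<phi> x. \<phi> (complex_of_real x)"
proof
  fix \<phi> \<psi> x assume "test_rel \<phi> \<psi>"
  moreover have "complex_of_real x \<in> closure (strip n)" if "n \<ge> 1" for n
    using that by (simp add: closure_strip)
  ultimately show "\<phi> (complex_of_real x) = \<psi> (complex_of_real x)"
    by (auto simp: test_rel_def)
qed

text \<open>
  The locally convex inductive limit topology, i.e. the finest locally convex topology making all
  canonical maps continuous: it is generated by all seminorms on the limit whose composition with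
  each canonical map is a continuous seminorm on the normed space \<^term>\<open>O_strip n\<close>. These seminorms
  are closed under addition, so single seminorms suffice to describe the open sets.
\<close>

definition inductive_limit_seminorm :: "(test \<Rightarrow> real) \<Rightarrow> bool" where
  "inductive_limit_seminorm q \<longleftrightarrow> seminorm test_scale q \<and>
     (\<forall>n\<ge>1. \<exists>C. \<forall>\<phi>\<in>O_strip n. q (abs_test \<phi>) \<le> C * O_strip_norm n \<phi>)"

lemma seminorm_nonneg:
  assumes "vector_space sc" "seminorm sc q"
  shows "0 \<le> q x"
proof -
  interpret vector_space sc by fact
  have a: "q (sc c y) = cmod c * q y" for c y using assms(2) by (simp add: seminorm_def)
  have "0 = q (x + sc (-1) x)" using a[of 0 x] by simp
  also have "\<dots> \<le> q x + q (sc (-1) x)" using assms(2) unfolding seminorm_def by blast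
  also have "\<dots> = 2 * q x" using a[of "-1" x] by simp
  finally show ?thesis by simp
qed

lemma inductive_limit_seminorm_add:
  assumes "inductive_limit_seminorm q" "inductive_limit_seminorm r"
  shows "inductive_limit_seminorm (\<lambda>x. q x + r x)"
proof -
  have "seminorm test_scale (\<lambda>x. q x + r x)"
    using assms unfolding inductive_limit_seminorm_def seminorm_def
    by (auto simp: algebra_simps intro: add_mono) (smt (verit))
  moreover have "\<exists>C. \<forall>\<phi>\<in>O_strip n. q (abs_test \<phi>) + r (abs_test \<phi>) \<le> C * O_strip_norm n \<phi>"
    if "n \<ge> 1" for n
  proof -
    obtain C where C: "\<forall>\<phi>\<in>O_strip n. q (abs_test \<phi>) \<le> C * O_strip_norm n \<phi>"
      using assms(1) \<open>n \<ge> 1\<close> unfolding inductive_limit_seminorm_def by blast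
    obtain D where D: "\<forall>\<phi>\<in>O_strip n. r (abs_test \<phi>) \<le> D * O_strip_norm n \<phi>"
      using assms(2) \<open>n \<ge> 1\<close> unfolding inductive_limit_seminorm_def by blast
    show ?thesis
      using C D by (intro exI[of _ "C + D"]) (auto simp: ring_distribs intro!: add_mono)
  qed
  ultimately show ?thesis by (simp add: inductive_limit_seminorm_def)
qed

instantiation test :: topological_space
begin

definition open_test :: "test set \<Rightarrow> bool" where
  "open_test U \<longleftrightarrow>
     (\<forall>x\<in>U. \<exists>q \<epsilon>. inductive_limit_seminorm q \<and> \<epsilon> > 0 \<and> {y. q (y - x) < \<epsilon>} \<subseteq> U)"

instance
proof
  have "inductive_limit_seminorm (\<lambda>_. 0)"
    by (auto simp: inductive_limit_seminorm_def seminorm_def intro: exI[of _ 0])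
  then show "open (UNIV :: test set)"
    unfolding open_test_def by (auto intro: exI[of _ "1::real"])
next
  fix S T :: "test set" assume S: "open S" and T: "open T"
  show "open (S \<inter> T)"
    unfolding open_test_def
  proof
    fix x assume x: "x \<in> S \<inter> T"
    obtain q e where q: "inductive_limit_seminorm q" "e > 0" "{y. q (y - x) < e} \<subseteq> S"
      using S x unfolding open_test_def by blast
    obtain r d where r: "inductive_limit_seminorm r" "d > 0" "{y. r (y - x) < d} \<subseteq> T"
      using T x unfolding open_test_def by blast
    have nn: "0 \<le> q y" "0 \<le> r y" for y
      using q(1) r(1) seminorm_nonneg[OF vector_space_test_scale]
      unfolding inductive_limit_seminorm_def by blast+
    have "q (y - x) < e \<and> r (y - x) < d" if "q (y - x) + r (y - x) < min e d" for y
      using that nn[of "y - x"] by linarith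
    then have "{y. q (y - x) + r (y - x) < min e d} \<subseteq> S \<inter> T"
      using q(3) r(3) by blast
    then show "\<exists>q \<epsilon>. inductive_limit_seminorm q \<and> \<epsilon> > 0 \<and> {y. q (y - x) < \<epsilon>} \<subseteq> S \<inter> T"
      using inductive_limit_seminorm_add[OF q(1) r(1)] q(2) r(2)
      by (intro exI[of _ "\<lambda>x. q x + r x"] exI[of _ "min e d"]) auto
  qed
next
  fix K :: "test set set" assume "\<forall>S\<in>K. open S"
  then show "open (\<Union>K)"
    unfolding open_test_def by (fast dest: bspec)
qed

end


section \<open>Spaces of continuous linear maps\<close>

text \<open>
  The empty set is left out because the supremum of the empty set of reals is unspecified.
\<close>

definition Lb_topology ::
  "(complex \<Rightarrow> 'v \<Rightarrow> 'v) \<Rightarrow> (complex \<Rightarrow> 'e \<Rightarrow> 'e) \<Rightarrow> ('i \<Rightarrow> 'e \<Rightarrow> real) \<Rightarrow>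
   ('v::{ab_group_add,topological_space} \<Rightarrow> 'e::{ab_group_add,topological_space}) topology" where
  "Lb_topology sF sc p = seminorm_topology (continuous_linear_maps sF sc)
     {\<lambda>T. SUP x\<in>B. p \<alpha> (T x) | B \<alpha>. tvs_bounded sF B \<and> B \<noteq> {}}"


section \<open>Boundary values\<close>

definition Rtt_integrand ::
  "(complex \<Rightarrow> 'e \<Rightarrow> 'e) \<Rightarrow> real \<Rightarrow> real \<Rightarrow> (complex \<Rightarrow> 'e::ab_group_add) \<Rightarrow> test \<Rightarrow> real \<Rightarrow> 'e" where
  "Rtt_integrand sc t t' f \<phi> x =
     sc (test_on_real \<phi> x) (f (Complex x t) - f (Complex x (- t')))"

definition Rplus_integrand ::
  "(complex \<Rightarrow> 'e \<Rightarrow> 'e) \<Rightarrow> real \<Rightarrow> (complex \<Rightarrow> 'e::ab_group_add) \<Rightarrow> test \<Rightarrow> real \<Rightarrow> 'e" where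
  "Rplus_integrand sc t f \<phi> x = sc (test_on_real \<phi> x) (f (Complex x t))"

definition Rminus_integrand ::
  "(complex \<Rightarrow> 'e \<Rightarrow> 'e) \<Rightarrow> real \<Rightarrow> (complex \<Rightarrow> 'e::ab_group_add) \<Rightarrow> test \<Rightarrow> real \<Rightarrow> 'e" where
  "Rminus_integrand sc t f \<phi> x = sc (test_on_real \<phi> x) (f (Complex x (- t)))"

definition Rtt ::
  "(complex \<Rightarrow> 'e \<Rightarrow> 'e) \<Rightarrow> real \<Rightarrow> real \<Rightarrow> (complex \<Rightarrow> 'e::{ab_group_add,topological_space}) \<Rightarrow>
   test \<Rightarrow> 'e" where
  "Rtt sc t t' f \<phi> = pettis_integral sc (Rtt_integrand sc t t' f \<phi>)"

definition Rplus_t ::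
  "(complex \<Rightarrow> 'e \<Rightarrow> 'e) \<Rightarrow> real \<Rightarrow> (complex \<Rightarrow> 'e::{ab_group_add,topological_space}) \<Rightarrow>
   test \<Rightarrow> 'e" where
  "Rplus_t sc t f \<phi> = pettis_integral sc (Rplus_integrand sc t f \<phi>)"

definition Rminus_t ::
  "(complex \<Rightarrow> 'e \<Rightarrow> 'e) \<Rightarrow> real \<Rightarrow> (complex \<Rightarrow> 'e::{ab_group_add,topological_space}) \<Rightarrow>
   test \<Rightarrow> 'e" where
  "Rminus_t sc t f \<phi> = pettis_integral sc (Rminus_integrand sc t f \<phi>)"

definition R_map ::
  "(complex \<Rightarrow> 'e \<Rightarrow> 'e) \<Rightarrow> (complex \<Rightarrow> 'e::{ab_group_add,t2_space}) \<Rightarrow> test \<Rightarrow> 'e" where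
  "R_map sc f \<phi> = Lim (at_right 0 \<times>\<^sub>F at_right 0) (\<lambda>(t, t'). Rtt sc t t' f \<phi>)"

definition Rplus ::
  "(complex \<Rightarrow> 'e \<Rightarrow> 'e) \<Rightarrow> (complex \<Rightarrow> 'e::{ab_group_add,t2_space}) \<Rightarrow> test \<Rightarrow> 'e" where
  "Rplus sc f \<phi> = Lim (at_right 0) (\<lambda>t. Rplus_t sc t f \<phi>)"

definition Rminus ::
  "(complex \<Rightarrow> 'e \<Rightarrow> 'e) \<Rightarrow> (complex \<Rightarrow> 'e::{ab_group_add,t2_space}) \<Rightarrow> test \<Rightarrow> 'e" where
  "Rminus sc f \<phi> = Lim (at_right 0) (\<lambda>t. Rminus_t sc t f \<phi>)"

text \<open>The value on a class of a map that is constant on the class.\<close>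

definition R_quotient ::
  "(complex \<Rightarrow> 'e \<Rightarrow> 'e) \<Rightarrow> (complex \<Rightarrow> 'e::{ab_group_add,t2_space}) set \<Rightarrow> test \<Rightarrow> 'e" where
  "R_quotient sc A = the_elem (R_map sc ` A)"

definition path_integrand ::
  "(complex \<Rightarrow> 'e \<Rightarrow> 'e) \<Rightarrow> real \<Rightarrow> (complex \<Rightarrow> 'e) \<Rightarrow> (complex \<Rightarrow> complex) \<Rightarrow> real \<Rightarrow> 'e" where
  "path_integrand sc s f \<phi> x = sc (\<phi> (Complex x s)) (f (Complex x s))"

definition path_integral_gamma ::
  "(complex \<Rightarrow> 'e \<Rightarrow> 'e) \<Rightarrow> real \<Rightarrow> (complex \<Rightarrow> 'e::{ab_group_add,topological_space}) \<Rightarrow>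
   (complex \<Rightarrow> complex) \<Rightarrow> 'e" where
  "path_integral_gamma sc t f \<phi> =
     pettis_integral sc (path_integrand sc (- t) f \<phi>) - pettis_integral sc (path_integrand sc t f \<phi>)"

text \<open>
  The common value of the path integrals over all representatives \<open>f\<close> of the class \<open>A\<close>, all
  representatives \<open>\<phi>\<close> of the test function and all admissible \<open>t\<close>.
\<close>

definition H_map ::
  "(complex \<Rightarrow> 'e \<Rightarrow> 'e) \<Rightarrow> (complex \<Rightarrow> 'e::{ab_group_add,topological_space}) set \<Rightarrow> test \<Rightarrow> 'e" where
  "H_map sc A \<Phi> = (THE e. \<forall>f\<in>A. \<forall>n\<ge>1. \<forall>\<phi>\<in>O_strip n. \<forall>t.
     abs_test \<phi> = \<Phi> \<and> 0 < t \<and> t < 1 / n \<longrightarrow> path_integral_gamma sc t f \<phi> = e)"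

end

theory Submission
  imports Defs "HOL-Complex_Analysis.Complex_Analysis"
begin

text \<open>
  The boundary values are integrals over lines inside the domain in disguise. For a test function
  \<open>\<phi>\<close> that is holomorphic near the real line, the contour of \<open>\<integral> f (x + \<i> t) \<phi> x dx\<close> may be moved by
  some \<open>\<i> s\<close> into the upper half plane without changing the integral, and in
  \<open>\<integral> f (x + \<i> (t + s)) \<phi> (x + \<i> s) dx\<close> the limit \<open>t \<rightarrow> 0\<close> is harmless: \<open>f\<close> is Lipschitz near the line
  of height \<open>s\<close>, and the error is \<open>O(t)\<close> with a constant depending only on the step of the inductive
  limit that contains \<open>\<phi>\<close> (\<open>Rplus_t_approximates\<close>). Hence the supremum over \<open>t\<close> of the errors divided
  by \<open>t\<close> is a continuous seminorm on the test functions, and continuous seminorms are bounded on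
  bounded sets: this is the convergence in the topology of bounded convergence
  (\<open>limitin_Rplus_t\<close>, \<open>limitin_Rtt\<close>). The limit is the integral over a line of small height, so that
  the difference of the limits from the two sides is the contour integral defining \<open>H_map\<close> up to its
  sign, and it vanishes for entire \<open>f\<close> (\<open>R_map_null\<close>).

  The inverse is a Cauchy transform. Let \<open>K z w = exp (- (z - w)\<^sup>2) / (z - w)\<close> be the Cauchy kernel
  damped by a Gaussian. If \<open>Im z \<noteq> 0\<close>, then \<open>K z\<close> is a test function, and \<open>z \<mapsto> \<i> / (2 \<pi>) T (K z)\<close> is
  exponentially growing for every continuous linear \<open>T\<close> (\<open>cauchy_transform_slit\<close>). Its boundary value is
  \<open>T\<close>: Cauchy's formula writes \<open>\<phi>\<close> as an integral of multiples of the functions \<open>K z\<close> over two lines, and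
  the Riemann sums of this integral converge to \<open>\<phi>\<close> in the norm of a step of the limit, so that \<open>T\<close> may
  be applied to them (\<open>R_map_cauchy_transform\<close>). Conversely, if the boundary value of \<open>f\<close> is zero, it
  vanishes on all \<open>K z\<close>. This is what is needed to express \<open>f z\<close> near the real line by integrals over the
  lines of height \<open>1\<close> and \<open>-1\<close> alone, and these integrals continue \<open>f\<close> across the real line with
  the same growth (\<open>R_map_zero_imp_null\<close>).

  Both maps are continuous. For the Cauchy transform this holds because suitable multiples of the
  functions \<open>K z\<close> with \<open>1 / n < \<bar>Im z\<bar> < n\<close> lie in a ball of a step of the limit
  (\<open>continuous_cauchy_transform\<close>). The other direction needs that every bounded set of test functions
  comes from a ball of one step (\<open>bounded_test_sets\<close>). This regularity of the limit is derived from the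
  Taylor coefficients at real points: if they could not be estimated uniformly, a continuous seminorm
  that is unbounded on the bounded set could be written down.

  Statements about vector-valued functions are reduced to scalar ones by the functionals in the polar
  of a seminorm \<open>p \<alpha>\<close>. By the Hahn-Banach theorem they recover \<open>p \<alpha>\<close> and separate points. Sequential
  completeness enters only where limits are produced: as limits of Riemann sums, which are the Pettis
  integrals (\<open>vtame_integral\<close>), and as limits of difference quotients (\<open>derivative_existsI\<close>).
\<close>

section \<open>Seminorms and the Hahn-Banach theorem\<close>

locale seminormed = vector_space sc for sc :: "complex \<Rightarrow> 'v \<Rightarrow> 'v::ab_group_add" +
  fixes q :: "'v \<Rightarrow> real"
  assumes seminorm_q: "seminorm sc q"
begin

lemma triangle: "q (x + y) \<le> q x + q y"
  using seminorm_q by (simp add: seminorm_def)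

lemma homogeneous: "q (sc c x) = cmod c * q x"
  using seminorm_q by (simp add: seminorm_def)

lemma zero [simp]: "q 0 = 0"
  using homogeneous[of 0 0] by simp

lemma minus [simp]: "q (- x) = q x"
  using homogeneous[of "-1" x] by (simp add: scale_minus_left)

lemma nonneg [simp]: "0 \<le> q x"
  by (rule seminorm_nonneg[OF vector_space_axioms seminorm_q])

lemma triangle_diff: "q (x - y) \<le> q x + q y"
  using triangle[of x "- y"] by simp

definition sublinear :: "('v \<Rightarrow> real) \<Rightarrow> bool" where
  "sublinear f \<longleftrightarrow> (\<forall>x y. f (x + y) \<le> f x + f y) \<and> (\<forall>r x. 0 \<le> r \<longrightarrow> f (sc (of_real r) x) = r * f x)"

lemma sublinear_seminorm: "sublinear q"
  unfolding sublinear_def by (simp add: triangle homogeneous)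

lemma sublinear_zero: "sublinear f \<Longrightarrow> f 0 = 0"
  unfolding sublinear_def by (metis mult_zero_left of_real_0 order_refl scale_zero_left)

lemma sublinear_lower: "sublinear f \<Longrightarrow> - f (- x) \<le> f x"
  using sublinear_zero[of f] unfolding sublinear_def
  by (metis add.right_inverse add_le_imp_le_right add.commute diff_0 diff_le_eq)

text \<open>
  Pushing a sublinear functional down in the direction \<open>y\<close> as far as sublinearity allows: the result
  takes the value \<open>- f y\<close> at \<open>- y\<close>. A functional that cannot be pushed down in any direction is
  therefore odd, and so it is linear.
\<close>

definition push_down :: "('v \<Rightarrow> real) \<Rightarrow> 'v \<Rightarrow> 'v \<Rightarrow> real" where
  "push_down f y x = (INF t\<in>{0..}. f (x + sc (of_real t) y) - t * f y)"

lemma push_down_bdd: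
  assumes "sublinear f"
  shows "bdd_below ((\<lambda>t. f (x + sc (of_real t) y) - t * f y) ` {0..})"
proof (rule bdd_belowI2)
  fix t :: real assume "t \<in> {0..}"
  then have t: "0 \<le> t" by simp
  have "t * f y = f (sc (of_real t) y)"
    using assms t unfolding sublinear_def by simp
  also have "\<dots> = f ((x + sc (of_real t) y) + (- x))" by simp
  also have "\<dots> \<le> f (x + sc (of_real t) y) + f (- x)"
    using assms unfolding sublinear_def by blast
  finally show "- f (- x) \<le> f (x + sc (of_real t) y) - t * f y" by simp
qed

lemma push_down_le_at:
  assumes "sublinear f" "0 \<le> t"
  shows "push_down f y x \<le> f (x + sc (of_real t) y) - t * f y"
  unfolding push_down_def by (rule cINF_lower[OF push_down_bdd[OF assms(1)]]) (use assms in simp)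

lemma push_down_le: "sublinear f \<Longrightarrow> push_down f y x \<le> f x"
  using push_down_le_at[of f 0 y x] by simp

lemma push_down_at_minus: "sublinear f \<Longrightarrow> push_down f y (- y) \<le> - f y"
  using push_down_le_at[of f 1 y "- y"] by (simp add: sublinear_zero)

lemma sublinear_push_down:
  assumes f: "sublinear f"
  shows "sublinear (push_down f y)"
  unfolding sublinear_def
proof safe
  have add: "f (a + b) \<le> f a + f b" for a b using f unfolding sublinear_def by blast
  have hom: "f (sc (of_real r) a) = r * f a" if "0 \<le> r" for r a
    using f that unfolding sublinear_def by blast
  fix a b
  have "push_down f y (a + b) - (f (b + sc (of_real s) y) - s * f y) \<le> push_down f y a"
    if s: "0 \<le> s" for s
    unfolding push_down_def[of f y a]
  proof (rule cINF_greatest)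
    fix t :: real assume "t \<in> {0..}"
    then have t: "0 \<le> t" by simp
    have "push_down f y (a + b) \<le> f (a + b + sc (of_real (s + t)) y) - (s + t) * f y"
      using s t by (intro push_down_le_at f) simp
    also have "a + b + sc (of_real (s + t)) y = (a + sc (of_real t) y) + (b + sc (of_real s) y)"
      by (simp add: scale_left_distrib algebra_simps)
    also have "f \<dots> - (s + t) * f y \<le>
        f (a + sc (of_real t) y) + f (b + sc (of_real s) y) - (s + t) * f y"
      by (intro diff_right_mono add)
    finally show "push_down f y (a + b) - (f (b + sc (of_real s) y) - s * f y)
        \<le> f (a + sc (of_real t) y) - t * f y"
      by (simp add: ring_distribs)
  qed simp
  then have "push_down f y (a + b) - push_down f y a \<le> f (b + sc (of_real s) y) - s * f y"
    if "0 \<le> s" for s using that by (force simp: algebra_simps)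
  then have "push_down f y (a + b) - push_down f y a \<le> push_down f y b"
    unfolding push_down_def[of f y b] by (intro cINF_greatest) auto
  then show "push_down f y (a + b) \<le> push_down f y a + push_down f y b" by simp
next
  have hom: "f (sc (of_real r) a) = r * f a" if "0 \<le> r" for r a
    using f that unfolding sublinear_def by blast
  have le: "push_down f y (sc (of_real r) x) \<le> r * push_down f y x" if r: "0 < r" for r x
  proof -
    have "push_down f y (sc (of_real r) x) / r \<le> push_down f y x"
      unfolding push_down_def[of f y x]
    proof (rule cINF_greatest)
      fix t :: real assume "t \<in> {0..}"
      then have t: "0 \<le> t" by simp
      have "push_down f y (sc (of_real r) x) \<le> f (sc (of_real r) x + sc (of_real (r * t)) y) - (r * t) * f y"
        using r t by (intro push_down_le_at f) simp
      also have "sc (of_real r) x + sc (of_real (r * t)) y = sc (of_real r) (x + sc (of_real t) y)"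
        by (simp add: scale_right_distrib)
      finally have "push_down f y (sc (of_real r) x) \<le> r * (f (x + sc (of_real t) y) - t * f y)"
        using r by (simp add: hom right_diff_distrib mult.assoc del: scale_right_distrib)
      then show "push_down f y (sc (of_real r) x) / r \<le> f (x + sc (of_real t) y) - t * f y"
        using r by (simp add: divide_le_eq mult.commute)
    qed simp
    then show ?thesis using r by (simp add: divide_le_eq mult.commute)
  qed
  fix r :: real and x assume "0 \<le> r"
  show "push_down f y (sc (of_real r) x) = r * push_down f y x"
  proof (cases "r = 0")
    case True
    have "push_down f y 0 = (INF t\<in>{0::real..}. 0)"
      unfolding push_down_def by (rule INF_cong) (use hom in auto)
    then show ?thesis using True by simp
  next
    case False
    then have r: "0 < r" using \<open>0 \<le> r\<close> by simp
    have "push_down f y x = push_down f y (sc (of_real (1 / r)) (sc (of_real r) x))"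
      using r by simp
    also have "\<dots> \<le> (1 / r) * push_down f y (sc (of_real r) x)"
      using r by (intro le) simp
    finally show ?thesis using le[OF r, of x] r by (simp add: field_simps)
  qed
qed

text \<open>
  Zorn's lemma applies to the sublinear functionals below \<open>f\<close>: the pointwise infimum of a chain is
  finite, since every sublinear \<open>g \<le> f\<close> satisfies \<open>- f (- x) \<le> - g (- x) \<le> g x\<close>.
\<close>

lemma sublinear_minimal_exists:
  assumes f: "sublinear f"
  obtains g where "sublinear g" "\<And>x. g x \<le> f x"
    "\<And>h. sublinear h \<Longrightarrow> (\<And>x. h x \<le> g x) \<Longrightarrow> h = g"
proof -
  define A where "A = {g. sublinear g \<and> (\<forall>x. g x \<le> f x)}"
  define P where "P = (\<lambda>g h :: 'v \<Rightarrow> real. \<forall>x. h x \<le> g x)"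
  have "\<exists>m\<in>A. \<forall>a\<in>A. P m a \<longrightarrow> a = m"
  proof (rule predicate_Zorn)
    show "partial_order_on A (relation_of P A)"
      by (rule partial_order_on_relation_ofI) (auto simp: P_def fun_eq_iff intro: order_trans antisym)
  next
    fix C assume C: "C \<in> Chains (relation_of P A)"
    have CA: "C \<subseteq> A" using C by (auto simp: Chains_def relation_of_def)
    have chain: "P g h \<or> P h g" if "g \<in> C" "h \<in> C" for g h
      using C that by (auto simp: Chains_def relation_of_def)
    show "\<exists>u\<in>A. \<forall>a\<in>C. P a u"
    proof (cases "C = {}")
      case True
      then show ?thesis using f by (auto simp: A_def)
    next
      case False
      have bdd: "bdd_below ((\<lambda>g. g x) ` C)" for x
      proof (rule bdd_belowI2)
        fix g assume "g \<in> C"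
        then have g: "sublinear g" "g (- x) \<le> f (- x)" using CA by (auto simp: A_def)
        show "- f (- x) \<le> g x" using sublinear_lower[OF g(1), of x] g(2) by simp
      qed
      define u where "u = (\<lambda>x. INF g\<in>C. g x)"
      have u_le: "u x \<le> g x" if "g \<in> C" for g x
        unfolding u_def using cINF_lower[OF bdd that] .
      have u_greatest: "c \<le> u x" if "\<And>g. g \<in> C \<Longrightarrow> c \<le> g x" for c x
        unfolding u_def using False that by (rule cINF_greatest)
      have "sublinear u"
        unfolding sublinear_def
      proof safe
        fix x y
        have "u (x + y) \<le> g x + h y" if gh: "g \<in> C" "h \<in> C" for g h
        proof -
          have sub: "sublinear g" "sublinear h" using gh CA by (auto simp: A_def)
          show ?thesis
            using chain[OF gh]
          proof
            assume "P g h"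
            then have "h x \<le> g x" by (simp add: P_def)
            moreover have "u (x + y) \<le> h (x + y)" using u_le gh by blast
            moreover have "h (x + y) \<le> h x + h y" using sub unfolding sublinear_def by blast
            ultimately show ?thesis by linarith
          next
            assume "P h g"
            then have "g y \<le> h y" by (simp add: P_def)
            moreover have "u (x + y) \<le> g (x + y)" using u_le gh by blast
            moreover have "g (x + y) \<le> g x + g y" using sub unfolding sublinear_def by blast
            ultimately show ?thesis by linarith
          qed
        qed
        then have "u (x + y) - g x \<le> h y" if "g \<in> C" "h \<in> C" for g h
          using that by (simp add: diff_le_eq add.commute[of "h y"])
        then have "u (x + y) - g x \<le> u y" if "g \<in> C" for g
          using that by (intro u_greatest)
        then have "u (x + y) - u y \<le> u x"
          by (intro u_greatest) (simp add: algebra_simps)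
        then show "u (x + y) \<le> u x + u y" by simp
      next
        fix r :: real and x assume r: "0 \<le> r"
        have hom: "g (sc (of_real r) x) = r * g x" if "g \<in> C" for g
          using that CA r unfolding A_def sublinear_def by blast
        have "u (sc (of_real r) x) = (INF g\<in>C. r * g x)"
          unfolding u_def by (rule INF_cong) (use hom in auto)
        also have "\<dots> = r * u x"
        proof (cases "r = 0")
          case True
          then show ?thesis using False by simp
        next
          case False
          then have r: "0 < r" using r by simp
          show ?thesis
          proof (rule antisym)
            have "(INF g\<in>C. r * g x) / r \<le> u x"
              unfolding u_def
            proof (rule cINF_greatest[OF \<open>C \<noteq> {}\<close>])
              fix g assume "g \<in> C"
              have "bdd_below ((\<lambda>g. r * g x) ` C)"
                using bdd_below_image_mono[of "\<lambda>a. r * a" "(\<lambda>g. g x) ` C"] bdd[of x] r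
                by (simp add: image_image mono_def)
              then have "(INF g\<in>C. r * g x) \<le> r * g x" using \<open>g \<in> C\<close> by (intro cINF_lower)
              then show "(INF g\<in>C. r * g x) / r \<le> g x" using r by (simp add: divide_le_eq mult.commute)
            qed
            then show "(INF g\<in>C. r * g x) \<le> r * u x" using r by (simp add: divide_le_eq mult.commute)
            show "r * u x \<le> (INF g\<in>C. r * g x)"
              using r u_le \<open>C \<noteq> {}\<close> by (intro cINF_greatest) auto
          qed
        qed
        finally show "u (sc (of_real r) x) = r * u x" .
      qed
      moreover have "u x \<le> f x" for x
        using False u_le CA unfolding A_def by (force intro: order_trans)
      ultimately show ?thesis using u_le by (auto simp: A_def P_def)
    qed
  qed
  then obtain g where g: "g \<in> A" "\<forall>a\<in>A. P g a \<longrightarrow> a = g" by blast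
  show ?thesis
  proof (rule that[of g])
    show "sublinear g" "g x \<le> f x" for x using g(1) by (auto simp: A_def)
    show "h = g" if "sublinear h" "\<And>x. h x \<le> g x" for h
      using g that by (auto simp: A_def P_def intro: order_trans)
  qed
qed

text \<open>
  Pushing \<open>q\<close> down in the direction \<open>x\<^sub>0\<close> first forces the value at \<open>x\<^sub>0\<close>. A minimal functional below
  the result cannot be pushed down further, so it is odd and hence linear.
\<close>

lemma real_Hahn_Banach:
  obtains g where "\<And>x y. g (x + y) = g x + g y" "\<And>r x. g (sc (of_real r) x) = r * g x"
    "\<And>x. g x \<le> q x" "g x\<^sub>0 = q x\<^sub>0"
proof -
  obtain g where g: "sublinear g" "\<And>x. g x \<le> push_down q x\<^sub>0 x"
    and min: "\<And>h. sublinear h \<Longrightarrow> (\<And>x. h x \<le> g x) \<Longrightarrow> h = g"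
    using sublinear_minimal_exists[OF sublinear_push_down[OF sublinear_seminorm]] by metis
  have pd: "push_down g y = g" for y
    using sublinear_push_down[OF g(1)] push_down_le[OF g(1)] by (rule min)
  have neg: "g (- y) = - g y" for y
    using push_down_at_minus[OF g(1), of y] sublinear_lower[OF g(1), of y] by (simp add: pd)
  have sub: "g (x + y) \<le> g x + g y" and hom: "0 \<le> r \<Longrightarrow> g (sc (of_real r) x) = r * g x" for r x y
    using g(1) by (auto simp: sublinear_def)
  show ?thesis
  proof
    show "g (x + y) = g x + g y" for x y
      using sub[of x y] sub[of "x + y" "- y"] neg[of y] by simp
    show "g (sc (of_real r) x) = r * g x" for r x
    proof (cases "0 \<le> r")
      case False
      have "g (sc (of_real r) x) = g (- sc (of_real (- r)) x)" by (simp add: scale_minus_left)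
      also have "\<dots> = r * g x" using False hom[of "- r" x] by (simp add: neg)
      finally show ?thesis .
    qed (rule hom)
    show le: "g x \<le> q x" for x
      using g(2)[of x] push_down_le[OF sublinear_seminorm, of x\<^sub>0 x] by linarith
    have "g (- x\<^sub>0) \<le> - q x\<^sub>0"
      using g(2)[of "- x\<^sub>0"] push_down_at_minus[OF sublinear_seminorm, of x\<^sub>0] by linarith
    then show "g x\<^sub>0 = q x\<^sub>0" using le[of "x\<^sub>0"] neg[of "x\<^sub>0"] by simp
  qed
qed

text \<open>
  The complex functional with real part \<open>g\<close> is \<open>x \<mapsto> g x - \<i> g (\<i> x)\<close>; rotating its value onto the
  positive real axis shows that it obeys the same bound as \<open>g\<close>.
\<close>

theorem Hahn_Banach:
  obtains u where "Vector_Spaces.linear sc (*) u" "\<And>x. cmod (u x) \<le> q x" "u x\<^sub>0 = of_real (q x\<^sub>0)"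
proof -
  obtain g where add: "\<And>x y. g (x + y) = g x + g y"
    and hom: "\<And>r x. g (sc (of_real r) x) = r * g x"
    and le: "\<And>x. g x \<le> q x" and eq: "g x\<^sub>0 = q x\<^sub>0"
    using real_Hahn_Banach[of x\<^sub>0] by metis
  define u where "u = (\<lambda>x. Complex (g x) (- g (sc \<i> x)))"
  have g_neg: "g (- x) = - g x" for x
    using hom[of "-1" x] by simp
  have g_diff: "g (x - y) = g x - g y" for x y
    using add[of x "- y"] by (simp add: g_neg)
  have u_add: "u (x + y) = u x + u y" for x y
    by (simp add: u_def add scale_right_distrib complex_eq_iff)
  have u_scale: "u (sc c x) = c * u x" for c x
  proof -
    have "sc c x = sc (of_real (Re c)) x + sc (of_real (Im c)) (sc \<i> x)" for x
      by (simp add: scale_left_distrib[symmetric] mult.commute flip: complex_eq)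
    moreover have "sc \<i> (sc \<i> x) = - x" by simp
    moreover have "sc \<i> (sc c x) = sc c (sc \<i> x)" by (simp add: mult.commute)
    ultimately show ?thesis
      unfolding u_def complex_eq_iff by (simp add: add hom g_neg g_diff del: scale_scale)
  qed
  have bound: "cmod (u x) \<le> q x" for x
  proof (cases "u x = 0")
    case False
    \<comment> \<open>the rotation that makes \<open>u x\<close> real and positive\<close>
    define c where "c = cnj (u x) / of_real (cmod (u x))"
    have "cnj (u x) * u x = of_real (cmod (u x)) * of_real (cmod (u x))"
      using complex_norm_square[of "u x"] by (simp add: power2_eq_square mult.commute)
    then have c: "cmod c = 1" "c * u x = of_real (cmod (u x))"
      using False by (simp_all add: c_def norm_divide)
    have "cmod (u x) = Re (u (sc c x))" by (simp add: u_scale c)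
    also have "\<dots> = g (sc c x)" by (simp add: u_def)
    also have "\<dots> \<le> q x" using le[of "sc c x"] c by (simp add: homogeneous)
    finally show ?thesis .
  qed simp
  have "u x\<^sub>0 = of_real (q x\<^sub>0)"
  proof -
    have "(cmod (u x\<^sub>0))\<^sup>2 \<le> (q x\<^sub>0)\<^sup>2" using bound by (intro power_mono) auto
    then have "Im (u x\<^sub>0) = 0" by (simp add: cmod_power2) (simp add: u_def eq)
    then show ?thesis by (simp add: complex_eq_iff) (simp add: u_def eq)
  qed
  moreover have "Vector_Spaces.linear sc (*) u"
  proof -
    interpret C: vector_space "(*) :: complex \<Rightarrow> complex \<Rightarrow> complex"
      by unfold_locales (simp_all add: algebra_simps)
    show ?thesis by unfold_locales (simp_all add: u_add u_scale)
  qed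
  ultimately show ?thesis using bound that by blast
qed

end


section \<open>Locally convex spaces\<close>

locale lcs = vector_space sc for sc :: "complex \<Rightarrow> 'e \<Rightarrow> 'e::{ab_group_add,t2_space}" +
  fixes p :: "'i \<Rightarrow> 'e \<Rightarrow> real"
  assumes dfs: "directed_fundamental_system sc p"
begin

sublocale p: seminormed sc "p \<alpha>" for \<alpha>
  by unfold_locales (use dfs in \<open>simp add: directed_fundamental_system_def\<close>)

lemma open_iff: "open U \<longleftrightarrow> (\<forall>x\<in>U. \<exists>\<alpha>. \<exists>\<epsilon>>0. {y. p \<alpha> (y - x) < \<epsilon>} \<subseteq> U)"
  using dfs unfolding directed_fundamental_system_def by blast

lemma open_ballE:
  assumes "open U" "x \<in> U"
  obtains \<alpha> \<epsilon> where "\<epsilon> > 0" "{y. p \<alpha> (y - x) < \<epsilon>} \<subseteq> U"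
  using assms unfolding open_iff by blast

lemma open_ball: "open {y. p \<alpha> (y - x) < \<epsilon>}"
  unfolding open_iff
proof
  fix y assume "y \<in> {y. p \<alpha> (y - x) < \<epsilon>}"
  then have y: "p \<alpha> (y - x) < \<epsilon>" by simp
  have "p \<alpha> (z - x) < \<epsilon>" if "p \<alpha> (z - y) < \<epsilon> - p \<alpha> (y - x)" for z
    using p.triangle[of \<alpha> "z - y" "y - x"] that by simp
  then show "\<exists>\<beta>. \<exists>\<delta>>0. {z. p \<beta> (z - y) < \<delta>} \<subseteq> {y. p \<alpha> (y - x) < \<epsilon>}"
    using y by (intro exI[of _ \<alpha>] exI[of _ "\<epsilon> - p \<alpha> (y - x)"]) auto
qed

lemma seminorm_tendsto_iff: "(X \<longlongrightarrow> l) F \<longleftrightarrow> (\<forall>\<alpha>. ((\<lambda>i. p \<alpha> (X i - l)) \<longlongrightarrow> 0) F)"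
proof
  assume X: "(X \<longlongrightarrow> l) F"
  show "\<forall>\<alpha>. ((\<lambda>i. p \<alpha> (X i - l)) \<longlongrightarrow> 0) F"
  proof (intro allI order_tendstoI)
    fix \<alpha> and a :: real assume "a < 0"
    then show "\<forall>\<^sub>F i in F. a < p \<alpha> (X i - l)"
      by (intro always_eventually allI) (metis less_le_trans p.nonneg)
  next
    fix \<alpha> and a :: real assume "0 < a"
    then have "\<forall>\<^sub>F i in F. X i \<in> {y. p \<alpha> (y - l) < a}"
      by (intro topological_tendstoD[OF X open_ball]) simp
    then show "\<forall>\<^sub>F i in F. p \<alpha> (X i - l) < a" by simp
  qed
next
  assume X: "\<forall>\<alpha>. ((\<lambda>i. p \<alpha> (X i - l)) \<longlongrightarrow> 0) F"
  show "(X \<longlongrightarrow> l) F"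
  proof (rule topological_tendstoI)
    fix U assume "open U" "l \<in> U"
    then obtain \<alpha> \<epsilon> where U: "\<epsilon> > 0" "{y. p \<alpha> (y - l) < \<epsilon>} \<subseteq> U" unfolding open_iff by blast
    have "\<forall>\<^sub>F i in F. p \<alpha> (X i - l) < \<epsilon>" using X U(1) order_tendstoD(2) by blast
    then show "\<forall>\<^sub>F i in F. X i \<in> U" by eventually_elim (use U in auto)
  qed
qed

lemma eq_zeroI:
  assumes "\<And>\<alpha>. p \<alpha> x = 0"
  shows "x = 0"
proof (rule tendsto_unique[OF sequentially_bot])
  show "(\<lambda>_::nat. x) \<longlonglongrightarrow> x" by simp
  show "(\<lambda>_::nat. x) \<longlonglongrightarrow> 0" unfolding seminorm_tendsto_iff using assms by simp
qed

text \<open>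
  The absolute polar of the unit ball of \<open>p \<alpha>\<close>. Estimates of \<open>p \<alpha>\<close> by scalar estimates that are uniform over
  it are what turns complex analysis into analysis of vector-valued functions.
\<close>

definition polar :: "'i \<Rightarrow> ('e \<Rightarrow> complex) set" where
  "polar \<alpha> = {u. Vector_Spaces.linear sc (*) u \<and> (\<forall>x. cmod (u x) \<le> p \<alpha> x)}"

abbreviation dual :: "('e \<Rightarrow> complex) set" where
  "dual \<equiv> continuous_linear_maps sc (*)"

lemma polar_le: "u \<in> polar \<alpha> \<Longrightarrow> cmod (u x) \<le> p \<alpha> x"
  by (simp add: polar_def)

lemma seminorm_le_polar:
  assumes "\<And>u. u \<in> polar \<alpha> \<Longrightarrow> cmod (u x) \<le> M"
  shows "p \<alpha> x \<le> M"
proof -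
  obtain u where u: "Vector_Spaces.linear sc (*) u" "\<And>y. cmod (u y) \<le> p \<alpha> y" "u x = of_real (p \<alpha> x)"
    by (rule p.Hahn_Banach[of \<alpha> x]) (rule that)
  then have "cmod (u x) \<le> M" by (intro assms) (simp add: polar_def)
  then show ?thesis using u by simp
qed

lemma linear_dual:
  assumes "Vector_Spaces.linear sc (*) (u :: 'e \<Rightarrow> complex)"
  shows "u (x + y) = u x + u y" "u (x - y) = u x - u y" "u (sc c x) = c * u x" "u 0 = 0"
    "u (sum g A) = (\<Sum>i\<in>A. u (g i))" "u (- x) = - u x"
proof -
  interpret Vector_Spaces.linear sc "(*)" u by fact
  show "u (x + y) = u x + u y" "u (x - y) = u x - u y" "u (sc c x) = c * u x" "u 0 = 0"
    "u (sum g A) = (\<Sum>i\<in>A. u (g i))" "u (- x) = - u x"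
    by (rule add diff scale zero sum neg)+
qed

lemma dual_linear: "u \<in> dual \<Longrightarrow> Vector_Spaces.linear sc (*) u"
  by (simp add: continuous_linear_maps_def)

lemmas dual_simps = linear_dual[OF dual_linear]

lemma dualI:
  assumes "Vector_Spaces.linear sc (*) u" "\<And>x. cmod (u x) \<le> C * p \<alpha> x"
  shows "u \<in> dual"
proof -
  have "(u \<longlongrightarrow> u x) (at x)" for x
  proof -
    have "((\<lambda>y. C * p \<alpha> (y - x)) \<longlongrightarrow> C * 0) (at x)"
      by (rule tendsto_mult_left[OF seminorm_tendsto_iff[THEN iffD1, rule_format, OF tendsto_ident_at]])
    moreover have "cmod (u y - u x) \<le> C * p \<alpha> (y - x)" for y
      using assms(2)[of "y - x"] by (simp only: linear_dual(2)[OF assms(1)])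
    ultimately have "((\<lambda>y. u y - u x) \<longlongrightarrow> 0) (at x)"
      using Lim_null_comparison[OF always_eventually, of "\<lambda>y. u y - u x" "\<lambda>y. C * p \<alpha> (y - x)" "at x"]
      by simp
    then show ?thesis by (simp add: LIM_zero_iff)
  qed
  then show ?thesis using assms(1) by (simp add: continuous_linear_maps_def continuous_on_def)
qed

lemma polar_dual: "u \<in> polar \<alpha> \<Longrightarrow> u \<in> dual"
  by (rule dualI[of u 1 \<alpha>]) (auto simp: polar_def)

lemma dual_bounded:
  assumes u: "u \<in> dual"
  obtains \<alpha> C where "0 \<le> C" "\<And>x. cmod (u x) \<le> C * p \<alpha> x"
proof -
  have "open (u -` ball 0 1)"
    using u by (intro open_vimage) (simp_all add: continuous_linear_maps_def)
  moreover have "0 \<in> u -` ball 0 1" using dual_simps(4)[OF u] by simp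
  ultimately obtain \<alpha> \<epsilon> where e: "\<epsilon> > 0" "{y. p \<alpha> (y - 0) < \<epsilon>} \<subseteq> u -` ball 0 1"
    unfolding open_iff by blast
  have "cmod (u x) \<le> (1 / \<epsilon>) * p \<alpha> x" for x
  proof (rule ccontr)
    assume "\<not> ?thesis"
    then have less: "p \<alpha> x < \<epsilon> * cmod (u x)" using e(1) by (simp add: field_simps)
    then have pos: "cmod (u x) > 0" using e(1) p.nonneg[of \<alpha> x]
      by (cases "u x = 0") auto
    have "p \<alpha> (sc (of_real (1 / cmod (u x))) x) < \<epsilon>"
      using less pos by (simp add: p.homogeneous field_simps norm_divide)
    then have "cmod (u (sc (of_real (1 / cmod (u x))) x)) < 1" using e(2) by auto
    then show False using pos by (simp add: dual_simps(3)[OF u] norm_mult norm_divide)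
  qed
  then show ?thesis using e(1) by (intro that[of "1 / \<epsilon>" \<alpha>]) auto
qed

lemma polar_separates:
  assumes "\<And>u \<alpha>. u \<in> polar \<alpha> \<Longrightarrow> u x = u y"
  shows "x = y"
proof -
  have "x - y = 0"
  proof (rule eq_zeroI)
    fix \<alpha>
    have "p \<alpha> (x - y) \<le> 0"
      by (rule seminorm_le_polar) (simp add: dual_simps(2) polar_dual assms)
    then show "p \<alpha> (x - y) = 0" using p.nonneg[of \<alpha> "x - y"] by linarith
  qed
  then show ?thesis by simp
qed

lemma dual_separates: "(\<And>u. u \<in> dual \<Longrightarrow> u x = u y) \<Longrightarrow> x = y"
  by (rule polar_separates) (simp add: polar_dual)

end

locale sc_lcs = lcs sc p
  for sc :: "complex \<Rightarrow> 'e \<Rightarrow> 'e::{ab_group_add,t2_space}" and p :: "'i \<Rightarrow> 'e \<Rightarrow> real" +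
  assumes seq_complete: "sequentially_complete TYPE('e)"
begin

lemma Cauchy_converges:
  assumes "\<And>\<alpha> \<epsilon>. \<epsilon> > 0 \<Longrightarrow> \<exists>N. \<forall>m\<ge>N. \<forall>n\<ge>N. p \<alpha> (X m - X n) < \<epsilon>"
  obtains l where "X \<longlonglongrightarrow> l"
proof -
  have "\<exists>N. \<forall>m\<ge>N. \<forall>n\<ge>N. X m - X n \<in> U" if "open U" "0 \<in> U" for U
  proof -
    obtain \<alpha> \<epsilon> where "\<epsilon> > 0" "{y. p \<alpha> (y - 0) < \<epsilon>} \<subseteq> U"
      using open_ballE[OF \<open>open U\<close> \<open>0 \<in> U\<close>] by blast
    then show ?thesis using assms[of \<epsilon> \<alpha>] by fastforce
  qed
  then have "convergent X" using seq_complete unfolding sequentially_complete_def by blast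
  then show ?thesis using that by (auto simp: convergent_def)
qed

end

section \<open>Riemann sums and Pettis integrals over the real line\<close>

definition riemann_sum :: "(complex \<Rightarrow> 'v \<Rightarrow> 'v) \<Rightarrow> (real \<Rightarrow> 'v::ab_group_add) \<Rightarrow> nat \<Rightarrow> 'v" where
  "riemann_sum sc g N = (\<Sum>k\<in>{- int (N\<^sup>2)..<int (N\<^sup>2)}. sc (of_real (1 / N)) (g (k / N)))"

text \<open>
  Twice the half-line integral: the function is dominated by the sum of the one-sided exponential and
  its reflection.
\<close>

lemma integrable_exp_abs:
  assumes d: "0 < (d::real)"
  shows "integrable lebesgue (\<lambda>x. exp (- d * \<bar>x\<bar>))"
proof -
  define h where "h x = (if 0 \<le> x then exp (- d * x) else 0)" for x :: real
  have "(\<lambda>x. exp (- d * x)) absolutely_integrable_on {0..}"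
    using integrable_on_exp_minus_to_infinity[OF d, of 0]
    by (intro nonnegative_absolutely_integrable_1) auto
  then have "integrable lebesgue h"
    unfolding set_integrable_def by (rule back_subst[of "integrable lebesgue"]) (auto simp: h_def indicator_def)
  moreover have meas: "h \<in> borel_measurable borel"
    unfolding h_def by measurable
  ultimately have h: "integrable lborel h" by (subst (asm) integrable_completion) simp_all
  from lborel_integrable_real_affine[OF h, of "-1" 0] have h': "integrable lborel (\<lambda>x. h (- x))" by simp
  have "integrable lborel (\<lambda>x. exp (- d * \<bar>x\<bar>))"
    by (rule Bochner_Integration.integrable_bound[OF Bochner_Integration.integrable_add[OF h h']])
      (auto simp: h_def abs_if)
  then show ?thesis by (subst integrable_completion) simp_all
qed

text \<open>
  Exponential decay together with a Lipschitz condition carrying the same weight. The two constants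
  alone control the error of the Riemann sums, uniformly in \<open>G\<close>.
\<close>

definition tame :: "real \<Rightarrow> real \<Rightarrow> (real \<Rightarrow> complex) \<Rightarrow> bool" where
  "tame C d G \<longleftrightarrow> (\<forall>x. cmod (G x) \<le> C * exp (- d * \<bar>x\<bar>)) \<and>
     (\<forall>x y. \<bar>x - y\<bar> \<le> 1 \<longrightarrow> cmod (G x - G y) \<le> C * \<bar>x - y\<bar> * exp (- d * \<bar>x\<bar>))"

lemma tame_continuous:
  assumes "tame C d G"
  shows "continuous_on UNIV G"
proof -
  have "(G \<longlongrightarrow> G x) (at x)" for x
  proof -
    have "((\<lambda>y. C * \<bar>x - y\<bar> * exp (- d * \<bar>x\<bar>)) \<longlongrightarrow> C * \<bar>x - x\<bar> * exp (- d * \<bar>x\<bar>)) (at x)"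
      by (intro tendsto_intros)
    moreover have "\<forall>\<^sub>F y in at x. cmod (G y - G x) \<le> C * \<bar>x - y\<bar> * exp (- d * \<bar>x\<bar>)"
      unfolding eventually_at
      by (rule exI[of _ 1]) (use assms in \<open>auto simp: tame_def dist_real_def norm_minus_commute[of _ "G x"] abs_minus_commute[of _ x]\<close>)
    ultimately have "((\<lambda>y. G y - G x) \<longlongrightarrow> 0) (at x)"
      using Lim_null_comparison[of "\<lambda>y. G y - G x" "\<lambda>y. C * \<bar>x - y\<bar> * exp (- d * \<bar>x\<bar>)" "at x"] by simp
    then show ?thesis by (simp add: LIM_zero_iff)
  qed
  then show ?thesis by (simp add: continuous_on_def)
qed

lemma continuous_lebesgue_measurable:
  fixes G :: "real \<Rightarrow> complex"
  shows "continuous_on UNIV G \<Longrightarrow> G \<in> borel_measurable lebesgue"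
  by (intro measurable_completion) (simp add: borel_measurable_continuous_onI)

lemma integrable_exp_boundI:
  fixes G :: "real \<Rightarrow> complex"
  assumes "continuous_on UNIV G" "\<And>x. cmod (G x) \<le> C * exp (- d * \<bar>x\<bar>)" "0 < d"
  shows "integrable lebesgue G"
  by (rule Bochner_Integration.integrable_bound[OF integrable_mult_right[OF integrable_exp_abs[OF assms(3)]]
        continuous_lebesgue_measurable[OF assms(1)], of C])
    (use assms(2) order_trans[OF assms(2) abs_ge_self] in auto)

lemma tame_integrable: "tame C d G \<Longrightarrow> 0 < d \<Longrightarrow> integrable lebesgue G"
  by (rule integrable_exp_boundI[OF tame_continuous]) (auto simp: tame_def)

text \<open>
  The first summand accounts for the mesh \<open>1 / N\<close>, the second one for the part of the line outside
  \<open>[-N, N]\<close>.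
\<close>

definition riemann_error :: "real \<Rightarrow> nat \<Rightarrow> real" where
  "riemann_error d N = (LINT x|lebesgue. exp (- d * \<bar>x\<bar>) * (1 / N + indicator {x. N \<le> \<bar>x\<bar>} x))"

lemma integrable_riemann_error:
  assumes "0 < d"
  shows "integrable lebesgue (\<lambda>x. exp (- d * \<bar>x\<bar>) * (1 / real N + indicator {x. N \<le> \<bar>x\<bar>} x))"
proof (rule Bochner_Integration.integrable_bound)
  show "integrable lebesgue (\<lambda>x. (1 / real N + 1) * exp (- d * \<bar>x\<bar>))"
    using integrable_exp_abs[OF assms] by simp
  show "(\<lambda>x. exp (- d * \<bar>x\<bar>) * (1 / real N + indicator {x. N \<le> \<bar>x\<bar>} x)) \<in> borel_measurable lebesgue"
    by (intro measurable_completion) measurable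
qed (auto simp: indicator_def algebra_simps)

lemma riemann_error_tendsto:
  assumes d: "0 < d"
  shows "riemann_error d \<longlonglongrightarrow> 0"
proof -
  have "(\<lambda>N. riemann_error d N) \<longlonglongrightarrow> (LINT x|(lebesgue::real measure). 0)"
    unfolding riemann_error_def
  proof (rule integral_dominated_convergence[where w = "\<lambda>x. 2 * exp (- d * \<bar>x\<bar>)"])
    show "(\<lambda>x. exp (- d * \<bar>x\<bar>) * (1 / real N + indicator {x. real N \<le> \<bar>x\<bar>} x)) \<in> borel_measurable lebesgue" for N
      using integrable_riemann_error[OF d] by blast
    show "integrable lebesgue (\<lambda>x. 2 * exp (- d * \<bar>x\<bar>))"
      using integrable_exp_abs[OF d] by simp
    show "AE x in lebesgue. (\<lambda>N. exp (- d * \<bar>x\<bar>) * (1 / real N + indicator {x. real N \<le> \<bar>x\<bar>} x)) \<longlonglongrightarrow> 0"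
    proof (rule AE_I2)
      fix x :: real
      have "\<forall>\<^sub>F N in sequentially. indicator {x. real N \<le> \<bar>x\<bar>} x = (0::real)"
        using eventually_gt_at_top[of "nat \<lceil>\<bar>x\<bar>\<rceil>"] by eventually_elim (auto simp: indicator_def, linarith)
      then have "(\<lambda>N. indicator {x. real N \<le> \<bar>x\<bar>} x :: real) \<longlonglongrightarrow> 0" by (rule tendsto_eventually)
      from tendsto_mult_left[OF tendsto_add[OF lim_1_over_n this], of "exp (- d * \<bar>x\<bar>)"]
      show "(\<lambda>N. exp (- d * \<bar>x\<bar>) * (1 / real N + indicator {x. real N \<le> \<bar>x\<bar>} x)) \<longlonglongrightarrow> 0" by simp
    qed
    show "AE x in lebesgue. norm (exp (- d * \<bar>x\<bar>) * (1 / real N + indicator {x. real N \<le> \<bar>x\<bar>} x)) \<le> 2 * exp (- d * \<bar>x\<bar>)" for N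
      by (rule AE_I2) (cases "N = 0", auto simp: indicator_def field_simps)
  qed simp
  then show ?thesis by simp
qed

text \<open>
  The Riemann sum is the integral of the step function \<open>s\<close> with the values of \<open>G\<close> at the left end
  points. It differs from \<open>G\<close> by the Lipschitz estimate inside \<open>[-N, N)\<close> and by \<open>G\<close> itself outside.
\<close>

lemma riemann_sum_error:
  assumes G: "tame C d G" and d: "0 < d" and N: "0 < N" and C: "0 \<le> C"
  shows "cmod (riemann_sum (*) G N - (LINT x|lebesgue. G x)) \<le> C * riemann_error d N"
proof -
  define I where "I k = {real_of_int k / N..<real_of_int (k + 1) / N}" for k :: int
  define K where "K = {- int (N\<^sup>2)..<int (N\<^sup>2)}"
  define s where "s x = (\<Sum>k\<in>K. indicator (I k) x *\<^sub>R G (k / N))" for x :: real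
  have meas: "emeasure lebesgue (I k) = ennreal (1 / N)" for k
    unfolding I_def by (simp add: divide_right_mono diff_divide_distrib[symmetric])
  have lm: "I k \<in> sets lebesgue" for k unfolding I_def by simp
  have int_k: "integrable lebesgue (\<lambda>x. indicator (I k) x *\<^sub>R G (k / N))" for k
    by (rule integrable_scaleR_left) (use lm meas in \<open>auto intro!: integrable_real_indicator simp: less_top[symmetric]\<close>)
  have int_s: "integrable lebesgue s"
    unfolding s_def by (rule Bochner_Integration.integrable_sum) (rule int_k)
  have "(LINT x|lebesgue. s x) = (\<Sum>k\<in>K. LINT x|lebesgue. indicator (I k) x *\<^sub>R G (k / N))"
    unfolding s_def by (rule Bochner_Integration.integral_sum) (rule int_k)
  also have "\<dots> = (\<Sum>k\<in>K. measure lebesgue (I k) *\<^sub>R G (k / N))"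
    by (intro sum.cong refl) (use lm meas in \<open>simp\<close>)
  also have "\<dots> = riemann_sum (*) G N"
    unfolding riemann_sum_def K_def[symmetric]
    by (intro sum.cong refl) (simp add: measure_def meas scaleR_conv_of_real)
  finally have s: "(LINT x|lebesgue. s x) = riemann_sum (*) G N" .
  have iff: "x \<in> I k \<longleftrightarrow> k = \<lfloor>N * x\<rfloor>" for x :: real and k
  proof -
    have "x \<in> I k \<longleftrightarrow> k \<le> N * x \<and> N * x < k + 1"
      unfolding I_def using N by (auto simp: field_simps)
    then show ?thesis using floor_eq_iff[of "N * x" k] by auto
  qed
  have s_eq: "s x = (if \<lfloor>N * x\<rfloor> \<in> K then G (\<lfloor>N * x\<rfloor> / N) else 0)" for x :: real
  proof -
    have "s x = (\<Sum>k\<in>K. if k = \<lfloor>N * x\<rfloor> then G (k / N) else 0)"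
      unfolding s_def by (intro sum.cong refl) (simp add: indicator_def iff)
    then show ?thesis by (simp add: K_def)
  qed
  have K_iff: "\<lfloor>N * x\<rfloor> \<in> K \<longleftrightarrow> - real N \<le> x \<and> x < N" for x :: real
  proof -
    have "\<lfloor>N * x\<rfloor> \<in> K \<longleftrightarrow> - (real N)\<^sup>2 \<le> N * x \<and> N * x < (real N)\<^sup>2"
      unfolding K_def by (simp add: le_floor_iff floor_less_iff)
    also have "\<dots> \<longleftrightarrow> real N * (- N) \<le> N * x \<and> N * x < N * real N"
      by (simp add: power2_eq_square)
    also have "\<dots> \<longleftrightarrow> - real N \<le> x \<and> x < N"
      using N by (subst mult_le_cancel_left_pos, simp, subst mult_less_cancel_left_pos, simp, simp)
    finally show ?thesis .
  qed
  have le: "cmod (s x - G x) \<le> C * (exp (- d * \<bar>x\<bar>) * (1 / real N + indicator {x. N \<le> \<bar>x\<bar>} x))" for x :: real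
  proof (cases "\<lfloor>N * x\<rfloor> \<in> K")
    case True
    define y where "y = \<lfloor>N * x\<rfloor> / real N"
    have yN: "y * N = \<lfloor>N * x\<rfloor>" using N by (simp add: y_def)
    have "y * N \<le> N * x" "N * x - y * N < 1" unfolding yN by linarith+
    then have y: "\<bar>x - y\<bar> \<le> 1 / N"
      using N by (simp add: field_simps)
    also have "1 / real N \<le> 1" using N by simp
    finally have y1: "\<bar>x - y\<bar> \<le> 1" .
    have "cmod (s x - G x) = cmod (G x - G y)"
      using True by (simp add: s_eq y_def norm_minus_commute)
    also have "\<dots> \<le> C * \<bar>x - y\<bar> * exp (- d * \<bar>x\<bar>)" using G y1 unfolding tame_def by blast
    also have "\<dots> \<le> C * (1 / N) * exp (- d * \<bar>x\<bar>)"
      by (intro mult_right_mono mult_left_mono y C) simp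
    also have "\<dots> = C * (exp (- d * \<bar>x\<bar>) * (1 / N + 0))" by simp
    also have "\<dots> \<le> C * (exp (- d * \<bar>x\<bar>) * (1 / real N + indicator {x. N \<le> \<bar>x\<bar>} x))"
      by (intro mult_left_mono add_left_mono C) auto
    finally show ?thesis .
  next
    case False
    then have x: "indicator {x. N \<le> \<bar>x\<bar>} x = (1::real)"
      unfolding K_iff by (auto simp: indicator_def)
    have "cmod (s x - G x) = cmod (G x)" using False by (simp add: s_eq)
    also have "\<dots> \<le> C * exp (- d * \<bar>x\<bar>)" using G unfolding tame_def by blast
    also have "\<dots> \<le> C * (exp (- d * \<bar>x\<bar>) * (1 / real N + 1))"
      using C by (intro mult_left_mono) auto
    finally show ?thesis by (simp add: x)
  qed
  have int_G: "integrable lebesgue G" by (rule tame_integrable[OF G d])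
  have "cmod (riemann_sum (*) G N - (LINT x|lebesgue. G x)) = cmod (LINT x|lebesgue. s x - G x)"
    using int_s int_G by (simp add: s)
  also have "\<dots> \<le> (LINT x|lebesgue. C * (exp (- d * \<bar>x\<bar>) * (1 / real N + indicator {x. N \<le> \<bar>x\<bar>} x)))"
    using le integrable_riemann_error[OF d, of N] int_s int_G
    by (intro Bochner_Integration.integral_norm_bound_integral) auto
  also have "\<dots> = C * riemann_error d N" by (simp add: riemann_error_def)
  finally show ?thesis .
qed

context lcs
begin

text \<open>
  For each seminorm the constants are common to all functionals in its polar, so that the error of the
  Riemann sums is uniform over the polar and therefore an error in the seminorm.
\<close>

definition vtame :: "(real \<Rightarrow> 'e) \<Rightarrow> bool" where
  "vtame g \<longleftrightarrow> (\<forall>\<alpha>. \<exists>C d. 0 < d \<and> 0 \<le> C \<and> (\<forall>u\<in>polar \<alpha>. tame C d (\<lambda>x. u (g x))))"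

lemma has_pettis_integral_unique:
  assumes "has_pettis_integral sc g a" "has_pettis_integral sc g b"
  shows "a = b"
  using assms by (intro dual_separates) (metis has_pettis_integral_def)

lemma pettis_integral_eq: "has_pettis_integral sc g a \<Longrightarrow> pettis_integral sc g = a"
  unfolding pettis_integral_def using has_pettis_integral_unique by blast

lemma has_pettis_integral_integral: "pettis_integrable sc g \<Longrightarrow> has_pettis_integral sc g (pettis_integral sc g)"
  using pettis_integral_eq by (auto simp: pettis_integrable_def)

lemma has_pettis_integral_add:
  "has_pettis_integral sc g a \<Longrightarrow> has_pettis_integral sc h b \<Longrightarrow>
    has_pettis_integral sc (\<lambda>x. g x + h x) (a + b)"
  by (simp add: has_pettis_integral_def dual_simps)

lemma has_pettis_integral_diff:
  "has_pettis_integral sc g a \<Longrightarrow> has_pettis_integral sc h b \<Longrightarrow>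
    has_pettis_integral sc (\<lambda>x. g x - h x) (a - b)"
  by (simp add: has_pettis_integral_def dual_simps)

lemma has_pettis_integral_scale:
  "has_pettis_integral sc g a \<Longrightarrow> has_pettis_integral sc (\<lambda>x. sc c (g x)) (sc c a)"
  by (simp add: has_pettis_integral_def dual_simps)

lemma pettis_integral_le:
  assumes "has_pettis_integral sc g a" "\<And>x. p \<alpha> (g x) \<le> b x" "integrable lebesgue b"
  shows "p \<alpha> a \<le> (LINT x|lebesgue. b x)"
proof (rule seminorm_le_polar)
  fix u assume u: "u \<in> polar \<alpha>"
  then have int: "integrable lebesgue (\<lambda>x. u (g x))" "(LINT x|lebesgue. u (g x)) = u a"
    using assms(1) polar_dual by (auto simp: has_pettis_integral_def)
  have "cmod (LINT x|lebesgue. u (g x)) \<le> (LINT x|lebesgue. b x)"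
    using int assms(3) order_trans[OF polar_le[OF u] assms(2)]
    by (intro Bochner_Integration.integral_norm_bound_integral) auto
  then show "cmod (u a) \<le> (LINT x|lebesgue. b x)" by (simp add: int)
qed

lemma polar_of_dual:
  assumes u: "u \<in> dual"
  obtains \<alpha> D where "0 < D" "(\<lambda>x. u x / of_real D) \<in> polar \<alpha>"
proof -
  obtain \<alpha> D where D: "0 \<le> D" "\<And>x. cmod (u x) \<le> D * p \<alpha> x" using dual_bounded[OF u] by blast
  interpret u: Vector_Spaces.linear sc "(*)" u by (rule dual_linear[OF u])
  have "Vector_Spaces.linear sc (*) (\<lambda>x. u x / of_real (D + 1))"
    by unfold_locales (simp_all add: u.add u.scale add_divide_distrib)
  moreover have "cmod (u x / of_real (D + 1)) \<le> p \<alpha> x" for x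
    using D order_trans[OF D(2) mult_right_mono[of D "D + 1" "p \<alpha> x"]]
    by (simp add: norm_divide divide_le_eq mult.commute)
  ultimately show ?thesis using D(1) by (intro that[of "D + 1" \<alpha>]) (auto simp: polar_def)
qed

end

context sc_lcs
begin

text \<open>
  The Riemann sums are Cauchy, because functionals in a polar map them to scalar Riemann sums with a
  uniform error. Their limit has the values required of the Pettis integral, since functionals are continuous.
\<close>

lemma vtame_integral:
  assumes g: "vtame g"
  obtains a where "has_pettis_integral sc g a" "riemann_sum sc g \<longlonglongrightarrow> a"
proof -
  have u_sum: "u (riemann_sum sc g N) = riemann_sum (*) (\<lambda>x. u (g x)) N" if "u \<in> dual" for u N
    by (simp add: riemann_sum_def dual_simps[OF that])
  have err: "\<exists>C d. 0 < d \<and> 0 \<le> C \<and>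
      (\<forall>u\<in>polar \<alpha>. \<forall>N>0. cmod (u (riemann_sum sc g N) - (LINT x|lebesgue. u (g x))) \<le> C * riemann_error d N)" for \<alpha>
  proof -
    obtain C d where "0 < d" "0 \<le> C" "\<forall>u\<in>polar \<alpha>. tame C d (\<lambda>x. u (g x))"
      using g unfolding vtame_def by blast
    then show ?thesis
      by (intro exI[of _ C] exI[of _ d]) (simp add: u_sum polar_dual riemann_sum_error)
  qed
  obtain a where a: "riemann_sum sc g \<longlonglongrightarrow> a"
  proof (rule Cauchy_converges)
    fix \<alpha> and \<epsilon> :: real assume e: "\<epsilon> > 0"
    obtain C d where C: "0 < d" "0 \<le> C"
      "\<And>u N. u \<in> polar \<alpha> \<Longrightarrow> N > 0 \<Longrightarrow>
         cmod (u (riemann_sum sc g N) - (LINT x|lebesgue. u (g x))) \<le> C * riemann_error d N"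
      using err by metis
    have "(\<lambda>N. C * riemann_error d N) \<longlonglongrightarrow> C * 0"
      by (intro tendsto_mult_left riemann_error_tendsto C)
    then have "\<forall>\<^sub>F N in sequentially. C * riemann_error d N < \<epsilon> / 2"
      using e by (intro order_tendstoD(2)[of _ "C * 0"]) auto
    then obtain M where M: "\<And>N. N \<ge> M \<Longrightarrow> C * riemann_error d N < \<epsilon> / 2"
      unfolding eventually_sequentially by blast
    have "p \<alpha> (riemann_sum sc g m - riemann_sum sc g n) < \<epsilon>" if mn: "m \<ge> Suc M" "n \<ge> Suc M" for m n
    proof -
      have "p \<alpha> (riemann_sum sc g m - riemann_sum sc g n) \<le> C * riemann_error d m + C * riemann_error d n"
      proof (rule seminorm_le_polar)
        fix u assume u: "u \<in> polar \<alpha>"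
        let ?I = "LINT x|lebesgue. u (g x)"
        have "u (riemann_sum sc g m - riemann_sum sc g n) =
            (u (riemann_sum sc g m) - ?I) - (u (riemann_sum sc g n) - ?I)"
          by (simp add: dual_simps(2)[OF polar_dual[OF u]])
        then show "cmod (u (riemann_sum sc g m - riemann_sum sc g n)) \<le> C * riemann_error d m + C * riemann_error d n"
          using C(3)[OF u, of m] C(3)[OF u, of n] mn norm_triangle_ineq4[of "u (riemann_sum sc g m) - ?I" "u (riemann_sum sc g n) - ?I"]
          by simp
      qed
      then show ?thesis using M[of m] M[of n] mn by simp
    qed
    then show "\<exists>N. \<forall>m\<ge>N. \<forall>n\<ge>N. p \<alpha> (riemann_sum sc g m - riemann_sum sc g n) < \<epsilon>" by blast
  qed
  moreover have "has_pettis_integral sc g a"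
    unfolding has_pettis_integral_def
  proof
    fix u assume u: "u \<in> dual"
    obtain \<alpha> D where D: "0 < D" "(\<lambda>x. u x / of_real D) \<in> polar \<alpha>" by (rule polar_of_dual[OF u])
    define v where "v = (\<lambda>x. u x / of_real D)"
    have v: "v \<in> polar \<alpha>" and uv: "u = (\<lambda>x. of_real D * v x)" using D by (auto simp: v_def)
    obtain C d where C: "0 < d" "0 \<le> C" "\<forall>u\<in>polar \<alpha>. tame C d (\<lambda>x. u (g x))"
      using g unfolding vtame_def by blast
    have int: "integrable lebesgue (\<lambda>x. v (g x))" using C v tame_integrable by blast
    have "(\<lambda>N. v (riemann_sum sc g N)) \<longlonglongrightarrow> (LINT x|lebesgue. v (g x))"
    proof (rule LIM_zero_cancel[OF Lim_null_comparison])
      show "\<forall>\<^sub>F N in sequentially. norm (v (riemann_sum sc g N) - (LINT x|lebesgue. v (g x))) \<le> C * riemann_error d N"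
        using eventually_gt_at_top[of 0]
        by eventually_elim (use C v in \<open>simp add: u_sum polar_dual riemann_sum_error\<close>)
      show "(\<lambda>N. C * riemann_error d N) \<longlonglongrightarrow> 0"
        using tendsto_mult_left[OF riemann_error_tendsto[OF C(1)], of C] by simp
    qed
    moreover have "(\<lambda>N. v (riemann_sum sc g N)) \<longlonglongrightarrow> v a"
    proof -
      have "continuous_on UNIV v" using polar_dual[OF v] by (simp add: continuous_linear_maps_def)
      then show ?thesis using a by (rule continuous_on_tendsto_compose) auto
    qed
    ultimately have "(LINT x|lebesgue. v (g x)) = v a" using LIMSEQ_unique by blast
    then show "integrable lebesgue (\<lambda>x. u (g x)) \<and> (LINT x|lebesgue. u (g x)) = u a"
      using int by (simp add: uv)
  qed
  ultimately show ?thesis using that by blast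
qed

lemma vtame_integrable: "vtame g \<Longrightarrow> pettis_integrable sc g"
  using vtame_integral by (metis pettis_integrable_def)

lemma riemann_sum_tendsto: "vtame g \<Longrightarrow> riemann_sum sc g \<longlonglongrightarrow> pettis_integral sc g"
  using vtame_integral pettis_integral_eq by metis

end

section \<open>Holomorphic functions on horizontal strips\<close>

definition hstrip :: "real \<Rightarrow> real \<Rightarrow> complex set" where
  "hstrip a b = {z. a < Im z \<and> Im z < b}"

lemma hstrip_iff [simp]: "z \<in> hstrip a b \<longleftrightarrow> a < Im z \<and> Im z < b"
  by (simp add: hstrip_def)

lemma open_hstrip [simp, intro]: "open (hstrip a b)"
  unfolding hstrip_def by (intro open_Collect_conj open_Collect_less continuous_intros)

lemma convex_hstrip [simp, intro]: "convex (hstrip a b)"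
proof -
  have "hstrip a b = {z. Im z > a} \<inter> {z. Im z < b}" by (auto simp: hstrip_def)
  then show ?thesis by (simp add: convex_Int convex_halfspace_Im_gt convex_halfspace_Im_lt)
qed

lemma tendsto_integral_symmetric_interval:
  fixes g :: "real \<Rightarrow> complex"
  assumes g: "integrable lebesgue g"
  shows "(\<lambda>N::nat. integral {- real N..real N} g) \<longlonglongrightarrow> (LINT x|lebesgue. g x)"
proof -
  have "(\<lambda>N::nat. LINT x|lebesgue. indicator {- real N..real N} x *\<^sub>R g x) \<longlonglongrightarrow> (LINT x|lebesgue. g x)"
  proof (rule integral_dominated_convergence[where w = "\<lambda>x. norm (g x)"])
    show "AE x in lebesgue. (\<lambda>N. indicator {- real N..real N} x *\<^sub>R g x) \<longlonglongrightarrow> g x"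
    proof (rule AE_I2, rule tendsto_eventually)
      fix x :: real
      show "\<forall>\<^sub>F N in sequentially. indicator {- real N..real N} x *\<^sub>R g x = g x"
        using eventually_gt_at_top[of "nat \<lceil>\<bar>x\<bar>\<rceil>"]
        by eventually_elim (auto simp: indicator_def, linarith+)
    qed
    show "(\<lambda>x. indicator {- real N..real N} x *\<^sub>R g x) \<in> borel_measurable lebesgue" for N :: nat
      using g by (intro borel_measurable_scaleR borel_measurable_indicator) auto
  qed (use g in \<open>auto simp: indicator_def\<close>)
  moreover have "(LINT x|lebesgue. indicator {- real N..real N} x *\<^sub>R g x) = integral {- real N..real N} g" for N :: nat
  proof -
    have "set_integrable lebesgue {- real N..real N} g"
      using g unfolding set_integrable_def by (intro integrable_mult_indicator) auto
    then show ?thesis using set_lebesgue_integral_eq_integral(2) by (simp add: set_lebesgue_integral_def)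
  qed
  ultimately show ?thesis by simp
qed

lemma has_integral_horizontal:
  assumes P: "\<And>z. z \<in> S \<Longrightarrow> (P has_field_derivative D z) (at z)"
    and S: "\<And>x. Complex x y \<in> S" and N: "a \<le> b"
  shows "((\<lambda>x. D (Complex x y)) has_integral (P (Complex b y) - P (Complex a y))) {a..b}"
proof (rule fundamental_theorem_of_calculus[OF N])
  fix x assume "x \<in> {a..b}"
  have "((\<lambda>x. of_real x + \<i> * of_real y) has_vector_derivative 1) (at x)"
    by (auto intro!: derivative_eq_intros)
  then have "((\<lambda>x. Complex x y) has_vector_derivative 1) (at x)"
    by (simp add: complex_eq[symmetric] Complex_eq)
  then have "((P \<circ> (\<lambda>x. Complex x y)) has_vector_derivative 1 * D (Complex x y)) (at x)"
    by (rule field_vector_diff_chain_at) (rule P[OF S])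
  then show "((\<lambda>x. P (Complex x y)) has_vector_derivative D (Complex x y)) (at x within {a..b})"
    by (simp add: o_def has_vector_derivative_at_within)
qed

text \<open>
  A function that is holomorphic on a strip has a primitive \<open>P\<close> there. The integrals along two lines
  over \<open>[-N, N]\<close> therefore differ by two increments of \<open>P\<close> along vertical segments of fixed length.
\<close>

lemma truncated_contour_shift:
  assumes D: "D holomorphic_on hstrip a' b'" and ab: "a \<in> {a'<..<b'}" "b \<in> {a'<..<b'}"
    and B: "B \<longlonglongrightarrow> 0"
    and le: "\<forall>\<^sub>F N in sequentially. \<forall>y\<in>closed_segment a b.
      cmod (D (Complex (real N) y)) \<le> B N \<and> cmod (D (Complex (- real N) y)) \<le> B N"
  shows "(\<lambda>N::nat. integral {- real N..real N} (\<lambda>x. D (Complex x a)) -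
      integral {- real N..real N} (\<lambda>x. D (Complex x b))) \<longlonglongrightarrow> 0"
proof -
  obtain P where P: "\<And>z. z \<in> hstrip a' b' \<Longrightarrow> (P has_field_derivative D z) (at z)"
    using holomorphic_convex_primitive'[OF convex_hstrip open_hstrip D] at_within_open[OF _ open_hstrip, of _ a' b'] by metis
  have int: "integral {- real N..real N} (\<lambda>x. D (Complex x y)) = P (Complex N y) - P (Complex (- real N) y)"
    if "y \<in> {a'<..<b'}" for y and N :: nat
    by (rule integral_unique, rule has_integral_horizontal[where S = "hstrip a' b'", OF P]) (use that in auto)
  have seg: "cmod (P (Complex x a) - P (Complex x b)) \<le> M * \<bar>a - b\<bar>"
    if M: "\<And>y. y \<in> closed_segment a b \<Longrightarrow> cmod (D (Complex x y)) \<le> M" for x M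
  proof -
    define S where "S = (\<lambda>y. Complex x y) ` closed_segment a b"
    have "convex S"
    proof -
      have "S = (+) (of_real x) ` (\<lambda>y. y *\<^sub>R \<i>) ` closed_segment a b"
        unfolding S_def image_image by (rule image_cong) (simp_all add: complex_eq_iff)
      moreover have "linear (\<lambda>y. y *\<^sub>R \<i>)" by (rule linearI) (simp_all add: algebra_simps)
      ultimately show ?thesis by (simp only: convex_translation convex_linear_image convex_closed_segment)
    qed
    moreover have in_strip: "closed_segment a b \<subseteq> {a'<..<b'}"
      using ab by (intro closed_segment_subset) auto
    then have "(P has_field_derivative D z) (at z within S)" if "z \<in> S" for z
      using that by (intro has_field_derivative_at_within[OF P]) (auto simp: S_def)
    moreover have "cmod (D z) \<le> M" if "z \<in> S" for z using that M by (auto simp: S_def)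
    ultimately have "cmod (P (Complex x a) - P (Complex x b)) \<le> M * cmod (Complex x a - Complex x b)"
      by (rule field_differentiable_bound) (auto simp: S_def)
    also have "cmod (Complex x a - Complex x b) = \<bar>a - b\<bar>" by (simp add: cmod_def)
    finally show ?thesis .
  qed
  show ?thesis
  proof (rule Lim_null_comparison)
    show "\<forall>\<^sub>F N in sequentially. cmod (integral {- real N..real N} (\<lambda>x. D (Complex x a)) -
      integral {- real N..real N} (\<lambda>x. D (Complex x b))) \<le> 2 * \<bar>a - b\<bar> * B N"
      using le
    proof eventually_elim
      case (elim N)
      have "integral {- real N..real N} (\<lambda>x. D (Complex x a)) -
          integral {- real N..real N} (\<lambda>x. D (Complex x b)) =
          (P (Complex N a) - P (Complex N b)) - (P (Complex (- real N) a) - P (Complex (- real N) b))"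
        using ab by (simp add: int)
      also have "cmod \<dots> \<le> B N * \<bar>a - b\<bar> + B N * \<bar>a - b\<bar>"
        using elim by (intro norm_triangle_le_diff add_mono seg) auto
      finally show ?case by (simp add: mult.commute mult.left_commute)
    qed
    show "(\<lambda>N. 2 * \<bar>a - b\<bar> * B N) \<longlonglongrightarrow> 0" using tendsto_mult_left[OF B] by simp
  qed
qed

lemma continuous_on_line:
  assumes "G holomorphic_on hstrip a b" "a < t" "t < b"
  shows "continuous_on UNIV (\<lambda>x. G (Complex x t))"
  by (rule continuous_on_compose2[OF holomorphic_on_imp_continuous_on[OF assms(1)]])
    (use assms in \<open>auto intro!: continuous_intros\<close>)

text \<open>
  The difference of the truncated integrals tends to zero, because the integrand is exponentially small on
  the vertical segments at the ends.
\<close>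

theorem contour_shift:
  assumes G: "G holomorphic_on hstrip a' b'" and ab: "a \<in> {a'<..<b'}" "b \<in> {a'<..<b'}"
    and d: "0 < d" and le: "\<And>z. z \<in> hstrip a' b' \<Longrightarrow> cmod (G z) \<le> C * exp (- d * \<bar>Re z\<bar>)"
  shows "(LINT x|lebesgue. G (Complex x a)) = (LINT x|lebesgue. G (Complex x b))"
proof -
  have seg: "closed_segment a b \<subseteq> {a'<..<b'}"
    using ab by (intro closed_segment_subset) auto
  have int: "integrable lebesgue (\<lambda>x. G (Complex x t))" if "t \<in> {a'<..<b'}" for t
    using that d le[of "Complex _ t"]
    by (intro integrable_exp_boundI[OF continuous_on_line[OF G]]) auto
  have line: "cmod (G (Complex s y)) \<le> C * exp (- d * \<bar>s\<bar>)" if "y \<in> closed_segment a b" for s y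
    using le[of "Complex s y"] that seg by auto
  have "(\<lambda>N::nat. C * exp (- d * real N)) \<longlonglongrightarrow> C * 0"
    using d by (intro tendsto_mult_left) real_asymp
  then have "(\<lambda>N::nat. integral {- real N..real N} (\<lambda>x. G (Complex x a)) -
      integral {- real N..real N} (\<lambda>x. G (Complex x b))) \<longlonglongrightarrow> 0"
    using line[of _ "real _"] line[of _ "- real _"] by (intro truncated_contour_shift[OF G ab, of "\<lambda>N. C * exp (- d * real N)"] always_eventually) auto
  moreover have "(\<lambda>N::nat. integral {- real N..real N} (\<lambda>x. G (Complex x a)) -
      integral {- real N..real N} (\<lambda>x. G (Complex x b))) \<longlonglongrightarrow>
      (LINT x|lebesgue. G (Complex x a)) - (LINT x|lebesgue. G (Complex x b))"
    by (intro tendsto_diff tendsto_integral_symmetric_interval int ab)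
  ultimately have "(LINT x|lebesgue. G (Complex x a)) - (LINT x|lebesgue. G (Complex x b)) = 0"
    by (rule LIMSEQ_unique[rotated])
  then show ?thesis by simp
qed

text \<open>
  The argument of \<open>c + \<i> N\<close> tends to \<open>\<pi> / 2\<close> and that of \<open>c - \<i> N\<close> to \<open>- \<pi> / 2\<close>, while the moduli cancel.
  Dividing by \<open>N\<close> before taking the logarithm turns this into continuity of \<open>Ln\<close> at \<open>\<i>\<close> and \<open>- \<i>\<close>.
\<close>

lemma Ln_vertical_increment:
  assumes c: "0 < Re c"
  shows "(\<lambda>N::nat. Ln (c + \<i> * of_nat N) - Ln (c - \<i> * of_nat N)) \<longlonglongrightarrow> \<i> * pi"
proof -
  have lim: "(\<lambda>N::nat. Ln (c / of_nat N + s)) \<longlonglongrightarrow> Ln s" if "s \<in> {\<i>, - \<i>}" for s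
  proof -
    have "s \<notin> \<real>\<^sub>\<le>\<^sub>0" using that by (auto simp: complex_nonpos_Reals_iff)
    moreover have "(\<lambda>N::nat. c / of_nat N + s) \<longlonglongrightarrow> 0 + s"
      by (intro tendsto_add tendsto_const lim_const_over_n)
    ultimately show ?thesis using tendsto_Ln[of "\<lambda>N. c / of_nat N + s" s sequentially] by simp
  qed
  have "(\<lambda>N::nat. Ln (c / of_nat N + \<i>) - Ln (c / of_nat N + - \<i>)) \<longlonglongrightarrow> Ln \<i> - Ln (- \<i>)"
    by (intro tendsto_diff lim) auto
  moreover have "Ln \<i> - Ln (- \<i>) = \<i> * pi" by simp
  moreover have "\<forall>\<^sub>F N in sequentially. Ln (c / of_nat N + \<i>) - Ln (c / of_nat N + - \<i>) = Ln (c + \<i> * of_nat N) - Ln (c - \<i> * of_nat N)"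
    using eventually_gt_at_top[of 0]
  proof eventually_elim
    case (elim N)
    have ne: "c / of_nat N + s \<noteq> 0" if "s \<in> {\<i>, - \<i>}" for s
    proof
      assume "c / of_nat N + s = 0"
      then have "Re (c / of_nat N + s) = 0" by simp
      then show False using that c elim by (auto simp: Re_divide_of_nat)
    qed
    have eq: "Ln (c + s * of_nat N) = Ln (of_real (real N)) + Ln (c / of_nat N + s)" if "s \<in> {\<i>, - \<i>}" for s
    proof -
      have "c + s * of_nat N = of_real (real N) * (c / of_nat N + s)" using elim by (simp add: field_simps)
      moreover have "Ln (of_real (real N) * (c / of_nat N + s)) = Ln (of_real (real N)) + Ln (c / of_nat N + s)"
        using Ln_times_of_real[of "real N", OF _ ne[OF that]] elim by (simp only: of_nat_0_less_iff)
      ultimately show ?thesis by (simp only:)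
    qed
    show ?case using eq[of \<i>] eq[of "- \<i>"] by simp
  qed
  ultimately show ?thesis using Lim_transform_eventually[of "\<lambda>N. Ln (c / of_nat N + \<i>) - Ln (c / of_nat N + - \<i>)"]
    by (simp only:)
qed

lemma has_field_derivative_Ln_affine:
  assumes "c * (z - \<zeta>) \<notin> \<real>\<^sub>\<le>\<^sub>0"
  shows "((\<lambda>z. Ln (c * (z - \<zeta>))) has_field_derivative 1 / (z - \<zeta>)) (at z)"
proof -
  have "c \<noteq> 0" using assms by (metis mult_zero_left nonpos_Reals_zero_I)
  moreover have "((\<lambda>z. c * (z - \<zeta>)) has_field_derivative c) (at z)"
    by (rule derivative_eq_intros refl | simp)+
  then have "((\<lambda>z. Ln (c * (z - \<zeta>))) has_field_derivative inverse (c * (z - \<zeta>)) * c) (at z)"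
    using has_field_derivative_Ln[OF assms] by (rule DERIV_chain2[where f = Ln, rotated])
  ultimately show ?thesis by (elim DERIV_cong) (cases "z = \<zeta>", auto simp: field_simps)
qed

text \<open>
  Rotating by \<open>\<i>\<close> below \<open>\<zeta>\<close> and by \<open>- \<i>\<close> above \<open>\<zeta>\<close> moves each line into the right half plane, where the
  principal logarithm is a primitive. Either line contributes \<open>\<pi> \<i>\<close>.
\<close>

lemma truncated_Cauchy_kernel:
  assumes "a < Im \<zeta>" "Im \<zeta> < b"
  shows "(\<lambda>N::nat. integral {- real N..real N} (\<lambda>x. 1 / (Complex x a - \<zeta>)) -
      integral {- real N..real N} (\<lambda>x. 1 / (Complex x b - \<zeta>))) \<longlonglongrightarrow> 2 * pi * \<i>"
proof -
  have low: "((\<lambda>z. Ln (\<i> * (z - \<zeta>))) has_field_derivative 1 / (z - \<zeta>)) (at z)" if "z \<in> {z. Im z < Im \<zeta>}" for z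
  proof -
    have "\<i> * (z - \<zeta>) \<notin> \<real>\<^sub>\<le>\<^sub>0" using that by (auto simp: complex_nonpos_Reals_iff)
    then show ?thesis by (rule has_field_derivative_Ln_affine)
  qed
  have up: "((\<lambda>z. Ln (- \<i> * (z - \<zeta>))) has_field_derivative 1 / (z - \<zeta>)) (at z)" if "z \<in> {z. Im \<zeta> < Im z}" for z
  proof -
    have "- \<i> * (z - \<zeta>) \<notin> \<real>\<^sub>\<le>\<^sub>0" using that by (auto simp: complex_nonpos_Reals_iff)
    then show ?thesis by (rule has_field_derivative_Ln_affine)
  qed
  define c where "c = \<i> * (\<i> * a - \<zeta>)"
  define c' where "c' = - \<i> * (\<i> * b - \<zeta>)"
  have "integral {- real N..real N} (\<lambda>x. 1 / (Complex x a - \<zeta>)) = Ln (c + \<i> * of_nat N) - Ln (c - \<i> * of_nat N)" for N :: nat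
  proof -
    have "integral {- real N..real N} (\<lambda>x. 1 / (Complex x a - \<zeta>)) =
        Ln (\<i> * (Complex N a - \<zeta>)) - Ln (\<i> * (Complex (- real N) a - \<zeta>))"
      by (rule integral_unique, rule has_integral_horizontal[where S = "{z. Im z < Im \<zeta>}", OF low]) (use assms in auto)
    moreover have "\<i> * (Complex N a - \<zeta>) = c + \<i> * of_nat N" "\<i> * (Complex (- real N) a - \<zeta>) = c - \<i> * of_nat N"
      by (simp_all add: c_def complex_eq_iff)
    ultimately show ?thesis by (simp only:)
  qed
  moreover have "integral {- real N..real N} (\<lambda>x. 1 / (Complex x b - \<zeta>)) = - (Ln (c' + \<i> * of_nat N) - Ln (c' - \<i> * of_nat N))" for N :: nat
  proof -
    have "integral {- real N..real N} (\<lambda>x. 1 / (Complex x b - \<zeta>)) =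
        Ln (- \<i> * (Complex N b - \<zeta>)) - Ln (- \<i> * (Complex (- real N) b - \<zeta>))"
      by (rule integral_unique, rule has_integral_horizontal[where S = "{z. Im \<zeta> < Im z}", OF up]) (use assms in auto)
    moreover have "- \<i> * (Complex N b - \<zeta>) = c' - \<i> * of_nat N" "- \<i> * (Complex (- real N) b - \<zeta>) = c' + \<i> * of_nat N"
      by (simp_all add: c'_def complex_eq_iff)
    ultimately show ?thesis by (simp only: minus_diff_eq)
  qed
  moreover have "0 < Re c" "0 < Re c'" using assms by (simp_all add: c_def c'_def)
  then have "(\<lambda>N::nat. (Ln (c + \<i> * of_nat N) - Ln (c - \<i> * of_nat N)) - (- (Ln (c' + \<i> * of_nat N) - Ln (c' - \<i> * of_nat N))))
      \<longlonglongrightarrow> \<i> * pi - (- (\<i> * pi))"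
    by (intro tendsto_diff tendsto_minus Ln_vertical_increment)
  ultimately show ?thesis by (simp add: mult_ac)
qed

text \<open>
  Dividing out the pole leaves the quotient \<open>(h z - h \<zeta>) / (z - \<zeta>)\<close>, which is holomorphic on the
  whole strip and vanishes at infinity, so that only the kernel \<open>1 / (z - \<zeta>)\<close> contributes.
\<close>

theorem strip_Cauchy_formula:
  assumes h: "h holomorphic_on hstrip a' b'" and ab: "a' < a" "a < Im \<zeta>" "Im \<zeta> < b" "b < b'"
    and M: "\<And>z. z \<in> hstrip a' b' \<Longrightarrow> cmod (h z) \<le> M"
    and int: "integrable lebesgue (\<lambda>x. h (Complex x a) / (Complex x a - \<zeta>))"
      "integrable lebesgue (\<lambda>x. h (Complex x b) / (Complex x b - \<zeta>))"
  shows "(LINT x|lebesgue. h (Complex x a) / (Complex x a - \<zeta>)) -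
    (LINT x|lebesgue. h (Complex x b) / (Complex x b - \<zeta>)) = 2 * pi * \<i> * h \<zeta>"
proof -
  define D where "D z = (if z = \<zeta> then deriv h \<zeta> else (h z - h \<zeta>) / (z - \<zeta>))" for z
  have D: "D holomorphic_on hstrip a' b'"
    unfolding D_def by (rule pole_lemma_open[OF h]) simp
  have "0 \<le> M" using M[of \<zeta>] ab norm_ge_zero[of "h \<zeta>"] by (simp add: order_trans[OF norm_ge_zero])
  have lim: "(\<lambda>N::nat. integral {- real N..real N} (\<lambda>x. D (Complex x a)) -
      integral {- real N..real N} (\<lambda>x. D (Complex x b))) \<longlonglongrightarrow> 0"
  proof (rule truncated_contour_shift[OF D])
    show "(\<lambda>N::nat. 2 * M / (real N - \<bar>Re \<zeta>\<bar>)) \<longlonglongrightarrow> 0" by real_asymp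
    show "\<forall>\<^sub>F N in sequentially. \<forall>y\<in>closed_segment a b.
      cmod (D (Complex (real N) y)) \<le> 2 * M / (real N - \<bar>Re \<zeta>\<bar>) \<and>
      cmod (D (Complex (- real N) y)) \<le> 2 * M / (real N - \<bar>Re \<zeta>\<bar>)"
      using eventually_gt_at_top[of "nat \<lceil>\<bar>Re \<zeta>\<bar>\<rceil>"]
    proof eventually_elim
      case (elim N)
      then have N: "\<bar>Re \<zeta>\<bar> < real N" by linarith
      have "cmod (D (Complex s y)) \<le> 2 * M / (real N - \<bar>Re \<zeta>\<bar>)"
        if s: "\<bar>s\<bar> = real N" and y: "y \<in> closed_segment a b" for s y
      proof -
        have ge: "real N - \<bar>Re \<zeta>\<bar> \<le> cmod (Complex s y - \<zeta>)"
          using abs_Re_le_cmod[of "Complex s y - \<zeta>"] s by auto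
        have y': "y \<in> {a'<..<b'}"
          using y ab closed_segment_subset[of a "{a'<..<b'}" b] by auto
        have "cmod (h (Complex s y) - h \<zeta>) \<le> 2 * M"
          using norm_triangle_ineq4[of "h (Complex s y)" "h \<zeta>"] M[of "Complex s y"] M[of \<zeta>] y' ab by simp
        then have "cmod (h (Complex s y) - h \<zeta>) / cmod (Complex s y - \<zeta>) \<le> 2 * M / (real N - \<bar>Re \<zeta>\<bar>)"
          using ge N \<open>0 \<le> M\<close> by (intro frac_le) auto
        moreover have "Complex s y \<noteq> \<zeta>" using s N by auto
        ultimately show ?thesis by (simp add: D_def norm_divide)
      qed
      then show ?case by simp
    qed
  qed (use ab in auto)
  have cont: "continuous_on {- real N..real N} (\<lambda>x. h (Complex x t) / (Complex x t - \<zeta>))"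
    "continuous_on {- real N..real N} (\<lambda>x. h \<zeta> * (1 / (Complex x t - \<zeta>)))"
    if t: "t \<noteq> Im \<zeta>" "t \<in> {a'<..<b'}" for t and N :: nat
    using t by (auto intro!: continuous_intros continuous_on_subset[OF continuous_on_line[OF h]] simp: complex_eq_iff)
  have D_int: "integral {- real N..real N} (\<lambda>x. D (Complex x t)) =
      integral {- real N..real N} (\<lambda>x. h (Complex x t) / (Complex x t - \<zeta>)) -
      h \<zeta> * integral {- real N..real N} (\<lambda>x. 1 / (Complex x t - \<zeta>))"
    if t: "t \<noteq> Im \<zeta>" "t \<in> {a'<..<b'}" for t and N :: nat
  proof -
    have "D (Complex x t) = h (Complex x t) / (Complex x t - \<zeta>) - h \<zeta> * (1 / (Complex x t - \<zeta>))" for x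
      using t by (auto simp: D_def complex_eq_iff diff_divide_distrib)
    then have "integral {- real N..real N} (\<lambda>x. D (Complex x t)) = integral {- real N..real N}
        (\<lambda>x. h (Complex x t) / (Complex x t - \<zeta>) - h \<zeta> * (1 / (Complex x t - \<zeta>)))"
      by (simp only:)
    also have "\<dots> = integral {- real N..real N} (\<lambda>x. h (Complex x t) / (Complex x t - \<zeta>)) -
        integral {- real N..real N} (\<lambda>x. h \<zeta> * (1 / (Complex x t - \<zeta>)))"
      by (intro Henstock_Kurzweil_Integration.integral_diff integrable_continuous_real cont t)
    finally show ?thesis by (simp only: Henstock_Kurzweil_Integration.integral_mult_right)
  qed
  have lim': "(\<lambda>N::nat. (integral {- real N..real N} (\<lambda>x. h (Complex x a) / (Complex x a - \<zeta>)) -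
      integral {- real N..real N} (\<lambda>x. h (Complex x b) / (Complex x b - \<zeta>))) -
      h \<zeta> * (integral {- real N..real N} (\<lambda>x. 1 / (Complex x a - \<zeta>)) -
      integral {- real N..real N} (\<lambda>x. 1 / (Complex x b - \<zeta>)))) \<longlonglongrightarrow>
      ((LINT x|lebesgue. h (Complex x a) / (Complex x a - \<zeta>)) -
      (LINT x|lebesgue. h (Complex x b) / (Complex x b - \<zeta>))) - h \<zeta> * (2 * pi * \<i>)"
    by (intro tendsto_diff tendsto_mult_left tendsto_integral_symmetric_interval int truncated_Cauchy_kernel ab)
  have "(\<lambda>N::nat. (integral {- real N..real N} (\<lambda>x. h (Complex x a) / (Complex x a - \<zeta>)) -
      integral {- real N..real N} (\<lambda>x. h (Complex x b) / (Complex x b - \<zeta>))) -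
      h \<zeta> * (integral {- real N..real N} (\<lambda>x. 1 / (Complex x a - \<zeta>)) -
      integral {- real N..real N} (\<lambda>x. 1 / (Complex x b - \<zeta>)))) \<longlonglongrightarrow> 0"
    using lim ab by (simp add: D_int algebra_simps)
  from LIMSEQ_unique[OF lim' this] show ?thesis by (simp add: mult_ac)
qed

subsection \<open>Cauchy estimates\<close>

lemma deriv_bound:
  assumes g: "g holomorphic_on ball z (2 * r)" and C: "\<And>w. w \<in> ball z (2 * r) \<Longrightarrow> cmod (g w) \<le> C"
    and r: "0 < r" and w: "w \<in> ball z r"
  shows "cmod (deriv g w) \<le> 2 * C / r"
proof -
  have sub: "cball w (r / 2) \<subseteq> ball z (2 * r)"
  proof
    fix v assume "v \<in> cball w (r / 2)"
    then show "v \<in> ball z (2 * r)" using w r dist_triangle[of z v w] by simp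
  qed
  have "cmod ((deriv ^^ 1) g w) \<le> fact 1 * C / (r / 2) ^ 1"
  proof (rule Cauchy_inequality)
    show "g holomorphic_on ball w (r / 2)"
      by (rule holomorphic_on_subset[OF g order_trans[OF ball_subset_cball sub]])
    show "continuous_on (cball w (r / 2)) g"
      by (rule continuous_on_subset[OF holomorphic_on_imp_continuous_on[OF g] sub])
    show "cmod (g x) \<le> C" if "cmod (w - x) = r / 2" for x
      using that sub by (intro C) (auto simp: dist_norm)
  qed (use r in auto)
  then show ?thesis by (simp add: mult.commute)
qed

lemma holomorphic_Lipschitz:
  assumes g: "g holomorphic_on ball z (2 * r)" and C: "\<And>w. w \<in> ball z (2 * r) \<Longrightarrow> cmod (g w) \<le> C"
    and r: "0 < r" and w: "w \<in> ball z r"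
  shows "cmod (g w - g z) \<le> (2 * C / r) * cmod (w - z)"
proof (rule field_differentiable_bound[of "ball z r"])
  show "(g has_field_derivative deriv g x) (at x within ball z r)" if "x \<in> ball z r" for x
    by (rule has_field_derivative_at_within, rule holomorphic_derivI[OF g]) (use that r in auto)
qed (use deriv_bound[OF g C r] w r in auto)

text \<open>
  Both difference quotients are within \<open>O(\<bar>h\<bar>)\<close> and \<open>O(\<bar>k\<bar>)\<close> of the derivative. The derivative does not
  occur in the estimate, so that it can be applied to functions whose derivative is yet to be constructed.
\<close>

lemma difference_quotients_Cauchy:
  assumes g: "g holomorphic_on ball z (2 * r)" and C: "\<And>w. w \<in> ball z (2 * r) \<Longrightarrow> cmod (g w) \<le> C"
    and r: "0 < r" and hk: "0 < cmod h" "cmod h < r / 2" "0 < cmod k" "cmod k < r / 2"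
  shows "cmod ((g (z + h) - g z) / h - (g (z + k) - g z) / k) \<le> (8 * C / r\<^sup>2) * (cmod h + cmod k)"
proof -
  have dg: "deriv g holomorphic_on ball z (2 * (r / 2))"
    using g r by (intro holomorphic_deriv holomorphic_on_subset[OF g]) auto
  have dg_le: "cmod (deriv g w) \<le> 2 * C / r" if "w \<in> ball z (2 * (r / 2))" for w
    using deriv_bound[OF g C r] that by simp
  have lip: "cmod (deriv g w - deriv g z) \<le> (8 * C / r\<^sup>2) * cmod (w - z)" if "w \<in> ball z (r / 2)" for w
    using holomorphic_Lipschitz[OF dg dg_le _ that] r by (simp add: power2_eq_square field_simps)
  have C0: "0 \<le> C" using order_trans[OF norm_ge_zero C[of z]] r by simp
  have one: "cmod ((g (z + h) - g z) / h - deriv g z) \<le> (8 * C / r\<^sup>2) * cmod h"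
    if h: "0 < cmod h" "cmod h < r / 2" for h
  proof -
    have "cmod ((g (z + h) - deriv g z * (z + h)) - (g z - deriv g z * z)) \<le> ((8 * C / r\<^sup>2) * cmod h) * cmod ((z + h) - z)"
    proof (rule field_differentiable_bound[of "cball z (cmod h)"])
      fix x assume x: "x \<in> cball z (cmod h)"
      show "((\<lambda>w. g w - deriv g z * w) has_field_derivative deriv g x - deriv g z) (at x within cball z (cmod h))"
        using holomorphic_derivI[OF g open_ball, of x] x h r by (auto intro!: derivative_eq_intros has_field_derivative_at_within[where x = x and s = "cball z (cmod h)"])
      have "cmod (x - z) \<le> cmod h" using x by (simp add: dist_norm norm_minus_commute)
      then show "cmod (deriv g x - deriv g z) \<le> 8 * C / r\<^sup>2 * cmod h"
        using x h C0 r by (intro order_trans[OF lip mult_left_mono]) auto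
    qed (auto simp: dist_norm)
    also have "(g (z + h) - deriv g z * (z + h)) - (g z - deriv g z * z) = ((g (z + h) - g z) / h - deriv g z) * h"
      using h by (simp add: field_simps)
    finally have "cmod ((g (z + h) - g z) / h - deriv g z) * cmod h \<le> (8 * C / r\<^sup>2 * cmod h) * cmod h"
      by (simp only: norm_mult add_diff_cancel_left')
    then show ?thesis by (rule mult_right_le_imp_le) (rule h)
  qed
  have "(g (z + h) - g z) / h - (g (z + k) - g z) / k =
      ((g (z + h) - g z) / h - deriv g z) - ((g (z + k) - g z) / k - deriv g z)" by simp
  also have "cmod \<dots> \<le> (8 * C / r\<^sup>2) * cmod h + (8 * C / r\<^sup>2) * cmod k"
    using one hk by (intro order_trans[OF norm_triangle_ineq4 add_mono]) auto
  finally show ?thesis by (simp add: ring_distribs)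
qed

definition tame_const :: "real \<Rightarrow> real \<Rightarrow> real" where
  "tame_const r d = 1 + 2 * exp (2 * r * d) / r + (1 + exp d) / r"

lemma tame_const_pos: "0 < r \<Longrightarrow> 0 < tame_const r d"
  unfolding tame_const_def by (intro add_pos_nonneg) (auto simp: add_nonneg_nonneg)

text \<open>
  Cauchy's estimate for the derivative on discs inside the strip gives the Lipschitz condition for
  increments below \<open>r\<close>; for the others the decay of both values is enough. The constant is proportional to \<open>C\<close>.
\<close>

lemma tame_line:
  assumes G: "G holomorphic_on hstrip (t - 2 * r) (t + 2 * r)" and r: "0 < r" and d: "0 < d"
    and le: "\<And>z. z \<in> hstrip (t - 2 * r) (t + 2 * r) \<Longrightarrow> cmod (G z) \<le> C * exp (- d * \<bar>Re z\<bar>)"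
  shows "tame (C * tame_const r d) d (\<lambda>x. G (Complex x t))"
  unfolding tame_def
proof (intro conjI allI impI)
  have C: "0 \<le> C" using order_trans[OF norm_ge_zero le[of "Complex 0 t"]] r by simp
  have le_t: "cmod (G (Complex x t)) \<le> C * exp (- d * \<bar>x\<bar>)" for x
    using le[of "Complex x t"] r by simp
  fix x
  have "cmod (G (Complex x t)) \<le> C * 1 * exp (- d * \<bar>x\<bar>)" using le_t by simp
  also have "\<dots> \<le> C * tame_const r d * exp (- d * \<bar>x\<bar>)"
    using C r by (intro mult_right_mono mult_left_mono) (auto simp: tame_const_def add_nonneg_nonneg)
  finally show "cmod (G (Complex x t)) \<le> C * tame_const r d * exp (- d * \<bar>x\<bar>)" .
  fix y assume xy: "\<bar>x - y\<bar> \<le> 1"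
  show "cmod (G (Complex x t) - G (Complex y t)) \<le> C * tame_const r d * \<bar>x - y\<bar> * exp (- d * \<bar>x\<bar>)"
  proof (cases "\<bar>x - y\<bar> < r")
    case True
    have ball: "Im w \<in> {t - 2 * r<..<t + 2 * r} \<and> \<bar>Re w - x\<bar> < 2 * r" if "w \<in> ball (Complex x t) (2 * r)" for w
      using that abs_Im_le_cmod[of "w - Complex x t"] abs_Re_le_cmod[of "w - Complex x t"]
      by (auto simp: dist_norm norm_minus_commute)
    have "cmod (G (Complex y t) - G (Complex x t)) \<le>
        (2 * (C * exp (2 * r * d) * exp (- d * \<bar>x\<bar>)) / r) * cmod (Complex y t - Complex x t)"
    proof (rule holomorphic_Lipschitz[OF _ _ r])
      show "G holomorphic_on ball (Complex x t) (2 * r)"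
        using ball by (intro holomorphic_on_subset[OF G]) auto
      show "cmod (G w) \<le> C * exp (2 * r * d) * exp (- d * \<bar>x\<bar>)" if w: "w \<in> ball (Complex x t) (2 * r)" for w
      proof -
        have "cmod (G w) \<le> C * exp (- d * \<bar>Re w\<bar>)" using ball[OF w] by (intro le) auto
        also have "d * (\<bar>x\<bar> - \<bar>Re w\<bar>) \<le> d * (2 * r)" using ball[OF w] d by (intro mult_left_mono) auto
        then have "C * exp (- d * \<bar>Re w\<bar>) \<le> C * exp (2 * r * d + - d * \<bar>x\<bar>)"
          using C by (intro mult_left_mono) (auto simp: algebra_simps)
        finally show ?thesis by (simp add: exp_add[symmetric] mult.assoc)
      qed
      show "Complex y t \<in> ball (Complex x t) r" using True by (simp add: dist_norm cmod_def)
    qed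
    also have "cmod (Complex y t - Complex x t) = \<bar>x - y\<bar>" by (simp add: cmod_def)
    also have "(2 * (C * exp (2 * r * d) * exp (- d * \<bar>x\<bar>)) / r) * \<bar>x - y\<bar> =
        C * (2 * exp (2 * r * d) / r) * \<bar>x - y\<bar> * exp (- d * \<bar>x\<bar>)" by simp
    also have "\<dots> \<le> C * tame_const r d * \<bar>x - y\<bar> * exp (- d * \<bar>x\<bar>)"
      using C r by (intro mult_right_mono mult_left_mono) (auto simp: tame_const_def add_nonneg_nonneg)
    finally show ?thesis by (simp add: norm_minus_commute)
  next
    case False
    have "d * (\<bar>x\<bar> - \<bar>y\<bar>) \<le> d * 1" using xy d by (intro mult_left_mono) auto
    then have "C * exp (- d * \<bar>y\<bar>) \<le> C * (exp d * exp (- d * \<bar>x\<bar>))"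
      using C by (intro mult_left_mono) (auto simp: algebra_simps simp flip: exp_add)
    then have "cmod (G (Complex x t) - G (Complex y t)) \<le> C * (1 + exp d) * exp (- d * \<bar>x\<bar>) * 1"
      using norm_triangle_ineq4[of "G (Complex x t)" "G (Complex y t)"] le_t[of x] le_t[of y]
      by (simp add: algebra_simps)
    also have "\<dots> \<le> C * (1 + exp d) * exp (- d * \<bar>x\<bar>) * (\<bar>x - y\<bar> / r)"
      using False C r by (intro mult_left_mono) (auto simp: add_nonneg_nonneg)
    also have "\<dots> = C * ((1 + exp d) / r) * \<bar>x - y\<bar> * exp (- d * \<bar>x\<bar>)" by simp
    also have "\<dots> \<le> C * tame_const r d * \<bar>x - y\<bar> * exp (- d * \<bar>x\<bar>)"
      using C r by (intro mult_right_mono mult_left_mono) (auto simp: tame_const_def add_nonneg_nonneg)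
    finally show ?thesis .
  qed
qed

section \<open>Vector-valued holomorphic functions on strips\<close>

text \<open>
  The Gaussian factor equals \<open>1\<close> at the pole, so that Cauchy's formula is unaffected, and makes the kernel decay faster
  than any exponential along every horizontal line.
\<close>

definition cauchy_kernel :: "complex \<Rightarrow> complex \<Rightarrow> complex" where
  "cauchy_kernel z w = exp (- (z - w)\<^sup>2) / (z - w)"

lemma cauchy_kernel_swap: "cauchy_kernel z w = - cauchy_kernel w z"
  unfolding cauchy_kernel_def by (metis minus_diff_eq minus_divide_right power2_commute)

lemma holomorphic_cauchy_kernel:
  assumes "z \<notin> S"
  shows "cauchy_kernel z holomorphic_on S" "(\<lambda>w. cauchy_kernel w z) holomorphic_on S"
  using assms unfolding cauchy_kernel_def by (auto intro!: holomorphic_intros)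

text \<open>
  The real part of \<open>- (x + \<i> y)\<^sup>2\<close> is \<open>y\<^sup>2 - x\<^sup>2\<close>, and \<open>x\<^sup>2 \<ge> 2 \<bar>x\<bar> - 1\<close>. The exponential on the right
  suffices against weights \<open>exp (\<bar>x\<bar> / n)\<close> and is easier to combine with them.
\<close>

lemma gaussian_bound:
  assumes L: "\<bar>Im z - Im w\<bar> \<le> L"
  shows "cmod (exp (- (z - w)\<^sup>2)) \<le> exp (L\<^sup>2 + 1) * exp (- 2 * \<bar>Re z - Re w\<bar>)"
proof -
  define x y where "x = Re z - Re w" and "y = Im z - Im w"
  have "cmod (exp (- (z - w)\<^sup>2)) = exp (Re (- (z - w)\<^sup>2))" by simp
  also have "Re (- (z - w)\<^sup>2) = y\<^sup>2 - x\<^sup>2" by (simp add: power2_eq_square x_def y_def)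
  also have "exp (y\<^sup>2 - x\<^sup>2) \<le> exp ((L\<^sup>2 + 1) + - 2 * \<bar>x\<bar>)"
  proof -
    have "y\<^sup>2 \<le> L\<^sup>2" using L unfolding y_def by (metis abs_ge_zero power2_abs power_mono)
    moreover have "0 \<le> (\<bar>x\<bar> - 1)\<^sup>2" by simp
    then have "2 * \<bar>x\<bar> \<le> x\<^sup>2 + 1" by (simp add: power2_diff)
    ultimately show ?thesis by simp
  qed
  also have "\<dots> = exp (L\<^sup>2 + 1) * exp (- 2 * \<bar>x\<bar>)" by (rule exp_add)
  finally show ?thesis by (simp add: x_def)
qed

lemma cauchy_kernel_bound:
  assumes d: "0 < d" "d \<le> \<bar>Im z - Im w\<bar>" and L: "\<bar>Im z - Im w\<bar> \<le> L"
  shows "cmod (cauchy_kernel z w) \<le> exp (L\<^sup>2 + 1) / d * exp (- 2 * \<bar>Re z - Re w\<bar>)"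
proof -
  have "d \<le> cmod (z - w)" using d(2) abs_Im_le_cmod[of "z - w"] by simp
  then have "cmod (cauchy_kernel z w) \<le> (exp (L\<^sup>2 + 1) * exp (- 2 * \<bar>Re z - Re w\<bar>)) / d"
    unfolding cauchy_kernel_def norm_divide using d(1) by (intro frac_le gaussian_bound L) auto
  then show ?thesis by simp
qed

context lcs
begin

text \<open>
  Identities and estimates between integrals only see the scalar functions \<open>u \<circ> G\<close>, and these notions are
  stable under the products and translations that occur below.
\<close>

definition weakly_holomorphic_on :: "(complex \<Rightarrow> 'e) \<Rightarrow> complex set \<Rightarrow> bool" where
  "weakly_holomorphic_on G S \<longleftrightarrow> (\<forall>u\<in>dual. (\<lambda>z. u (G z)) holomorphic_on S)"

lemma weakly_holomorphic_onD: "weakly_holomorphic_on G S \<Longrightarrow> u \<in> polar \<alpha> \<Longrightarrow> (\<lambda>z. u (G z)) holomorphic_on S"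
  by (simp add: weakly_holomorphic_on_def polar_dual)

lemma weakly_holomorphic_on_subset:
  "weakly_holomorphic_on G S \<Longrightarrow> T \<subseteq> S \<Longrightarrow> weakly_holomorphic_on G T"
  unfolding weakly_holomorphic_on_def by (blast intro: holomorphic_on_subset)

lemma vholomorphic_imp_weakly_holomorphic:
  assumes f: "vholomorphic_on sc f S" and S: "open S"
  shows "weakly_holomorphic_on f S"
  unfolding weakly_holomorphic_on_def
proof
  fix u assume u: "u \<in> dual"
  have "(\<lambda>z. u (f z)) field_differentiable at z" if z: "z \<in> S" for z
  proof -
    obtain d where d: "((\<lambda>h. sc (inverse h) (f (z + h) - f z)) \<longlongrightarrow> d) (at 0)"
      using f z unfolding vholomorphic_on_def by blast
    have "continuous_on UNIV u" using u by (simp add: continuous_linear_maps_def)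
    then have "((\<lambda>h. u (sc (inverse h) (f (z + h) - f z))) \<longlongrightarrow> u d) (at 0)"
      using d by (rule continuous_on_tendsto_compose) auto
    then have "((\<lambda>h. (u (f (z + h)) - u (f z)) / h) \<longlongrightarrow> u d) (at 0)"
      by (simp add: dual_simps[OF u] divide_inverse mult.commute)
    then have "((\<lambda>z. u (f z)) has_field_derivative u d) (at z)"
      by (simp add: DERIV_def)
    then show ?thesis by (auto simp: field_differentiable_def)
  qed
  then show "(\<lambda>z. u (f z)) holomorphic_on S"
    by (simp add: holomorphic_on_def field_differentiable_at_within)
qed

lemma weakly_holomorphic_on_scale:
  "\<phi> holomorphic_on S \<Longrightarrow> weakly_holomorphic_on G S \<Longrightarrow> weakly_holomorphic_on (\<lambda>z. sc (\<phi> z) (G z)) S"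
  unfolding weakly_holomorphic_on_def by (simp add: dual_simps holomorphic_on_mult)

lemma weakly_holomorphic_on_shift:
  assumes "weakly_holomorphic_on G S" "\<And>z. z \<in> T \<Longrightarrow> z + c \<in> S"
  shows "weakly_holomorphic_on (\<lambda>z. G (z + c)) T"
  unfolding weakly_holomorphic_on_def
proof
  fix u assume "u \<in> dual"
  then have "(\<lambda>z. u (G z)) holomorphic_on S" using assms(1) by (simp add: weakly_holomorphic_on_def)
  moreover have "(\<lambda>z. z + c) holomorphic_on T" by (intro holomorphic_intros)
  ultimately have "((\<lambda>z. u (G z)) \<circ> (\<lambda>z. z + c)) holomorphic_on T"
    using assms(2) by (intro holomorphic_on_compose_gen[where t = S]) auto
  then show "(\<lambda>z. u (G (z + c))) holomorphic_on T" by (simp add: o_def)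
qed


lemma weakly_holomorphic_Lipschitz:
  assumes G: "weakly_holomorphic_on G (ball z (2 * r))"
    and C: "\<And>w. w \<in> ball z (2 * r) \<Longrightarrow> p \<alpha> (G w) \<le> C"
    and r: "0 < r" and w: "w \<in> ball z r"
  shows "p \<alpha> (G w - G z) \<le> (2 * C / r) * cmod (w - z)"
proof (rule seminorm_le_polar)
  fix u assume u: "u \<in> polar \<alpha>"
  have "cmod (u (G w) - u (G z)) \<le> (2 * C / r) * cmod (w - z)"
    by (rule holomorphic_Lipschitz[OF weakly_holomorphic_onD[OF G u] order_trans[OF polar_le[OF u] C] r w])
  then show "cmod (u (G w - G z)) \<le> (2 * C / r) * cmod (w - z)"
    by (simp add: dual_simps(2)[OF polar_dual[OF u]])
qed

text \<open>
  The class of integrands: for these the integrals over all lines of the strip exist and agree.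
\<close>

definition holomorphic_decaying :: "real \<Rightarrow> real \<Rightarrow> (complex \<Rightarrow> 'e) \<Rightarrow> bool" where
  "holomorphic_decaying a b G \<longleftrightarrow> weakly_holomorphic_on G (hstrip a b) \<and>
     (\<forall>\<alpha>. \<exists>C d. 0 < d \<and> 0 \<le> C \<and> (\<forall>z\<in>hstrip a b. p \<alpha> (G z) \<le> C * exp (- d * \<bar>Re z\<bar>)))"

lemma holomorphic_decaying_vtame:
  assumes G: "holomorphic_decaying a b G" and t: "a < t" "t < b"
  shows "vtame (\<lambda>x. G (Complex x t))"
  unfolding vtame_def
proof
  fix \<alpha>
  obtain C d where C: "0 < d" "0 \<le> C" "\<And>z. z \<in> hstrip a b \<Longrightarrow> p \<alpha> (G z) \<le> C * exp (- d * \<bar>Re z\<bar>)"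
    using G unfolding holomorphic_decaying_def by blast
  define r where "r = min (t - a) (b - t) / 2"
  have r: "0 < r" using t by (simp add: r_def)
  have sub: "hstrip (t - 2 * r) (t + 2 * r) \<subseteq> hstrip a b" by (auto simp: r_def)
  have "tame (C * tame_const r d) d (\<lambda>x. u (G (Complex x t)))" if u: "u \<in> polar \<alpha>" for u
  proof (rule tame_line[OF _ r C(1)])
    show "(\<lambda>z. u (G z)) holomorphic_on hstrip (t - 2 * r) (t + 2 * r)"
      using G u sub unfolding holomorphic_decaying_def
      by (blast intro: holomorphic_on_subset weakly_holomorphic_onD)
    show "cmod (u (G z)) \<le> C * exp (- d * \<bar>Re z\<bar>)" if "z \<in> hstrip (t - 2 * r) (t + 2 * r)" for z
      using that sub by (intro order_trans[OF polar_le[OF u] C(3)]) blast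
  qed
  then show "\<exists>C d. 0 < d \<and> 0 \<le> C \<and> (\<forall>u\<in>polar \<alpha>. tame C d (\<lambda>x. u (G (Complex x t))))"
    using C r tame_const_pos[OF r, of d] by (intro exI[of _ "C * tame_const r d"] exI[of _ d]) auto
qed

end

context sc_lcs
begin

lemma holomorphic_decaying_has_integral:
  assumes "holomorphic_decaying a b G" "a < t" "t < b"
  shows "has_pettis_integral sc (\<lambda>x. G (Complex x t)) (pettis_integral sc (\<lambda>x. G (Complex x t)))"
  using vtame_integrable[OF holomorphic_decaying_vtame[OF assms]] by (rule has_pettis_integral_integral)

lemma holomorphic_decaying_shift:
  assumes G: "holomorphic_decaying a b G" and s: "a < s" "s < b" and t: "a < t" "t < b"
  shows "pettis_integral sc (\<lambda>x. G (Complex x s)) = pettis_integral sc (\<lambda>x. G (Complex x t))"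
proof -
  have "u (pettis_integral sc (\<lambda>x. G (Complex x s))) = u (pettis_integral sc (\<lambda>x. G (Complex x t)))"
    if u: "u \<in> polar \<alpha>" for u \<alpha>
  proof -
    obtain C d where C: "0 < d" "0 \<le> C" "\<And>z. z \<in> hstrip a b \<Longrightarrow> p \<alpha> (G z) \<le> C * exp (- d * \<bar>Re z\<bar>)"
      using G unfolding holomorphic_decaying_def by blast
    have "(LINT x|lebesgue. u (G (Complex x s))) = (LINT x|lebesgue. u (G (Complex x t)))"
    proof (rule contour_shift[where C = C])
      show "(\<lambda>z. u (G z)) holomorphic_on hstrip a b"
        using G u unfolding holomorphic_decaying_def by (blast intro: weakly_holomorphic_onD)
      show "cmod (u (G z)) \<le> C * exp (- d * \<bar>Re z\<bar>)" if "z \<in> hstrip a b" for z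
        by (rule order_trans[OF polar_le[OF u] C(3)[OF that]])
    qed (use s t C in auto)
    then show ?thesis
      using holomorphic_decaying_has_integral[OF G s] holomorphic_decaying_has_integral[OF G t] polar_dual[OF u]
      by (auto simp: has_pettis_integral_def)
  qed
  then show ?thesis by (rule polar_separates)
qed

text \<open>
  In a sequentially complete space the difference quotients converge as soon as they are Cauchy with
  a modulus: the limit along one sequence of increments is then the limit along all of them.
\<close>

lemma derivative_existsI:
  assumes r: "0 < r"
    and le: "\<And>\<alpha>. \<exists>C\<ge>0. \<forall>h k. 0 < cmod h \<and> cmod h < r \<and> 0 < cmod k \<and> cmod k < r \<longrightarrow>
      p \<alpha> (sc (inverse h) (f (z + h) - f z) - sc (inverse k) (f (z + k) - f z)) \<le> C * (cmod h + cmod k)"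
  shows "\<exists>d. ((\<lambda>h. sc (inverse h) (f (z + h) - f z)) \<longlongrightarrow> d) (at 0)"
proof -
  define Q where "Q = (\<lambda>h. sc (inverse h) (f (z + h) - f z))"
  define e where "e n = complex_of_real (r / real (n + 2))" for n :: nat
  have e: "0 < cmod (e n)" "cmod (e n) < r" for n
    using r by (auto simp: e_def norm_divide field_simps simp flip: of_real_add intro: add_pos_nonneg)
  have e0: "(\<lambda>n. cmod (e n)) \<longlonglongrightarrow> 0"
    unfolding e_def using r by (simp add: norm_divide flip: of_real_add) real_asymp
  obtain l where l: "(\<lambda>n. Q (e n)) \<longlonglongrightarrow> l"
  proof (rule Cauchy_converges)
    fix \<alpha> and \<epsilon> :: real assume \<epsilon>: "0 < \<epsilon>"
    obtain C where C: "C \<ge> 0" "\<And>h k. 0 < cmod h \<Longrightarrow> cmod h < r \<Longrightarrow> 0 < cmod k \<Longrightarrow> cmod k < r \<Longrightarrow>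
      p \<alpha> (Q h - Q k) \<le> C * (cmod h + cmod k)" using le[of \<alpha>] unfolding Q_def by blast
    have "(\<lambda>n. C * cmod (e n)) \<longlonglongrightarrow> C * 0" by (intro tendsto_mult_left e0)
    then have "\<forall>\<^sub>F n in sequentially. C * cmod (e n) < \<epsilon> / 2"
      using \<epsilon> by (intro order_tendstoD(2)[of _ "C * 0"]) auto
    then obtain N where N: "\<And>n. n \<ge> N \<Longrightarrow> C * cmod (e n) < \<epsilon> / 2"
      unfolding eventually_sequentially by blast
    have "p \<alpha> (Q (e m) - Q (e n)) < \<epsilon>" if "m \<ge> N" "n \<ge> N" for m n
      using C(2)[of "e m" "e n"] e N[OF that(1)] N[OF that(2)] by (simp add: ring_distribs)
    then show "\<exists>N. \<forall>m\<ge>N. \<forall>n\<ge>N. p \<alpha> (Q (e m) - Q (e n)) < \<epsilon>" by blast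
  qed
  have "(Q \<longlongrightarrow> l) (at 0)"
    unfolding seminorm_tendsto_iff
  proof
    fix \<alpha>
    obtain C where C: "C \<ge> 0" "\<And>h k. 0 < cmod h \<Longrightarrow> cmod h < r \<Longrightarrow> 0 < cmod k \<Longrightarrow> cmod k < r \<Longrightarrow>
      p \<alpha> (Q h - Q k) \<le> C * (cmod h + cmod k)" using le[of \<alpha>] unfolding Q_def by blast
    have bound: "p \<alpha> (Q h - l) \<le> C * cmod h" if h: "0 < cmod h" "cmod h < r" for h
    proof (rule tendsto_lowerbound)
      have "(\<lambda>n. C * (cmod h + cmod (e n)) + p \<alpha> (Q (e n) - l)) \<longlonglongrightarrow> C * (cmod h + 0) + 0"
        using seminorm_tendsto_iff[THEN iffD1, OF l]
        by (intro tendsto_add tendsto_mult_left tendsto_const e0) blast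
      then show "(\<lambda>n. C * (cmod h + cmod (e n)) + p \<alpha> (Q (e n) - l)) \<longlonglongrightarrow> C * cmod h" by simp
      show "\<forall>\<^sub>F n in sequentially. p \<alpha> (Q h - l) \<le> C * (cmod h + cmod (e n)) + p \<alpha> (Q (e n) - l)"
      proof (intro always_eventually allI)
        fix n
        show "p \<alpha> (Q h - l) \<le> C * (cmod h + cmod (e n)) + p \<alpha> (Q (e n) - l)"
          using p.triangle[of \<alpha> "Q h - Q (e n)" "Q (e n) - l"] C(2)[OF h e(1)[of n] e(2)[of n]] by simp
      qed
    qed simp
    show "((\<lambda>h. p \<alpha> (Q h - l)) \<longlongrightarrow> 0) (at 0)"
    proof (rule tendsto_sandwich)
      show "\<forall>\<^sub>F h in at 0. 0 \<le> p \<alpha> (Q h - l)" by simp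
      show "\<forall>\<^sub>F h in at 0. p \<alpha> (Q h - l) \<le> C * cmod h"
        unfolding eventually_at by (rule exI[of _ r]) (use bound r in auto)
      have "((\<lambda>h. C * cmod h) \<longlongrightarrow> C * cmod 0) (at 0)" by (intro tendsto_intros)
      then show "((\<lambda>h. C * cmod h) \<longlongrightarrow> 0) (at 0)" by simp
    qed simp
  qed
  then show ?thesis unfolding Q_def by blast
qed

text \<open>
  A function that depends on \<open>z\<close> only through \<open>cauchy_kernel z\<close>, linearly and continuously for a
  weighted supremum norm on \<open>A\<close>, is holomorphic off \<open>A\<close>. Continuity on the three-term combinations
  that form the difference of two difference quotients is enough.
\<close>

lemma kernel_transform_differentiable:
  assumes r: "0 < r"
    and wt: "\<And>w. w \<in> A \<Longrightarrow> 0 < wt w"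
    and A: "\<And>w. w \<in> A \<Longrightarrow> w \<notin> ball z (2 * r)"
    and K: "\<And>w z'. w \<in> A \<Longrightarrow> z' \<in> ball z (2 * r) \<Longrightarrow> cmod (cauchy_kernel z' w) \<le> M\<^sub>0 * wt w"
    and f: "\<And>\<alpha>. \<exists>C\<ge>0. \<forall>a b c h k M. cmod h < r \<longrightarrow> cmod k < r \<longrightarrow>
      (\<forall>w\<in>A. cmod (a * cauchy_kernel (z + h) w + b * cauchy_kernel z w + c * cauchy_kernel (z + k) w) \<le> M * wt w) \<longrightarrow>
      p \<alpha> (sc a (f (z + h)) + sc b (f z) + sc c (f (z + k))) \<le> C * M"
  shows "\<exists>d. ((\<lambda>h. sc (inverse h) (f (z + h) - f z)) \<longlongrightarrow> d) (at 0)"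
proof (rule derivative_existsI)
  show "0 < r / 2" using r by simp
  fix \<alpha>
  obtain C where C: "C \<ge> 0" "\<And>a b c h k M. cmod h < r \<Longrightarrow> cmod k < r \<Longrightarrow>
      (\<And>w. w \<in> A \<Longrightarrow> cmod (a * cauchy_kernel (z + h) w + b * cauchy_kernel z w + c * cauchy_kernel (z + k) w) \<le> M * wt w) \<Longrightarrow>
      p \<alpha> (sc a (f (z + h)) + sc b (f z) + sc c (f (z + k))) \<le> C * M"
    using f[of \<alpha>] by blast
  have M0: "0 \<le> max M\<^sub>0 0" by simp
  have "p \<alpha> (sc (inverse h) (f (z + h) - f z) - sc (inverse k) (f (z + k) - f z)) \<le>
      (C * (8 * max M\<^sub>0 0 / r\<^sup>2)) * (cmod h + cmod k)"
    if hk: "0 < cmod h" "cmod h < r / 2" "0 < cmod k" "cmod k < r / 2" for h k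
  proof -
    have "p \<alpha> (sc (inverse h) (f (z + h)) + sc (inverse k - inverse h) (f z) + sc (- inverse k) (f (z + k))) \<le>
        C * ((8 * max M\<^sub>0 0 / r\<^sup>2) * (cmod h + cmod k))"
    proof (rule C(2))
      fix w assume w: "w \<in> A"
      have "cmod ((cauchy_kernel (z + h) w - cauchy_kernel z w) / h - (cauchy_kernel (z + k) w - cauchy_kernel z w) / k)
          \<le> (8 * (max M\<^sub>0 0 * wt w) / r\<^sup>2) * (cmod h + cmod k)"
      proof (rule difference_quotients_Cauchy[OF _ _ r hk])
        show "(\<lambda>z. cauchy_kernel z w) holomorphic_on ball z (2 * r)"
          by (rule holomorphic_cauchy_kernel(2)[OF A[OF w]])
        show "cmod (cauchy_kernel z' w) \<le> max M\<^sub>0 0 * wt w" if "z' \<in> ball z (2 * r)" for z'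
          by (rule order_trans[OF K[OF w that]]) (use wt[OF w] in \<open>simp add: mult_right_mono\<close>)
      qed
      also have "(cauchy_kernel (z + h) w - cauchy_kernel z w) / h - (cauchy_kernel (z + k) w - cauchy_kernel z w) / k =
          inverse h * cauchy_kernel (z + h) w + (inverse k - inverse h) * cauchy_kernel z w + (- inverse k) * cauchy_kernel (z + k) w"
        by (simp add: divide_inverse algebra_simps)
      finally show "cmod (inverse h * cauchy_kernel (z + h) w + (inverse k - inverse h) * cauchy_kernel z w + (- inverse k) * cauchy_kernel (z + k) w)
          \<le> (8 * max M\<^sub>0 0 / r\<^sup>2) * (cmod h + cmod k) * wt w"
        by (simp add: mult_ac)
    qed (use hk r in auto)
    also have "sc (inverse h) (f (z + h)) + sc (inverse k - inverse h) (f z) + sc (- inverse k) (f (z + k)) =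
        sc (inverse h) (f (z + h) - f z) - sc (inverse k) (f (z + k) - f z)"
      by (simp add: scale_right_diff_distrib scale_left_diff_distrib scale_minus_left)
    finally show ?thesis by (simp add: mult.assoc)
  qed
  then show "\<exists>C\<ge>0. \<forall>h k. 0 < cmod h \<and> cmod h < r / 2 \<and> 0 < cmod k \<and> cmod k < r / 2 \<longrightarrow>
      p \<alpha> (sc (inverse h) (f (z + h) - f z) - sc (inverse k) (f (z + k) - f z)) \<le> C * (cmod h + cmod k)"
    using C(1) M0 by (intro exI[of _ "C * (8 * max M\<^sub>0 0 / r\<^sup>2)"]) auto
qed

end

section \<open>Test functions\<close>

lemma strip_eq_hstrip: "strip n = hstrip (- (1 / n)) (1 / n)"
  by (auto simp: strip_def hstrip_def abs_less_iff)


lemma O_strip_norm_bound: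
  assumes \<phi>: "\<phi> \<in> O_strip n" and z: "\<bar>Im z\<bar> \<le> 1 / n"
  shows "cmod (\<phi> z) \<le> O_strip_norm n \<phi> * exp (- \<bar>Re z\<bar> / n)"
proof -
  have "cmod (\<phi> z) * exp (\<bar>Re z\<bar> / n) \<le> O_strip_norm n \<phi>"
    unfolding O_strip_norm_def using \<phi> z by (intro cSUP_upper) (auto simp: O_strip_def)
  then have "cmod (\<phi> z) * exp (\<bar>Re z\<bar> / n) * exp (- \<bar>Re z\<bar> / n) \<le> O_strip_norm n \<phi> * exp (- \<bar>Re z\<bar> / n)"
    by (rule mult_right_mono) simp
  then show ?thesis by (simp add: mult.assoc flip: exp_add)
qed

lemma weighted_le_iff: "cmod w \<le> M * exp (- \<bar>x\<bar> / n) \<longleftrightarrow> cmod w * exp (\<bar>x\<bar> / n) \<le> M"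
  by (simp add: exp_minus field_simps)

lemma O_strip_norm_leI:
  assumes "\<And>z. \<bar>Im z\<bar> \<le> 1 / n \<Longrightarrow> cmod (\<phi> z) \<le> M * exp (- \<bar>Re z\<bar> / n)"
  shows "O_strip_norm n \<phi> \<le> M"
  unfolding O_strip_norm_def
proof (rule cSUP_least)
  show "{z. \<bar>Im z\<bar> \<le> 1 / n} \<noteq> {}" by (auto intro: exI[of _ 0])
qed (use assms[unfolded weighted_le_iff] in auto)

lemma O_stripI:
  assumes "\<phi> holomorphic_on strip n" "continuous_on (closure (strip n)) \<phi>"
    and "\<And>z. \<bar>Im z\<bar> \<le> 1 / n \<Longrightarrow> cmod (\<phi> z) \<le> M * exp (- \<bar>Re z\<bar> / n)"
  shows "\<phi> \<in> O_strip n"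
  using assms(1,2) assms(3)[unfolded weighted_le_iff] by (auto simp: O_strip_def intro!: bdd_aboveI2[of _ _ M])

lemma O_stripI_hstrip:
  assumes n: "n \<ge> 1" and "\<phi> holomorphic_on hstrip (- b) b" "1 / n < b"
    and "\<And>z. \<bar>Im z\<bar> \<le> 1 / n \<Longrightarrow> cmod (\<phi> z) \<le> M * exp (- \<bar>Re z\<bar> / n)"
  shows "\<phi> \<in> O_strip n"
proof (rule O_stripI)
  show "\<phi> holomorphic_on strip n"
    using assms by (intro holomorphic_on_subset[OF assms(2)]) (auto simp: strip_eq_hstrip)
  show "continuous_on (closure (strip n)) \<phi>"
    using assms by - (rule continuous_on_subset[OF holomorphic_on_imp_continuous_on[OF assms(2)]],
      auto simp: closure_strip[OF n])
qed (rule assms)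

lemma O_strip_norm_nonneg: "\<phi> \<in> O_strip n \<Longrightarrow> 0 \<le> O_strip_norm n \<phi>"
  using O_strip_norm_bound[of \<phi> n 0] order_trans[OF norm_ge_zero, of "\<phi> 0"] by simp

lemma O_strip_holomorphic: "\<phi> \<in> O_strip n \<Longrightarrow> \<phi> holomorphic_on hstrip (- (1 / n)) (1 / n)"
  by (simp add: O_strip_def strip_eq_hstrip)

lemma O_strip_sum:
  assumes "finite I" "\<And>i. i \<in> I \<Longrightarrow> \<phi> i \<in> O_strip n"
  shows "(\<lambda>z. \<Sum>i\<in>I. \<phi> i z) \<in> O_strip n"
  using assms by (induction I rule: finite_induct) (auto simp: O_strip_zero intro: O_strip_add)

lemma test_rel_refl: "n \<ge> 1 \<Longrightarrow> \<phi> \<in> O_strip n \<Longrightarrow> test_rel \<phi> \<phi>"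
  by (auto simp: test_rel_def)

lemma test_cases:
  obtains n \<phi> where "n \<ge> 1" "\<phi> \<in> O_strip n" "\<Phi> = abs_test \<phi>"
  using Quotient3_rep_reflp[OF Quotient3_test, of \<Phi>] Quotient3_abs_rep[OF Quotient3_test, of \<Phi>]
  unfolding test_rel_def by metis

lemma abs_test_cong:
  assumes "n \<ge> 1" "\<phi> \<in> O_strip n" "\<psi> \<in> O_strip n" "\<And>z. \<bar>Im z\<bar> \<le> 1 / n \<Longrightarrow> \<phi> z = \<psi> z"
  shows "abs_test \<phi> = abs_test \<psi>"
  using assms by (intro Quotient3_rel_abs[OF Quotient3_test]) (auto simp: test_rel_def closure_strip)

lemma abs_test_add:
  "n \<ge> 1 \<Longrightarrow> \<phi> \<in> O_strip n \<Longrightarrow> \<psi> \<in> O_strip n \<Longrightarrow>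
    abs_test \<phi> + abs_test \<psi> = abs_test (\<lambda>z. \<phi> z + \<psi> z)"
  by (rule plus_test.abs_eq) (auto intro: test_rel_refl)

lemma abs_test_scale:
  "n \<ge> 1 \<Longrightarrow> \<phi> \<in> O_strip n \<Longrightarrow> test_scale c (abs_test \<phi>) = abs_test (\<lambda>z. c * \<phi> z)"
  by (rule test_scale.abs_eq) (auto intro: test_rel_refl)

lemma abs_test_zero: "abs_test (\<lambda>_. 0) = 0"
  by (simp add: zero_test_def)

lemma abs_test_sum:
  assumes "n \<ge> 1" "finite I" "\<And>i. i \<in> I \<Longrightarrow> \<phi> i \<in> O_strip n"
  shows "(\<Sum>i\<in>I. abs_test (\<phi> i)) = abs_test (\<lambda>z. \<Sum>i\<in>I. \<phi> i z)"
  using assms(2,3)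
proof (induction I rule: finite_induct)
  case (insert i I)
  then show ?case using assms(1) by (simp add: abs_test_add O_strip_sum)
qed (simp add: abs_test_zero)

lemma test_on_real_abs: "n \<ge> 1 \<Longrightarrow> \<phi> \<in> O_strip n \<Longrightarrow> test_on_real (abs_test \<phi>) x = \<phi> (Complex x 0)"
  using test_on_real.abs_eq[OF test_rel_refl, of n \<phi>] by (simp add: complex_of_real_def)

interpretation test: vector_space test_scale by (rule vector_space_test_scale)

lemma inductive_limit_seminorm_nonneg: "inductive_limit_seminorm q \<Longrightarrow> 0 \<le> q \<Phi>"
  using seminorm_nonneg[OF vector_space_test_scale] by (simp add: inductive_limit_seminorm_def)

lemma inductive_limit_seminorm_scale:
  "inductive_limit_seminorm q \<Longrightarrow> q (test_scale c \<Phi>) = cmod c * q \<Phi>"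
  by (simp add: inductive_limit_seminorm_def seminorm_def)

text \<open>
  Arbitrary suprema are allowed as long as they are bounded on the unit ball of each step separately.
  All continuous seminorms constructed below arise in this way.
\<close>

lemma inductive_limit_seminorm_SUP:
  assumes I: "I \<noteq> {}" and q: "\<And>i. i \<in> I \<Longrightarrow> seminorm test_scale (q i)"
    and bound: "\<And>n. n \<ge> 1 \<Longrightarrow> \<exists>C. \<forall>i\<in>I. \<forall>\<phi>\<in>O_strip n. q i (abs_test \<phi>) \<le> C * O_strip_norm n \<phi>"
  shows "inductive_limit_seminorm (\<lambda>\<Phi>. SUP i\<in>I. q i \<Phi>)"
    and "\<And>i \<Phi>. i \<in> I \<Longrightarrow> q i \<Phi> \<le> (SUP i\<in>I. q i \<Phi>)"
proof -
  have bdd: "bdd_above ((\<lambda>i. q i \<Phi>) ` I)" for \<Phi>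
  proof -
    obtain n \<phi> where n: "n \<ge> 1" "\<phi> \<in> O_strip n" "\<Phi> = abs_test \<phi>" by (rule test_cases)
    then show ?thesis using bound[OF n(1)] by (auto simp: bdd_above_def)
  qed
  show le: "q i \<Phi> \<le> (SUP i\<in>I. q i \<Phi>)" if "i \<in> I" for i \<Phi>
    using that bdd by (rule cSUP_upper)
  have sub: "q i (x + y) \<le> q i x + q i y" and hom: "q i (test_scale c x) = cmod c * q i x" if "i \<in> I" for i x y c
    using q[OF that] by (auto simp: seminorm_def)
  define S where "S = (\<lambda>\<Phi>. SUP i\<in>I. q i \<Phi>)"
  have S_le: "S \<Phi> \<le> M" if "\<And>i. i \<in> I \<Longrightarrow> q i \<Phi> \<le> M" for \<Phi> M
    unfolding S_def by (rule cSUP_least[OF I that])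
  have le_S: "q i \<Phi> \<le> S \<Phi>" if "i \<in> I" for i \<Phi> unfolding S_def by (rule le[OF that])
  have hom_le: "S (test_scale c x) \<le> cmod c * S x" for c x
    by (rule S_le) (simp add: hom le_S mult_left_mono)
  have "seminorm test_scale S"
    unfolding seminorm_def
  proof (intro conjI allI)
    fix x y show "S (x + y) \<le> S x + S y"
      by (rule S_le) (meson add_mono le_S order_trans sub)
  next
    fix c x
    show "S (test_scale c x) = cmod c * S x"
    proof (cases "c = 0")
      case True
      have "S 0 = 0"
        unfolding S_def using hom[of _ 0 0] I by simp
      then show ?thesis using True by simp
    next
      case False
      have "S x = S (test_scale (inverse c) (test_scale c x))" using False by simp
      also have "\<dots> \<le> cmod (inverse c) * S (test_scale c x)" by (rule hom_le)
      finally have "cmod c * S x \<le> S (test_scale c x)"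
        using False by (simp add: norm_inverse norm_divide field_simps)
      then show ?thesis using hom_le[of c x] by simp
    qed
  qed
  moreover have "\<exists>C. \<forall>\<phi>\<in>O_strip n. S (abs_test \<phi>) \<le> C * O_strip_norm n \<phi>" if "n \<ge> 1" for n
    using bound[OF that] S_le by meson
  ultimately show "inductive_limit_seminorm (\<lambda>\<Phi>. SUP i\<in>I. q i \<Phi>)"
    by (simp add: inductive_limit_seminorm_def S_def)
qed

lemma bounded_inductive_limit_seminorm:
  assumes B: "tvs_bounded test_scale B" and q: "inductive_limit_seminorm q"
  obtains M where "0 \<le> M" "\<And>\<Phi>. \<Phi> \<in> B \<Longrightarrow> q \<Phi> \<le> M"
proof -
  have sub: "q (x + y) \<le> q x + q y" for x y
    using q by (auto simp: inductive_limit_seminorm_def seminorm_def)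
  have "open {\<Phi>. q \<Phi> < 1}"
    unfolding open_test_def
  proof
    fix x assume "x \<in> {\<Phi>. q \<Phi> < 1}"
    moreover have "q y < 1" if "q (y - x) < 1 - q x" for y
      using sub[of "y - x" x] that by simp
    ultimately show "\<exists>r \<epsilon>. inductive_limit_seminorm r \<and> \<epsilon> > 0 \<and> {y. r (y - x) < \<epsilon>} \<subseteq> {\<Phi>. q \<Phi> < 1}"
      using q by (intro exI[of _ q] exI[of _ "1 - q x"]) auto
  qed
  moreover have "0 \<in> {\<Phi>. q \<Phi> < 1}"
    using inductive_limit_seminorm_scale[OF q, of 0 0] by simp
  ultimately obtain r where r: "r > 0" "\<And>c. cmod c \<ge> r \<Longrightarrow> B \<subseteq> test_scale c ` {\<Phi>. q \<Phi> < 1}"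
    using B unfolding tvs_bounded_def by blast
  show ?thesis
  proof (rule that[of r])
    fix \<Phi> assume "\<Phi> \<in> B"
    then obtain \<Psi> where "\<Phi> = test_scale (of_real r) \<Psi>" "q \<Psi> < 1" using r(1) r(2)[of "of_real r"] by auto
    then show "q \<Phi> \<le> r" using r(1) by (simp add: inductive_limit_seminorm_scale[OF q])
  qed (use r in simp)
qed

lemma tvs_bounded_O_strip_ball:
  assumes n: "n \<ge> 1" and B: "B \<subseteq> abs_test ` {\<phi> \<in> O_strip n. O_strip_norm n \<phi> \<le> M}"
  shows "tvs_bounded test_scale B"
  unfolding tvs_bounded_def
proof (intro allI impI)
  fix U :: "test set" assume U: "open U \<and> 0 \<in> U"
  then obtain q \<epsilon> where q: "inductive_limit_seminorm q" "\<epsilon> > 0" "{y. q (y - 0) < \<epsilon>} \<subseteq> U"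
    unfolding open_test_def by blast
  obtain C where C: "\<And>\<phi>. \<phi> \<in> O_strip n \<Longrightarrow> q (abs_test \<phi>) \<le> C * O_strip_norm n \<phi>"
    using q(1) n unfolding inductive_limit_seminorm_def by blast
  have qB: "q \<Phi> \<le> \<bar>C\<bar> * \<bar>M\<bar>" if "\<Phi> \<in> B" for \<Phi>
  proof -
    obtain \<phi> where \<phi>: "\<phi> \<in> O_strip n" "O_strip_norm n \<phi> \<le> M" "\<Phi> = abs_test \<phi>"
      using \<open>\<Phi> \<in> B\<close> B by blast
    have "q \<Phi> \<le> C * O_strip_norm n \<phi>" using C \<phi> by blast
    also have "\<dots> \<le> \<bar>C\<bar> * \<bar>M\<bar>" using \<phi> O_strip_norm_nonneg[OF \<phi>(1)] by (intro mult_mono) auto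
    finally show ?thesis .
  qed
  define r where "r = (\<bar>C\<bar> * \<bar>M\<bar> + 1) / \<epsilon>"
  have "B \<subseteq> test_scale c ` U" if c: "cmod c \<ge> r" for c
  proof
    fix \<Phi> assume \<Phi>: "\<Phi> \<in> B"
    have r0: "r > 0" using q(2) by (simp add: r_def add_nonneg_pos)
    then have c0: "c \<noteq> 0" using c by auto
    have "q (test_scale (inverse c) \<Phi>) = q \<Phi> / cmod c"
      by (simp add: inductive_limit_seminorm_scale[OF q(1)] norm_inverse divide_inverse mult.commute)
    also have "q \<Phi> < r * \<epsilon>" using qB[OF \<Phi>] q(2) by (simp add: r_def)
    then have "q \<Phi> < cmod c * \<epsilon>" using q(2) mult_right_mono[OF c, of \<epsilon>] by linarith
    then have "q \<Phi> / cmod c < \<epsilon>" using c0 by (simp add: divide_less_eq mult.commute)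
    finally have "test_scale (inverse c) \<Phi> \<in> U" using q(3) by auto
    then show "\<Phi> \<in> test_scale c ` U" using c0 by (intro image_eqI[of _ _ "test_scale (inverse c) \<Phi>"]) auto
  qed
  then show "\<exists>r>0. \<forall>c. cmod c \<ge> r \<longrightarrow> B \<subseteq> test_scale c ` U"
    using q(2) by (intro exI[of _ r]) (auto simp: r_def add_nonneg_pos)
qed

subsection \<open>Bounded sets of test functions\<close>


lemma ball_subset_hstrip: "b \<le> r \<Longrightarrow> ball (of_real x) b \<subseteq> hstrip (- r) r"
proof
  fix w assume "b \<le> r" "w \<in> ball (complex_of_real x) b"
  then have "\<bar>Im w\<bar> < r" using abs_Im_le_cmod[of "of_real x - w"] by (simp add: dist_norm)
  then show "w \<in> hstrip (- r) r" by (auto simp: abs_less_iff)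
qed

text \<open>
  A germ of a holomorphic function along the real line whose Taylor coefficients at all real points
  grow at most like \<open>N\<^sup>k\<close> extends to the strip of half-width \<open>1 / N\<close>: two of the discs of radius
  \<open>1 / N\<close> around real points meet in a connected set that contains real points if it is nonempty.
\<close>
lemma Taylor_extension:
  fixes N :: real
  assumes \<phi>: "\<phi> holomorphic_on hstrip (- \<rho>) \<rho>" and \<rho>: "0 < \<rho>" and N: "0 < N"
    and le: "\<And>k x. cmod ((deriv ^^ k) \<phi> (of_real x) / fact k) \<le> M x * N ^ k"
  obtains F where "F holomorphic_on hstrip (- (1 / N)) (1 / N)"
    "\<And>z. \<bar>Im z\<bar> < \<rho> \<Longrightarrow> \<bar>Im z\<bar> < 1 / N \<Longrightarrow> F z = \<phi> z"
    "\<And>z. \<bar>Im z\<bar> \<le> 1 / (2 * N) \<Longrightarrow> cmod (F z) \<le> 2 * M (Re z)"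
proof -
  define c where "c x k = (deriv ^^ k) \<phi> (of_real x) / fact k" for x k
  define P where "P x w = (\<Sum>k. c x k * (w - of_real x) ^ k)" for x w
  define D where "D x = ball (complex_of_real x) (1 / N)" for x
  have M0: "0 \<le> M x" for x using order_trans[OF norm_ge_zero le[of 0 x]] by simp
  have term_le: "cmod (c x k * (w - of_real x) ^ k) \<le> M x * (N * cmod (w - of_real x)) ^ k" for x k w
    using mult_right_mono[OF le[of k x, folded c_def], of "cmod (w - of_real x) ^ k"]
    by (simp add: norm_mult norm_power power_mult_distrib mult.assoc)
  have geo: "summable (\<lambda>k. M x * (N * cmod (w - of_real x)) ^ k)" if "w \<in> D x" for x w
    using that N by (intro summable_mult summable_geometric) (auto simp: D_def dist_norm norm_minus_commute field_simps)
  have sums: "(\<lambda>k. c x k * (w - of_real x) ^ k) sums P x w" if "w \<in> D x" for x w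
    unfolding P_def by (intro summable_sums summable_comparison_test'[OF geo[OF that]]) (rule term_le)
  have P_hol: "P x holomorphic_on D x" for x
    unfolding D_def by (rule power_series_holomorphic) (use sums in \<open>simp add: D_def\<close>)
  have P_small: "P x w = \<phi> w" if w: "w \<in> ball (of_real x) (min \<rho> (1 / N))" for x w
  proof -
    have "\<phi> holomorphic_on ball (of_real x) \<rho>"
    proof (rule holomorphic_on_subset[OF \<phi>])
      show "ball (of_real x) \<rho> \<subseteq> hstrip (- \<rho>) \<rho>"
        by (rule ball_subset_hstrip) simp
    qed
    then have "(\<lambda>k. c x k * (w - of_real x) ^ k) sums \<phi> w"
      unfolding c_def by (rule holomorphic_power_series) (use w in simp)
    then show ?thesis using sums[of w x] w by (auto simp: D_def dest: sums_unique2)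
  qed
  have P_strip: "P x w = \<phi> w" if w: "w \<in> D x" "\<bar>Im w\<bar> < \<rho>" for x w
  proof (rule analytic_continuation_open[of "ball (of_real x) (min \<rho> (1 / N))" "D x \<inter> hstrip (- \<rho>) \<rho>" "P x" \<phi>])
    show "ball (of_real x) (min \<rho> (1 / N)) \<subseteq> D x \<inter> hstrip (- \<rho>) \<rho>"
      using ball_subset_hstrip[of "min \<rho> (1 / N)" \<rho> x] unfolding D_def by (intro Int_greatest subset_ball) simp_all
    show "connected (D x \<inter> hstrip (- \<rho>) \<rho>)"
      by (intro convex_connected convex_Int) (auto simp: D_def)
    show "P x holomorphic_on D x \<inter> hstrip (- \<rho>) \<rho>" by (rule holomorphic_on_subset[OF P_hol]) auto
    show "\<phi> holomorphic_on D x \<inter> hstrip (- \<rho>) \<rho>" by (rule holomorphic_on_subset[OF \<phi>]) auto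
  qed (use \<rho> N w P_small in \<open>auto simp: D_def min_le_iff_disj intro: open_Int\<close>)
  \<comment> \<open>the real part of a common point of two discs lies in both of them\<close>
  have P_unique: "P x w = P y w" if w: "w \<in> D x" "w \<in> D y" for x y w
  proof (rule analytic_continuation_open[of "D x \<inter> D y \<inter> hstrip (- \<rho>) \<rho>" "D x \<inter> D y" "P x" "P y"])
    have "of_real (Re w) \<in> D v" if "w \<in> D v" for v
      using that abs_Re_le_cmod[of "of_real v - w"]
      by (auto simp: D_def dist_norm simp flip: of_real_diff intro: le_less_trans)
    then have "of_real (Re w) \<in> D x \<inter> D y \<inter> hstrip (- \<rho>) \<rho>" using w \<rho> by simp
    then show "D x \<inter> D y \<inter> hstrip (- \<rho>) \<rho> \<noteq> {}" by blast
    show "connected (D x \<inter> D y)"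
      by (intro convex_connected convex_Int) (auto simp: D_def)
    show "P x holomorphic_on D x \<inter> D y" by (rule holomorphic_on_subset[OF P_hol]) auto
    show "P y holomorphic_on D x \<inter> D y" by (rule holomorphic_on_subset[OF P_hol]) auto
  qed (use w P_strip in \<open>auto simp: D_def intro: open_Int\<close>)
  define F where "F z = P (Re z) z" for z
  have in_D: "z \<in> D (Re z)" if "\<bar>Im z\<bar> < 1 / N" for z
    using that by (simp add: D_def dist_norm cmod_def)
  have "F holomorphic_on (\<Union>x. D x \<inter> hstrip (- (1 / N)) (1 / N))"
  proof (rule holomorphic_on_UN_open)
    fix x
    show "F holomorphic_on D x \<inter> hstrip (- (1 / N)) (1 / N)"
    proof (rule holomorphic_transform[OF holomorphic_on_subset[OF P_hol[of x]]])
      show "P x z = F z" if "z \<in> D x \<inter> hstrip (- (1 / N)) (1 / N)" for z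
        unfolding F_def using that by (intro P_unique in_D) auto
    qed auto
    show "open (D x \<inter> hstrip (- (1 / N)) (1 / N))" by (intro open_Int) (auto simp: D_def)
  qed
  then have "F holomorphic_on hstrip (- (1 / N)) (1 / N)"
  proof (rule holomorphic_on_subset, intro subsetI)
    fix z assume z: "z \<in> hstrip (- (1 / N)) (1 / N)"
    then have "z \<in> D (Re z)" by (intro in_D) (simp add: abs_less_iff)
    then show "z \<in> (\<Union>x. D x \<inter> hstrip (- (1 / N)) (1 / N))" using z by blast
  qed
  moreover have "F z = \<phi> z" if "\<bar>Im z\<bar> < \<rho>" "\<bar>Im z\<bar> < 1 / N" for z
    unfolding F_def using that by (intro P_strip in_D)
  moreover have "cmod (F z) \<le> 2 * M (Re z)" if z: "\<bar>Im z\<bar> \<le> 1 / (2 * N)" for z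
  proof -
    let ?q = "N * cmod (z - of_real (Re z))"
    have "cmod (z - of_real (Re z)) = \<bar>Im z\<bar>" by (simp add: cmod_def)
    then have q: "?q \<le> 1 / 2" "0 \<le> ?q" using z N by (auto simp: field_simps)
    have "1 / (2 * N) < 1 / N" using N by (simp add: field_simps)
    then have zD: "z \<in> D (Re z)" using z by (intro in_D) linarith
    have "cmod (F z) \<le> (\<Sum>k. M (Re z) * ?q ^ k)"
      unfolding F_def P_def by (rule norm_suminf_le[OF term_le geo[OF zD]])
    also have "\<dots> = M (Re z) * (1 / (1 - ?q))"
      using q by (subst suminf_mult) (auto intro!: summable_geometric simp: suminf_geometric)
    also have "\<dots> \<le> M (Re z) * 2"
      using q M0 by (intro mult_left_mono) (auto simp: field_simps)
    finally show ?thesis by simp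
  qed
  ultimately show ?thesis by (rule that)
qed

text \<open>
  The Taylor coefficient of a representative at a real point; it depends on the germ only.
\<close>

definition test_coeff :: "nat \<Rightarrow> real \<Rightarrow> test \<Rightarrow> complex" where
  "test_coeff k x \<Phi> = (deriv ^^ k) (rep_test \<Phi>) (of_real x) / fact k"

lemma test_coeff_abs:
  assumes n: "n \<ge> 1" and \<phi>: "\<phi> \<in> O_strip n"
  shows "test_coeff k x (abs_test \<phi>) = (deriv ^^ k) \<phi> (of_real x) / fact k"
proof -
  have "test_rel (rep_test (abs_test \<phi>)) \<phi>"
    using Quotient3_rep_abs[OF Quotient3_test, OF test_rel_refl[OF n \<phi>]] .
  then obtain m where m: "m \<ge> 1" "rep_test (abs_test \<phi>) \<in> O_strip m" "\<phi> \<in> O_strip m"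
    "\<forall>z\<in>closure (strip m). rep_test (abs_test \<phi>) z = \<phi> z" by (auto simp: test_rel_def)
  have "(deriv ^^ k) (rep_test (abs_test \<phi>)) (of_real x) = (deriv ^^ k) \<phi> (of_real x)"
  proof (rule higher_deriv_transform_within_open)
    show "rep_test (abs_test \<phi>) w = \<phi> w" if "w \<in> hstrip (- (1 / m)) (1 / m)" for w
      using that m(4) closure_subset[of "strip m"] by (auto simp: strip_eq_hstrip)
  qed (use m in \<open>auto intro: O_strip_holomorphic\<close>)
  then show ?thesis by (simp add: test_coeff_def)
qed

text \<open>
  Cauchy's inequality on the disc of radius \<open>1 / n\<close>, where the weight varies by the factor \<open>exp 1\<close> at most.
\<close>

lemma test_coeff_le:
  assumes n: "n \<ge> 1" and \<phi>: "\<phi> \<in> O_strip n"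
  shows "cmod (test_coeff k x (abs_test \<phi>)) \<le> (exp 1 * O_strip_norm n \<phi>) * real n ^ k * exp (- \<bar>x\<bar> / n)"
proof -
  let ?B = "exp 1 * O_strip_norm n \<phi> * exp (- \<bar>x\<bar> / n)"
  have n0: "0 < real n" using n by simp
  have sub: "\<bar>Im w\<bar> \<le> 1 / n \<and> \<bar>Re w - x\<bar> \<le> 1 / n" if "w \<in> cball (of_real x) (1 / n)" for w
    using that abs_Im_le_cmod[of "w - of_real x"] abs_Re_le_cmod[of "w - of_real x"]
    by (auto simp: dist_norm norm_minus_commute)
  have "cmod ((deriv ^^ k) \<phi> (of_real x)) \<le> fact k * ?B / (1 / n) ^ k"
  proof (rule Cauchy_inequality)
    show "\<phi> holomorphic_on ball (of_real x) (1 / n)"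
    proof (rule holomorphic_on_subset[OF O_strip_holomorphic[OF \<phi>]])
      show "ball (of_real x) (1 / n) \<subseteq> hstrip (- (1 / real n)) (1 / n)"
        by (rule ball_subset_hstrip) simp
    qed
    show "continuous_on (cball (of_real x) (1 / n)) \<phi>"
      using \<phi> sub by - (rule continuous_on_subset[of "closure (strip n)" \<phi>], auto simp: O_strip_def closure_strip[OF n])
    fix w assume "cmod (of_real x - w) = 1 / n"
    then have w: "\<bar>Im w\<bar> \<le> 1 / n" "\<bar>Re w - x\<bar> \<le> 1 / n" using sub[of w] by (auto simp: dist_norm)
    have "cmod (\<phi> w) \<le> O_strip_norm n \<phi> * exp (- \<bar>Re w\<bar> / n)" by (rule O_strip_norm_bound[OF \<phi> w(1)])
    also have "\<dots> \<le> O_strip_norm n \<phi> * exp (1 + - \<bar>x\<bar> / n)"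
    proof (intro mult_left_mono O_strip_norm_nonneg \<phi>)
      have "1 / real n \<le> 1" using n by simp
      then have "\<bar>x\<bar> - \<bar>Re w\<bar> \<le> 1" using w(2) by linarith
      also have "1 \<le> real n" using n by simp
      finally have "(\<bar>x\<bar> - \<bar>Re w\<bar>) / n \<le> 1" using n0 by (simp add: divide_le_eq)
      then show "exp (- \<bar>Re w\<bar> / n) \<le> exp (1 + - \<bar>x\<bar> / n)" by (simp add: diff_divide_distrib)
    qed
    also have "\<dots> = ?B" by (simp only: exp_add) simp
    finally show "cmod (\<phi> w) \<le> ?B" .
  qed (use n0 in simp)
  then show ?thesis
    by (simp add: test_coeff_abs[OF n \<phi>] norm_divide divide_le_eq power_one_over) (simp add: mult_ac divide_inverse)
qed

lemma seminorm_test_coeff: "0 \<le> c \<Longrightarrow> seminorm test_scale (\<lambda>\<Phi>. c * cmod (test_coeff k x \<Phi>))"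
  unfolding seminorm_def
proof (intro conjI allI)
  assume c: "0 \<le> c"
  fix \<Phi> \<Psi>
  obtain n \<phi> where n: "n \<ge> 1" "\<phi> \<in> O_strip n" "\<Phi> = abs_test \<phi>" by (rule test_cases)
  obtain m \<psi> where m: "m \<ge> 1" "\<psi> \<in> O_strip m" "\<Psi> = abs_test \<psi>" by (rule test_cases)
  define l where "l = max n m"
  have l: "l \<ge> 1" "\<phi> \<in> O_strip l" "\<psi> \<in> O_strip l"
    using n m O_strip_mono[of n l] O_strip_mono[of m l] by (auto simp: l_def)
  have "(deriv ^^ k) (\<lambda>z. \<phi> z + \<psi> z) (of_real x) = (deriv ^^ k) \<phi> (of_real x) + (deriv ^^ k) \<psi> (of_real x)"
    by (rule higher_deriv_add[OF O_strip_holomorphic O_strip_holomorphic]) (use l in auto)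
  then have "test_coeff k x (\<Phi> + \<Psi>) = test_coeff k x \<Phi> + test_coeff k x \<Psi>"
    using l by (simp add: n m abs_test_add test_coeff_abs O_strip_add add_divide_distrib)
  then show "c * cmod (test_coeff k x (\<Phi> + \<Psi>)) \<le> c * cmod (test_coeff k x \<Phi>) + c * cmod (test_coeff k x \<Psi>)"
    using mult_left_mono[OF norm_triangle_ineq c] by (simp add: ring_distribs)
next
  assume "0 \<le> c"
  fix a \<Phi>
  obtain n \<phi> where n: "n \<ge> 1" "\<phi> \<in> O_strip n" "\<Phi> = abs_test \<phi>" by (rule test_cases)
  have "(deriv ^^ k) (\<lambda>z. a * \<phi> z) (of_real x) = a * (deriv ^^ k) \<phi> (of_real x)"
    by (rule higher_deriv_cmult[OF O_strip_holomorphic[OF n(2)]]) (use n in auto)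
  then have "test_coeff k x (test_scale a \<Phi>) = a * test_coeff k x \<Phi>"
    using n by (simp add: abs_test_scale test_coeff_abs O_strip_scale)
  then show "c * cmod (test_coeff k x (test_scale a \<Phi>)) = cmod a * (c * cmod (test_coeff k x \<Phi>))"
    by (simp add: norm_mult)
qed

text \<open>
  The inductive limit is regular. If the Taylor coefficients of the members of \<open>B\<close> violated the
  estimate for every \<open>n\<close>, say at \<open>(k\<^sub>n, x\<^sub>n)\<close>, then the supremum over \<open>n\<close> of the suitably weighted
  coefficients at \<open>(k\<^sub>n, x\<^sub>n)\<close> would be unbounded on \<open>B\<close>; but it is a continuous seminorm, because on
  each step of the limit the weights with large \<open>n\<close> are harmless.
\<close>

lemma bounded_test_coeff:
  assumes B: "tvs_bounded test_scale B"
  obtains N where "N \<ge> 1"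
    "\<And>\<Phi> k x. \<Phi> \<in> B \<Longrightarrow> cmod (test_coeff k x \<Phi>) \<le> real N * real N ^ k * exp (- \<bar>x\<bar> / N)"
proof (rule ccontr)
  assume "\<not> thesis"
  then have bad_N: "\<forall>N\<ge>1. \<exists>\<Phi> k x. \<Phi> \<in> B \<and> real N * real N ^ k * exp (- \<bar>x\<bar> / N) < cmod (test_coeff k x \<Phi>)"
    using that by (meson not_le)
  have "\<exists>\<Phi> k x. \<Phi> \<in> B \<and> real (Suc j) * real (Suc j) ^ k * exp (- \<bar>x\<bar> / Suc j) < cmod (test_coeff k x \<Phi>)" for j
    by (rule bad_N[rule_format]) simp
  then obtain \<Phi> k x where bad: "\<And>j. \<Phi> j \<in> B"
    "\<And>j. real (Suc j) * real (Suc j) ^ k j * exp (- \<bar>x j\<bar> / Suc j) < cmod (test_coeff (k j) (x j) (\<Phi> j))"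
    by metis
  \<comment> \<open>the weight that turns the violated estimate into \<open>Suc j < q j (\<Phi> j)\<close>\<close>
  define w where "w j = inverse (real (Suc j) ^ k j * exp (- \<bar>x j\<bar> / Suc j))" for j
  have w_pos: "0 < w j" for j by (simp add: w_def)
  define q where "q j = (\<lambda>\<Phi>. w j * cmod (test_coeff (k j) (x j) \<Phi>))" for j
  have bound: "\<exists>C. \<forall>j\<in>UNIV. \<forall>\<phi>\<in>O_strip n. q j (abs_test \<phi>) \<le> C * O_strip_norm n \<phi>" if n: "n \<ge> 1" for n
  proof -
    \<comment> \<open>the size of \<open>q j\<close> on the unit ball of \<open>O_strip n\<close>, up to the factor \<open>exp 1\<close>; it is at most \<open>1\<close> for \<open>Suc j \<ge> n\<close>\<close>
    define a where "a j = w j * (real n ^ k j * exp (- \<bar>x j\<bar> / n))" for j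
    have a0: "0 \<le> a j" for j using w_pos[of j] by (simp add: a_def)
    have a_le: "a j \<le> 1" if j: "n \<le> Suc j" for j
    proof -
      have "\<bar>x j\<bar> / Suc j \<le> \<bar>x j\<bar> / n" using j n by (intro divide_left_mono) auto
      then have "real n ^ k j * exp (- \<bar>x j\<bar> / n) \<le> real (Suc j) ^ k j * exp (- \<bar>x j\<bar> / Suc j)"
        using j by (intro mult_mono power_mono) auto
      then show ?thesis unfolding a_def w_def
        by (subst mult.commute) (simp add: divide_inverse[symmetric] divide_le_eq)
    qed
    have a_bd: "a j \<le> 1 + (\<Sum>i<n. a i)" for j
    proof (cases "n \<le> Suc j")
      case True
      then show ?thesis using a_le[OF True] a0 by (simp add: sum_nonneg add_increasing2)
    next
      case False
      then have "a j \<le> (\<Sum>i<n. a i)" using a0 by (intro member_le_sum) auto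
      then show ?thesis by simp
    qed
    have "q j (abs_test \<phi>) \<le> (exp 1 * (1 + (\<Sum>i<n. a i))) * O_strip_norm n \<phi>" if \<phi>: "\<phi> \<in> O_strip n" for j \<phi>
    proof -
      have "q j (abs_test \<phi>) \<le> w j * ((exp 1 * O_strip_norm n \<phi>) * real n ^ k j * exp (- \<bar>x j\<bar> / n))"
        unfolding q_def using w_pos[of j] by (intro mult_left_mono test_coeff_le n \<phi>) simp
      also have "\<dots> = a j * (exp 1 * O_strip_norm n \<phi>)" by (simp add: a_def)
      also have "\<dots> \<le> (1 + (\<Sum>i<n. a i)) * (exp 1 * O_strip_norm n \<phi>)"
        using O_strip_norm_nonneg[OF \<phi>] by (intro mult_right_mono a_bd) simp
      finally show ?thesis by (simp add: mult_ac)
    qed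
    then show ?thesis by blast
  qed
  have sn: "seminorm test_scale (q j)" for j
    unfolding q_def using w_pos[of j] by (intro seminorm_test_coeff) simp
  note SUP = inductive_limit_seminorm_SUP[of UNIV q, OF _ sn bound]
  obtain M where M: "\<And>\<Phi>. \<Phi> \<in> B \<Longrightarrow> (SUP j. q j \<Phi>) \<le> M"
    using bounded_inductive_limit_seminorm[OF B SUP(1)] by auto
  obtain j where j: "M < real j" using reals_Archimedean2 by blast
  have "real (Suc j) < q j (\<Phi> j)"
  proof -
    have "real (Suc j) = w j * (real (Suc j) * real (Suc j) ^ k j * exp (- \<bar>x j\<bar> / Suc j))"
      by (simp add: w_def field_simps del: of_nat_Suc)
    also have "\<dots> < q j (\<Phi> j)" unfolding q_def by (intro mult_strict_left_mono bad(2) w_pos)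
    finally show ?thesis .
  qed
  also have "q j (\<Phi> j) \<le> M" using SUP(2)[of j "\<Phi> j"] M[OF bad(1)[of j]] by simp
  finally show False using j by simp
qed

text \<open>
  The uniform bound on the Taylor coefficients yields representatives on the strip of half-width \<open>1 / N\<close>.
  Halving the width leaves a geometric series with ratio \<open>1 / 2\<close>, which bounds them uniformly.
\<close>

theorem bounded_test_sets:
  assumes B: "tvs_bounded test_scale B"
  obtains n M where "n \<ge> 1" "B \<subseteq> abs_test ` {\<phi> \<in> O_strip n. O_strip_norm n \<phi> \<le> M}"
proof -
  obtain N where N: "N \<ge> 1"
    "\<And>\<Phi> k x. \<Phi> \<in> B \<Longrightarrow> cmod (test_coeff k x \<Phi>) \<le> real N * real N ^ k * exp (- \<bar>x\<bar> / N)"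
    using bounded_test_coeff[OF B] by blast
  define n where "n = 2 * N"
  have n: "n \<ge> 1" "N \<le> n" using N(1) by (auto simp: n_def)
  have "\<Phi> \<in> abs_test ` {\<phi> \<in> O_strip n. O_strip_norm n \<phi> \<le> 2 * real N}" if \<Phi>: "\<Phi> \<in> B" for \<Phi>
  proof -
    obtain m \<phi> where m: "m \<ge> 1" "\<phi> \<in> O_strip m" "\<Phi> = abs_test \<phi>" by (rule test_cases)
    have coeff: "cmod ((deriv ^^ k) \<phi> (of_real x) / fact k) \<le> (real N * exp (- \<bar>x\<bar> / N)) * real N ^ k" for k x
      using N(2)[OF \<Phi>, of k x] unfolding m(3) test_coeff_abs[OF m(1,2)] by (simp add: mult_ac)
    have pos: "0 < 1 / real m" "0 < real N" using m N by auto
    obtain F where F: "F holomorphic_on hstrip (- (1 / N)) (1 / N)"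
      "\<And>z. \<bar>Im z\<bar> < 1 / m \<Longrightarrow> \<bar>Im z\<bar> < 1 / N \<Longrightarrow> F z = \<phi> z"
      "\<And>z. \<bar>Im z\<bar> \<le> 1 / (2 * real N) \<Longrightarrow> cmod (F z) \<le> 2 * (real N * exp (- \<bar>Re z\<bar> / N))"
      by (rule Taylor_extension[of \<phi> "1 / real m" "real N" "\<lambda>x. real N * exp (- \<bar>x\<bar> / N)",
            OF O_strip_holomorphic[OF m(2)] pos coeff]) (rule that)
    have F_le: "cmod (F z) \<le> (2 * real N) * exp (- \<bar>Re z\<bar> / n)" if "\<bar>Im z\<bar> \<le> 1 / n" for z
    proof -
      have "\<bar>Re z\<bar> / n \<le> \<bar>Re z\<bar> / N" using n N(1) by (intro divide_left_mono) auto
      then have "2 * (real N * exp (- \<bar>Re z\<bar> / N)) \<le> (2 * real N) * exp (- \<bar>Re z\<bar> / n)"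
        unfolding mult.assoc[symmetric] by (intro mult_left_mono) auto
      then show ?thesis using F(3)[of z] that by (simp add: n_def)
    qed
    have F_O: "F \<in> O_strip n"
      by (rule O_stripI_hstrip[OF n(1) F(1) _ F_le]) (use N(1) in \<open>simp_all add: n_def field_simps\<close>)
    define l where "l = 2 * max m n"
    have l: "l \<ge> 1" "n \<le> l" "m \<le> l" using n m by (auto simp: l_def)
    have "1 / real l < 1 / real m" "1 / real l < 1 / real N"
      using n m N(1) by (auto simp: l_def n_def intro!: divide_strict_left_mono)
    then have "abs_test F = abs_test \<phi>"
      using l O_strip_mono[OF n(1) l(2)] O_strip_mono[OF m(1) l(3)] F_O m(2)
      by (intro abs_test_cong[OF l(1)] F(2)) auto
    then show ?thesis using F_O m(3) O_strip_norm_leI[OF F_le] by (intro image_eqI[of _ _ F]) auto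
  qed
  then show ?thesis using n by (intro that[of n "2 * real N"]) auto
qed

subsection \<open>Continuous linear maps on test functions\<close>

context lcs
begin

text \<open>
  A neighbourhood of \<open>0\<close> mapped into the unit ball of \<open>p \<alpha>\<close> contains a ball of a continuous seminorm \<open>q\<close>;
  rescaling gives \<open>p \<alpha> (T \<Phi>) \<le> C q \<Phi>\<close>, up to a margin for the case \<open>q \<Phi> = 0\<close>.
\<close>

lemma continuous_linear_on_test:
  assumes T: "T \<in> continuous_linear_maps test_scale sc" and n: "n \<ge> 1"
  obtains C where "0 \<le> C" "\<And>\<phi>. \<phi> \<in> O_strip n \<Longrightarrow> p \<alpha> (T (abs_test \<phi>)) \<le> C * O_strip_norm n \<phi>"
proof -
  interpret T: Vector_Spaces.linear test_scale sc T using T by (simp add: continuous_linear_maps_def)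
  have "open (T -` {y. p \<alpha> (y - 0) < 1})"
    using T by (intro open_vimage open_ball) (simp add: continuous_linear_maps_def)
  moreover have "0 \<in> T -` {y. p \<alpha> (y - 0) < 1}" by (simp add: T.zero)
  ultimately obtain q \<epsilon> where q: "inductive_limit_seminorm q" "\<epsilon> > 0"
    "{y. q (y - 0) < \<epsilon>} \<subseteq> T -` {y. p \<alpha> (y - 0) < 1}" unfolding open_test_def by blast
  obtain C where C: "\<And>\<phi>. \<phi> \<in> O_strip n \<Longrightarrow> q (abs_test \<phi>) \<le> C * O_strip_norm n \<phi>"
    using q(1) n unfolding inductive_limit_seminorm_def by blast
  have le: "p \<alpha> (T \<Phi>) \<le> (2 / \<epsilon>) * q \<Phi> + \<delta>" if \<delta>: "\<delta> > 0" for \<Phi> \<delta>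
  proof -
    define s where "s = (2 / \<epsilon>) * q \<Phi> + \<delta>"
    have s: "s > 0" using q(2) \<delta> inductive_limit_seminorm_nonneg[OF q(1)] by (simp add: s_def add_nonneg_pos)
    have "2 * q \<Phi> < s * \<epsilon> \<or> q \<Phi> = 0" using q(2) \<delta> by (simp add: s_def field_simps)
    then have "q \<Phi> < s * \<epsilon>" using q(2) s inductive_limit_seminorm_nonneg[OF q(1), of \<Phi>] by auto
    then have "q (test_scale (of_real (1 / s)) \<Phi>) < \<epsilon>"
      using s by (simp add: inductive_limit_seminorm_scale[OF q(1)] divide_less_eq mult.commute norm_divide)
    then have "p \<alpha> (T (test_scale (of_real (1 / s)) \<Phi>)) < 1" using q(3) by auto
    then show ?thesis using s by (simp add: T.scale p.homogeneous norm_divide) (simp add: s_def)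
  qed
  have "p \<alpha> (T \<Phi>) \<le> (2 / \<epsilon>) * q \<Phi>" for \<Phi> by (rule field_le_epsilon) (rule le)
  then have "p \<alpha> (T (abs_test \<phi>)) \<le> (2 / \<epsilon> * \<bar>C\<bar>) * O_strip_norm n \<phi>" if \<phi>: "\<phi> \<in> O_strip n" for \<phi>
  proof -
    have "p \<alpha> (T (abs_test \<phi>)) \<le> (2 / \<epsilon>) * q (abs_test \<phi>)" by fact
    also have "\<dots> \<le> (2 / \<epsilon>) * (\<bar>C\<bar> * O_strip_norm n \<phi>)"
      using C[OF \<phi>] q(2) O_strip_norm_nonneg[OF \<phi>] mult_right_mono[OF abs_ge_self, of "O_strip_norm n \<phi>" C]
      by (intro mult_left_mono) auto
    finally show ?thesis by (simp add: mult.assoc)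
  qed
  then show ?thesis using q(2) by (intro that[of "2 / \<epsilon> * \<bar>C\<bar>"]) auto
qed

lemma seminorm_compose_linear:
  assumes "Vector_Spaces.linear test_scale sc T"
  shows "seminorm test_scale (\<lambda>\<Phi>. p \<alpha> (T \<Phi>))"
proof -
  interpret T: Vector_Spaces.linear test_scale sc T by fact
  show ?thesis by (simp add: seminorm_def T.add T.scale p.triangle p.homogeneous)
qed

lemma continuous_linear_on_testI:
  assumes T: "Vector_Spaces.linear test_scale sc T"
    and le: "\<And>\<alpha> n. n \<ge> 1 \<Longrightarrow> \<exists>C. \<forall>\<phi>\<in>O_strip n. p \<alpha> (T (abs_test \<phi>)) \<le> C * O_strip_norm n \<phi>"
  shows "T \<in> continuous_linear_maps test_scale sc"
proof -
  interpret T: Vector_Spaces.linear test_scale sc T by fact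
  have "open (T -` U)" if U: "open U" for U
    unfolding open_test_def
  proof
    fix x assume "x \<in> T -` U"
    then have "T x \<in> U" by simp
    then obtain \<alpha> \<epsilon> where e: "\<epsilon> > 0" "{y. p \<alpha> (y - T x) < \<epsilon>} \<subseteq> U"
      using open_ballE[OF U] by blast
    have "inductive_limit_seminorm (\<lambda>\<Phi>. p \<alpha> (T \<Phi>))"
      using seminorm_compose_linear[OF T] le by (simp add: inductive_limit_seminorm_def)
    then show "\<exists>q \<epsilon>. inductive_limit_seminorm q \<and> \<epsilon> > 0 \<and> {y. q (y - x) < \<epsilon>} \<subseteq> T -` U"
      using e by (intro exI[of _ "\<lambda>\<Phi>. p \<alpha> (T \<Phi>)"] exI[of _ \<epsilon>]) (auto simp: T.diff)
  qed
  then have "continuous_on UNIV T" by (simp add: continuous_on_open_vimage)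
  then show ?thesis using T by (simp add: continuous_linear_maps_def)
qed

lemma continuous_linear_bounded:
  assumes T: "T \<in> continuous_linear_maps test_scale sc" and B: "tvs_bounded test_scale B"
  shows "bdd_above ((\<lambda>\<Phi>. p \<alpha> (T \<Phi>)) ` B)"
proof -
  have "inductive_limit_seminorm (\<lambda>\<Phi>. p \<alpha> (T \<Phi>))"
    unfolding inductive_limit_seminorm_def
  proof (intro conjI allI impI)
    show "seminorm test_scale (\<lambda>\<Phi>. p \<alpha> (T \<Phi>))"
      using T by (intro seminorm_compose_linear) (simp add: continuous_linear_maps_def)
    fix n :: nat assume n: "1 \<le> n"
    obtain C where "\<And>\<phi>. \<phi> \<in> O_strip n \<Longrightarrow> p \<alpha> (T (abs_test \<phi>)) \<le> C * O_strip_norm n \<phi>"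
      by (rule continuous_linear_on_test[OF T n, of \<alpha>]) (rule that)
    then show "\<exists>C. \<forall>\<phi>\<in>O_strip n. p \<alpha> (T (abs_test \<phi>)) \<le> C * O_strip_norm n \<phi>" by blast
  qed
  then obtain M where "\<And>\<Phi>. \<Phi> \<in> B \<Longrightarrow> p \<alpha> (T \<Phi>) \<le> M"
    by (rule bounded_inductive_limit_seminorm[OF B]) (rule that)
  then show ?thesis by (rule bdd_aboveI2)
qed

end

section \<open>Exponentially growing functions and their line integrals\<close>

context lcs
begin

lemma Oexp_norm_upper:
  assumes f: "f \<in> Oexp_slit sc p" and n: "n \<ge> 2" and z: "1 / n < \<bar>Im z\<bar>" "\<bar>Im z\<bar> < n"
  shows "p \<alpha> (f z) \<le> Oexp_norm p n \<alpha> f * exp (\<bar>Re z\<bar> / n)"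
proof -
  have "p \<alpha> (f z) * exp (- \<bar>Re z\<bar> / n) \<le> Oexp_norm p n \<alpha> f"
    unfolding Oexp_norm_def using f n z by (intro cSUP_upper) (auto simp: Oexp_slit_def)
  then have "p \<alpha> (f z) * exp (- \<bar>Re z\<bar> / n) * exp (\<bar>Re z\<bar> / n) \<le> Oexp_norm p n \<alpha> f * exp (\<bar>Re z\<bar> / n)"
    by (rule mult_right_mono) simp
  then show ?thesis by (simp add: mult.assoc flip: exp_add)
qed

lemma Oexp_strip_nonempty: "n \<ge> 2 \<Longrightarrow> \<i> \<in> {z. 1 / real n < \<bar>Im z\<bar> \<and> \<bar>Im z\<bar> < n}"
  by simp

lemma Oexp_norm_nonneg:
  assumes "f \<in> Oexp_slit sc p" "n \<ge> 2"
  shows "0 \<le> Oexp_norm p n \<alpha> f"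
  using order_trans[OF p.nonneg Oexp_norm_upper[OF assms, of \<i> \<alpha>]] assms(2) by simp

lemma Oexp_norm_leI:
  assumes "n \<ge> 2" "\<And>z. 1 / n < \<bar>Im z\<bar> \<Longrightarrow> \<bar>Im z\<bar> < n \<Longrightarrow> p \<alpha> (f z) \<le> M * exp (\<bar>Re z\<bar> / n)"
  shows "Oexp_norm p n \<alpha> f \<le> M"
  unfolding Oexp_norm_def
proof (rule cSUP_least)
  show "{z. 1 / real n < \<bar>Im z\<bar> \<and> \<bar>Im z\<bar> < n} \<noteq> {}"
    using Oexp_strip_nonempty[OF assms(1)] by blast
  fix z assume "z \<in> {z. 1 / real n < \<bar>Im z\<bar> \<and> \<bar>Im z\<bar> < n}"
  then have "p \<alpha> (f z) * exp (- \<bar>Re z\<bar> / n) \<le> M * exp (\<bar>Re z\<bar> / n) * exp (- \<bar>Re z\<bar> / n)"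
    using assms(2)[of z] by (intro mult_right_mono) auto
  then show "p \<alpha> (f z) * exp (- \<bar>Re z\<bar> / n) \<le> M" by (simp add: mult.assoc flip: exp_add)
qed

lemma Oexp_slitI:
  assumes "\<And>z. Im z = 0 \<Longrightarrow> f z = 0" "vholomorphic_on sc f {z. Im z \<noteq> 0}"
    and "\<And>n \<alpha>. n \<ge> 2 \<Longrightarrow> \<exists>M. \<forall>z. 1 / real n < \<bar>Im z\<bar> \<longrightarrow> \<bar>Im z\<bar> < n \<longrightarrow> p \<alpha> (f z) \<le> M * exp (\<bar>Re z\<bar> / n)"
  shows "f \<in> Oexp_slit sc p"
proof -
  have "bdd_above ((\<lambda>z. p \<alpha> (f z) * exp (- \<bar>Re z\<bar> / n)) ` {z. 1 / n < \<bar>Im z\<bar> \<and> \<bar>Im z\<bar> < n})"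
    if n: "n \<ge> 2" for n :: nat and \<alpha>
  proof -
    obtain M where M: "\<And>z. 1 / real n < \<bar>Im z\<bar> \<Longrightarrow> \<bar>Im z\<bar> < n \<Longrightarrow> p \<alpha> (f z) \<le> M * exp (\<bar>Re z\<bar> / n)"
      using assms(3)[OF n] by blast
    have "p \<alpha> (f z) * exp (- \<bar>Re z\<bar> / n) \<le> M" if "1 / n < \<bar>Im z\<bar>" "\<bar>Im z\<bar> < n" for z
    proof -
      have "p \<alpha> (f z) * exp (- \<bar>Re z\<bar> / n) \<le> M * exp (\<bar>Re z\<bar> / n) * exp (- \<bar>Re z\<bar> / n)"
        using M[OF that] by (intro mult_right_mono) auto
      then show ?thesis by (simp add: mult.assoc flip: exp_add)
    qed
    then show ?thesis by (intro bdd_aboveI2[of _ _ M]) simp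
  qed
  then show ?thesis using assms(1,2) by (simp add: Oexp_slit_def)
qed

lemma open_slit: "open {z. Im z \<noteq> 0}"
  by (intro open_Collect_neq continuous_intros)

lemma Oexp_slit_weakly_holomorphic:
  assumes "f \<in> Oexp_slit sc p"
  shows "weakly_holomorphic_on f {z. Im z \<noteq> 0}"
  using assms by (intro vholomorphic_imp_weakly_holomorphic open_slit) (simp add: Oexp_slit_def)

lemma holomorphic_decaying_product:
  assumes n: "n \<ge> 1" and \<phi>: "\<phi> \<in> O_strip n" and ab: "- (1 / n) \<le> a" "b \<le> 1 / n"
    and F: "weakly_holomorphic_on F (hstrip a b)"
    and growth: "\<And>\<alpha>. \<exists>N K. n < N \<and> 0 \<le> K \<and> (\<forall>z\<in>hstrip a b. p \<alpha> (F z) \<le> K * exp (\<bar>Re z\<bar> / real N))"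
  shows "holomorphic_decaying a b (\<lambda>z. sc (\<phi> z) (F z))"
  unfolding holomorphic_decaying_def
proof (intro conjI allI)
  show "weakly_holomorphic_on (\<lambda>z. sc (\<phi> z) (F z)) (hstrip a b)"
    using ab by (intro weakly_holomorphic_on_scale F holomorphic_on_subset[OF O_strip_holomorphic[OF \<phi>]]) auto
  fix \<alpha>
  obtain N K where N: "n < N" "0 \<le> K" "\<And>z. z \<in> hstrip a b \<Longrightarrow> p \<alpha> (F z) \<le> K * exp (\<bar>Re z\<bar> / real N)"
    using growth by blast
  define d where "d = 1 / real n - 1 / real N"
  have d: "0 < d" using n N(1) by (simp add: d_def field_simps)
  have "p \<alpha> (sc (\<phi> z) (F z)) \<le> (O_strip_norm n \<phi> * K) * exp (- d * \<bar>Re z\<bar>)" if z: "z \<in> hstrip a b" for z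
  proof -
    have "\<bar>Im z\<bar> \<le> 1 / n" using z ab by auto
    then have "p \<alpha> (sc (\<phi> z) (F z)) \<le> (O_strip_norm n \<phi> * exp (- \<bar>Re z\<bar> / n)) * (K * exp (\<bar>Re z\<bar> / N))"
      unfolding p.homogeneous by (intro mult_mono O_strip_norm_bound \<phi> N(3) z mult_nonneg_nonneg O_strip_norm_nonneg) auto
    also have "\<dots> = (O_strip_norm n \<phi> * K) * exp (- d * \<bar>Re z\<bar>)"
      by (simp add: d_def algebra_simps flip: exp_add)
    finally show ?thesis .
  qed
  then show "\<exists>C d. 0 < d \<and> 0 \<le> C \<and> (\<forall>z\<in>hstrip a b. p \<alpha> (sc (\<phi> z) (F z)) \<le> C * exp (- d * \<bar>Re z\<bar>))"
    using d N(2) O_strip_norm_nonneg[OF \<phi>] by (intro exI[of _ "O_strip_norm n \<phi> * K"] exI[of _ d]) auto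
qed

text \<open>
  Any growth exponent \<open>1 / N\<close> is available for \<open>f\<close> on a strip away from the real line, so that the decay
  of a test function always wins. A condition on \<open>\<bar>y + t\<bar>\<close> covers strips on either side of the line.
\<close>

lemma holomorphic_decaying_shifted:
  assumes f: "f \<in> Oexp_slit sc p" and n: "n \<ge> 1" and \<phi>: "\<phi> \<in> O_strip n" and ab: "- (1 / n) \<le> a" "b \<le> 1 / n"
    and \<epsilon>: "0 < \<epsilon>" "\<And>y. a < y \<Longrightarrow> y < b \<Longrightarrow> \<epsilon> \<le> \<bar>y + t\<bar>"
  shows "holomorphic_decaying a b (\<lambda>z. sc (\<phi> z) (f (z + Complex 0 t)))"
proof (rule holomorphic_decaying_product[OF n \<phi> ab])
  show "weakly_holomorphic_on (\<lambda>z. f (z + Complex 0 t)) (hstrip a b)"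
  proof (rule weakly_holomorphic_on_shift[OF Oexp_slit_weakly_holomorphic[OF f]])
    fix z assume "z \<in> hstrip a b"
    then have "\<epsilon> \<le> \<bar>Im z + t\<bar>" by (intro \<epsilon>(2)) auto
    then show "z + Complex 0 t \<in> {z. Im z \<noteq> 0}" using \<epsilon>(1) by auto
  qed
  fix \<alpha>
  obtain N :: nat where N: "max (real n + 2) (max (1 / \<epsilon>) (1 + \<bar>t\<bar>)) < real N"
    using reals_Archimedean2 by blast
  have N2: "N \<ge> 2" "n < N" using N by auto
  have "p \<alpha> (f (z + Complex 0 t)) \<le> Oexp_norm p N \<alpha> f * exp (\<bar>Re z\<bar> / N)" if z: "z \<in> hstrip a b" for z
  proof -
    have "1 / real N < \<epsilon>" using N \<epsilon>(1) by (simp add: field_simps)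
    also have "\<epsilon> \<le> \<bar>Im z + t\<bar>" using z by (intro \<epsilon>(2)) auto
    finally have 1: "1 / real N < \<bar>Im (z + Complex 0 t)\<bar>" by simp
    have "1 / real n \<le> 1" using n by simp
    then have "\<bar>Im z\<bar> \<le> 1" using z ab by auto
    then have "\<bar>Im (z + Complex 0 t)\<bar> < N" using N abs_triangle_ineq[of "Im z" t] by simp
    from Oexp_norm_upper[OF f N2(1) 1 this] show ?thesis by simp
  qed
  then show "\<exists>N K. n < N \<and> 0 \<le> K \<and> (\<forall>z\<in>hstrip a b. p \<alpha> (f (z + Complex 0 t)) \<le> K * exp (\<bar>Re z\<bar> / real N))"
    using N2 Oexp_norm_nonneg[OF f N2(1)] by blast
qed

text \<open>
  The product decays like \<open>exp (- d \<bar>x\<bar>)\<close> with \<open>d = 1 / n - 1 / N > 0\<close>.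
\<close>

lemma weighted_integral_bound:
  assumes e: "has_pettis_integral sc (\<lambda>x. sc (k x) (g x)) e" and n: "n \<ge> 1" "n < N"
    and k: "\<And>x. cmod (k x) \<le> M * exp (- \<bar>x\<bar> / real n)"
    and g: "\<And>x. p \<alpha> (g x) \<le> K * exp (\<bar>x\<bar> / real N)"
  shows "p \<alpha> e \<le> K * (LINT x|lebesgue. exp (- (1 / real n - 1 / real N) * \<bar>x\<bar>)) * M"
proof -
  define d where "d = 1 / real n - 1 / real N"
  have d: "0 < d" using n by (simp add: d_def field_simps)
  have K: "0 \<le> K" using order_trans[OF p.nonneg g[of 0]] by simp
  have M: "0 \<le> M" using order_trans[OF norm_ge_zero k[of 0]] by simp
  have "p \<alpha> (sc (k x) (g x)) \<le> (K * M) * exp (- d * \<bar>x\<bar>)" for x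
  proof -
    have "p \<alpha> (sc (k x) (g x)) \<le> (M * exp (- \<bar>x\<bar> / n)) * (K * exp (\<bar>x\<bar> / N))"
      using M unfolding p.homogeneous by (intro mult_mono k g) auto
    also have "\<dots> = (K * M) * exp (- d * \<bar>x\<bar>)"
      by (simp add: d_def algebra_simps flip: exp_add)
    finally show ?thesis .
  qed
  then have "p \<alpha> e \<le> (LINT x|lebesgue. (K * M) * exp (- d * \<bar>x\<bar>))"
    by (rule pettis_integral_le[OF e]) (intro integrable_mult_right integrable_exp_abs d)
  then show ?thesis by (simp add: d_def mult_ac)
qed

lemma line_integral_bound:
  assumes e: "has_pettis_integral sc (\<lambda>x. sc (\<phi> (Complex x s)) (g x)) e"
    and \<phi>: "\<phi> \<in> O_strip n" and s: "\<bar>s\<bar> \<le> 1 / n" and n: "n \<ge> 1" "n < N"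
    and g: "\<And>x. p \<alpha> (g x) \<le> K * exp (\<bar>x\<bar> / real N)"
  shows "p \<alpha> e \<le> K * (LINT x|lebesgue. exp (- (1 / real n - 1 / real N) * \<bar>x\<bar>)) * O_strip_norm n \<phi>"
  by (rule weighted_integral_bound[OF e n _ g]) (use O_strip_norm_bound[OF \<phi>, of "Complex _ s"] s in simp)

end

context sc_lcs
begin

abbreviation line_int :: "real \<Rightarrow> (complex \<Rightarrow> 'e) \<Rightarrow> (complex \<Rightarrow> complex) \<Rightarrow> 'e" where
  "line_int s f \<phi> \<equiv> pettis_integral sc (path_integrand sc s f \<phi>)"

text \<open>
  The sign \<open>\<sigma>\<close> selects the half plane, here and below. The contour is moved away from the real line, from
  height \<open>0\<close> to \<open>\<sigma> s\<close>, on a strip that stays at distance \<open>t / 2\<close> from the line where \<open>f\<close> is undefined.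
\<close>

lemma shifted_line_integrals:
  fixes \<sigma> t s :: real
  assumes f: "f \<in> Oexp_slit sc p" and n: "n \<ge> 1" and \<phi>: "\<phi> \<in> O_strip n" and \<sigma>: "\<sigma> \<in> {-1, 1}"
    and t: "0 < t" and s: "0 \<le> s" "s < 1 / n"
  shows "has_pettis_integral sc (\<lambda>x. sc (\<phi> (Complex x (\<sigma> * s))) (f (Complex x (\<sigma> * (s + t)))))
    (Rplus_t sc (\<sigma> * t) f (abs_test \<phi>))"
proof -
  define \<eta> where "\<eta> = min (t / 2) (1 / n)"
  define \<theta> where "\<theta> = (s + 1 / n) / 2"
  define a where "a = (if \<sigma> = 1 then - \<eta> else - \<theta>)"
  define b where "b = (if \<sigma> = 1 then \<theta> else \<eta>)"
  have n0: "0 < 1 / real n" using n by simp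
  have eta: "0 < \<eta>" "\<eta> \<le> 1 / n" using t n0 by (simp_all add: \<eta>_def)
  have theta: "s < \<theta>" "\<theta> \<le> 1 / n" "0 < \<theta>"
    using s n0 by (simp_all add: \<theta>_def)
  have ab: "- (1 / n) \<le> a" "b \<le> 1 / n" "a < 0" "0 < b" "a < \<sigma> * s" "\<sigma> * s < b"
    using \<sigma> eta theta s(1) by (auto simp: a_def b_def)
  have G: "holomorphic_decaying a b (\<lambda>z. sc (\<phi> z) (f (z + Complex 0 (\<sigma> * t))))"
  proof (rule holomorphic_decaying_shifted[OF f n \<phi> ab(1,2)])
    show "0 < t / 2" using t by simp
    show "t / 2 \<le> \<bar>y + \<sigma> * t\<bar>" if "a < y" "y < b" for y
      using that \<sigma> t by (auto simp: a_def b_def \<eta>_def)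
  qed
  have eq: "Rplus_integrand sc (\<sigma> * t) f (abs_test \<phi>) = (\<lambda>x. sc (\<phi> (Complex x 0)) (f (Complex x 0 + Complex 0 (\<sigma> * t))))"
    by (simp add: Rplus_integrand_def fun_eq_iff test_on_real_abs[OF n \<phi>] plus_complex.code)
  have "Rplus_t sc (\<sigma> * t) f (abs_test \<phi>) =
      pettis_integral sc (\<lambda>x. sc (\<phi> (Complex x (\<sigma> * s))) (f (Complex x (\<sigma> * s) + Complex 0 (\<sigma> * t))))"
    unfolding Rplus_t_def eq by (rule holomorphic_decaying_shift[OF G]) (use ab in auto)
  moreover have "Complex x (\<sigma> * s) + Complex 0 (\<sigma> * t) = Complex x (\<sigma> * (s + t))" for x
    by (simp add: ring_distribs plus_complex.code)
  ultimately show ?thesis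
    using holomorphic_decaying_has_integral[OF G ab(5,6)] by simp
qed

lemma line_integral_independent:
  fixes \<sigma> s s' :: real
  assumes f: "f \<in> Oexp_slit sc p" and n: "n \<ge> 1" and \<phi>: "\<phi> \<in> O_strip n" and \<sigma>: "\<sigma> \<in> {-1, 1}"
    and s: "0 < s" "s < 1 / n" and s': "0 < s'" "s' < 1 / n"
  shows "line_int (\<sigma> * s) f \<phi> = line_int (\<sigma> * s') f \<phi>"
    and "has_pettis_integral sc (path_integrand sc (\<sigma> * s) f \<phi>) (line_int (\<sigma> * s) f \<phi>)"
    and "vtame (path_integrand sc (\<sigma> * s) f \<phi>)"
proof -
  define \<eta> where "\<eta> = min s s' / 2"
  define \<theta> where "\<theta> = (max s s' + 1 / n) / 2"
  define a where "a = (if \<sigma> = 1 then \<eta> else - \<theta>)"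
  define b where "b = (if \<sigma> = 1 then \<theta> else - \<eta>)"
  have ab: "- (1 / n) \<le> a" "b \<le> 1 / n" "a < \<sigma> * s" "\<sigma> * s < b" "a < \<sigma> * s'" "\<sigma> * s' < b"
    using \<sigma> s s' by (auto simp: a_def b_def \<eta>_def \<theta>_def min_def max_def field_simps)
  have G: "holomorphic_decaying a b (\<lambda>z. sc (\<phi> z) (f (z + Complex 0 0)))"
  proof (rule holomorphic_decaying_shifted[OF f n \<phi> ab(1,2)])
    show eta: "0 < \<eta>" using s s' by (simp add: \<eta>_def)
    show "\<eta> \<le> \<bar>y + 0\<bar>" if "a < y" "y < b" for y
      using that \<sigma> eta by (auto simp: a_def b_def)
  qed
  have eq: "path_integrand sc t f \<phi> = (\<lambda>x. sc (\<phi> (Complex x t)) (f (Complex x t + Complex 0 0)))" for t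
    by (simp add: path_integrand_def fun_eq_iff flip: zero_complex.code)
  show "line_int (\<sigma> * s) f \<phi> = line_int (\<sigma> * s') f \<phi>"
    unfolding eq by (rule holomorphic_decaying_shift[OF G ab(3-6)])
  show "has_pettis_integral sc (path_integrand sc (\<sigma> * s) f \<phi>) (line_int (\<sigma> * s) f \<phi>)"
    unfolding eq by (rule holomorphic_decaying_has_integral[OF G ab(3,4)])
  show "vtame (path_integrand sc (\<sigma> * s) f \<phi>)"
    unfolding eq by (rule holomorphic_decaying_vtame[OF G ab(3,4)])
qed

lemma Rplus_has_integral:
  assumes f: "f \<in> Oexp_slit sc p" and t: "t \<noteq> 0"
  shows "has_pettis_integral sc (Rplus_integrand sc t f \<Phi>) (Rplus_t sc t f \<Phi>)"
proof -
  obtain n \<phi> where n: "n \<ge> 1" "\<phi> \<in> O_strip n" "\<Phi> = abs_test \<phi>" by (rule test_cases)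
  define \<sigma> where "\<sigma> = sgn t"
  have \<sigma>: "\<sigma> \<in> {-1, 1}" "t = \<sigma> * \<bar>t\<bar>" "0 < \<bar>t\<bar>" using t by (auto simp: \<sigma>_def sgn_if)
  have "Rplus_integrand sc t f \<Phi> = (\<lambda>x. sc (\<phi> (Complex x (\<sigma> * 0))) (f (Complex x (\<sigma> * (0 + \<bar>t\<bar>)))))"
    using \<sigma>(2) by (simp add: Rplus_integrand_def n(3) test_on_real_abs[OF n(1,2)] fun_eq_iff)
  then show ?thesis
    using shifted_line_integrals[OF f n(1,2) \<sigma>(1,3), of 0] n(1) unfolding n(3) \<sigma>(2)[symmetric] by simp
qed

lemma test_on_real_add: "test_on_real (\<Phi> + \<Psi>) x = test_on_real \<Phi> x + test_on_real \<Psi> x"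
  by transfer simp

lemma test_on_real_scale: "test_on_real (test_scale c \<Phi>) x = c * test_on_real \<Phi> x"
  by transfer simp

lemma linear_testI:
  assumes "\<And>\<Phi> \<Psi>. T (\<Phi> + \<Psi>) = T \<Phi> + T \<Psi>" "\<And>c \<Phi>. T (test_scale c \<Phi>) = sc c (T \<Phi>)"
  shows "Vector_Spaces.linear test_scale sc T"
proof -
  interpret test: vector_space test_scale by (rule vector_space_test_scale)
  show ?thesis by unfold_locales (simp_all add: assms)
qed

lemma linear_Rplus_t:
  assumes f: "f \<in> Oexp_slit sc p" and t: "t \<noteq> 0"
  shows "Vector_Spaces.linear test_scale sc (Rplus_t sc t f)"
proof (rule linear_testI)
  note I = Rplus_has_integral[OF f t]
  fix \<Phi> \<Psi> c
  have "Rplus_integrand sc t f (\<Phi> + \<Psi>) = (\<lambda>x. Rplus_integrand sc t f \<Phi> x + Rplus_integrand sc t f \<Psi> x)"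
    by (simp add: Rplus_integrand_def fun_eq_iff test_on_real_add scale_left_distrib)
  then show "Rplus_t sc t f (\<Phi> + \<Psi>) = Rplus_t sc t f \<Phi> + Rplus_t sc t f \<Psi>"
    using pettis_integral_eq[OF has_pettis_integral_add[OF I I]] by (simp add: Rplus_t_def)
  have "Rplus_integrand sc t f (test_scale c \<Phi>) = (\<lambda>x. sc c (Rplus_integrand sc t f \<Phi> x))"
    by (simp add: Rplus_integrand_def fun_eq_iff test_on_real_scale)
  then show "Rplus_t sc t f (test_scale c \<Phi>) = sc c (Rplus_t sc t f \<Phi>)"
    using pettis_integral_eq[OF has_pettis_integral_scale[OF I]] by (simp add: Rplus_t_def)
qed

lemma Rplus_t_bound:
  assumes f: "f \<in> Oexp_slit sc p" and n: "n \<ge> 1" and \<phi>: "\<phi> \<in> O_strip n"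
    and N: "n < N" "N \<ge> 2" and t: "1 / real N < \<bar>t\<bar>" "\<bar>t\<bar> < N"
  shows "p \<alpha> (Rplus_t sc t f (abs_test \<phi>)) \<le>
    Oexp_norm p N \<alpha> f * (LINT x|lebesgue. exp (- (1 / real n - 1 / real N) * \<bar>x\<bar>)) * O_strip_norm n \<phi>"
proof (rule line_integral_bound[OF _ \<phi> _ n N(1)])
  have "t \<noteq> 0" using t by auto
  then show "has_pettis_integral sc (\<lambda>x. sc (\<phi> (Complex x 0)) (f (Complex x t))) (Rplus_t sc t f (abs_test \<phi>))"
    using Rplus_has_integral[OF f, of t "abs_test \<phi>"]
    by (simp add: Rplus_integrand_def[abs_def] test_on_real_abs[OF n \<phi>])
  show "p \<alpha> (f (Complex x t)) \<le> Oexp_norm p N \<alpha> f * exp (\<bar>x\<bar> / N)" for x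
    using Oexp_norm_upper[OF f N(2), of "Complex x t"] t by simp
qed simp

lemma line_int_bound:
  assumes f: "f \<in> Oexp_slit sc p" and n: "n \<ge> 1" and \<phi>: "\<phi> \<in> O_strip n" and \<sigma>: "\<sigma> \<in> {-1, 1 :: real}"
    and N: "n < N" "N \<ge> 2" and s: "0 < s" "s < 1 / n" "1 / real N < s"
  shows "p \<alpha> (line_int (\<sigma> * s) f \<phi>) \<le>
    Oexp_norm p N \<alpha> f * (LINT x|lebesgue. exp (- (1 / real n - 1 / real N) * \<bar>x\<bar>)) * O_strip_norm n \<phi>"
proof (rule line_integral_bound[OF _ \<phi> _ n N(1)])
  show "has_pettis_integral sc (\<lambda>x. sc (\<phi> (Complex x (\<sigma> * s))) (f (Complex x (\<sigma> * s)))) (line_int (\<sigma> * s) f \<phi>)"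
    using line_integral_independent(2)[OF f n \<phi> \<sigma> s(1,2) s(1,2)] by (simp add: path_integrand_def[abs_def])
  have abs: "\<bar>\<sigma> * s\<bar> = s" using \<sigma> s by auto
  show "\<bar>\<sigma> * s\<bar> \<le> 1 / n" using s abs by simp
  have "1 / real n \<le> 1" using n by simp
  then have "s < N" using s N by linarith
  then show "p \<alpha> (f (Complex x (\<sigma> * s))) \<le> Oexp_norm p N \<alpha> f * exp (\<bar>x\<bar> / N)" for x
    using Oexp_norm_upper[OF f N(2), of "Complex x (\<sigma> * s)"] abs s by simp
qed

lemma continuous_Rplus_t:
  assumes f: "f \<in> Oexp_slit sc p" and t: "t \<noteq> 0"
  shows "Rplus_t sc t f \<in> continuous_linear_maps test_scale sc"
proof (rule continuous_linear_on_testI[OF linear_Rplus_t[OF assms]])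
  fix \<alpha> and n :: nat assume n: "n \<ge> 1"
  obtain N :: nat where N: "max (real n + 2) (max (1 / \<bar>t\<bar>) \<bar>t\<bar>) < real N" using reals_Archimedean2 by blast
  then have "n < N" "N \<ge> 2" "1 / real N < \<bar>t\<bar>" "\<bar>t\<bar> < N" using t by (auto simp: field_simps)
  from Rplus_t_bound[OF f n _ this]
  show "\<exists>C. \<forall>\<phi>\<in>O_strip n. p \<alpha> (Rplus_t sc t f (abs_test \<phi>)) \<le> C * O_strip_norm n \<phi>" by blast
qed

text \<open>
  Moving the contour by \<open>s = 1 / (2 n)\<close> into the half plane turns the boundary value into an
  ordinary integral over a line inside the domain, and there \<open>f\<close> is Lipschitz. For the remaining
  \<open>t\<close>, bounded away from \<open>0\<close>, both terms are bounded.
\<close>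

lemma Rplus_t_approximates:
  assumes f: "f \<in> Oexp_slit sc p" and n: "n \<ge> 1" and \<sigma>: "\<sigma> \<in> {-1, 1 :: real}"
  shows "\<exists>C\<ge>0. \<forall>\<phi>\<in>O_strip n. \<forall>t. 0 < t \<longrightarrow> t \<le> 1 \<longrightarrow>
    p \<alpha> (Rplus_t sc (\<sigma> * t) f (abs_test \<phi>) - line_int (\<sigma> * (1 / (2 * n))) f \<phi>) \<le> t * (C * O_strip_norm n \<phi>)"
proof -
  \<comment> \<open>all heights that occur, from \<open>2 r\<close> to \<open>1\<close>, lie strictly between \<open>1 / N\<close> and \<open>N\<close>\<close>
  define N where "N = 16 * n"
  define s where "s = 1 / (2 * real n)"
  define r where "r = 1 / (8 * real n)"
  define K where "K = Oexp_norm p N \<alpha> f"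
  define E where "E = (LINT x|lebesgue. exp (- (1 / real n - 1 / real N) * \<bar>x\<bar>))"
  define C\<^sub>1 where "C\<^sub>1 = 2 * (K * exp 1) / r * E"
  define C\<^sub>2 where "C\<^sub>2 = 2 * (K * E) / r"
  have N: "n < N" "N \<ge> 2" using n by (auto simp: N_def)
  have n1: "1 \<le> real n" using n by simp
  have r: "0 < r" using n by (simp add: r_def)
  have s: "0 < s" "s < 1 / n" "1 / real N < s" "s = 4 * r" using n by (simp_all add: s_def N_def r_def field_simps)
  have rN: "1 / real N < r" "r \<le> 1" using n1 by (simp_all add: r_def N_def field_simps)
  have K: "0 \<le> K" unfolding K_def by (rule Oexp_norm_nonneg[OF f N(2)])
  have E: "0 \<le> E" unfolding E_def by (rule integral_nonneg_AE) simp
  have C1: "p \<alpha> (Rplus_t sc (\<sigma> * t) f (abs_test \<phi>) - line_int (\<sigma> * s) f \<phi>) \<le> t * (C\<^sub>1 * O_strip_norm n \<phi>)"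
    if \<phi>: "\<phi> \<in> O_strip n" and t: "0 < t" "t < r" for \<phi> t
  proof -
    have "has_pettis_integral sc (\<lambda>x. sc (\<phi> (Complex x (\<sigma> * s))) (f (Complex x (\<sigma> * (s + t)))) -
        path_integrand sc (\<sigma> * s) f \<phi> x) (Rplus_t sc (\<sigma> * t) f (abs_test \<phi>) - line_int (\<sigma> * s) f \<phi>)"
      by (intro has_pettis_integral_diff shifted_line_integrals line_integral_independent(2)[where s' = s])
        (use f n \<phi> \<sigma> s t in auto)
    then have I: "has_pettis_integral sc (\<lambda>x. sc (\<phi> (Complex x (\<sigma> * s))) (f (Complex x (\<sigma> * (s + t))) - f (Complex x (\<sigma> * s))))
        (Rplus_t sc (\<sigma> * t) f (abs_test \<phi>) - line_int (\<sigma> * s) f \<phi>)"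
      by (simp add: path_integrand_def scale_right_diff_distrib)
    have "p \<alpha> (f (Complex x (\<sigma> * (s + t))) - f (Complex x (\<sigma> * s))) \<le> (t * (2 * (K * exp 1) / r)) * exp (\<bar>x\<bar> / N)" for x
    proof -
      let ?z = "Complex x (\<sigma> * s)"
      have ball: "1 / real N < \<bar>Im w\<bar> \<and> \<bar>Im w\<bar> < N \<and> \<bar>Re w\<bar> \<le> \<bar>x\<bar> + 1" if "w \<in> ball ?z (2 * r)" for w
      proof -
        have "\<bar>Im w - \<sigma> * s\<bar> < 2 * r" "\<bar>Re w - x\<bar> < 2 * r"
          using that abs_Im_le_cmod[of "w - ?z"] abs_Re_le_cmod[of "w - ?z"]
          by (auto simp: dist_norm norm_minus_commute)
        then have "2 * r < \<bar>Im w\<bar>" "\<bar>Im w\<bar> < 6 * r" "\<bar>Re w\<bar> \<le> \<bar>x\<bar> + 2 * r"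
          using \<sigma> s(4) by auto
        moreover have "r \<le> 1 / 8" "16 \<le> real N" using n1 by (simp_all add: r_def N_def field_simps)
        ultimately show ?thesis using rN by linarith
      qed
      have "p \<alpha> (f (Complex x (\<sigma> * (s + t))) - f ?z) \<le> (2 * (K * exp 1 * exp (\<bar>x\<bar> / N)) / r) * cmod (Complex x (\<sigma> * (s + t)) - ?z)"
      proof (rule weakly_holomorphic_Lipschitz[OF _ _ r])
        show "weakly_holomorphic_on f (ball ?z (2 * r))"
        proof (rule weakly_holomorphic_on_subset[OF Oexp_slit_weakly_holomorphic[OF f]], intro subsetI)
          fix w assume "w \<in> ball ?z (2 * r)"
          then have "0 < \<bar>Im w\<bar>" using ball[of w] by (meson less_trans divide_nonneg_nonneg le_less_trans of_nat_0_le_iff zero_le_one)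
          then show "w \<in> {z. Im z \<noteq> 0}" by auto
        qed
        fix w assume w: "w \<in> ball ?z (2 * r)"
        have "p \<alpha> (f w) \<le> K * exp (\<bar>Re w\<bar> / N)"
          unfolding K_def using ball[OF w] by (intro Oexp_norm_upper f N(2)) auto
        also have "\<bar>Re w\<bar> / N \<le> 1 + \<bar>x\<bar> / N"
        proof -
          have "\<bar>Re w\<bar> / N \<le> (\<bar>x\<bar> + 1) / N" using ball[OF w] by (intro divide_right_mono) auto
          also have "(\<bar>x\<bar> + 1) / N \<le> 1 + \<bar>x\<bar> / N" using N by (simp add: add_divide_distrib)
          finally show ?thesis .
        qed
        then have "K * exp (\<bar>Re w\<bar> / N) \<le> K * exp (1 + \<bar>x\<bar> / N)" using K by (intro mult_left_mono) auto
        finally show "p \<alpha> (f w) \<le> K * exp 1 * exp (\<bar>x\<bar> / N)" by (simp add: exp_add)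
      next
        show "Complex x (\<sigma> * (s + t)) \<in> ball ?z r"
          using \<sigma> t by (auto simp: dist_norm cmod_def)
      qed
      also have "cmod (Complex x (\<sigma> * (s + t)) - ?z) = t" using \<sigma> t by (auto simp: cmod_def)
      finally show ?thesis by (simp add: mult_ac)
    qed
    from line_integral_bound[OF I \<phi> _ n N(1) this]
    have "p \<alpha> (Rplus_t sc (\<sigma> * t) f (abs_test \<phi>) - line_int (\<sigma> * s) f \<phi>) \<le> (t * (2 * (K * exp 1) / r)) * E * O_strip_norm n \<phi>"
      using \<sigma> s by (auto simp: E_def)
    then show ?thesis by (simp add: C\<^sub>1_def mult_ac)
  qed
  have C2: "p \<alpha> (Rplus_t sc (\<sigma> * t) f (abs_test \<phi>) - line_int (\<sigma> * s) f \<phi>) \<le> t * (C\<^sub>2 * O_strip_norm n \<phi>)"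
    if \<phi>: "\<phi> \<in> O_strip n" and t: "r \<le> t" "t \<le> 1" for \<phi> t
  proof -
    have abs: "\<bar>\<sigma> * t\<bar> = t" using \<sigma> t r by auto
    have "p \<alpha> (Rplus_t sc (\<sigma> * t) f (abs_test \<phi>)) \<le> K * E * O_strip_norm n \<phi>"
      unfolding K_def E_def using t rN N abs by (intro Rplus_t_bound f n \<phi>) auto
    moreover have "p \<alpha> (line_int (\<sigma> * s) f \<phi>) \<le> K * E * O_strip_norm n \<phi>"
      unfolding K_def E_def by (intro line_int_bound f n \<phi> \<sigma> N s)
    ultimately have "p \<alpha> (Rplus_t sc (\<sigma> * t) f (abs_test \<phi>) - line_int (\<sigma> * s) f \<phi>) \<le> 1 * (2 * (K * E) * O_strip_norm n \<phi>)"
      using p.triangle_diff[of \<alpha> "Rplus_t sc (\<sigma> * t) f (abs_test \<phi>)" "line_int (\<sigma> * s) f \<phi>"] by simp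
    also have "\<dots> \<le> (t / r) * (2 * (K * E) * O_strip_norm n \<phi>)"
      using t r K E O_strip_norm_nonneg[OF \<phi>] by (intro mult_right_mono) auto
    finally show ?thesis by (simp add: C\<^sub>2_def mult_ac)
  qed
  have "0 \<le> C\<^sub>1" "0 \<le> C\<^sub>2" using K E r by (simp_all add: C\<^sub>1_def C\<^sub>2_def)
  then have "p \<alpha> (Rplus_t sc (\<sigma> * t) f (abs_test \<phi>) - line_int (\<sigma> * s) f \<phi>) \<le> t * (max C\<^sub>1 C\<^sub>2 * O_strip_norm n \<phi>)"
    if \<phi>: "\<phi> \<in> O_strip n" and t: "0 < t" "t \<le> 1" for \<phi> t
  proof (cases "t < r")
    case True
    have "t * (C\<^sub>1 * O_strip_norm n \<phi>) \<le> t * (max C\<^sub>1 C\<^sub>2 * O_strip_norm n \<phi>)"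
      using t O_strip_norm_nonneg[OF \<phi>] by (intro mult_left_mono mult_right_mono) auto
    then show ?thesis using C1[OF \<phi> t(1) True] by linarith
  next
    case False
    have "t * (C\<^sub>2 * O_strip_norm n \<phi>) \<le> t * (max C\<^sub>1 C\<^sub>2 * O_strip_norm n \<phi>)"
      using t O_strip_norm_nonneg[OF \<phi>] by (intro mult_left_mono mult_right_mono) auto
    then show ?thesis using C2[OF \<phi> _ t(2)] False by linarith
  qed
  then show ?thesis using \<open>0 \<le> C\<^sub>1\<close> unfolding s_def by (intro exI[of _ "max C\<^sub>1 C\<^sub>2"]) auto
qed

end

section \<open>Boundary values\<close>

lemma limitin_seminorm_topology:
  assumes "l \<in> V" "\<forall>\<^sub>F i in F. X i \<in> V"
    and "\<And>q \<epsilon>. q \<in> P \<Longrightarrow> 0 < \<epsilon> \<Longrightarrow> \<forall>\<^sub>F i in F. q (X i - l) < \<epsilon>"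
  shows "limitin (seminorm_topology V P) X l F"
  unfolding limitin_def
proof (intro conjI allI impI)
  show "l \<in> topspace (seminorm_topology V P)" using assms(1) by simp
  fix U assume U: "openin (seminorm_topology V P) U \<and> l \<in> U"
  then obtain Q \<epsilon> where Q: "finite Q" "Q \<subseteq> P" "\<epsilon> > 0" "{y\<in>V. \<forall>q\<in>Q. q (y - l) < \<epsilon>} \<subseteq> U"
    unfolding openin_seminorm_topology by blast
  have "\<forall>\<^sub>F i in F. \<forall>q\<in>Q. q (X i - l) < \<epsilon>"
    using Q by (intro eventually_ball_finite ballI assms(3)) auto
  then show "\<forall>\<^sub>F i in F. X i \<in> U"
    using assms(2) by eventually_elim (use Q(4) in auto)
qed

text \<open>
  A basic neighbourhood of \<open>h x\<close> involves finitely many seminorms \<open>q\<close>. The sum of their Lipschitz constants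
  gives one radius for the corresponding seminorms at \<open>x\<close>.
\<close>

lemma continuous_map_seminorm_topology:
  assumes V: "\<And>x. x \<in> V \<Longrightarrow> h x \<in> W"
    and le: "\<And>q. q \<in> Q \<Longrightarrow> \<exists>p\<in>P. \<exists>C\<ge>0. \<forall>x\<in>V. \<forall>y\<in>V. q (h y - h x) \<le> C * p (y - x)"
  shows "continuous_map (seminorm_topology V P) (seminorm_topology W Q) h"
  unfolding continuous_map_def
proof (intro conjI allI impI)
  show "h \<in> topspace (seminorm_topology V P) \<rightarrow> topspace (seminorm_topology W Q)" using V by simp
  fix U assume U: "openin (seminorm_topology W Q) U"
  show "openin (seminorm_topology V P) {x \<in> topspace (seminorm_topology V P). h x \<in> U}"
    unfolding openin_seminorm_topology topspace_seminorm_topology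
  proof (intro conjI ballI)
    fix x assume x: "x \<in> {x \<in> V. h x \<in> U}"
    then obtain F \<epsilon> where F: "finite F" "F \<subseteq> Q" "\<epsilon> > 0" "{y\<in>W. \<forall>q\<in>F. q (y - h x) < \<epsilon>} \<subseteq> U"
      using U unfolding openin_seminorm_topology by blast
    have "\<forall>q\<in>F. \<exists>r. fst r \<in> P \<and> 0 \<le> snd r \<and> (\<forall>x\<in>V. \<forall>y\<in>V. q (h y - h x) \<le> snd r * fst r (y - x))"
    proof
      fix q assume "q \<in> F"
      then have "\<exists>p\<in>P. \<exists>C\<ge>0. \<forall>x\<in>V. \<forall>y\<in>V. q (h y - h x) \<le> C * p (y - x)" using F(2) by (intro le) blast
      then obtain p C where "p \<in> P" "0 \<le> C" "\<forall>x\<in>V. \<forall>y\<in>V. q (h y - h x) \<le> C * p (y - x)" by (elim bexE exE conjE)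
      then show "\<exists>r. fst r \<in> P \<and> 0 \<le> snd r \<and> (\<forall>x\<in>V. \<forall>y\<in>V. q (h y - h x) \<le> snd r * fst r (y - x))"
        by (intro exI[of _ "(p, C)"]) simp
    qed
    from bchoice[OF this] obtain r where r: "\<forall>q\<in>F. fst (r q) \<in> P \<and> 0 \<le> snd (r q) \<and>
      (\<forall>x\<in>V. \<forall>y\<in>V. q (h y - h x) \<le> snd (r q) * fst (r q) (y - x))" ..
    define pp CC where "pp q = fst (r q)" and "CC q = snd (r q)" for q
    have pp: "\<And>q. q \<in> F \<Longrightarrow> pp q \<in> P" "\<And>q. q \<in> F \<Longrightarrow> 0 \<le> CC q"
      "\<And>q x y. q \<in> F \<Longrightarrow> x \<in> V \<Longrightarrow> y \<in> V \<Longrightarrow> q (h y - h x) \<le> CC q * pp q (y - x)"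
      using r by (simp_all add: pp_def CC_def)
    define C where "C = (\<Sum>q\<in>F. CC q)"
    have C: "0 \<le> C" unfolding C_def by (intro sum_nonneg pp)
    have CC: "CC q \<le> C" if "q \<in> F" for q
      unfolding C_def using that pp F(1) by (intro member_le_sum) auto
    define \<delta> where "\<delta> = \<epsilon> / (C + 1)"
    have \<delta>: "0 < \<delta>" using F(3) C by (simp add: \<delta>_def)
    have "h y \<in> U" if y: "y \<in> V" "\<And>q. q \<in> pp ` F \<Longrightarrow> q (y - x) < \<delta>" for y
    proof -
      have "q (h y - h x) < \<epsilon>" if q: "q \<in> F" for q
      proof -
        have "q (h y - h x) \<le> CC q * pp q (y - x)" using pp(3)[OF q _ y(1)] x by simp
        also have "\<dots> \<le> CC q * \<delta>" using pp(2)[OF q] y(2)[of "pp q"] q by (intro mult_left_mono) auto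
        also have "\<dots> \<le> C * \<delta>" using CC[OF q] \<delta> by simp
        also have "\<dots> < (C + 1) * \<delta>" using \<delta> by simp
        also have "\<dots> = \<epsilon>" using C by (simp add: \<delta>_def)
        finally show ?thesis .
      qed
      then show ?thesis using F(4) V[OF y(1)] by blast
    qed
    then show "\<exists>F \<epsilon>. finite F \<and> F \<subseteq> P \<and> \<epsilon> > 0 \<and> {y\<in>V. \<forall>q\<in>F. q (y - x) < \<epsilon>} \<subseteq> {x \<in> V. h x \<in> U}"
      using F(1) pp(1) \<delta> by (intro exI[of _ "pp ` F"] exI[of _ \<delta>]) auto
  qed auto
qed

context lcs
begin

lemma Lb_limitI:
  assumes "l \<in> continuous_linear_maps test_scale sc"
    and "\<forall>\<^sub>F i in F. X i \<in> continuous_linear_maps test_scale sc"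
    and "\<And>\<alpha> B. tvs_bounded test_scale B \<Longrightarrow>
      \<exists>c. (c \<longlongrightarrow> (0::real)) F \<and> (\<forall>\<^sub>F i in F. \<forall>\<Phi>\<in>B. p \<alpha> (X i \<Phi> - l \<Phi>) \<le> c i)"
  shows "limitin (Lb_topology test_scale sc p) X l F"
  unfolding Lb_topology_def
proof (rule limitin_seminorm_topology[OF assms(1,2)])
  fix q and \<epsilon> :: real
  assume "q \<in> {\<lambda>T. SUP x\<in>B. p \<alpha> (T x) | B \<alpha>. tvs_bounded test_scale B \<and> B \<noteq> {}}" and \<epsilon>: "0 < \<epsilon>"
  then obtain B \<alpha> where q: "q = (\<lambda>T. SUP x\<in>B. p \<alpha> (T x))" and B: "tvs_bounded test_scale B" "B \<noteq> {}"
    by blast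
  obtain c where c: "(c \<longlongrightarrow> 0) F" "\<forall>\<^sub>F i in F. \<forall>\<Phi>\<in>B. p \<alpha> (X i \<Phi> - l \<Phi>) \<le> c i"
    using assms(3)[OF B(1)] by blast
  have "\<forall>\<^sub>F i in F. c i < \<epsilon>" using c(1) \<epsilon> by (rule order_tendstoD(2))
  with c(2) show "\<forall>\<^sub>F i in F. q (X i - l) < \<epsilon>"
  proof eventually_elim
    case (elim i)
    have "q (X i - l) \<le> c i" unfolding q by (rule cSUP_least[OF B(2)]) (use elim in simp)
    then show ?case using elim by simp
  qed
qed

end

context sc_lcs
begin

text \<open>
  For \<open>\<sigma> = 1\<close> and \<open>\<sigma> = -1\<close> these are the limits from above and from below.
\<close>

definition boundary_value :: "real \<Rightarrow> (complex \<Rightarrow> 'e) \<Rightarrow> test \<Rightarrow> 'e" where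
  "boundary_value \<sigma> f \<Phi> = Lim (at_right 0) (\<lambda>t. Rplus_t sc (\<sigma> * t) f \<Phi>)"

lemma boundary_value_eq_line_int:
  assumes f: "f \<in> Oexp_slit sc p" and n: "n \<ge> 1" and \<phi>: "\<phi> \<in> O_strip n" and \<sigma>: "\<sigma> \<in> {-1, 1 :: real}"
    and s: "0 < s" "s < 1 / n"
  shows "boundary_value \<sigma> f (abs_test \<phi>) = line_int (\<sigma> * s) f \<phi>"
proof -
  let ?L = "line_int (\<sigma> * (1 / (2 * real n))) f \<phi>"
  have "((\<lambda>t. Rplus_t sc (\<sigma> * t) f (abs_test \<phi>)) \<longlongrightarrow> ?L) (at_right 0)"
    unfolding seminorm_tendsto_iff
  proof
    fix \<alpha>
    from Rplus_t_approximates[OF f n \<sigma>, of \<alpha>] obtain C where "\<forall>\<phi>\<in>O_strip n. \<forall>t. 0 < t \<longrightarrow> t \<le> 1 \<longrightarrow>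
      p \<alpha> (Rplus_t sc (\<sigma> * t) f (abs_test \<phi>) - line_int (\<sigma> * (1 / (2 * real n))) f \<phi>) \<le> t * (C * O_strip_norm n \<phi>)"
      by (elim exE conjE)
    note C = this[rule_format, OF \<phi>]
    show "((\<lambda>t. p \<alpha> (Rplus_t sc (\<sigma> * t) f (abs_test \<phi>) - ?L)) \<longlongrightarrow> 0) (at_right 0)"
    proof (rule tendsto_sandwich[of "\<lambda>_. 0"])
      show "\<forall>\<^sub>F t in at_right 0. p \<alpha> (Rplus_t sc (\<sigma> * t) f (abs_test \<phi>) - ?L) \<le> t * (C * O_strip_norm n \<phi>)"
        unfolding eventually_at_right_field by (rule exI[of _ 1]) (use C in auto)
      have "((\<lambda>t. t * (C * O_strip_norm n \<phi>)) \<longlongrightarrow> 0 * (C * O_strip_norm n \<phi>)) (at_right 0)"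
        by (intro tendsto_intros)
      then show "((\<lambda>t. t * (C * O_strip_norm n \<phi>)) \<longlongrightarrow> 0) (at_right 0)" by simp
    qed simp_all
  qed
  then have "boundary_value \<sigma> f (abs_test \<phi>) = ?L"
    unfolding boundary_value_def by (intro tendsto_Lim) simp_all
  also have "\<dots> = line_int (\<sigma> * s) f \<phi>"
    by (rule line_integral_independent(1)[OF f n \<phi> \<sigma> _ _ s]) (use n in \<open>simp_all add: field_simps\<close>)
  finally show ?thesis .
qed

lemma boundary_value_line_integral:
  assumes f: "f \<in> Oexp_slit sc p" and n: "n \<ge> 1" and \<phi>: "\<phi> \<in> O_strip n" and \<sigma>: "\<sigma> \<in> {-1, 1 :: real}"
    and s: "0 < s" "s < 1 / n"
  shows "has_pettis_integral sc (path_integrand sc (\<sigma> * s) f \<phi>) (boundary_value \<sigma> f (abs_test \<phi>))"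
  unfolding boundary_value_eq_line_int[OF assms] by (rule line_integral_independent(2)[OF assms s])

lemma linear_boundary_value:
  assumes f: "f \<in> Oexp_slit sc p" and \<sigma>: "\<sigma> \<in> {-1, 1 :: real}"
  shows "Vector_Spaces.linear test_scale sc (boundary_value \<sigma> f)"
proof (rule linear_testI)
  fix \<Phi> \<Psi> c
  obtain n \<phi> where n: "n \<ge> 1" "\<phi> \<in> O_strip n" "\<Phi> = abs_test \<phi>" by (rule test_cases)
  obtain m \<psi> where m: "m \<ge> 1" "\<psi> \<in> O_strip m" "\<Psi> = abs_test \<psi>" by (rule test_cases)
  define l where "l = max n m"
  have l: "l \<ge> 1" and \<phi>: "\<phi> \<in> O_strip l" and \<psi>: "\<psi> \<in> O_strip l"
    using n m O_strip_mono[of n l] O_strip_mono[of m l] by (auto simp: l_def)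
  define s where "s = 1 / (2 * real l)"
  have s: "0 < s" "s < 1 / l" using l by (simp_all add: s_def field_simps)
  note I = boundary_value_line_integral[OF f l _ \<sigma> s]
  have "path_integrand sc (\<sigma> * s) f (\<lambda>z. \<phi> z + \<psi> z) =
      (\<lambda>x. path_integrand sc (\<sigma> * s) f \<phi> x + path_integrand sc (\<sigma> * s) f \<psi> x)"
    by (simp add: path_integrand_def fun_eq_iff scale_left_distrib)
  then show "boundary_value \<sigma> f (\<Phi> + \<Psi>) = boundary_value \<sigma> f \<Phi> + boundary_value \<sigma> f \<Psi>"
    using has_pettis_integral_unique[OF _ has_pettis_integral_add[OF I[OF \<phi>] I[OF \<psi>]]] I[OF O_strip_add[OF \<phi> \<psi>]]
    by (simp add: n(3) m(3) abs_test_add[OF l \<phi> \<psi>])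
  have "path_integrand sc (\<sigma> * s) f (\<lambda>z. c * \<phi> z) = (\<lambda>x. sc c (path_integrand sc (\<sigma> * s) f \<phi> x))"
    by (simp add: path_integrand_def fun_eq_iff)
  then show "boundary_value \<sigma> f (test_scale c \<Phi>) = sc c (boundary_value \<sigma> f \<Phi>)"
    using has_pettis_integral_unique[OF _ has_pettis_integral_scale[OF I[OF \<phi>], of c]] I[OF O_strip_scale[OF \<phi>, of c]]
    by (simp add: n(3) abs_test_scale[OF l \<phi>])
qed

lemma boundary_value_bound:
  assumes f: "f \<in> Oexp_slit sc p" and n: "n \<ge> 1" and \<phi>: "\<phi> \<in> O_strip n" and \<sigma>: "\<sigma> \<in> {-1, 1 :: real}"
  shows "p \<alpha> (boundary_value \<sigma> f (abs_test \<phi>)) \<le>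
    Oexp_norm p (3 * n) \<alpha> f * (LINT x|lebesgue. exp (- (1 / real n - 1 / real (3 * n)) * \<bar>x\<bar>)) * O_strip_norm n \<phi>"
proof -
  have s: "0 < 1 / (2 * real n)" "1 / (2 * real n) < 1 / n" "1 / real (3 * n) < 1 / (2 * real n)"
    using n by (simp_all add: field_simps)
  show ?thesis
    unfolding boundary_value_eq_line_int[OF f n \<phi> \<sigma> s(1,2)]
    by (rule line_int_bound[OF f n \<phi> \<sigma> _ _ s]) (use n in auto)
qed

lemma continuous_boundary_value:
  assumes f: "f \<in> Oexp_slit sc p" and \<sigma>: "\<sigma> \<in> {-1, 1 :: real}"
  shows "boundary_value \<sigma> f \<in> continuous_linear_maps test_scale sc"
proof (rule continuous_linear_on_testI[OF linear_boundary_value[OF assms]])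
  fix \<alpha> and n :: nat assume n: "n \<ge> 1"
  show "\<exists>C. \<forall>\<phi>\<in>O_strip n. p \<alpha> (boundary_value \<sigma> f (abs_test \<phi>)) \<le> C * O_strip_norm n \<phi>"
    by (intro exI ballI) (rule boundary_value_bound[OF f n _ \<sigma>])
qed

text \<open>
  On every step of the inductive limit the error is \<open>O(t)\<close>, so that the supremum of the errors
  divided by \<open>t\<close> is a continuous seminorm. It is bounded on every bounded set.
\<close>

lemma Rplus_t_error_seminorm:
  assumes f: "f \<in> Oexp_slit sc p" and \<sigma>: "\<sigma> \<in> {-1, 1 :: real}"
  obtains q where "inductive_limit_seminorm q"
    "\<And>t \<Phi>. 0 < t \<Longrightarrow> t \<le> 1 \<Longrightarrow> p \<alpha> (Rplus_t sc (\<sigma> * t) f \<Phi> - boundary_value \<sigma> f \<Phi>) \<le> t * q \<Phi>"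
proof -
  define e where "e t \<Phi> = (1 / t) * p \<alpha> (Rplus_t sc (\<sigma> * t) f \<Phi> - boundary_value \<sigma> f \<Phi>)" for t \<Phi>
  have sn: "seminorm test_scale (e t)" if t: "t \<in> {0<..1}" for t
  proof -
    have "\<sigma> * t \<noteq> 0" using \<sigma> t by auto
    then interpret R: Vector_Spaces.linear test_scale sc "Rplus_t sc (\<sigma> * t) f" by (rule linear_Rplus_t[OF f])
    interpret b: Vector_Spaces.linear test_scale sc "boundary_value \<sigma> f" by (rule linear_boundary_value[OF assms])
    have "Vector_Spaces.linear test_scale sc (\<lambda>\<Phi>. Rplus_t sc (\<sigma> * t) f \<Phi> - boundary_value \<sigma> f \<Phi>)"
      by (rule linear_testI) (simp_all add: R.add b.add R.scale b.scale scale_right_diff_distrib)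
    from seminorm_compose_linear[OF this, of \<alpha>] show ?thesis
      using t mult_left_mono[of _ _ "1 / t"] by (simp add: seminorm_def e_def flip: distrib_left)
        (simp add: field_simps add_divide_distrib[symmetric] divide_right_mono)
  qed
  have bound: "\<exists>C. \<forall>t\<in>{0<..1}. \<forall>\<phi>\<in>O_strip n. e t (abs_test \<phi>) \<le> C * O_strip_norm n \<phi>" if n: "n \<ge> 1" for n
  proof -
    from Rplus_t_approximates[OF f n \<sigma>, of \<alpha>] obtain C where "\<forall>\<phi>\<in>O_strip n. \<forall>t. 0 < t \<longrightarrow> t \<le> 1 \<longrightarrow>
      p \<alpha> (Rplus_t sc (\<sigma> * t) f (abs_test \<phi>) - line_int (\<sigma> * (1 / (2 * real n))) f \<phi>) \<le> t * (C * O_strip_norm n \<phi>)"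
      by (elim exE conjE)
    note C = this[rule_format]
    have half: "0 < 1 / (2 * real n)" "1 / (2 * real n) < 1 / real n" using n by (simp_all add: field_simps)
    have "e t (abs_test \<phi>) \<le> C * O_strip_norm n \<phi>" if "t \<in> {0<..1}" "\<phi> \<in> O_strip n" for t \<phi>
    proof -
      have "p \<alpha> (Rplus_t sc (\<sigma> * t) f (abs_test \<phi>) - boundary_value \<sigma> f (abs_test \<phi>)) \<le> t * (C * O_strip_norm n \<phi>)"
        using C[OF that(2), of t] that(1) boundary_value_eq_line_int[OF f n that(2) \<sigma> half] by simp
      then show ?thesis using that by (simp add: e_def divide_le_eq mult.commute)
    qed
    then show ?thesis by blast
  qed
  note SUP = inductive_limit_seminorm_SUP[of "{0<..1}" e, OF _ sn bound]
  show ?thesis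
  proof (rule that)
    show "inductive_limit_seminorm (\<lambda>\<Phi>. SUP t\<in>{0<..1}. e t \<Phi>)" by (rule SUP(1)) auto
    fix t :: real and \<Phi> assume t: "0 < t" "t \<le> 1"
    have "e t \<Phi> \<le> (SUP t\<in>{0<..1}. e t \<Phi>)" by (rule SUP(2)) (use t in auto)
    then show "p \<alpha> (Rplus_t sc (\<sigma> * t) f \<Phi> - boundary_value \<sigma> f \<Phi>) \<le> t * (SUP t\<in>{0<..1}. e t \<Phi>)"
      using t unfolding e_def[of t] by (simp add: divide_le_eq mult.commute)
  qed
qed

lemma Rplus_t_error_bounded:
  assumes f: "f \<in> Oexp_slit sc p" and \<sigma>: "\<sigma> \<in> {-1, 1 :: real}" and B: "tvs_bounded test_scale B"
  obtains M where
    "\<And>t \<Phi>. 0 < t \<Longrightarrow> t \<le> 1 \<Longrightarrow> \<Phi> \<in> B \<Longrightarrow> p \<alpha> (Rplus_t sc (\<sigma> * t) f \<Phi> - boundary_value \<sigma> f \<Phi>) \<le> t * M"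
proof -
  obtain q where q: "inductive_limit_seminorm q"
    "\<And>t \<Phi>. 0 < t \<Longrightarrow> t \<le> 1 \<Longrightarrow> p \<alpha> (Rplus_t sc (\<sigma> * t) f \<Phi> - boundary_value \<sigma> f \<Phi>) \<le> t * q \<Phi>"
    by (rule Rplus_t_error_seminorm[OF f \<sigma>, of \<alpha>]) (rule that)
  obtain M where M: "\<And>\<Phi>. \<Phi> \<in> B \<Longrightarrow> q \<Phi> \<le> M"
    by (rule bounded_inductive_limit_seminorm[OF B q(1)]) (rule that)
  show ?thesis
  proof (rule that)
    fix t :: real and \<Phi> assume t: "0 < t" "t \<le> 1" and \<Phi>: "\<Phi> \<in> B"
    have "t * q \<Phi> \<le> t * M" using t M[OF \<Phi>] by (intro mult_left_mono) auto
    then show "p \<alpha> (Rplus_t sc (\<sigma> * t) f \<Phi> - boundary_value \<sigma> f \<Phi>) \<le> t * M"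
      using q(2)[OF t, of \<Phi>] by linarith
  qed
qed

lemma eventually_at_right_01: "\<forall>\<^sub>F t in at_right (0::real). 0 < t \<and> t \<le> 1"
  unfolding eventually_at_right_field by (rule exI[of _ 1]) auto

lemma limitin_Rplus_t:
  assumes f: "f \<in> Oexp_slit sc p" and \<sigma>: "\<sigma> \<in> {-1, 1 :: real}"
  shows "limitin (Lb_topology test_scale sc p) (\<lambda>t. Rplus_t sc (\<sigma> * t) f) (boundary_value \<sigma> f) (at_right 0)"
proof (rule Lb_limitI[OF continuous_boundary_value[OF assms]])
  show "\<forall>\<^sub>F t in at_right 0. Rplus_t sc (\<sigma> * t) f \<in> continuous_linear_maps test_scale sc"
    using eventually_at_right_01 by eventually_elim (use \<sigma> in \<open>auto intro!: continuous_Rplus_t f\<close>)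
  fix \<alpha> B assume "tvs_bounded test_scale B"
  then obtain M where M: "\<And>t \<Phi>. 0 < t \<Longrightarrow> t \<le> 1 \<Longrightarrow> \<Phi> \<in> B \<Longrightarrow>
      p \<alpha> (Rplus_t sc (\<sigma> * t) f \<Phi> - boundary_value \<sigma> f \<Phi>) \<le> t * M"
    by (rule Rplus_t_error_bounded[OF f \<sigma>, of _ \<alpha>]) (rule that)
  have "((\<lambda>t. t * M) \<longlongrightarrow> 0 * M) (at_right 0)" by (intro tendsto_intros)
  moreover have "\<forall>\<^sub>F t in at_right 0. \<forall>\<Phi>\<in>B. p \<alpha> (Rplus_t sc (\<sigma> * t) f \<Phi> - boundary_value \<sigma> f \<Phi>) \<le> t * M"
    using eventually_at_right_01 by eventually_elim (use M in auto)
  ultimately show "\<exists>c. (c \<longlongrightarrow> 0) (at_right 0) \<and>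
      (\<forall>\<^sub>F t in at_right 0. \<forall>\<Phi>\<in>B. p \<alpha> (Rplus_t sc (\<sigma> * t) f \<Phi> - boundary_value \<sigma> f \<Phi>) \<le> c t)"
    by (intro exI[of _ "\<lambda>t. t * M"]) simp
qed

lemma Rtt_has_integral:
  assumes f: "f \<in> Oexp_slit sc p" and t: "0 < t" "0 < t'"
  shows "has_pettis_integral sc (Rtt_integrand sc t t' f \<Phi>) (Rplus_t sc (1 * t) f \<Phi> - Rplus_t sc (-1 * t') f \<Phi>)"
    and "Rtt sc t t' f \<Phi> = Rplus_t sc (1 * t) f \<Phi> - Rplus_t sc (-1 * t') f \<Phi>"
proof -
  have "Rtt_integrand sc t t' f \<Phi> = (\<lambda>x. Rplus_integrand sc t f \<Phi> x - Rplus_integrand sc (- t') f \<Phi> x)"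
    by (simp add: Rtt_integrand_def Rplus_integrand_def fun_eq_iff scale_right_diff_distrib)
  then show I: "has_pettis_integral sc (Rtt_integrand sc t t' f \<Phi>) (Rplus_t sc (1 * t) f \<Phi> - Rplus_t sc (-1 * t') f \<Phi>)"
    using t by (auto intro!: has_pettis_integral_diff Rplus_has_integral f)
  show "Rtt sc t t' f \<Phi> = Rplus_t sc (1 * t) f \<Phi> - Rplus_t sc (-1 * t') f \<Phi>"
    unfolding Rtt_def by (rule pettis_integral_eq[OF I])
qed

lemma continuous_linear_diff:
  assumes "S \<in> continuous_linear_maps test_scale sc" "T \<in> continuous_linear_maps test_scale sc"
  shows "(\<lambda>\<Phi>. S \<Phi> - T \<Phi>) \<in> continuous_linear_maps test_scale sc"
proof (rule continuous_linear_on_testI)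
  interpret S: Vector_Spaces.linear test_scale sc S using assms(1) by (simp add: continuous_linear_maps_def)
  interpret T: Vector_Spaces.linear test_scale sc T using assms(2) by (simp add: continuous_linear_maps_def)
  show "Vector_Spaces.linear test_scale sc (\<lambda>\<Phi>. S \<Phi> - T \<Phi>)"
    by (rule linear_testI) (simp_all add: S.add T.add S.scale T.scale scale_right_diff_distrib)
  fix \<alpha> and n :: nat assume n: "n \<ge> 1"
  obtain C where C: "\<And>\<phi>. \<phi> \<in> O_strip n \<Longrightarrow> p \<alpha> (S (abs_test \<phi>)) \<le> C * O_strip_norm n \<phi>"
    by (rule continuous_linear_on_test[OF assms(1) n, of \<alpha>]) (rule that)
  obtain D where D: "\<And>\<phi>. \<phi> \<in> O_strip n \<Longrightarrow> p \<alpha> (T (abs_test \<phi>)) \<le> D * O_strip_norm n \<phi>"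
    by (rule continuous_linear_on_test[OF assms(2) n, of \<alpha>]) (rule that)
  have "p \<alpha> (S (abs_test \<phi>) - T (abs_test \<phi>)) \<le> (C + D) * O_strip_norm n \<phi>" if "\<phi> \<in> O_strip n" for \<phi>
    using p.triangle_diff[of \<alpha> "S (abs_test \<phi>)" "T (abs_test \<phi>)"] C[OF that] D[OF that] by (simp add: ring_distribs)
  then show "\<exists>C. \<forall>\<phi>\<in>O_strip n. p \<alpha> (S (abs_test \<phi>) - T (abs_test \<phi>)) \<le> C * O_strip_norm n \<phi>" by blast
qed

text \<open>
  Both one-sided errors are bounded by multiples of \<open>t\<close> and \<open>t'\<close>, uniformly on a bounded set; a singleton
  gives the pointwise limit in the definition of \<open>R_map\<close>.
\<close>

lemma limitin_Rtt:
  assumes f: "f \<in> Oexp_slit sc p"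
  shows "R_map sc f = boundary_value 1 f - boundary_value (-1) f"
    and "R_map sc f \<in> continuous_linear_maps test_scale sc"
    and "limitin (Lb_topology test_scale sc p) (\<lambda>(t, t'). Rtt sc t t' f) (R_map sc f) (at_right 0 \<times>\<^sub>F at_right 0)"
    and "0 < t \<Longrightarrow> 0 < t' \<Longrightarrow> Rtt sc t t' f \<in> continuous_linear_maps test_scale sc"
proof -
  define D where "D = (\<lambda>\<Phi>. boundary_value 1 f \<Phi> - boundary_value (-1) f \<Phi>)"
  have D: "D \<in> continuous_linear_maps test_scale sc"
    unfolding D_def by (intro continuous_linear_diff continuous_boundary_value f) auto
  have ev: "\<forall>\<^sub>F (t, t') in at_right 0 \<times>\<^sub>F at_right 0. (0 < t \<and> t \<le> (1::real)) \<and> (0 < t' \<and> t' \<le> (1::real))"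
    by (rule eventually_mono[OF eventually_prodI[OF eventually_at_right_01 eventually_at_right_01]]) auto
  have Rtt_eq: "Rtt sc t t' f = (\<lambda>\<Phi>. Rplus_t sc (1 * t) f \<Phi> - Rplus_t sc (-1 * t') f \<Phi>)" if "0 < t" "0 < t'" for t t'
    using Rtt_has_integral(2)[OF f that] by (simp add: fun_eq_iff)
  show Rtt_cont: "Rtt sc t t' f \<in> continuous_linear_maps test_scale sc" if "0 < t" "0 < t'" for t t'
    unfolding Rtt_eq[OF that] using that by (intro continuous_linear_diff continuous_Rplus_t f) auto
  have err: "\<exists>c. (c \<longlongrightarrow> 0) (at_right 0 \<times>\<^sub>F at_right 0) \<and>
      (\<forall>\<^sub>F i in at_right 0 \<times>\<^sub>F at_right 0. \<forall>\<Phi>\<in>B. p \<alpha> ((case i of (t, t') \<Rightarrow> Rtt sc t t' f) \<Phi> - D \<Phi>) \<le> c i)"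
    if B: "tvs_bounded test_scale B" for \<alpha> B
  proof -
    obtain M where M: "\<And>t \<Phi>. 0 < t \<Longrightarrow> t \<le> 1 \<Longrightarrow> \<Phi> \<in> B \<Longrightarrow>
        p \<alpha> (Rplus_t sc (1 * t) f \<Phi> - boundary_value 1 f \<Phi>) \<le> t * M"
      by (rule Rplus_t_error_bounded[OF f _ B, of 1 \<alpha>]) (simp, rule that)
    obtain M' where M': "\<And>t \<Phi>. 0 < t \<Longrightarrow> t \<le> 1 \<Longrightarrow> \<Phi> \<in> B \<Longrightarrow>
        p \<alpha> (Rplus_t sc (-1 * t) f \<Phi> - boundary_value (-1) f \<Phi>) \<le> t * M'"
      by (rule Rplus_t_error_bounded[OF f _ B, of "-1" \<alpha>]) (simp, rule that)
    have "(fst \<longlongrightarrow> 0) (at_right (0::real) \<times>\<^sub>F at_right (0::real))"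
      by (rule filterlim_mono[OF filterlim_fst at_within_le_nhds order_refl])
    moreover have "(snd \<longlongrightarrow> 0) (at_right (0::real) \<times>\<^sub>F at_right (0::real))"
      by (rule filterlim_mono[OF filterlim_snd at_within_le_nhds order_refl])
    ultimately have "((\<lambda>i. fst i * M + snd i * M') \<longlongrightarrow> 0 * M + 0 * M') (at_right 0 \<times>\<^sub>F at_right 0)"
      by (intro tendsto_intros)
    moreover have "\<forall>\<^sub>F i in at_right 0 \<times>\<^sub>F at_right 0. \<forall>\<Phi>\<in>B.
        p \<alpha> ((case i of (t, t') \<Rightarrow> Rtt sc t t' f) \<Phi> - D \<Phi>) \<le> fst i * M + snd i * M'"
      using ev
    proof eventually_elim
      case (elim i)
      obtain t t' where i: "i = (t, t')" by (cases i)
      have t: "0 < t" "t \<le> 1" "0 < t'" "t' \<le> 1" using elim by (auto simp: i)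
      have "p \<alpha> (Rtt sc t t' f \<Phi> - D \<Phi>) \<le> t * M + t' * M'" if \<Phi>: "\<Phi> \<in> B" for \<Phi>
      proof -
        have "Rtt sc t t' f \<Phi> - D \<Phi> = (Rplus_t sc (1 * t) f \<Phi> - boundary_value 1 f \<Phi>) -
            (Rplus_t sc (-1 * t') f \<Phi> - boundary_value (-1) f \<Phi>)"
          by (simp add: Rtt_eq[OF t(1,3)] D_def)
        then show ?thesis
          using p.triangle_diff[of \<alpha> "Rplus_t sc (1 * t) f \<Phi> - boundary_value 1 f \<Phi>"
              "Rplus_t sc (-1 * t') f \<Phi> - boundary_value (-1) f \<Phi>"] M[OF t(1,2) \<Phi>] M'[OF t(3,4) \<Phi>] by simp
      qed
      then show ?case by (simp add: i)
    qed
    ultimately show ?thesis by (intro exI[of _ "\<lambda>i. fst i * M + snd i * M'"]) simp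
  qed
  have "((\<lambda>(t, t'). Rtt sc t t' f \<Phi>) \<longlongrightarrow> D \<Phi>) (at_right 0 \<times>\<^sub>F at_right 0)" for \<Phi>
    unfolding seminorm_tendsto_iff
  proof
    fix \<alpha>
    obtain n \<phi> where n: "n \<ge> 1" "\<phi> \<in> O_strip n" "\<Phi> = abs_test \<phi>" by (rule test_cases)
    have "tvs_bounded test_scale {\<Phi>}"
      by (rule tvs_bounded_O_strip_ball[OF n(1), of _ "O_strip_norm n \<phi>"]) (use n in auto)
    from err[OF this, of \<alpha>] obtain c where c: "(c \<longlongrightarrow> 0) (at_right 0 \<times>\<^sub>F at_right 0)"
      "\<forall>\<^sub>F i in at_right 0 \<times>\<^sub>F at_right 0. p \<alpha> ((case i of (t, t') \<Rightarrow> Rtt sc t t' f) \<Phi> - D \<Phi>) \<le> c i"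
      by auto
    show "((\<lambda>i. p \<alpha> ((case i of (t, t') \<Rightarrow> Rtt sc t t' f \<Phi>) - D \<Phi>)) \<longlongrightarrow> 0) (at_right 0 \<times>\<^sub>F at_right 0)"
    proof (rule tendsto_sandwich[OF _ _ tendsto_const c(1)])
      show "\<forall>\<^sub>F i in at_right 0 \<times>\<^sub>F at_right 0. p \<alpha> ((case i of (t, t') \<Rightarrow> Rtt sc t t' f \<Phi>) - D \<Phi>) \<le> c i"
        using c(2) by eventually_elim (auto split: prod.splits)
    qed simp
  qed
  then have R: "R_map sc f = D"
    by (intro ext) (simp add: R_map_def tendsto_Lim prod_filter_eq_bot)
  then show "R_map sc f = boundary_value 1 f - boundary_value (-1) f" by (simp add: D_def fun_eq_iff)
  show "R_map sc f \<in> continuous_linear_maps test_scale sc" unfolding R by (rule D)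
  show "limitin (Lb_topology test_scale sc p) (\<lambda>(t, t'). Rtt sc t t' f) (R_map sc f) (at_right 0 \<times>\<^sub>F at_right 0)"
    unfolding R
  proof (rule Lb_limitI[OF D _ err])
    show "\<forall>\<^sub>F i in at_right 0 \<times>\<^sub>F at_right 0. (case i of (t, t') \<Rightarrow> Rtt sc t t' f) \<in> continuous_linear_maps test_scale sc"
      using ev by eventually_elim (auto intro: Rtt_cont)
  qed
qed

end

section \<open>The quotient space\<close>

context lcs
begin

lemma seminorm_tendsto_add:
  fixes X Y :: "'j \<Rightarrow> 'e"
  assumes "(X \<longlongrightarrow> a) F" "(Y \<longlongrightarrow> b) F"
  shows "((\<lambda>i. X i + Y i) \<longlongrightarrow> a + b) F"
  unfolding seminorm_tendsto_iff
proof
  fix \<alpha>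
  have "((\<lambda>i. p \<alpha> (X i - a) + p \<alpha> (Y i - b)) \<longlongrightarrow> 0 + 0) F"
    using assms by (intro tendsto_add) (simp_all add: seminorm_tendsto_iff)
  then have lim: "((\<lambda>i. p \<alpha> (X i - a) + p \<alpha> (Y i - b)) \<longlongrightarrow> 0) F" by simp
  have "p \<alpha> (X i + Y i - (a + b)) \<le> p \<alpha> (X i - a) + p \<alpha> (Y i - b)" for i
    using p.triangle[of \<alpha> "X i - a" "Y i - b"] by (simp add: algebra_simps)
  then show "((\<lambda>i. p \<alpha> (X i + Y i - (a + b))) \<longlongrightarrow> 0) F"
    by (intro tendsto_sandwich[OF _ _ tendsto_const lim]) simp_all
qed

lemma seminorm_tendsto_scale:
  fixes X :: "'j \<Rightarrow> 'e"
  assumes "(X \<longlongrightarrow> a) F"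
  shows "((\<lambda>i. sc c (X i)) \<longlongrightarrow> sc c a) F"
  unfolding seminorm_tendsto_iff
proof
  fix \<alpha>
  have "((\<lambda>i. cmod c * p \<alpha> (X i - a)) \<longlongrightarrow> cmod c * 0) F"
    using assms by (intro tendsto_mult_left) (simp add: seminorm_tendsto_iff)
  then show "((\<lambda>i. p \<alpha> (sc c (X i) - sc c a)) \<longlongrightarrow> 0) F"
    by (simp add: p.homogeneous flip: scale_right_diff_distrib)
qed

lemma vholomorphic_on_add:
  assumes "vholomorphic_on sc f S" "vholomorphic_on sc g S"
  shows "vholomorphic_on sc (\<lambda>z. f z + g z) S"
  unfolding vholomorphic_on_def
proof
  fix z assume z: "z \<in> S"
  obtain d e where "((\<lambda>h. sc (inverse h) (f (z + h) - f z)) \<longlongrightarrow> d) (at 0)"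
    "((\<lambda>h. sc (inverse h) (g (z + h) - g z)) \<longlongrightarrow> e) (at 0)"
    using assms z unfolding vholomorphic_on_def by metis
  from seminorm_tendsto_add[OF this]
  have "((\<lambda>h. sc (inverse h) (f (z + h) + g (z + h) - (f z + g z))) \<longlongrightarrow> d + e) (at 0)"
    by (simp add: algebra_simps)
  then show "\<exists>d. ((\<lambda>h. sc (inverse h) (f (z + h) + g (z + h) - (f z + g z))) \<longlongrightarrow> d) (at 0)" by blast
qed

lemma vholomorphic_on_scale:
  assumes "vholomorphic_on sc f S"
  shows "vholomorphic_on sc (\<lambda>z. sc c (f z)) S"
  unfolding vholomorphic_on_def
proof
  fix z assume z: "z \<in> S"
  obtain d where "((\<lambda>h. sc (inverse h) (f (z + h) - f z)) \<longlongrightarrow> d) (at 0)"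
    using assms z unfolding vholomorphic_on_def by metis
  from seminorm_tendsto_scale[OF this, of c]
  have "((\<lambda>h. sc (inverse h) (sc c (f (z + h)) - sc c (f z))) \<longlongrightarrow> sc c d) (at 0)"
    by (simp add: mult.commute flip: scale_right_diff_distrib)
  then show "\<exists>d. ((\<lambda>h. sc (inverse h) (sc c (f (z + h)) - sc c (f z))) \<longlongrightarrow> d) (at 0)" by blast
qed

lemma vholomorphic_at_transform:
  assumes S: "open S" "z \<in> S" and eq: "\<And>w. w \<in> S \<Longrightarrow> f w = g w"
    and f: "\<exists>d. ((\<lambda>h. sc (inverse h) (f (z + h) - f z)) \<longlongrightarrow> d) (at 0)"
  shows "\<exists>d. ((\<lambda>h. sc (inverse h) (g (z + h) - g z)) \<longlongrightarrow> d) (at 0)"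
proof -
  obtain e where e: "e > 0" "ball z e \<subseteq> S" using S openE by blast
  have "\<forall>\<^sub>F h in at 0. sc (inverse h) (f (z + h) - f z) = sc (inverse h) (g (z + h) - g z)"
    unfolding eventually_at
  proof (intro exI[of _ e] conjI ballI impI)
    fix h :: complex assume "h \<noteq> 0 \<and> dist h 0 < e"
    then have "z + h \<in> S" using e by (auto simp: dist_norm)
    then show "sc (inverse h) (f (z + h) - f z) = sc (inverse h) (g (z + h) - g z)"
      using eq S(2) by simp
  qed (rule e)
  note ev = this
  from f obtain d where d: "((\<lambda>h. sc (inverse h) (f (z + h) - f z)) \<longlongrightarrow> d) (at 0)" ..
  show ?thesis by (rule exI, rule tendsto_cong[THEN iffD1, OF ev d])
qed

lemma Oexp_slit_add: "f \<in> Oexp_slit sc p \<Longrightarrow> g \<in> Oexp_slit sc p \<Longrightarrow> (\<lambda>z. f z + g z) \<in> Oexp_slit sc p"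
proof (rule Oexp_slitI)
  assume f: "f \<in> Oexp_slit sc p" and g: "g \<in> Oexp_slit sc p"
  show "f z + g z = 0" if "Im z = 0" for z using f g that by (simp add: Oexp_slit_def)
  show "vholomorphic_on sc (\<lambda>z. f z + g z) {z. Im z \<noteq> 0}"
    using f g by (intro vholomorphic_on_add) (simp_all add: Oexp_slit_def)
  fix n :: nat and \<alpha> assume n: "n \<ge> 2"
  have "p \<alpha> (f z + g z) \<le> (Oexp_norm p n \<alpha> f + Oexp_norm p n \<alpha> g) * exp (\<bar>Re z\<bar> / n)"
    if "1 / real n < \<bar>Im z\<bar>" "\<bar>Im z\<bar> < n" for z
    using p.triangle[of \<alpha> "f z" "g z"] Oexp_norm_upper[OF f n that, of \<alpha>] Oexp_norm_upper[OF g n that, of \<alpha>]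
    by (simp add: ring_distribs)
  then show "\<exists>M. \<forall>z. 1 / real n < \<bar>Im z\<bar> \<longrightarrow> \<bar>Im z\<bar> < n \<longrightarrow> p \<alpha> (f z + g z) \<le> M * exp (\<bar>Re z\<bar> / n)" by blast
qed

lemma Oexp_slit_scale: "f \<in> Oexp_slit sc p \<Longrightarrow> (\<lambda>z. sc c (f z)) \<in> Oexp_slit sc p"
proof (rule Oexp_slitI)
  assume f: "f \<in> Oexp_slit sc p"
  show "sc c (f z) = 0" if "Im z = 0" for z using f that by (simp add: Oexp_slit_def)
  show "vholomorphic_on sc (\<lambda>z. sc c (f z)) {z. Im z \<noteq> 0}"
    using f by (intro vholomorphic_on_scale) (simp add: Oexp_slit_def)
  fix n :: nat and \<alpha> assume n: "n \<ge> 2"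
  have "p \<alpha> (sc c (f z)) \<le> (cmod c * Oexp_norm p n \<alpha> f) * exp (\<bar>Re z\<bar> / n)"
    if "1 / real n < \<bar>Im z\<bar>" "\<bar>Im z\<bar> < n" for z
    using mult_left_mono[OF Oexp_norm_upper[OF f n that, of \<alpha>], of "cmod c"] by (simp add: p.homogeneous mult.assoc)
  then show "\<exists>M. \<forall>z. 1 / real n < \<bar>Im z\<bar> \<longrightarrow> \<bar>Im z\<bar> < n \<longrightarrow> p \<alpha> (sc c (f z)) \<le> M * exp (\<bar>Re z\<bar> / n)" by blast
qed

lemma Oexp_slit_diff: "f \<in> Oexp_slit sc p \<Longrightarrow> g \<in> Oexp_slit sc p \<Longrightarrow> (\<lambda>z. f z - g z) \<in> Oexp_slit sc p"
  using Oexp_slit_add[of f "\<lambda>z. sc (-1) (g z)"] Oexp_slit_scale[of g "-1"] by simp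

lemma Oexp_entire_upper:
  assumes "g \<in> Oexp_entire sc p" "n \<ge> 2"
  shows "\<exists>M\<ge>0. \<forall>z. \<bar>Im z\<bar> < real n \<longrightarrow> p \<alpha> (g z) \<le> M * exp (\<bar>Re z\<bar> / n)"
proof -
  have "bdd_above ((\<lambda>z. p \<alpha> (g z) * exp (- \<bar>Re z\<bar> / n)) ` {z. \<bar>Im z\<bar> < n})"
    using assms by (simp add: Oexp_entire_def)
  then obtain M where M: "\<And>z. \<bar>Im z\<bar> < n \<Longrightarrow> p \<alpha> (g z) * exp (- \<bar>Re z\<bar> / n) \<le> M"
    unfolding bdd_above_def by auto
  have "p \<alpha> (g z) \<le> M * exp (\<bar>Re z\<bar> / n)" if "\<bar>Im z\<bar> < n" for z
  proof -
    have "p \<alpha> (g z) * exp (- \<bar>Re z\<bar> / n) * exp (\<bar>Re z\<bar> / n) \<le> M * exp (\<bar>Re z\<bar> / n)"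
      using M[OF that] by (rule mult_right_mono) simp
    then show ?thesis by (simp add: mult.assoc flip: exp_add)
  qed
  moreover have "0 \<le> M" using order_trans[OF p.nonneg[of \<alpha> "g 0"]] M[of 0] assms(2) by simp
  ultimately show ?thesis by blast
qed

lemma Oexp_entireI:
  assumes "vholomorphic_on sc g UNIV"
    and "\<And>n \<alpha>. n \<ge> 2 \<Longrightarrow> \<exists>M. \<forall>z. \<bar>Im z\<bar> < real n \<longrightarrow> p \<alpha> (g z) \<le> M * exp (\<bar>Re z\<bar> / n)"
  shows "g \<in> Oexp_entire sc p"
proof -
  have "bdd_above ((\<lambda>z. p \<alpha> (g z) * exp (- \<bar>Re z\<bar> / n)) ` {z. \<bar>Im z\<bar> < n})" if n: "n \<ge> 2" for n :: nat and \<alpha>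
  proof -
    obtain M where M: "\<And>z. \<bar>Im z\<bar> < real n \<Longrightarrow> p \<alpha> (g z) \<le> M * exp (\<bar>Re z\<bar> / n)"
      using assms(2)[OF n] by blast
    have "p \<alpha> (g z) * exp (- \<bar>Re z\<bar> / n) \<le> M" if "\<bar>Im z\<bar> < n" for z
    proof -
      have "p \<alpha> (g z) * exp (- \<bar>Re z\<bar> / n) \<le> M * exp (\<bar>Re z\<bar> / n) * exp (- \<bar>Re z\<bar> / n)"
        using M[OF that] by (intro mult_right_mono) auto
      then show ?thesis by (simp add: mult.assoc flip: exp_add)
    qed
    then show ?thesis by (intro bdd_aboveI2[of _ _ M]) simp
  qed
  then show ?thesis using assms(1) by (simp add: Oexp_entire_def)
qed

lemma Oexp_entire_add: "f \<in> Oexp_entire sc p \<Longrightarrow> g \<in> Oexp_entire sc p \<Longrightarrow> (\<lambda>z. f z + g z) \<in> Oexp_entire sc p"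
proof (rule Oexp_entireI)
  assume f: "f \<in> Oexp_entire sc p" and g: "g \<in> Oexp_entire sc p"
  show "vholomorphic_on sc (\<lambda>z. f z + g z) UNIV"
    using f g by (intro vholomorphic_on_add) (simp_all add: Oexp_entire_def)
  fix n :: nat and \<alpha> assume n: "n \<ge> 2"
  obtain M where M: "\<forall>z. \<bar>Im z\<bar> < real n \<longrightarrow> p \<alpha> (f z) \<le> M * exp (\<bar>Re z\<bar> / n)"
    using Oexp_entire_upper[OF f n, of \<alpha>] by (elim exE conjE) (rule that)
  obtain K where K: "\<forall>z. \<bar>Im z\<bar> < real n \<longrightarrow> p \<alpha> (g z) \<le> K * exp (\<bar>Re z\<bar> / n)"
    using Oexp_entire_upper[OF g n, of \<alpha>] by (elim exE conjE) (rule that)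
  have "p \<alpha> (f z + g z) \<le> (M + K) * exp (\<bar>Re z\<bar> / n)" if "\<bar>Im z\<bar> < real n" for z
    using p.triangle[of \<alpha> "f z" "g z"] M[rule_format, OF that] K[rule_format, OF that] by (simp add: ring_distribs)
  then show "\<exists>M. \<forall>z. \<bar>Im z\<bar> < real n \<longrightarrow> p \<alpha> (f z + g z) \<le> M * exp (\<bar>Re z\<bar> / n)" by blast
qed

lemma Oexp_entire_scale: "f \<in> Oexp_entire sc p \<Longrightarrow> (\<lambda>z. sc c (f z)) \<in> Oexp_entire sc p"
proof (rule Oexp_entireI)
  assume f: "f \<in> Oexp_entire sc p"
  show "vholomorphic_on sc (\<lambda>z. sc c (f z)) UNIV"
    using f by (intro vholomorphic_on_scale) (simp_all add: Oexp_entire_def)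
  fix n :: nat and \<alpha> assume n: "n \<ge> 2"
  obtain M where M: "\<forall>z. \<bar>Im z\<bar> < real n \<longrightarrow> p \<alpha> (f z) \<le> M * exp (\<bar>Re z\<bar> / n)"
    using Oexp_entire_upper[OF f n, of \<alpha>] by (elim exE conjE) (rule that)
  have "p \<alpha> (sc c (f z)) \<le> (cmod c * M) * exp (\<bar>Re z\<bar> / n)" if "\<bar>Im z\<bar> < real n" for z
    using mult_left_mono[OF M[rule_format, OF that], of "cmod c"] by (simp add: p.homogeneous mult.assoc)
  then show "\<exists>M. \<forall>z. \<bar>Im z\<bar> < real n \<longrightarrow> p \<alpha> (sc c (f z)) \<le> M * exp (\<bar>Re z\<bar> / n)" by blast
qed

lemma Oexp_null_add: "f \<in> Oexp_null sc p \<Longrightarrow> g \<in> Oexp_null sc p \<Longrightarrow> (\<lambda>z. f z + g z) \<in> Oexp_null sc p"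
  unfolding Oexp_null_def
proof (elim imageE)
  fix F G assume *: "f = (\<lambda>z. if Im z = 0 then 0 else F z)" "F \<in> Oexp_entire sc p"
    "g = (\<lambda>z. if Im z = 0 then 0 else G z)" "G \<in> Oexp_entire sc p"
  show "(\<lambda>z. f z + g z) \<in> (\<lambda>f z. if Im z = 0 then 0 else f z) ` Oexp_entire sc p"
    by (rule image_eqI[OF _ Oexp_entire_add[OF *(2,4)]]) (auto simp: *)
qed

lemma Oexp_null_scale: "f \<in> Oexp_null sc p \<Longrightarrow> (\<lambda>z. sc c (f z)) \<in> Oexp_null sc p"
  unfolding Oexp_null_def
proof (elim imageE)
  fix F assume *: "f = (\<lambda>z. if Im z = 0 then 0 else F z)" "F \<in> Oexp_entire sc p"
  show "(\<lambda>z. sc c (f z)) \<in> (\<lambda>f z. if Im z = 0 then 0 else f z) ` Oexp_entire sc p"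
    by (rule image_eqI[OF _ Oexp_entire_scale[OF *(2)]]) (auto simp: *)
qed

lemma Oexp_null_zero: "(\<lambda>_. 0) \<in> Oexp_null sc p"
proof -
  have "(\<lambda>_. 0) \<in> Oexp_entire sc p"
    by (rule Oexp_entireI) (auto simp: vholomorphic_on_def intro!: exI[of _ 0])
  then show ?thesis unfolding Oexp_null_def by (rule image_eqI[rotated]) auto
qed

lemma Oexp_null_subset: "Oexp_null sc p \<subseteq> Oexp_slit sc p"
proof
  fix f assume "f \<in> Oexp_null sc p"
  then obtain F where F: "F \<in> Oexp_entire sc p" and f: "f = (\<lambda>z. if Im z = 0 then 0 else F z)"
    unfolding Oexp_null_def by blast
  show "f \<in> Oexp_slit sc p"
  proof (rule Oexp_slitI)
    show "vholomorphic_on sc f {z. Im z \<noteq> 0}"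
      unfolding vholomorphic_on_def
    proof
      fix z assume z: "z \<in> {z. Im z \<noteq> 0}"
      show "\<exists>d. ((\<lambda>h. sc (inverse h) (f (z + h) - f z)) \<longlongrightarrow> d) (at 0)"
        by (rule vholomorphic_at_transform[OF open_slit z, of F]) (use F in \<open>auto simp: f Oexp_entire_def vholomorphic_on_def\<close>)
    qed
    fix n :: nat and \<alpha> assume n: "n \<ge> 2"
    obtain M where M: "\<forall>z. \<bar>Im z\<bar> < real n \<longrightarrow> p \<alpha> (F z) \<le> M * exp (\<bar>Re z\<bar> / n)"
      using Oexp_entire_upper[OF F n, of \<alpha>] by (elim exE conjE) (rule that)
    have "p \<alpha> (f z) \<le> M * exp (\<bar>Re z\<bar> / n)" if "1 / real n < \<bar>Im z\<bar>" "\<bar>Im z\<bar> < n" for z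
      using M that by (auto simp: f)
    then show "\<exists>M. \<forall>z. 1 / real n < \<bar>Im z\<bar> \<longrightarrow> \<bar>Im z\<bar> < n \<longrightarrow> p \<alpha> (f z) \<le> M * exp (\<bar>Re z\<bar> / n)" by blast
  qed (simp add: f)
qed

lemma Oexp_class_iff: "g \<in> Oexp_class sc p f \<longleftrightarrow> (\<lambda>z. g z - f z) \<in> Oexp_null sc p"
proof
  assume "g \<in> Oexp_class sc p f"
  then obtain c where "c \<in> Oexp_null sc p" "g = f + c"
    by (auto simp: Oexp_class_def elt_set_plus_def)
  then show "(\<lambda>z. g z - f z) \<in> Oexp_null sc p" by (simp add: plus_fun_def)
next
  assume "(\<lambda>z. g z - f z) \<in> Oexp_null sc p"
  then show "g \<in> Oexp_class sc p f"
    by (auto simp: Oexp_class_def elt_set_plus_def plus_fun_def intro!: bexI[of _ "\<lambda>z. g z - f z"])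
qed

lemma Oexp_class_self: "f \<in> Oexp_class sc p f"
  by (simp add: Oexp_class_iff Oexp_null_zero)

lemma Oexp_class_eqI:
  assumes "(\<lambda>z. f z - g z) \<in> Oexp_null sc p"
  shows "Oexp_class sc p f = Oexp_class sc p g"
proof -
  have minus: "(\<lambda>z. g z - f z) \<in> Oexp_null sc p"
    using Oexp_null_scale[OF assms, of "-1"] by simp
  have "h \<in> Oexp_class sc p f \<longleftrightarrow> h \<in> Oexp_class sc p g" for h
    unfolding Oexp_class_iff
    using Oexp_null_add[of "\<lambda>z. h z - f z", OF _ assms] Oexp_null_add[of "\<lambda>z. h z - g z", OF _ minus] by auto
  then show ?thesis by blast
qed

lemma Oexp_class_subset_slit:
  assumes f: "f \<in> Oexp_slit sc p" and g: "g \<in> Oexp_class sc p f"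
  shows "g \<in> Oexp_slit sc p"
  using Oexp_slit_add[OF f, of "\<lambda>z. g z - f z"] g Oexp_null_subset by (auto simp: Oexp_class_iff)

lemma Oexp_class_add: "Oexp_class sc p f + Oexp_class sc p g = Oexp_class sc p (\<lambda>z. f z + g z)"
proof (intro equalityI subsetI)
  fix h assume "h \<in> Oexp_class sc p f + Oexp_class sc p g"
  then obtain a b where ab: "a \<in> Oexp_class sc p f" "b \<in> Oexp_class sc p g" "h = a + b"
    by (auto simp: set_plus_def)
  then show "h \<in> Oexp_class sc p (\<lambda>z. f z + g z)"
    using Oexp_null_add[of "\<lambda>z. a z - f z" "\<lambda>z. b z - g z"]
    by (simp add: Oexp_class_iff plus_fun_def algebra_simps)
next
  fix h assume "h \<in> Oexp_class sc p (\<lambda>z. f z + g z)"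
  then have "(\<lambda>z. h z - g z) \<in> Oexp_class sc p f" by (simp add: Oexp_class_iff algebra_simps)
  moreover have "h = (\<lambda>z. h z - g z) + g" by (simp add: plus_fun_def)
  ultimately show "h \<in> Oexp_class sc p f + Oexp_class sc p g"
    using Oexp_class_self[of g] unfolding set_plus_def by blast
qed

lemma Oexp_quotient_scale_class:
  "Oexp_quotient_scale sc p c (Oexp_class sc p f) = Oexp_class sc p (\<lambda>z. sc c (f z))"
proof (intro equalityI subsetI)
  fix h assume "h \<in> Oexp_quotient_scale sc p c (Oexp_class sc p f)"
  then obtain a b where ab: "a \<in> Oexp_class sc p f" "b \<in> Oexp_null sc p" "h = (\<lambda>z. sc c (a z)) + b"
    by (auto simp: Oexp_quotient_scale_def set_plus_def)
  then show "h \<in> Oexp_class sc p (\<lambda>z. sc c (f z))"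
    using Oexp_null_add[OF Oexp_null_scale[of "\<lambda>z. a z - f z" c] ab(2)]
    by (simp add: Oexp_class_iff plus_fun_def scale_right_diff_distrib algebra_simps)
next
  fix h assume "h \<in> Oexp_class sc p (\<lambda>z. sc c (f z))"
  then have "(\<lambda>z. h z - sc c (f z)) \<in> Oexp_null sc p" by (simp add: Oexp_class_iff)
  moreover have "h = (\<lambda>z. sc c (f z)) + (\<lambda>z. h z - sc c (f z))" by (simp add: plus_fun_def)
  ultimately show "h \<in> Oexp_quotient_scale sc p c (Oexp_class sc p f)"
    using Oexp_class_self[of f] unfolding Oexp_quotient_scale_def set_plus_def by blast
qed

end

context sc_lcs
begin

lemma boundary_value_add:
  assumes f: "f \<in> Oexp_slit sc p" and g: "g \<in> Oexp_slit sc p" and \<sigma>: "\<sigma> \<in> {-1, 1 :: real}"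
  shows "boundary_value \<sigma> (\<lambda>z. f z + g z) \<Phi> = boundary_value \<sigma> f \<Phi> + boundary_value \<sigma> g \<Phi>"
proof -
  obtain n \<phi> where n: "n \<ge> 1" "\<phi> \<in> O_strip n" "\<Phi> = abs_test \<phi>" by (rule test_cases)
  have s: "0 < 1 / (2 * real n)" "1 / (2 * real n) < 1 / n" using n by (simp_all add: field_simps)
  note I = boundary_value_line_integral[OF _ n(1,2) \<sigma> s]
  have "path_integrand sc (\<sigma> * (1 / (2 * real n))) (\<lambda>z. f z + g z) \<phi> =
      (\<lambda>x. path_integrand sc (\<sigma> * (1 / (2 * real n))) f \<phi> x + path_integrand sc (\<sigma> * (1 / (2 * real n))) g \<phi> x)"
    by (simp add: path_integrand_def fun_eq_iff scale_right_distrib)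
  then show ?thesis
    using has_pettis_integral_unique[OF _ has_pettis_integral_add[OF I[OF f] I[OF g]]] I[OF Oexp_slit_add[OF f g]]
    by (simp add: n(3))
qed

lemma boundary_value_scale:
  assumes f: "f \<in> Oexp_slit sc p" and \<sigma>: "\<sigma> \<in> {-1, 1 :: real}"
  shows "boundary_value \<sigma> (\<lambda>z. sc c (f z)) \<Phi> = sc c (boundary_value \<sigma> f \<Phi>)"
proof -
  obtain n \<phi> where n: "n \<ge> 1" "\<phi> \<in> O_strip n" "\<Phi> = abs_test \<phi>" by (rule test_cases)
  have s: "0 < 1 / (2 * real n)" "1 / (2 * real n) < 1 / n" using n by (simp_all add: field_simps)
  note I = boundary_value_line_integral[OF _ n(1,2) \<sigma> s]
  have "path_integrand sc (\<sigma> * (1 / (2 * real n))) (\<lambda>z. sc c (f z)) \<phi> =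
      (\<lambda>x. sc c (path_integrand sc (\<sigma> * (1 / (2 * real n))) f \<phi> x))"
    by (simp add: path_integrand_def fun_eq_iff mult.commute)
  then show ?thesis
    using has_pettis_integral_unique[OF _ has_pettis_integral_scale[OF I[OF f], of c]] I[OF Oexp_slit_scale[OF f, of c]]
    by (simp add: n(3))
qed

lemma R_map_eq: "f \<in> Oexp_slit sc p \<Longrightarrow> R_map sc f \<Phi> = boundary_value 1 f \<Phi> - boundary_value (-1) f \<Phi>"
  by (simp add: limitin_Rtt(1))

lemma R_map_add:
  assumes "f \<in> Oexp_slit sc p" "g \<in> Oexp_slit sc p"
  shows "R_map sc (\<lambda>z. f z + g z) = R_map sc f + R_map sc g"
  using assms by (simp add: fun_eq_iff R_map_eq Oexp_slit_add boundary_value_add)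

lemma R_map_scale:
  assumes "f \<in> Oexp_slit sc p"
  shows "R_map sc (\<lambda>z. sc c (f z)) = (\<lambda>\<Phi>. sc c (R_map sc f \<Phi>))"
  using assms by (simp add: fun_eq_iff R_map_eq Oexp_slit_scale boundary_value_scale scale_right_diff_distrib)

lemma R_map_diff:
  assumes "f \<in> Oexp_slit sc p" "g \<in> Oexp_slit sc p"
  shows "R_map sc (\<lambda>z. f z - g z) = R_map sc f - R_map sc g"
  using R_map_add[OF Oexp_slit_diff[OF assms] assms(2)] by simp

lemma path_integral_gamma_eq:
  assumes f: "f \<in> Oexp_slit sc p" and n: "n \<ge> 1" and \<phi>: "\<phi> \<in> O_strip n" and t: "0 < t" "t < 1 / n"
  shows "path_integral_gamma sc t f \<phi> = - R_map sc f (abs_test \<phi>)"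
  using boundary_value_eq_line_int[OF f n \<phi> _ t, of 1] boundary_value_eq_line_int[OF f n \<phi> _ t, of "-1"]
  by (simp add: path_integral_gamma_def R_map_eq[OF f])

text \<open>
  For the restriction of an entire function the contour can be moved across the real line.
\<close>

lemma R_map_null:
  assumes g: "g \<in> Oexp_null sc p"
  shows "R_map sc g = 0"
proof
  fix \<Phi>
  obtain n \<phi> where n: "n \<ge> 1" "\<phi> \<in> O_strip n" "\<Phi> = abs_test \<phi>" by (rule test_cases)
  obtain G where G: "G \<in> Oexp_entire sc p" and g_eq: "g = (\<lambda>z. if Im z = 0 then 0 else G z)"
    using g unfolding Oexp_null_def by blast
  have g_slit: "g \<in> Oexp_slit sc p" using g Oexp_null_subset by blast
  define s where "s = 1 / (2 * real n)"
  have s: "0 < s" "s < 1 / n" using n by (simp_all add: s_def field_simps)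
  have hd: "holomorphic_decaying (- (1 / n)) (1 / n) (\<lambda>z. sc (\<phi> z) (G z))"
  proof (rule holomorphic_decaying_product[OF n(1,2)])
    have "weakly_holomorphic_on G UNIV"
      using G by (intro vholomorphic_imp_weakly_holomorphic) (simp_all add: Oexp_entire_def)
    then show "weakly_holomorphic_on G (hstrip (- (1 / n)) (1 / n))"
      by (rule weakly_holomorphic_on_subset) simp
    fix \<alpha>
    obtain M where M: "0 \<le> M" "\<forall>z. \<bar>Im z\<bar> < real (n + 2) \<longrightarrow> p \<alpha> (G z) \<le> M * exp (\<bar>Re z\<bar> / real (n + 2))"
      using Oexp_entire_upper[OF G le_add2, of n \<alpha>] by (elim exE conjE) (rule that)
    have n1: "1 / real n \<le> 1" using n by simp
    have "p \<alpha> (G z) \<le> M * exp (\<bar>Re z\<bar> / real (n + 2))" if "z \<in> hstrip (- (1 / n)) (1 / n)" for z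
      using M(2)[rule_format, of z] that n1 by auto
    then show "\<exists>N K. n < N \<and> 0 \<le> K \<and> (\<forall>z\<in>hstrip (- (1 / n)) (1 / n). p \<alpha> (G z) \<le> K * exp (\<bar>Re z\<bar> / real N))"
      using M(1) by (intro exI[of _ "n + 2"] exI[of _ M]) simp
  qed simp_all
  have eq: "path_integrand sc t g \<phi> = (\<lambda>x. sc (\<phi> (Complex x t)) (G (Complex x t)))" if "t \<noteq> 0" for t
    using that by (simp add: path_integrand_def g_eq fun_eq_iff)
  have "line_int s g \<phi> = line_int (- s) g \<phi>"
    using s by (simp add: eq holomorphic_decaying_shift[OF hd, of s "- s"])
  then show "R_map sc g \<Phi> = 0 \<Phi>"
    using path_integral_gamma_eq[OF g_slit n(1,2) s] by (simp add: path_integral_gamma_def n(3))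
qed

lemma R_map_class:
  assumes f: "f \<in> Oexp_slit sc p" and g: "g \<in> Oexp_class sc p f"
  shows "R_map sc g = R_map sc f"
proof -
  have "(\<lambda>z. g z - f z) \<in> Oexp_null sc p" using g by (simp add: Oexp_class_iff)
  then have "R_map sc g - R_map sc f = 0"
    using R_map_null R_map_diff[OF Oexp_class_subset_slit[OF f g] f] by simp
  then show ?thesis by simp
qed

lemma R_quotient_class:
  assumes f: "f \<in> Oexp_slit sc p"
  shows "R_quotient sc (Oexp_class sc p f) = R_map sc f"
proof -
  have "R_map sc ` Oexp_class sc p f = {R_map sc f}"
  proof (intro equalityI image_subsetI)
    show "R_map sc g \<in> {R_map sc f}" if "g \<in> Oexp_class sc p f" for g
      unfolding R_map_class[OF f that] by (rule singletonI)
    show "{R_map sc f} \<subseteq> R_map sc ` Oexp_class sc p f"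
      by (simp add: Oexp_class_self)
  qed
  then show ?thesis by (simp add: R_quotient_def)
qed

text \<open>
  All the path integrals in the definition of \<open>H_map\<close> agree with \<open>- R_map sc f\<close>, which depends neither on
  the height, nor on the representatives.
\<close>

lemma H_map_class:
  assumes f: "f \<in> Oexp_slit sc p"
  shows "H_map sc (Oexp_class sc p f) \<Phi> = - R_map sc f \<Phi>"
  unfolding H_map_def
proof (rule the_equality)
  show "\<forall>g\<in>Oexp_class sc p f. \<forall>n\<ge>1. \<forall>\<phi>\<in>O_strip n. \<forall>t.
     abs_test \<phi> = \<Phi> \<and> 0 < t \<and> t < 1 / n \<longrightarrow> path_integral_gamma sc t g \<phi> = - R_map sc f \<Phi>"
  proof (intro ballI allI impI, elim conjE)
    fix g and n :: nat and \<phi> t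
    assume "g \<in> Oexp_class sc p f" "1 \<le> n" "\<phi> \<in> O_strip n" "abs_test \<phi> = \<Phi>" "0 < t" "t < 1 / n"
    then show "path_integral_gamma sc t g \<phi> = - R_map sc f \<Phi>"
      using path_integral_gamma_eq[OF Oexp_class_subset_slit[OF f], of g n \<phi> t] by (simp only: R_map_class[OF f])
  qed
next
  fix e
  assume e: "\<forall>g\<in>Oexp_class sc p f. \<forall>n\<ge>1. \<forall>\<phi>\<in>O_strip n. \<forall>t.
     abs_test \<phi> = \<Phi> \<and> 0 < t \<and> t < 1 / n \<longrightarrow> path_integral_gamma sc t g \<phi> = e"
  obtain n \<phi> where n: "n \<ge> 1" "\<phi> \<in> O_strip n" "\<Phi> = abs_test \<phi>" by (rule test_cases)
  have s: "0 < 1 / (2 * real n)" "1 / (2 * real n) < 1 / n" using n by (simp_all add: field_simps)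
  have "path_integral_gamma sc (1 / (2 * real n)) f \<phi> = e"
    using e[rule_format, OF Oexp_class_self n(1,2)] n(3) s by simp
  then show "e = - R_map sc f \<Phi>" using path_integral_gamma_eq[OF f n(1,2) s] n(3) by simp
qed

end

section \<open>The Cauchy transform\<close>

text \<open>
  The part of the exponential decay in \<open>\<bar>Re z - Re w\<bar>\<close> that is needed is traded for the weights of the
  two variables by the triangle inequality.
\<close>

lemma cauchy_kernel_weighted:
  assumes d: "0 < d" "d \<le> \<bar>Im z - Im w\<bar>" and L: "\<bar>Im z - Im w\<bar> \<le> L" and m: "(m::nat) \<ge> 1"
  shows "cmod (cauchy_kernel z w) \<le> (exp (L\<^sup>2 + 1) / d * exp (\<bar>Re z\<bar> / m)) * exp (- \<bar>Re w\<bar> / m)"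
proof -
  have "(\<bar>Re w\<bar> - \<bar>Re z\<bar>) / m \<le> \<bar>Re z - Re w\<bar> / m"
    using m by (intro divide_right_mono) auto
  also have "\<dots> \<le> \<bar>Re z - Re w\<bar> / 1" using m by (intro divide_left_mono) auto
  also have "\<dots> \<le> 2 * \<bar>Re z - Re w\<bar>" by simp
  finally have "(\<bar>Re w\<bar> - \<bar>Re z\<bar>) / m \<le> 2 * \<bar>Re z - Re w\<bar>" .
  then have "- 2 * \<bar>Re z - Re w\<bar> \<le> \<bar>Re z\<bar> / m + - \<bar>Re w\<bar> / m" by (simp add: diff_divide_distrib)
  then have "exp (- 2 * \<bar>Re z - Re w\<bar>) \<le> exp (\<bar>Re z\<bar> / m) * exp (- \<bar>Re w\<bar> / m)"
    by (subst exp_add[symmetric]) simp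
  then have "exp (L\<^sup>2 + 1) / d * exp (- 2 * \<bar>Re z - Re w\<bar>) \<le> exp (L\<^sup>2 + 1) / d * (exp (\<bar>Re z\<bar> / m) * exp (- \<bar>Re w\<bar> / m))"
    using d(1) by (intro mult_left_mono) auto
  then show ?thesis using cauchy_kernel_bound[OF d L] by (simp only: mult.assoc) 
qed

lemma cauchy_kernel_O_strip:
  assumes m: "m \<ge> 1" and z: "1 / real m < \<bar>Im z\<bar>"
  shows "cauchy_kernel z \<in> O_strip m"
    and "O_strip_norm m (cauchy_kernel z) \<le>
      exp ((\<bar>Im z\<bar> + 1)\<^sup>2 + 1) / (\<bar>Im z\<bar> - 1 / m) * exp (\<bar>Re z\<bar> / m)"
proof -
  have "1 / real m \<le> 1" using m by simp
  then have le: "cmod (cauchy_kernel z w) \<le>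
      (exp ((\<bar>Im z\<bar> + 1)\<^sup>2 + 1) / (\<bar>Im z\<bar> - 1 / m) * exp (\<bar>Re z\<bar> / m)) * exp (- \<bar>Re w\<bar> / m)"
    if "\<bar>Im w\<bar> \<le> 1 / m" for w
    using that z by (intro cauchy_kernel_weighted m) linarith+
  have "z \<notin> hstrip (- \<bar>Im z\<bar>) \<bar>Im z\<bar>" by auto
  from O_stripI_hstrip[OF m holomorphic_cauchy_kernel(1)[OF this] z le]
  show "cauchy_kernel z \<in> O_strip m" .
  show "O_strip_norm m (cauchy_kernel z) \<le>
      exp ((\<bar>Im z\<bar> + 1)\<^sup>2 + 1) / (\<bar>Im z\<bar> - 1 / m) * exp (\<bar>Re z\<bar> / m)"
    by (rule O_strip_norm_leI) (rule le)
qed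

context sc_lcs
begin

text \<open>
  The constant is \<open>- 1 / (2 \<pi> \<i>)\<close>: the sign reflects that \<open>R_map\<close> is the value from above minus the
  value from below, while the contour in Cauchy's formula runs in the positive sense.
\<close>

definition cauchy_transform :: "(test \<Rightarrow> 'e) \<Rightarrow> complex \<Rightarrow> 'e" where
  "cauchy_transform T z = (if Im z = 0 then 0 else sc (\<i> / (2 * pi)) (T (abs_test (cauchy_kernel z))))"

lemma linear_combination_test:
  assumes T: "Vector_Spaces.linear test_scale sc T" and m: "m \<ge> 1"
    and \<phi>: "\<phi>\<^sub>1 \<in> O_strip m" "\<phi>\<^sub>2 \<in> O_strip m" "\<phi>\<^sub>3 \<in> O_strip m"
  shows "(\<lambda>w. a * \<phi>\<^sub>1 w + b * \<phi>\<^sub>2 w + c * \<phi>\<^sub>3 w) \<in> O_strip m"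
    and "T (abs_test (\<lambda>w. a * \<phi>\<^sub>1 w + b * \<phi>\<^sub>2 w + c * \<phi>\<^sub>3 w)) =
      sc a (T (abs_test \<phi>\<^sub>1)) + sc b (T (abs_test \<phi>\<^sub>2)) + sc c (T (abs_test \<phi>\<^sub>3))"
proof -
  interpret T: Vector_Spaces.linear test_scale sc T by fact
  note O = O_strip_scale[OF \<phi>(1), of a] O_strip_scale[OF \<phi>(2), of b] O_strip_scale[OF \<phi>(3), of c]
  show "(\<lambda>w. a * \<phi>\<^sub>1 w + b * \<phi>\<^sub>2 w + c * \<phi>\<^sub>3 w) \<in> O_strip m"
    by (intro O_strip_add O)
  have "abs_test (\<lambda>w. a * \<phi>\<^sub>1 w + b * \<phi>\<^sub>2 w + c * \<phi>\<^sub>3 w) =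
      test_scale a (abs_test \<phi>\<^sub>1) + test_scale b (abs_test \<phi>\<^sub>2) + test_scale c (abs_test \<phi>\<^sub>3)"
    using abs_test_add[OF m O_strip_add[OF O(1,2)] O(3)] abs_test_add[OF m O(1,2)]
    by (simp add: abs_test_scale[OF m] \<phi>)
  then show "T (abs_test (\<lambda>w. a * \<phi>\<^sub>1 w + b * \<phi>\<^sub>2 w + c * \<phi>\<^sub>3 w)) =
      sc a (T (abs_test \<phi>\<^sub>1)) + sc b (T (abs_test \<phi>\<^sub>2)) + sc c (T (abs_test \<phi>\<^sub>3))"
    by (simp add: T.add T.scale)
qed

text \<open>
  On a small disc around \<open>z\<close> all functions \<open>cauchy_kernel z'\<close> lie in one step of the limit, and \<open>T\<close> is
  bounded there by the weighted supremum norm on a closed strip.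
\<close>

lemma cauchy_transform_differentiable:
  assumes T: "T \<in> continuous_linear_maps test_scale sc" and z: "Im z \<noteq> 0"
  shows "\<exists>d. ((\<lambda>h. sc (inverse h) (T (abs_test (cauchy_kernel (z + h))) - T (abs_test (cauchy_kernel z)))) \<longlongrightarrow> d) (at 0)"
proof -
  have lin: "Vector_Spaces.linear test_scale sc T" using T by (simp add: continuous_linear_maps_def)
  define r where "r = \<bar>Im z\<bar> / 4"
  have r: "0 < r" using z by (simp add: r_def)
  have zr: "\<bar>Im z\<bar> = 4 * r" by (simp add: r_def)
  obtain m :: nat where m0: "max 1 (1 / r) < real m" using reals_Archimedean2 by blast
  then have m: "m \<ge> 1" and mr: "1 / real m < r" using r by (simp_all add: field_simps)
  have ball: "2 * r < \<bar>Im v\<bar> \<and> \<bar>Im v\<bar> < 6 * r \<and> \<bar>Re v\<bar> \<le> \<bar>Re z\<bar> + 2 * r" if "v \<in> ball z (2 * r)" for v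
  proof -
    have "\<bar>Im v - Im z\<bar> < 2 * r" "\<bar>Re v - Re z\<bar> < 2 * r"
      using that abs_Im_le_cmod[of "v - z"] abs_Re_le_cmod[of "v - z"]
      by (auto simp: dist_norm norm_minus_commute)
    then show ?thesis using zr by linarith
  qed
  show ?thesis
  proof (rule kernel_transform_differentiable[OF r, where A = "{w. \<bar>Im w\<bar> \<le> 1 / m}" and wt = "\<lambda>w. exp (- \<bar>Re w\<bar> / m)"
        and M\<^sub>0 = "exp ((7 * r)\<^sup>2 + 1) / r * exp ((\<bar>Re z\<bar> + 2 * r) / m)"])
    show "0 < exp (- \<bar>Re w\<bar> / m)" for w by simp
    show "w \<notin> ball z (2 * r)" if "w \<in> {w. \<bar>Im w\<bar> \<le> 1 / m}" for w
      using ball[of w] that mr r by auto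
    fix w z' assume w: "w \<in> {w. \<bar>Im w\<bar> \<le> 1 / m}" and z': "z' \<in> ball z (2 * r)"
    have "r \<le> \<bar>Im z' - Im w\<bar>" "\<bar>Im z' - Im w\<bar> \<le> 7 * r" using w ball[OF z'] mr by auto
    from cauchy_kernel_weighted[OF r this m]
    have "cmod (cauchy_kernel z' w) \<le> (exp ((7 * r)\<^sup>2 + 1) / r * exp (\<bar>Re z'\<bar> / m)) * exp (- \<bar>Re w\<bar> / m)" .
    also have "\<dots> \<le> (exp ((7 * r)\<^sup>2 + 1) / r * exp ((\<bar>Re z\<bar> + 2 * r) / m)) * exp (- \<bar>Re w\<bar> / m)"
      using ball[OF z'] r by (intro mult_right_mono mult_left_mono) (auto intro!: divide_right_mono)
    finally show "cmod (cauchy_kernel z' w) \<le> (exp ((7 * r)\<^sup>2 + 1) / r * exp ((\<bar>Re z\<bar> + 2 * r) / m)) * exp (- \<bar>Re w\<bar> / m)" .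
  next
    fix \<alpha>
    obtain C where C: "0 \<le> C" "\<And>\<phi>. \<phi> \<in> O_strip m \<Longrightarrow> p \<alpha> (T (abs_test \<phi>)) \<le> C * O_strip_norm m \<phi>"
      by (rule continuous_linear_on_test[OF T m, of \<alpha>]) (rule that)
    have "p \<alpha> (sc a (T (abs_test (cauchy_kernel (z + h)))) + sc b (T (abs_test (cauchy_kernel z))) +
        sc c (T (abs_test (cauchy_kernel (z + k))))) \<le> C * M"
      if hk: "cmod h < r" "cmod k < r" and M: "\<forall>w\<in>{w. \<bar>Im w\<bar> \<le> 1 / m}.
        cmod (a * cauchy_kernel (z + h) w + b * cauchy_kernel z w + c * cauchy_kernel (z + k) w) \<le> M * exp (- \<bar>Re w\<bar> / m)"
      for a b c h k M
    proof -
      have K: "cauchy_kernel v \<in> O_strip m" if "v \<in> ball z (2 * r)" for v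
        using ball[OF that] mr r by (intro cauchy_kernel_O_strip m) auto
      have "z + h \<in> ball z (2 * r)" "z \<in> ball z (2 * r)" "z + k \<in> ball z (2 * r)"
        using hk r by (auto simp: dist_norm)
      note lc = linear_combination_test[OF lin m K[OF this(1)] K[OF this(2)] K[OF this(3)]]
      have "p \<alpha> (T (abs_test (\<lambda>w. a * cauchy_kernel (z + h) w + b * cauchy_kernel z w + c * cauchy_kernel (z + k) w)))
          \<le> C * O_strip_norm m (\<lambda>w. a * cauchy_kernel (z + h) w + b * cauchy_kernel z w + c * cauchy_kernel (z + k) w)"
        by (rule C(2)[OF lc(1)])
      also have "\<dots> \<le> C * M"
        using M by (intro mult_left_mono C(1) O_strip_norm_leI) auto
      finally show ?thesis by (simp only: lc(2))
    qed
    then show "\<exists>C\<ge>0. \<forall>a b c h k M. cmod h < r \<longrightarrow> cmod k < r \<longrightarrow>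
      (\<forall>w\<in>{w. \<bar>Im w\<bar> \<le> 1 / m}. cmod (a * cauchy_kernel (z + h) w + b * cauchy_kernel z w + c * cauchy_kernel (z + k) w) \<le> M * exp (- \<bar>Re w\<bar> / m)) \<longrightarrow>
      p \<alpha> (sc a (T (abs_test (cauchy_kernel (z + h)))) + sc b (T (abs_test (cauchy_kernel z))) +
        sc c (T (abs_test (cauchy_kernel (z + k))))) \<le> C * M"
      by (intro exI[of _ C] conjI C(1) allI impI)
  qed
qed

lemma cauchy_transform_slit:
  assumes T: "T \<in> continuous_linear_maps test_scale sc"
  shows "cauchy_transform T \<in> Oexp_slit sc p"
proof (rule Oexp_slitI)
  show "cauchy_transform T z = 0" if "Im z = 0" for z using that by (simp add: cauchy_transform_def)
  show "vholomorphic_on sc (cauchy_transform T) {z. Im z \<noteq> 0}"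
    unfolding vholomorphic_on_def
  proof
    fix z assume z: "z \<in> {z. Im z \<noteq> 0}"
    have "vholomorphic_on sc (\<lambda>z. T (abs_test (cauchy_kernel z))) {z. Im z \<noteq> 0}"
      unfolding vholomorphic_on_def using cauchy_transform_differentiable[OF T] by blast
    from vholomorphic_on_scale[OF this, of "\<i> / (2 * pi)"]
    have "\<exists>d. ((\<lambda>h. sc (inverse h) (sc (\<i> / (2 * pi)) (T (abs_test (cauchy_kernel (z + h)))) -
        sc (\<i> / (2 * pi)) (T (abs_test (cauchy_kernel z))))) \<longlongrightarrow> d) (at 0)"
      using z unfolding vholomorphic_on_def by (rule bspec)
    then show "\<exists>d. ((\<lambda>h. sc (inverse h) (cauchy_transform T (z + h) - cauchy_transform T z)) \<longlongrightarrow> d) (at 0)"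
      by (rule vholomorphic_at_transform[OF open_slit z, rotated]) (simp add: cauchy_transform_def)
  qed
  fix n :: nat and \<alpha> assume n: "n \<ge> 2"
  define m where "m = 2 * n"
  have m: "m \<ge> 1" using n by (simp add: m_def)
  obtain C where C: "0 \<le> C" "\<And>\<phi>. \<phi> \<in> O_strip m \<Longrightarrow> p \<alpha> (T (abs_test \<phi>)) \<le> C * O_strip_norm m \<phi>"
    by (rule continuous_linear_on_test[OF T m, of \<alpha>]) (rule that)
  define A where "A = exp ((real n + 1)\<^sup>2 + 1) / (1 / m)"
  have "p \<alpha> (cauchy_transform T z) \<le> (cmod (\<i> / (2 * pi)) * (C * A)) * exp (\<bar>Re z\<bar> / n)"
    if z: "1 / real n < \<bar>Im z\<bar>" "\<bar>Im z\<bar> < n" for z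
  proof -
    have half: "1 / real n = 2 * (1 / real m)" by (simp add: m_def)
    have m0: "0 < 1 / real m" using m by simp
    have zm: "1 / real m < \<bar>Im z\<bar>" "1 / real m \<le> \<bar>Im z\<bar> - 1 / m" "Im z \<noteq> 0" using z half m0 by auto
    note K = cauchy_kernel_O_strip[OF m zm(1)]
    have "p \<alpha> (T (abs_test (cauchy_kernel z))) \<le> C * O_strip_norm m (cauchy_kernel z)" by (rule C(2)[OF K(1)])
    also have "\<dots> \<le> C * (exp ((\<bar>Im z\<bar> + 1)\<^sup>2 + 1) / (\<bar>Im z\<bar> - 1 / m) * exp (\<bar>Re z\<bar> / m))"
      by (rule mult_left_mono[OF K(2) C(1)])
    also have "\<dots> \<le> C * (A * exp (\<bar>Re z\<bar> / n))"
    proof (intro mult_left_mono mult_mono C(1))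
      have "(\<bar>Im z\<bar> + 1)\<^sup>2 \<le> (real n + 1)\<^sup>2" using z by (intro power_mono) auto
      then show "exp ((\<bar>Im z\<bar> + 1)\<^sup>2 + 1) / (\<bar>Im z\<bar> - 1 / m) \<le> A"
        unfolding A_def using zm m0 by (intro frac_le) auto
      have "\<bar>Re z\<bar> / m \<le> \<bar>Re z\<bar> / n" using n by (intro divide_left_mono) (auto simp: m_def)
      then show "exp (\<bar>Re z\<bar> / m) \<le> exp (\<bar>Re z\<bar> / n)" by simp
    qed (use m0 in \<open>auto simp: A_def\<close>)
    finally have "cmod (\<i> / (2 * pi)) * p \<alpha> (T (abs_test (cauchy_kernel z))) \<le> cmod (\<i> / (2 * pi)) * (C * (A * exp (\<bar>Re z\<bar> / n)))"
      by (rule mult_left_mono) simp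
    then show ?thesis using zm(3) by (simp add: cauchy_transform_def p.homogeneous mult.assoc)
  qed
  then show "\<exists>M. \<forall>z. 1 / real n < \<bar>Im z\<bar> \<longrightarrow> \<bar>Im z\<bar> < n \<longrightarrow> p \<alpha> (cauchy_transform T z) \<le> M * exp (\<bar>Re z\<bar> / n)"
    by blast
qed

subsection \<open>Surjectivity\<close>

text \<open>
  Cauchy's formula reproduces \<open>\<phi>\<close> on a smaller strip from its values on two lines. The Riemann sums
  of the two integrals are linear combinations of the functions \<open>cauchy_kernel w\<close> and converge to
  \<open>2 \<pi> \<i> \<phi>\<close> in the norm of a step of the inductive limit, uniformly in the weighted sense, which is
  what allows a continuous linear map to be applied under the integral sign.
\<close>

definition kernel_riemann_sum :: "real \<Rightarrow> (complex \<Rightarrow> complex) \<Rightarrow> nat \<Rightarrow> complex \<Rightarrow> complex" where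
  "kernel_riemann_sum s \<phi> N \<zeta> =
    riemann_sum (*) (\<lambda>x. \<phi> (Complex x s) * cauchy_kernel (Complex x s) \<zeta>) N"

lemma kernel_riemann_sum_test:
  assumes T: "Vector_Spaces.linear test_scale sc T" and m: "m \<ge> 1" and s: "1 / real m < \<bar>s\<bar>"
  shows "kernel_riemann_sum s \<phi> N \<in> O_strip m"
    and "riemann_sum sc (path_integrand sc s (cauchy_transform T) \<phi>) N =
      sc (\<i> / (2 * pi)) (T (abs_test (kernel_riemann_sum s \<phi> N)))"
proof -
  interpret T: Vector_Spaces.linear test_scale sc T by fact
  define I where "I = {- int (N\<^sup>2)..<int (N\<^sup>2)}"
  define z where "z k = Complex (real_of_int k / N) s" for k :: int
  define a where "a k = of_real (1 / real N) * \<phi> (z k)" for k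
  have K: "cauchy_kernel (z k) \<in> O_strip m" for k
    by (rule cauchy_kernel_O_strip(1)[OF m]) (use s in \<open>simp add: z_def\<close>)
  have O: "(\<lambda>\<zeta>. a k * cauchy_kernel (z k) \<zeta>) \<in> O_strip m" for k by (rule O_strip_scale[OF K])
  have eq: "kernel_riemann_sum s \<phi> N = (\<lambda>\<zeta>. \<Sum>k\<in>I. a k * cauchy_kernel (z k) \<zeta>)"
    by (simp add: kernel_riemann_sum_def riemann_sum_def fun_eq_iff I_def z_def a_def mult.assoc)
  show "kernel_riemann_sum s \<phi> N \<in> O_strip m"
    unfolding eq by (rule O_strip_sum) (auto simp: I_def intro: O)
  have "abs_test (kernel_riemann_sum s \<phi> N) = (\<Sum>k\<in>I. abs_test (\<lambda>\<zeta>. a k * cauchy_kernel (z k) \<zeta>))"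
    unfolding eq by (rule abs_test_sum[OF m, symmetric]) (auto simp: I_def intro: O)
  also have "\<dots> = (\<Sum>k\<in>I. test_scale (a k) (abs_test (cauchy_kernel (z k))))"
    by (simp add: abs_test_scale[OF m K])
  finally have "T (abs_test (kernel_riemann_sum s \<phi> N)) = (\<Sum>k\<in>I. sc (a k) (T (abs_test (cauchy_kernel (z k)))))"
    by (simp add: T.sum T.scale)
  moreover have "s \<noteq> 0" using s by auto
  ultimately show "riemann_sum sc (path_integrand sc s (cauchy_transform T) \<phi>) N =
      sc (\<i> / (2 * pi)) (T (abs_test (kernel_riemann_sum s \<phi> N)))"
    by (simp add: riemann_sum_def path_integrand_def cauchy_transform_def I_def a_def z_def scale_sum_right mult_ac)
qed

text \<open>
  The Lipschitz and decay constants of the integrand contain the factor \<open>exp (- \<bar>Re \<zeta>\<bar> / m)\<close>. Without it the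
  error would not be small in the norm of \<open>O_strip m\<close>. Taking \<open>m > n\<close> leaves a part of the decay of
  \<open>\<phi>\<close> for the integration.
\<close>

lemma kernel_riemann_sum_error:
  fixes m :: nat
  assumes n: "n \<ge> 1" and \<phi>: "\<phi> \<in> O_strip n" and \<sigma>: "\<sigma> \<in> {-1, 1 :: real}"
    and t_def: "t = 1 / (2 * real n)" and m_def: "m = 4 * n"
  obtains C d where "0 < d"
    "\<And>\<zeta> N. \<bar>Im \<zeta>\<bar> \<le> 1 / m \<Longrightarrow> 0 < N \<Longrightarrow>
      cmod (kernel_riemann_sum (\<sigma> * t) \<phi> N \<zeta> - (LINT x|lebesgue. \<phi> (Complex x (\<sigma> * t)) * cauchy_kernel (Complex x (\<sigma> * t)) \<zeta>))
        \<le> (C * exp (- \<bar>Re \<zeta>\<bar> / m)) * riemann_error d N"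
    "\<And>\<zeta>. \<bar>Im \<zeta>\<bar> \<le> 1 / m \<Longrightarrow>
      integrable lebesgue (\<lambda>x. \<phi> (Complex x (\<sigma> * t)) * cauchy_kernel (Complex x (\<sigma> * t)) \<zeta>)"
proof -
  \<comment> \<open>the unit in which all heights are integers: \<open>1 / n = 16 q\<close>, \<open>t = 8 q\<close>, \<open>1 / m = 4 q\<close>\<close>
  define q where "q = 1 / (16 * real n)"
  have q: "0 < q" "q \<le> 1" using n by (simp_all add: q_def field_simps)
  have qs: "1 / real n = 16 * q" "t = 8 * q" "1 / real m = 4 * q" using n by (simp_all add: q_def t_def m_def field_simps)
  define d where "d = 1 / real n - 1 / real m"
  have d: "0 < d" using q by (simp add: d_def qs)
  define A where "A = exp (14\<^sup>2 + 1) / (2 * q)"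
  define C where "C = O_strip_norm n \<phi> * A"
  have m: "m \<ge> 1" using n by (simp add: m_def)
  have A: "0 \<le> A" using q by (simp add: A_def)
  have C: "0 \<le> C" using O_strip_norm_nonneg[OF \<phi>] A by (simp add: C_def)
  have tame: "tame ((C * exp (- \<bar>Re \<zeta>\<bar> / m)) * tame_const q d) d
      (\<lambda>x. \<phi> (Complex x (\<sigma> * t)) * cauchy_kernel (Complex x (\<sigma> * t)) \<zeta>)" if \<zeta>: "\<bar>Im \<zeta>\<bar> \<le> 1 / m" for \<zeta>
  proof (rule tame_line[OF _ q(1) d])
    let ?S = "hstrip (\<sigma> * t - 2 * q) (\<sigma> * t + 2 * q)"
    have S: "6 * q \<le> \<bar>Im w\<bar> \<and> \<bar>Im w\<bar> \<le> 10 * q" if "w \<in> ?S" for w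
      using that \<sigma> qs(2) q by auto
    have "\<zeta> \<notin> ?S" using S[of \<zeta>] \<zeta> qs(3) q by auto
    then show "(\<lambda>w. \<phi> w * cauchy_kernel w \<zeta>) holomorphic_on ?S"
      using S qs(1) q by (intro holomorphic_on_mult holomorphic_cauchy_kernel(2) holomorphic_on_subset[OF O_strip_holomorphic[OF \<phi>]])
        (force simp: abs_less_iff)+
    fix w assume w: "w \<in> ?S"
    have "\<bar>Im w\<bar> \<le> 1 / n" using S[OF w] qs(1) q by simp
    from O_strip_norm_bound[OF \<phi> this]
    have 1: "cmod (\<phi> w) \<le> O_strip_norm n \<phi> * exp (- \<bar>Re w\<bar> / n)" .
    have 2: "cmod (cauchy_kernel w \<zeta>) \<le> (A * exp (\<bar>Re w\<bar> / m)) * exp (- \<bar>Re \<zeta>\<bar> / m)"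
      unfolding A_def
      by (rule cauchy_kernel_weighted[OF _ _ _ m]) (use S[OF w] \<zeta> qs(3) q in linarith)+
    have "cmod (\<phi> w * cauchy_kernel w \<zeta>) \<le>
        (O_strip_norm n \<phi> * exp (- \<bar>Re w\<bar> / n)) * ((A * exp (\<bar>Re w\<bar> / m)) * exp (- \<bar>Re \<zeta>\<bar> / m))"
      unfolding norm_mult using O_strip_norm_nonneg[OF \<phi>] by (intro mult_mono 1 2) auto
    also have "\<dots> = (C * exp (- \<bar>Re \<zeta>\<bar> / m)) * (exp (- \<bar>Re w\<bar> / n) * exp (\<bar>Re w\<bar> / m))"
      by (simp add: C_def mult_ac)
    also have "exp (- \<bar>Re w\<bar> / n) * exp (\<bar>Re w\<bar> / m) = exp (- d * \<bar>Re w\<bar>)"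
      by (simp add: d_def algebra_simps flip: exp_add)
    finally show "cmod (\<phi> w * cauchy_kernel w \<zeta>) \<le> (C * exp (- \<bar>Re \<zeta>\<bar> / m)) * exp (- d * \<bar>Re w\<bar>)" .
  qed
  show ?thesis
  proof (rule that[of d "C * tame_const q d"])
    fix \<zeta> and N :: nat assume \<zeta>: "\<bar>Im \<zeta>\<bar> \<le> 1 / m" and N: "0 < N"
    have "0 \<le> (C * exp (- \<bar>Re \<zeta>\<bar> / m)) * tame_const q d"
      using C tame_const_pos[OF q(1), of d] by simp
    from riemann_sum_error[OF tame[OF \<zeta>] d N this]
    show "cmod (kernel_riemann_sum (\<sigma> * t) \<phi> N \<zeta> - (LINT x|lebesgue. \<phi> (Complex x (\<sigma> * t)) * cauchy_kernel (Complex x (\<sigma> * t)) \<zeta>))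
        \<le> (C * tame_const q d * exp (- \<bar>Re \<zeta>\<bar> / m)) * riemann_error d N"
      unfolding kernel_riemann_sum_def by (simp add: mult_ac)
  next
    fix \<zeta> assume "\<bar>Im \<zeta>\<bar> \<le> 1 / m"
    then show "integrable lebesgue (\<lambda>x. \<phi> (Complex x (\<sigma> * t)) * cauchy_kernel (Complex x (\<sigma> * t)) \<zeta>)"
      by (rule tame_integrable[OF tame d])
  qed (rule d)
qed

text \<open>
  The Cauchy formula for \<open>\<phi>\<close> multiplied by the Gaussian centred at \<open>\<zeta>\<close>.
\<close>

lemma kernel_reproduces:
  assumes \<phi>: "\<phi> \<in> O_strip n" and t: "0 < t" "t < 1 / n" and \<zeta>: "\<bar>Im \<zeta>\<bar> < t"
    and int: "\<And>\<sigma>. \<sigma> \<in> {-1, 1 :: real} \<Longrightarrow>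
      integrable lebesgue (\<lambda>x. \<phi> (Complex x (\<sigma> * t)) * cauchy_kernel (Complex x (\<sigma> * t)) \<zeta>)"
  shows "(LINT x|lebesgue. \<phi> (Complex x (-1 * t)) * cauchy_kernel (Complex x (-1 * t)) \<zeta>) -
    (LINT x|lebesgue. \<phi> (Complex x (1 * t)) * cauchy_kernel (Complex x (1 * t)) \<zeta>) = 2 * pi * \<i> * \<phi> \<zeta>"
proof -
  define h where "h w = \<phi> w * exp (- (w - \<zeta>)\<^sup>2)" for w
  have h_eq: "\<phi> w * cauchy_kernel w \<zeta> = h w / (w - \<zeta>)" for w
    by (simp add: h_def cauchy_kernel_def)
  have "(LINT x|lebesgue. h (Complex x (-1 * t)) / (Complex x (-1 * t) - \<zeta>)) -
    (LINT x|lebesgue. h (Complex x (1 * t)) / (Complex x (1 * t) - \<zeta>)) = 2 * pi * \<i> * h \<zeta>"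
  proof (rule strip_Cauchy_formula)
    show "h holomorphic_on hstrip (- (1 / n)) (1 / n)"
      unfolding h_def by (intro holomorphic_intros O_strip_holomorphic \<phi>)
    fix w assume w: "w \<in> hstrip (- (1 / n)) (1 / n)"
    then have "\<bar>Im w\<bar> \<le> 1 / n" by auto
    from O_strip_norm_bound[OF \<phi> this]
    have "cmod (\<phi> w) \<le> O_strip_norm n \<phi> * exp (- \<bar>Re w\<bar> / n)" .
    also have "\<dots> \<le> O_strip_norm n \<phi> * 1"
      using O_strip_norm_nonneg[OF \<phi>] by (intro mult_left_mono) auto
    finally have 1: "cmod (\<phi> w) \<le> O_strip_norm n \<phi>" by simp
    have "\<bar>Im w - Im \<zeta>\<bar> \<le> 2 * (1 / n)" using w \<zeta> t by auto
    from gaussian_bound[OF this]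
    have "cmod (exp (- (w - \<zeta>)\<^sup>2)) \<le> exp ((2 * (1 / n))\<^sup>2 + 1) * exp (- 2 * \<bar>Re w - Re \<zeta>\<bar>)" .
    also have "\<dots> \<le> exp ((2 * (1 / n))\<^sup>2 + 1) * 1" by (intro mult_left_mono) auto
    finally have 2: "cmod (exp (- (w - \<zeta>)\<^sup>2)) \<le> exp ((2 * (1 / n))\<^sup>2 + 1)" by simp
    show "cmod (h w) \<le> O_strip_norm n \<phi> * exp ((2 * (1 / n))\<^sup>2 + 1)"
      unfolding h_def norm_mult by (intro mult_mono 1 2 O_strip_norm_nonneg \<phi>) auto
  qed (use t \<zeta> int[of "-1"] int[of 1] in \<open>auto simp: h_eq\<close>)
  then show ?thesis by (simp add: h_eq) (simp add: h_def)
qed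

text \<open>
  The Riemann sums of the integrals of \<open>cauchy_transform T\<close> against \<open>\<phi>\<close> over the two lines are the values
  of \<open>T\<close> at \<open>kernel_riemann_sum\<close>, up to the constant. Their difference tends to \<open>- T \<Phi>\<close> because \<open>\<psi> N\<close>, the error in Cauchy's
  formula, tends to \<open>0\<close> in the norm of \<open>O_strip m\<close>; it also tends to the difference of the integrals.
\<close>

theorem R_map_cauchy_transform:
  assumes T: "T \<in> continuous_linear_maps test_scale sc"
  shows "R_map sc (cauchy_transform T) = T"
proof
  fix \<Phi>
  have lin: "Vector_Spaces.linear test_scale sc T" using T by (simp add: continuous_linear_maps_def)
  interpret T: Vector_Spaces.linear test_scale sc T by (rule lin)
  note F = cauchy_transform_slit[OF T]
  obtain n \<phi> where n: "n \<ge> 1" and \<phi>: "\<phi> \<in> O_strip n" and \<Phi>: "\<Phi> = abs_test \<phi>" by (rule test_cases)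
  define t where "t = 1 / (2 * real n)"
  define m where "m = 4 * n"
  have t: "0 < t" "t < 1 / n" "1 / real m < t" and m: "m \<ge> 1" "n \<le> m"
    using n by (simp_all add: t_def m_def field_simps)
  let ?J = "\<lambda>\<sigma> \<zeta>. LINT x|lebesgue. \<phi> (Complex x (\<sigma> * t)) * cauchy_kernel (Complex x (\<sigma> * t)) \<zeta>"
  obtain C\<^sub>1 d\<^sub>1 where 1: "0 < d\<^sub>1" "\<And>\<zeta> N. \<bar>Im \<zeta>\<bar> \<le> 1 / m \<Longrightarrow> 0 < N \<Longrightarrow>
      cmod (kernel_riemann_sum (-1 * t) \<phi> N \<zeta> - ?J (-1) \<zeta>) \<le> (C\<^sub>1 * exp (- \<bar>Re \<zeta>\<bar> / m)) * riemann_error d\<^sub>1 N"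
    "\<And>\<zeta>. \<bar>Im \<zeta>\<bar> \<le> 1 / m \<Longrightarrow> integrable lebesgue (\<lambda>x. \<phi> (Complex x (-1 * t)) * cauchy_kernel (Complex x (-1 * t)) \<zeta>)"
    by (rule kernel_riemann_sum_error[OF n \<phi> _ t_def m_def, of "-1"]) (simp, rule that)
  obtain C\<^sub>2 d\<^sub>2 where 2: "0 < d\<^sub>2" "\<And>\<zeta> N. \<bar>Im \<zeta>\<bar> \<le> 1 / m \<Longrightarrow> 0 < N \<Longrightarrow>
      cmod (kernel_riemann_sum (1 * t) \<phi> N \<zeta> - ?J 1 \<zeta>) \<le> (C\<^sub>2 * exp (- \<bar>Re \<zeta>\<bar> / m)) * riemann_error d\<^sub>2 N"
    "\<And>\<zeta>. \<bar>Im \<zeta>\<bar> \<le> 1 / m \<Longrightarrow> integrable lebesgue (\<lambda>x. \<phi> (Complex x (1 * t)) * cauchy_kernel (Complex x (1 * t)) \<zeta>)"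
    by (rule kernel_riemann_sum_error[OF n \<phi> _ t_def m_def, of 1]) (simp, rule that)
  define err where "err N = C\<^sub>1 * riemann_error d\<^sub>1 N + C\<^sub>2 * riemann_error d\<^sub>2 N" for N
  have \<phi>_m: "\<phi> \<in> O_strip m" using O_strip_mono[OF n m(2)] \<phi> by blast
  define \<psi> where "\<psi> N = (\<lambda>\<zeta>. 1 * kernel_riemann_sum (-1 * t) \<phi> N \<zeta> + (-1) * kernel_riemann_sum (1 * t) \<phi> N \<zeta> + (- (2 * pi * \<i>)) * \<phi> \<zeta>)" for N
  have \<psi>_norm: "O_strip_norm m (\<psi> N) \<le> err N" if N: "0 < N" for N
  proof (rule O_strip_norm_leI)
    fix \<zeta> assume \<zeta>: "\<bar>Im \<zeta>\<bar> \<le> 1 / m"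
    have "?J (-1) \<zeta> - ?J 1 \<zeta> = 2 * pi * \<i> * \<phi> \<zeta>"
      by (rule kernel_reproduces[OF \<phi> t(1,2)]) (use \<zeta> t 1(3) 2(3) in auto)
    then have "\<psi> N \<zeta> = (kernel_riemann_sum (-1 * t) \<phi> N \<zeta> - ?J (-1) \<zeta>) - (kernel_riemann_sum (1 * t) \<phi> N \<zeta> - ?J 1 \<zeta>)"
      by (simp add: \<psi>_def algebra_simps)
    also have "cmod \<dots> \<le> (C\<^sub>1 * exp (- \<bar>Re \<zeta>\<bar> / m)) * riemann_error d\<^sub>1 N + (C\<^sub>2 * exp (- \<bar>Re \<zeta>\<bar> / m)) * riemann_error d\<^sub>2 N"
      by (intro order_trans[OF norm_triangle_ineq4] add_mono 1(2) 2(2) \<zeta> N)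
    finally show "cmod (\<psi> N \<zeta>) \<le> err N * exp (- \<bar>Re \<zeta>\<bar> / m)"
      by (simp add: err_def algebra_simps)
  qed
  have st: "1 / real m < \<bar>-1 * t\<bar>" "1 / real m < \<bar>1 * t\<bar>" using t by auto
  note K\<^sub>1 = kernel_riemann_sum_test[OF lin m(1) st(1), of \<phi>]
  note K\<^sub>2 = kernel_riemann_sum_test[OF lin m(1) st(2), of \<phi>]
  note lc = linear_combination_test[OF lin m(1) K\<^sub>1(1) K\<^sub>2(1) \<phi>_m]
  define X where "X N = riemann_sum sc (path_integrand sc (-1 * t) (cauchy_transform T) \<phi>) N" for N
  define Y where "Y N = riemann_sum sc (path_integrand sc (1 * t) (cauchy_transform T) \<phi>) N" for N
  have XY: "X N + sc (-1) (Y N) + T \<Phi> = sc (\<i> / (2 * pi)) (T (abs_test (\<psi> N)))" for N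
    unfolding \<psi>_def lc(2) X_def Y_def K\<^sub>1(2) K\<^sub>2(2) \<Phi> by (simp add: scale_right_distrib scale_right_diff_distrib)
  have "(\<lambda>N. X N + sc (-1) (Y N) + T \<Phi>) \<longlonglongrightarrow> 0"
    unfolding seminorm_tendsto_iff
  proof
    fix \<alpha>
    obtain C where C: "0 \<le> C" "\<And>\<phi>. \<phi> \<in> O_strip m \<Longrightarrow> p \<alpha> (T (abs_test \<phi>)) \<le> C * O_strip_norm m \<phi>"
      by (rule continuous_linear_on_test[OF T m(1), of \<alpha>]) (rule that)
    define c where "c = cmod (\<i> / (2 * pi))"
    have "(\<lambda>N. c * (C * err N)) \<longlonglongrightarrow> c * (C * (C\<^sub>1 * 0 + C\<^sub>2 * 0))"
      unfolding err_def by (intro tendsto_intros riemann_error_tendsto 1(1) 2(1))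
    then have lim: "(\<lambda>N. c * (C * err N)) \<longlonglongrightarrow> 0" by simp
    have "\<forall>\<^sub>F N in sequentially. p \<alpha> (X N + sc (-1) (Y N) + T \<Phi> - 0) \<le> c * (C * err N)"
      using eventually_gt_at_top[of 0]
    proof eventually_elim
      case (elim N)
      have "\<psi> N \<in> O_strip m" unfolding \<psi>_def by (rule lc(1))
      then have "p \<alpha> (T (abs_test (\<psi> N))) \<le> C * O_strip_norm m (\<psi> N)" by (rule C(2))
      also have "\<dots> \<le> C * err N" by (intro mult_left_mono \<psi>_norm elim C(1))
      finally have "c * p \<alpha> (T (abs_test (\<psi> N))) \<le> c * (C * err N)"
        unfolding c_def by (rule mult_left_mono) simp
      then show ?case unfolding XY diff_zero p.homogeneous c_def .
    qed
    then show "(\<lambda>N. p \<alpha> (X N + sc (-1) (Y N) + T \<Phi> - 0)) \<longlonglongrightarrow> 0"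
      by (intro tendsto_sandwich[OF _ _ tendsto_const lim]) simp_all
  qed
  moreover have "(\<lambda>N. X N + sc (-1) (Y N) + T \<Phi>) \<longlonglongrightarrow>
      line_int (-1 * t) (cauchy_transform T) \<phi> + sc (-1) (line_int (1 * t) (cauchy_transform T) \<phi>) + T \<Phi>"
    unfolding X_def Y_def
    by (intro seminorm_tendsto_add seminorm_tendsto_scale tendsto_const riemann_sum_tendsto
        line_integral_independent(3)[OF F n \<phi> _ t(1,2) t(1,2)]) auto
  ultimately have "line_int (-1 * t) (cauchy_transform T) \<phi> + sc (-1) (line_int (1 * t) (cauchy_transform T) \<phi>) + T \<Phi> = 0"
    using LIMSEQ_unique by blast
  then have "T \<Phi> = line_int (1 * t) (cauchy_transform T) \<phi> - line_int (-1 * t) (cauchy_transform T) \<phi>"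
    by (simp add: algebra_simps eq_neg_iff_add_eq_0)
  then show "R_map sc (cauchy_transform T) \<Phi> = T \<Phi>"
    using boundary_value_eq_line_int[OF F n \<phi> _ t(1,2), of 1] boundary_value_eq_line_int[OF F n \<phi> _ t(1,2), of "-1"]
    by (simp add: R_map_eq[OF F] \<Phi>)
qed

end

subsection \<open>Injectivity\<close>

context sc_lcs
begin

text \<open>
  Here the variable of integration is the first argument of the kernel, as in Cauchy's formula.
\<close>

abbreviation kernel_line_int :: "(complex \<Rightarrow> 'e) \<Rightarrow> real \<Rightarrow> complex \<Rightarrow> 'e" where
  "kernel_line_int f s z \<equiv> pettis_integral sc (\<lambda>x. sc (cauchy_kernel (Complex x s) z) (f (Complex x s)))"

lemma holomorphic_decaying_kernel:
  assumes f: "f \<in> Oexp_slit sc p" and \<epsilon>: "0 < \<epsilon>"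
    and y: "\<And>y. a < y \<Longrightarrow> y < b \<Longrightarrow> \<epsilon> \<le> \<bar>y\<bar> \<and> \<bar>y\<bar> \<le> 2 \<and> \<epsilon> \<le> \<bar>y - Im z\<bar>"
  shows "holomorphic_decaying a b (\<lambda>w. sc (cauchy_kernel w z) (f w))"
  unfolding holomorphic_decaying_def
proof (intro conjI allI)
  have S: "\<epsilon> \<le> \<bar>Im w\<bar>" "\<bar>Im w\<bar> \<le> 2" "\<epsilon> \<le> \<bar>Im w - Im z\<bar>" if "w \<in> hstrip a b" for w
    using y[of "Im w"] that by auto
  have "z \<notin> hstrip a b" using S(3)[of z] \<epsilon> by auto
  moreover have "hstrip a b \<subseteq> {z. Im z \<noteq> 0}"
  proof
    fix w assume "w \<in> hstrip a b"
    then have "\<epsilon> \<le> \<bar>Im w\<bar>" by (rule S(1))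
    then show "w \<in> {z. Im z \<noteq> 0}" using \<epsilon> by auto
  qed
  ultimately show "weakly_holomorphic_on (\<lambda>w. sc (cauchy_kernel w z) (f w)) (hstrip a b)"
    by (intro weakly_holomorphic_on_scale holomorphic_cauchy_kernel(2)
        weakly_holomorphic_on_subset[OF Oexp_slit_weakly_holomorphic[OF f]])
  fix \<alpha>
  obtain N :: nat where N0: "max 3 (1 / \<epsilon>) < real N" using reals_Archimedean2 by blast
  then have N: "N \<ge> 2" and N\<epsilon>: "1 / real N < \<epsilon>" using \<epsilon> by (simp_all add: field_simps)
  define L where "L = 2 + \<bar>Im z\<bar>"
  define A where "A = exp (L\<^sup>2 + 1) / \<epsilon> * exp (\<bar>Re z\<bar> / real 1)"
  define K where "K = Oexp_norm p N \<alpha> f"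
  have A: "0 \<le> A" using \<epsilon> by (simp add: A_def)
  have K: "0 \<le> K" unfolding K_def by (rule Oexp_norm_nonneg[OF f N])
  have "p \<alpha> (sc (cauchy_kernel w z) (f w)) \<le> (A * K) * exp (- (1 / 2) * \<bar>Re w\<bar>)" if w: "w \<in> hstrip a b" for w
  proof -
    have "cmod (cauchy_kernel w z) = cmod (cauchy_kernel z w)" by (subst cauchy_kernel_swap) simp
    also have "\<dots> \<le> A * exp (- \<bar>Re w\<bar> / real 1)"
      unfolding A_def
      by (rule cauchy_kernel_weighted) (use S[OF w] \<epsilon> in \<open>auto simp: L_def abs_minus_commute\<close>)
    finally have 1: "cmod (cauchy_kernel w z) \<le> A * exp (- \<bar>Re w\<bar>)" by simp
    have "p \<alpha> (f w) \<le> K * exp (\<bar>Re w\<bar> / N)"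
      unfolding K_def using S[OF w] N0 N\<epsilon> by (intro Oexp_norm_upper f N) auto
    also have "\<bar>Re w\<bar> / N \<le> \<bar>Re w\<bar> / 2" using N by (intro divide_left_mono) auto
    then have "K * exp (\<bar>Re w\<bar> / N) \<le> K * exp (\<bar>Re w\<bar> / 2)" using K by (intro mult_left_mono) auto
    finally have 2: "p \<alpha> (f w) \<le> K * exp (\<bar>Re w\<bar> / 2)" .
    have "p \<alpha> (sc (cauchy_kernel w z) (f w)) \<le> (A * exp (- \<bar>Re w\<bar>)) * (K * exp (\<bar>Re w\<bar> / 2))"
      unfolding p.homogeneous using A by (intro mult_mono 1 2) auto
    also have "\<dots> = (A * K) * exp (- (1 / 2) * \<bar>Re w\<bar>)" by (simp add: field_simps flip: exp_add)
    finally show ?thesis .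
  qed
  then show "\<exists>C d. 0 < d \<and> 0 \<le> C \<and> (\<forall>w\<in>hstrip a b. p \<alpha> (sc (cauchy_kernel w z) (f w)) \<le> C * exp (- d * \<bar>Re w\<bar>))"
    using A K by (intro exI[of _ "A * K"] exI[of _ "1 / 2"]) auto
qed

lemma kernel_line_int_has_integral:
  assumes f: "f \<in> Oexp_slit sc p" and s: "s \<noteq> 0" "\<bar>s\<bar> \<le> 1" "s \<noteq> Im z"
  shows "has_pettis_integral sc (\<lambda>x. sc (cauchy_kernel (Complex x s) z) (f (Complex x s))) (kernel_line_int f s z)"
proof -
  define \<epsilon> where "\<epsilon> = min \<bar>s\<bar> \<bar>s - Im z\<bar> / 2"
  have \<epsilon>: "0 < \<epsilon>" "2 * \<epsilon> \<le> \<bar>s\<bar>" "2 * \<epsilon> \<le> \<bar>s - Im z\<bar>" using s by (auto simp: \<epsilon>_def)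
  have "holomorphic_decaying (s - \<epsilon>) (s + \<epsilon>) (\<lambda>w. sc (cauchy_kernel w z) (f w))"
    by (rule holomorphic_decaying_kernel[OF f \<epsilon>(1)]) (use \<epsilon> s in arith)
  then show ?thesis by (rule holomorphic_decaying_has_integral) (use \<epsilon> in auto)
qed

lemma kernel_line_int_shift:
  assumes f: "f \<in> Oexp_slit sc p" and \<sigma>: "\<sigma> \<in> {-1, 1 :: real}" and s: "0 < s" "s \<le> 1" "\<sigma> * Im z < 0"
  shows "kernel_line_int f (\<sigma> * 1) z = kernel_line_int f (\<sigma> * s) z"
proof -
  define \<epsilon> where "\<epsilon> = s / 2"
  define a where "a = (if \<sigma> = 1 then \<epsilon> else -2)"
  define b where "b = (if \<sigma> = 1 then 2 else - \<epsilon>)"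
  have "holomorphic_decaying a b (\<lambda>w. sc (cauchy_kernel w z) (f w))"
  proof (rule holomorphic_decaying_kernel[OF f])
    show "0 < \<epsilon>" using s by (simp add: \<epsilon>_def)
    show "\<epsilon> \<le> \<bar>y\<bar> \<and> \<bar>y\<bar> \<le> 2 \<and> \<epsilon> \<le> \<bar>y - Im z\<bar>" if "a < y" "y < b" for y
      using that \<sigma> s by (auto simp: a_def b_def \<epsilon>_def)
  qed
  then show ?thesis
    by (rule holomorphic_decaying_shift) (use \<sigma> s in \<open>auto simp: a_def b_def \<epsilon>_def\<close>)
qed

text \<open>
  Functionals in a polar reduce this to the scalar formula for \<open>u (f w) exp (- (w - z)\<^sup>2)\<close>. This function is
  bounded, because the Gaussian outweighs the growth of \<open>f\<close>.
\<close>

lemma vector_Cauchy_formula: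
  assumes f: "f \<in> Oexp_slit sc p" and z: "a < Im z" "Im z < b" and ab: "0 < a \<or> b < 0" "\<bar>a\<bar> \<le> 1" "\<bar>b\<bar> \<le> 1"
  shows "kernel_line_int f a z - kernel_line_int f b z = sc (2 * pi * \<i>) (f z)"
proof (rule polar_separates)
  fix u \<alpha> assume u: "u \<in> polar \<alpha>"
  note D = dual_simps[OF polar_dual[OF u]]
  define \<epsilon> where "\<epsilon> = min \<bar>a\<bar> \<bar>b\<bar> / 2"
  have \<epsilon>: "0 < \<epsilon>" "2 * \<epsilon> \<le> \<bar>a\<bar>" "2 * \<epsilon> \<le> \<bar>b\<bar>" "\<epsilon> \<le> 1" using z ab by (auto simp: \<epsilon>_def)
  define a' b' where "a' = a - \<epsilon>" and "b' = b + \<epsilon>"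
  have S: "\<epsilon> \<le> \<bar>Im w\<bar> \<and> \<bar>Im w\<bar> \<le> 2" if "w \<in> hstrip a' b'" for w
    using that \<epsilon> ab z by (auto simp: a'_def b'_def)
  obtain N :: nat where N0: "max 3 (1 / \<epsilon>) < real N" using reals_Archimedean2 by blast
  then have N: "N \<ge> 2" and N\<epsilon>: "1 / real N < \<epsilon>" using \<epsilon>(1) by (simp_all add: field_simps)
  define K where "K = Oexp_norm p N \<alpha> f"
  have K: "0 \<le> K" unfolding K_def by (rule Oexp_norm_nonneg[OF f N])
  define h where "h w = u (f w) * exp (- (w - z)\<^sup>2)" for w
  have h_eq: "u (sc (cauchy_kernel w z) (f w)) = h w / (w - z)" for w
    by (simp add: h_def cauchy_kernel_def D)
  have I: "integrable lebesgue (\<lambda>x. h (Complex x s) / (Complex x s - z))"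
    "(LINT x|lebesgue. h (Complex x s) / (Complex x s - z)) = u (kernel_line_int f s z)" if "s \<in> {a, b}" for s
  proof -
    have "s \<noteq> 0" "\<bar>s\<bar> \<le> 1" "s \<noteq> Im z" using that z ab by auto
    from kernel_line_int_has_integral[OF f this, unfolded has_pettis_integral_def, rule_format, OF polar_dual[OF u]]
    show "integrable lebesgue (\<lambda>x. h (Complex x s) / (Complex x s - z))"
      "(LINT x|lebesgue. h (Complex x s) / (Complex x s - z)) = u (kernel_line_int f s z)"
      by (simp_all add: h_eq)
  qed
  have "(LINT x|lebesgue. h (Complex x a) / (Complex x a - z)) -
    (LINT x|lebesgue. h (Complex x b) / (Complex x b - z)) = 2 * pi * \<i> * h z"
  proof (rule strip_Cauchy_formula[where a' = a' and b' = b'])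
    have "hstrip a' b' \<subseteq> {z. Im z \<noteq> 0}"
    proof
      fix w assume "w \<in> hstrip a' b'"
      from S[OF this] show "w \<in> {z. Im z \<noteq> 0}" using \<epsilon>(1) by auto
    qed
    then have "(\<lambda>w. u (f w)) holomorphic_on hstrip a' b'"
      using weakly_holomorphic_onD[OF Oexp_slit_weakly_holomorphic[OF f] u] by (rule holomorphic_on_subset[rotated])
    then show "h holomorphic_on hstrip a' b'"
      unfolding h_def by (intro holomorphic_intros)
    fix w assume w: "w \<in> hstrip a' b'"
    have "cmod (u (f w)) \<le> p \<alpha> (f w)" by (rule polar_le[OF u])
    also have "\<dots> \<le> K * exp (\<bar>Re w\<bar> / N)"
      unfolding K_def using S[OF w] N0 N\<epsilon> by (intro Oexp_norm_upper f N) auto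
    also have "\<bar>Re w\<bar> / N \<le> \<bar>Re w\<bar> / 1" using N by (intro divide_left_mono) auto
    also have "\<dots> \<le> \<bar>Re w - Re z\<bar> + \<bar>Re z\<bar>" by simp
    finally have 1: "cmod (u (f w)) \<le> K * exp (\<bar>Re w - Re z\<bar> + \<bar>Re z\<bar>)"
      using K by (simp add: mult_left_mono)
    have "\<bar>Im w - Im z\<bar> \<le> 3" using S[OF w] z ab by auto
    from gaussian_bound[OF this]
    have 2: "cmod (exp (- (w - z)\<^sup>2)) \<le> exp (3\<^sup>2 + 1) * exp (- 2 * \<bar>Re w - Re z\<bar>)" .
    have "cmod (h w) \<le> (K * exp (\<bar>Re w - Re z\<bar> + \<bar>Re z\<bar>)) * (exp (3\<^sup>2 + 1) * exp (- 2 * \<bar>Re w - Re z\<bar>))"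
      unfolding h_def norm_mult using K by (intro mult_mono 1 2) auto
    also have "\<dots> = (K * exp (3\<^sup>2 + 1) * exp \<bar>Re z\<bar>) * exp (- \<bar>Re w - Re z\<bar>)"
      by (simp add: mult_ac flip: exp_add)
    also have "\<dots> \<le> (K * exp (3\<^sup>2 + 1) * exp \<bar>Re z\<bar>) * 1"
      using K by (intro mult_left_mono) auto
    finally show "cmod (h w) \<le> (K * exp (3\<^sup>2 + 1) * exp \<bar>Re z\<bar>) * 1" .
  qed (use z \<epsilon> I(1) in \<open>auto simp: a'_def b'_def\<close>)
  moreover have "h z = u (f z)" by (simp add: h_def)
  ultimately show "u (kernel_line_int f a z - kernel_line_int f b z) = u (sc (2 * pi * \<i>) (f z))"
    by (simp add: I(2) D)
qed

text \<open>
  Up to the sign coming from \<open>cauchy_kernel_swap\<close>, the two sides are the integrals of \<open>f\<close> against the test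
  function \<open>cauchy_kernel z\<close> below and above the real line. They differ by \<open>R_map sc f\<close>.
\<close>

lemma R_map_zero_kernel:
  assumes f: "f \<in> Oexp_slit sc p" and R: "R_map sc f = 0" and s: "0 < s" "2 * s < \<bar>Im z\<bar>" and m: "m \<ge> 1" "s = 1 / (2 * real m)"
  shows "kernel_line_int f (- s) z = kernel_line_int f s z"
proof -
  have K: "cauchy_kernel z \<in> O_strip m"
    by (rule cauchy_kernel_O_strip(1)[OF m(1)]) (use s m in simp)
  have sm: "s < 1 / m" using m by (simp add: field_simps)
  have "line_int (- s) f (cauchy_kernel z) = line_int s f (cauchy_kernel z)"
    using path_integral_gamma_eq[OF f m(1) K s(1) sm] R by (simp add: path_integral_gamma_def)
  moreover have "kernel_line_int f t z = - line_int t f (cauchy_kernel z)" if "t \<in> {s, - s}" for t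
  proof -
    have "has_pettis_integral sc (path_integrand sc t f (cauchy_kernel z)) (line_int t f (cauchy_kernel z))"
      using line_integral_independent(2)[OF f m(1) K _ s(1) sm s(1) sm, of 1]
        line_integral_independent(2)[OF f m(1) K _ s(1) sm s(1) sm, of "-1"] that by auto
    from pettis_integral_eq[OF has_pettis_integral_scale[OF this, of "-1"]]
    have "pettis_integral sc (\<lambda>x. - path_integrand sc t f (cauchy_kernel z) x) = - line_int t f (cauchy_kernel z)"
      by simp
    moreover have "(\<lambda>x. - path_integrand sc t f (cauchy_kernel z) x) = (\<lambda>x. sc (cauchy_kernel (Complex x t) z) (f (Complex x t)))"
      by (simp add: path_integrand_def fun_eq_iff cauchy_kernel_swap[of "Complex _ t"])
    ultimately show ?thesis by simp
  qed
  ultimately show ?thesis by simp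
qed

definition strip_extension :: "(complex \<Rightarrow> 'e) \<Rightarrow> complex \<Rightarrow> 'e" where
  "strip_extension f z = sc (1 / (2 * pi * \<i>)) (kernel_line_int f (-1) z - kernel_line_int f 1 z)"

text \<open>
  Cauchy's formula on the strip between the line of height \<open>\<plusminus> s\<close> and the outer line of height \<open>\<plusminus> 1\<close> on
  the side of \<open>z\<close> expresses \<open>f z\<close> by the integrals over these two lines. The integral over the inner line can be
  moved to the other side of the real axis because \<open>R_map sc f\<close> vanishes on \<open>cauchy_kernel z\<close>, and from
  there to the outer line.
\<close>

lemma strip_extension_eq:
  assumes f: "f \<in> Oexp_slit sc p" and R: "R_map sc f = 0" and z: "Im z \<noteq> 0" "\<bar>Im z\<bar> < 1"
  shows "strip_extension f z = f z"
proof -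
  obtain m :: nat where m0: "max 1 (1 / \<bar>Im z\<bar>) < real m" using reals_Archimedean2 by blast
  then have m: "m \<ge> 1" by auto
  have mz: "1 / real m < \<bar>Im z\<bar>" using m0 m z by (simp add: field_simps)
  define s where "s = 1 / (2 * real m)"
  have "2 * s = 1 / real m" by (simp add: s_def)
  then have s: "0 < s" "2 * s < \<bar>Im z\<bar>" "s < 1" using m mz z by (simp_all add: s_def)
  have zero: "kernel_line_int f (- s) z = kernel_line_int f s z"
    by (rule R_map_zero_kernel[OF f R s(1,2) m s_def])
  have "kernel_line_int f (-1) z - kernel_line_int f 1 z = sc (2 * pi * \<i>) (f z)"
  proof (cases "0 < Im z")
    case True
    have "kernel_line_int f (-1 * 1) z = kernel_line_int f (-1 * s) z"
      by (rule kernel_line_int_shift[OF f]) (use s True in auto)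
    moreover have "kernel_line_int f s z - kernel_line_int f 1 z = sc (2 * pi * \<i>) (f z)"
      by (rule vector_Cauchy_formula[OF f]) (use s True z in auto)
    ultimately show ?thesis using zero by simp
  next
    case False
    then have neg: "Im z < 0" using z by simp
    have "kernel_line_int f (1 * 1) z = kernel_line_int f (1 * s) z"
      by (rule kernel_line_int_shift[OF f]) (use s neg in auto)
    moreover have "kernel_line_int f (-1) z - kernel_line_int f (- s) z = sc (2 * pi * \<i>) (f z)"
      by (rule vector_Cauchy_formula[OF f]) (use s neg z in auto)
    ultimately show ?thesis using zero by simp
  qed
  then show ?thesis by (simp add: strip_extension_def)
qed

text \<open>
  The linear combinations can be formed under the integrals, where \<open>f\<close> grows at most like \<open>exp (\<bar>x\<bar> / N)\<close>. The
  case of three terms serves for difference quotients, the case of one term for the growth.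
\<close>

lemma strip_extension_combination:
  assumes f: "f \<in> Oexp_slit sc p" and N: "N \<ge> 2" "n \<ge> 1" "n < N"
    and z: "\<bar>Im z\<^sub>1\<bar> < 1" "\<bar>Im z\<^sub>2\<bar> < 1" "\<bar>Im z\<^sub>3\<bar> < 1"
    and M: "\<And>w. \<bar>Im w\<bar> = 1 \<Longrightarrow>
      cmod (a * cauchy_kernel z\<^sub>1 w + b * cauchy_kernel z\<^sub>2 w + c * cauchy_kernel z\<^sub>3 w) \<le> M * exp (- \<bar>Re w\<bar> / real n)"
  shows "p \<alpha> (sc a (strip_extension f z\<^sub>1) + sc b (strip_extension f z\<^sub>2) + sc c (strip_extension f z\<^sub>3)) \<le>
    (2 * cmod (1 / (2 * pi * \<i>)) * (Oexp_norm p N \<alpha> f * (LINT x|lebesgue. exp (- (1 / real n - 1 / real N) * \<bar>x\<bar>)))) * M"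
proof -
  define e where "e s = sc a (kernel_line_int f s z\<^sub>1) + sc b (kernel_line_int f s z\<^sub>2) + sc c (kernel_line_int f s z\<^sub>3)" for s
  have e_le: "p \<alpha> (e s) \<le> Oexp_norm p N \<alpha> f * (LINT x|lebesgue. exp (- (1 / real n - 1 / real N) * \<bar>x\<bar>)) * M"
    if s: "\<bar>s\<bar> = 1" for s
  proof (rule weighted_integral_bound[OF _ N(2,3)])
    have "has_pettis_integral sc (\<lambda>x. sc a (sc (cauchy_kernel (Complex x s) z\<^sub>1) (f (Complex x s))) +
        sc b (sc (cauchy_kernel (Complex x s) z\<^sub>2) (f (Complex x s))) + sc c (sc (cauchy_kernel (Complex x s) z\<^sub>3) (f (Complex x s)))) (e s)"
      unfolding e_def
      by (intro has_pettis_integral_add has_pettis_integral_scale kernel_line_int_has_integral f) (use s z in auto)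
    then show "has_pettis_integral sc (\<lambda>x. sc (a * cauchy_kernel (Complex x s) z\<^sub>1 + b * cauchy_kernel (Complex x s) z\<^sub>2 +
        c * cauchy_kernel (Complex x s) z\<^sub>3) (f (Complex x s))) (e s)"
      by (simp add: scale_left_distrib)
    have "a * cauchy_kernel (Complex x s) z\<^sub>1 + b * cauchy_kernel (Complex x s) z\<^sub>2 + c * cauchy_kernel (Complex x s) z\<^sub>3 =
        - (a * cauchy_kernel z\<^sub>1 (Complex x s) + b * cauchy_kernel z\<^sub>2 (Complex x s) + c * cauchy_kernel z\<^sub>3 (Complex x s))" for x
      by (simp add: cauchy_kernel_swap[of "Complex x s"])
    then show "cmod (a * cauchy_kernel (Complex x s) z\<^sub>1 + b * cauchy_kernel (Complex x s) z\<^sub>2 + c * cauchy_kernel (Complex x s) z\<^sub>3)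
        \<le> M * exp (- \<bar>x\<bar> / real n)" for x
      using M[of "Complex x s"] s by (simp only: norm_minus_cancel) simp
    show "p \<alpha> (f (Complex x s)) \<le> Oexp_norm p N \<alpha> f * exp (\<bar>x\<bar> / real N)" for x
      using Oexp_norm_upper[OF f N(1), of "Complex x s" \<alpha>] s N(1) by simp
  qed
  have eq: "sc a (strip_extension f z\<^sub>1) + sc b (strip_extension f z\<^sub>2) + sc c (strip_extension f z\<^sub>3) =
      sc (1 / (2 * pi * \<i>)) (e (-1) - e 1)"
    by (simp add: strip_extension_def e_def scale_right_distrib scale_right_diff_distrib mult_ac)
  have "p \<alpha> (sc a (strip_extension f z\<^sub>1) + sc b (strip_extension f z\<^sub>2) + sc c (strip_extension f z\<^sub>3)) \<le>
      cmod (1 / (2 * pi * \<i>)) * (p \<alpha> (e (-1)) + p \<alpha> (e 1))"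
    unfolding eq p.homogeneous by (intro mult_left_mono p.triangle_diff norm_ge_zero)
  also have "\<dots> \<le> cmod (1 / (2 * pi * \<i>)) *
      (Oexp_norm p N \<alpha> f * (LINT x|lebesgue. exp (- (1 / real n - 1 / real N) * \<bar>x\<bar>)) * M +
       Oexp_norm p N \<alpha> f * (LINT x|lebesgue. exp (- (1 / real n - 1 / real N) * \<bar>x\<bar>)) * M)"
    by (intro mult_left_mono add_mono e_le) auto
  finally show ?thesis by (simp add: mult_ac)
qed

lemma strip_extension_differentiable:
  assumes f: "f \<in> Oexp_slit sc p" and z: "Im z = 0"
  shows "\<exists>d. ((\<lambda>h. sc (inverse h) (strip_extension f (z + h) - strip_extension f z)) \<longlongrightarrow> d) (at 0)"
proof -
  have ball: "\<bar>Im v\<bar> < 1 / 2 \<and> \<bar>Re v\<bar> \<le> \<bar>Re z\<bar> + 1" if "v \<in> ball z (2 * (1 / 4))" for v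
    using that z abs_Im_le_cmod[of "v - z"] abs_Re_le_cmod[of "v - z"]
    by (auto simp: dist_norm norm_minus_commute)
  show ?thesis
  proof (rule kernel_transform_differentiable[where r = "1 / 4" and A = "{w. \<bar>Im w\<bar> = 1}" and wt = "\<lambda>w. exp (- \<bar>Re w\<bar> / real 1)"
        and M\<^sub>0 = "exp (2\<^sup>2 + 1) / (1 / 2) * exp ((\<bar>Re z\<bar> + 1) / real 1)"])
    show "w \<notin> ball z (2 * (1 / 4))" if "w \<in> {w. \<bar>Im w\<bar> = 1}" for w
      using ball[of w] that by auto
    fix w z' assume w: "w \<in> {w. \<bar>Im w\<bar> = 1}" and z': "z' \<in> ball z (2 * (1 / 4))"
    have "\<bar>Im w\<bar> = 1" using w by simp
    then have "1 / 2 \<le> \<bar>Im z' - Im w\<bar>" "\<bar>Im z' - Im w\<bar> \<le> 2" using conjunct1[OF ball[OF z']] by linarith+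
    then have "cmod (cauchy_kernel z' w) \<le> (exp (2\<^sup>2 + 1) / (1 / 2) * exp (\<bar>Re z'\<bar> / real 1)) * exp (- \<bar>Re w\<bar> / real 1)"
      by (intro cauchy_kernel_weighted) auto
    also have "\<dots> \<le> (exp (2\<^sup>2 + 1) / (1 / 2) * exp ((\<bar>Re z\<bar> + 1) / real 1)) * exp (- \<bar>Re w\<bar> / real 1)"
      using ball[OF z'] by (intro mult_right_mono mult_left_mono) auto
    finally show "cmod (cauchy_kernel z' w) \<le> (exp (2\<^sup>2 + 1) / (1 / 2) * exp ((\<bar>Re z\<bar> + 1) / real 1)) * exp (- \<bar>Re w\<bar> / real 1)" .
  next
    fix \<alpha>
    define C where "C = 2 * cmod (1 / (2 * pi * \<i>)) * (Oexp_norm p 2 \<alpha> f * (LINT x|lebesgue. exp (- (1 / real 1 - 1 / real 2) * \<bar>x\<bar>)))"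
    have C: "0 \<le> C"
      unfolding C_def by (intro mult_nonneg_nonneg Oexp_norm_nonneg[OF f] integral_nonneg_AE) auto
    have "p \<alpha> (sc a (strip_extension f (z + h)) + sc b (strip_extension f z) + sc c (strip_extension f (z + k))) \<le> C * M"
      if hk: "cmod h < 1 / 4" "cmod k < 1 / 4" and M: "\<forall>w\<in>{w. \<bar>Im w\<bar> = 1}.
        cmod (a * cauchy_kernel (z + h) w + b * cauchy_kernel z w + c * cauchy_kernel (z + k) w) \<le> M * exp (- \<bar>Re w\<bar> / real 1)"
      for a b c h k M
      unfolding C_def
    proof (rule strip_extension_combination[OF f])
      have "z + h \<in> ball z (2 * (1 / 4))" "z \<in> ball z (2 * (1 / 4))" "z + k \<in> ball z (2 * (1 / 4))"
        using hk by (auto simp: dist_norm)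
      then show "\<bar>Im (z + h)\<bar> < 1" "\<bar>Im z\<bar> < 1" "\<bar>Im (z + k)\<bar> < 1"
        using ball by fastforce+
    qed (use M in auto)
    then show "\<exists>C\<ge>0. \<forall>a b c h k M. cmod h < 1 / 4 \<longrightarrow> cmod k < 1 / 4 \<longrightarrow>
      (\<forall>w\<in>{w. \<bar>Im w\<bar> = 1}. cmod (a * cauchy_kernel (z + h) w + b * cauchy_kernel z w + c * cauchy_kernel (z + k) w) \<le> M * exp (- \<bar>Re w\<bar> / real 1)) \<longrightarrow>
      p \<alpha> (sc a (strip_extension f (z + h)) + sc b (strip_extension f z) + sc c (strip_extension f (z + k))) \<le> C * M"
      by (intro exI[of _ C] conjI C allI impI)
  qed simp_all
qed

text \<open>
  Outside the strip \<open>\<bar>Im z\<bar> \<le> 1 / n\<close> the growth of \<open>f\<close> is known, and inside it the integral representation gives the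
  same growth. On the real line \<open>strip_extension f\<close> supplies the missing values.
\<close>

theorem R_map_zero_imp_null:
  assumes f: "f \<in> Oexp_slit sc p" and R: "R_map sc f = 0"
  shows "f \<in> Oexp_null sc p"
proof -
  define F where "F z = (if Im z = 0 then strip_extension f z else f z)" for z
  have F_strip: "F z = strip_extension f z" if "\<bar>Im z\<bar> < 1" for z
    using strip_extension_eq[OF f R _ that] by (simp add: F_def)
  have "F \<in> Oexp_entire sc p"
  proof (rule Oexp_entireI)
    show "vholomorphic_on sc F UNIV"
      unfolding vholomorphic_on_def
    proof
      fix z
      show "\<exists>d. ((\<lambda>h. sc (inverse h) (F (z + h) - F z)) \<longlongrightarrow> d) (at 0)"
      proof (cases "Im z = 0")
        case True
        show ?thesis
          by (rule vholomorphic_at_transform[of "hstrip (-1) 1", OF _ _ _ strip_extension_differentiable[OF f True]])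
            (use True F_strip in \<open>auto simp: abs_less_iff\<close>)
      next
        case False
        then have z: "z \<in> {z. Im z \<noteq> 0}" by simp
        have "\<exists>d. ((\<lambda>h. sc (inverse h) (f (z + h) - f z)) \<longlongrightarrow> d) (at 0)"
          using f z by (simp add: Oexp_slit_def vholomorphic_on_def)
        then show ?thesis
          by (rule vholomorphic_at_transform[OF open_slit z, rotated]) (simp add: F_def)
      qed
    qed
    fix n :: nat and \<alpha> assume n: "n \<ge> 2"
    define N where "N = n + 1"
    have N: "N \<ge> 2" "n \<ge> 1" "n < N" using n by (auto simp: N_def)
    define C where "C = 2 * cmod (1 / (2 * pi * \<i>)) * (Oexp_norm p N \<alpha> f * (LINT x|lebesgue. exp (- (1 / real n - 1 / real N) * \<bar>x\<bar>)))"
    define A where "A = exp (2\<^sup>2 + 1) / (1 / 2 :: real)"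
    have half: "1 / real n \<le> 1 / 2" using n by (simp add: field_simps)
    have "p \<alpha> (F z) \<le> max (Oexp_norm p n \<alpha> f) (C * A) * exp (\<bar>Re z\<bar> / n)" if z: "\<bar>Im z\<bar> < real n" for z
    proof (cases "1 / real n < \<bar>Im z\<bar>")
      case True
      then have "Im z \<noteq> 0" using half by auto
      then have "p \<alpha> (F z) \<le> Oexp_norm p n \<alpha> f * exp (\<bar>Re z\<bar> / n)"
        using Oexp_norm_upper[OF f n True z] by (simp add: F_def)
      also have "\<dots> \<le> max (Oexp_norm p n \<alpha> f) (C * A) * exp (\<bar>Re z\<bar> / n)" by (intro mult_right_mono) auto
      finally show ?thesis .
    next
      case False
      then have z1: "\<bar>Im z\<bar> \<le> 1 / 2" using half by linarith
      then have z2: "\<bar>Im z\<bar> < 1" by linarith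
      have "p \<alpha> (sc 1 (strip_extension f z) + sc 0 (strip_extension f z) + sc 0 (strip_extension f z)) \<le>
          C * (A * exp (\<bar>Re z\<bar> / n))"
        unfolding C_def
      proof (rule strip_extension_combination[OF f N z2 z2 z2])
        fix w assume w: "\<bar>Im w\<bar> = 1"
        have "1 / 2 \<le> \<bar>Im z - Im w\<bar>" "\<bar>Im z - Im w\<bar> \<le> 2" using w z1 by linarith+
        then have "cmod (cauchy_kernel z w) \<le> (A * exp (\<bar>Re z\<bar> / n)) * exp (- \<bar>Re w\<bar> / n)"
          unfolding A_def using N by (intro cauchy_kernel_weighted) auto
        then show "cmod (1 * cauchy_kernel z w + 0 * cauchy_kernel z w + 0 * cauchy_kernel z w) \<le>
            (A * exp (\<bar>Re z\<bar> / n)) * exp (- \<bar>Re w\<bar> / n)" by simp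
      qed
      then have "p \<alpha> (F z) \<le> (C * A) * exp (\<bar>Re z\<bar> / n)" by (simp add: F_strip[OF z2] mult.assoc)
      also have "\<dots> \<le> max (Oexp_norm p n \<alpha> f) (C * A) * exp (\<bar>Re z\<bar> / n)" by (intro mult_right_mono) auto
      finally show ?thesis .
    qed
    then show "\<exists>M. \<forall>z. \<bar>Im z\<bar> < real n \<longrightarrow> p \<alpha> (F z) \<le> M * exp (\<bar>Re z\<bar> / n)" by blast
  qed
  moreover have "f = (\<lambda>z. if Im z = 0 then 0 else F z)"
    using f by (auto simp: fun_eq_iff F_def Oexp_slit_def)
  ultimately show ?thesis unfolding Oexp_null_def by blast
qed

section \<open>The topological isomorphism\<close>

lemma cauchy_transform_diff:
  "cauchy_transform (\<lambda>\<Phi>. S \<Phi> - T \<Phi>) z = cauchy_transform S z - cauchy_transform T z"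
  by (simp add: cauchy_transform_def scale_right_diff_distrib)

text \<open>
  A bounded set lies in a ball of \<open>O_strip n\<close>. For \<open>\<phi>\<close> in this ball the boundary values are integrals over the lines of
  height \<open>\<plusminus> 1 / (2 n)\<close>, which are controlled by the single seminorm \<open>Oexp_norm p (3 * n) \<alpha>\<close>.
\<close>

lemma continuous_R_map:
  "continuous_map (Oexp_topology sc p) (Lb_topology test_scale sc p) (R_map sc)"
  unfolding Oexp_topology_def Lb_topology_def
proof (rule continuous_map_seminorm_topology)
  show "R_map sc f \<in> continuous_linear_maps test_scale sc" if "f \<in> Oexp_slit sc p" for f
    by (rule limitin_Rtt(2)[OF that])
  fix q assume "q \<in> {\<lambda>T. SUP x\<in>B. p \<alpha> (T x) | B \<alpha>. tvs_bounded test_scale B \<and> B \<noteq> {}}"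
  then obtain B \<alpha> where q: "q = (\<lambda>T. SUP x\<in>B. p \<alpha> (T x))" and B: "tvs_bounded test_scale B" "B \<noteq> {}" by blast
  obtain n M where n: "n \<ge> 1" and M: "B \<subseteq> abs_test ` {\<phi> \<in> O_strip n. O_strip_norm n \<phi> \<le> M}"
    by (rule bounded_test_sets[OF B(1)]) (rule that)
  have "3 * n \<ge> 2" using n by simp
  note Oexp0 = Oexp_norm_nonneg[OF _ this, of _ \<alpha>]
  define E where "E = (LINT x|lebesgue. exp (- (1 / real n - 1 / real (3 * n)) * \<bar>x\<bar>))"
  have E: "0 \<le> E" unfolding E_def by (rule integral_nonneg_AE) simp
  have "q (R_map sc g - R_map sc f) \<le> (2 * (E * \<bar>M\<bar>)) * Oexp_norm p (3 * n) \<alpha> (g - f)"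
    if f: "f \<in> Oexp_slit sc p" and g: "g \<in> Oexp_slit sc p" for f g
    unfolding q
  proof (rule cSUP_least[OF B(2)])
    fix \<Phi> assume "\<Phi> \<in> B"
    then obtain \<phi> where \<phi>: "\<phi> \<in> O_strip n" "O_strip_norm n \<phi> \<le> M" "\<Phi> = abs_test \<phi>" using M by blast
    define h where "h = (\<lambda>z. g z - f z)"
    have h: "h \<in> Oexp_slit sc p" unfolding h_def by (rule Oexp_slit_diff[OF g f])
    have gf: "g - f = h" by (simp add: h_def fun_eq_iff)
    have "(R_map sc g - R_map sc f) \<Phi> = R_map sc h \<Phi>" unfolding h_def R_map_diff[OF g f] ..
    also have "p \<alpha> \<dots> \<le> p \<alpha> (boundary_value 1 h \<Phi>) + p \<alpha> (boundary_value (-1) h \<Phi>)"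
      unfolding R_map_eq[OF h] by (rule p.triangle_diff)
    also have "\<dots> \<le> Oexp_norm p (3 * n) \<alpha> h * E * O_strip_norm n \<phi> + Oexp_norm p (3 * n) \<alpha> h * E * O_strip_norm n \<phi>"
      unfolding \<phi>(3) E_def by (intro add_mono boundary_value_bound h n \<phi>(1)) auto
    also have "\<dots> = (2 * Oexp_norm p (3 * n) \<alpha> h * E) * O_strip_norm n \<phi>" by simp
    also have "\<dots> \<le> (2 * Oexp_norm p (3 * n) \<alpha> h * E) * \<bar>M\<bar>"
      using Oexp0[OF h] E \<phi>(2) by (intro mult_left_mono) auto
    finally show "p \<alpha> ((R_map sc g - R_map sc f) \<Phi>) \<le> (2 * (E * \<bar>M\<bar>)) * Oexp_norm p (3 * n) \<alpha> (g - f)"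
      by (simp add: gf mult_ac)
  qed
  then show "\<exists>r\<in>{Oexp_norm p n \<alpha> | n \<alpha>. n \<ge> 2}. \<exists>C\<ge>0. \<forall>f\<in>Oexp_slit sc p. \<forall>g\<in>Oexp_slit sc p.
      q (R_map sc g - R_map sc f) \<le> C * r (g - f)"
    using E \<open>3 * n \<ge> 2\<close> by (intro bexI[of _ "Oexp_norm p (3 * n) \<alpha>"] exI[of _ "2 * (E * \<bar>M\<bar>)"]) auto
qed

text \<open>
  After multiplication by the weight \<open>exp (- \<bar>Re z\<bar> / n)\<close> the functions \<open>cauchy_kernel z\<close> with
  \<open>1 / n < \<bar>Im z\<bar> < n\<close> form a bounded subset of \<open>O_strip (2 * n)\<close>. The supremum over this set is a seminorm of the
  topology of bounded convergence, and it dominates \<open>Oexp_norm p n \<alpha>\<close>.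
\<close>

lemma continuous_cauchy_transform:
  "continuous_map (Lb_topology test_scale sc p) (Oexp_topology sc p) cauchy_transform"
  unfolding Oexp_topology_def Lb_topology_def
proof (rule continuous_map_seminorm_topology)
  show "cauchy_transform T \<in> Oexp_slit sc p" if "T \<in> continuous_linear_maps test_scale sc" for T
    by (rule cauchy_transform_slit[OF that])
  fix q assume "q \<in> {Oexp_norm p n \<alpha> | n \<alpha>. n \<ge> 2}"
  then obtain n \<alpha> where q: "q = Oexp_norm p n \<alpha>" and n: "n \<ge> 2" by blast
  define m where "m = 2 * n"
  have m: "m \<ge> 1" using n by (simp add: m_def)
  define S where "S = {z. 1 / real n < \<bar>Im z\<bar> \<and> \<bar>Im z\<bar> < n}"
  define \<kappa> where "\<kappa> z = (\<lambda>w. of_real (exp (- \<bar>Re z\<bar> / n)) * cauchy_kernel z w)" for z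
  define B where "B = (\<lambda>z. abs_test (\<kappa> z)) ` S"
  define A where "A = exp ((real n + 1)\<^sup>2 + 1) / (1 / m)"
  have K: "cauchy_kernel z \<in> O_strip m" "O_strip_norm m (\<kappa> z) \<le> A" if z: "z \<in> S" for z
  proof -
    have half: "1 / real n = 2 * (1 / real m)" by (simp add: m_def)
    have m0: "0 < 1 / real m" using m by simp
    have zS: "1 / real n < \<bar>Im z\<bar>" "\<bar>Im z\<bar> < n" using z by (auto simp: S_def)
    have zm: "1 / real m < \<bar>Im z\<bar>" "1 / real m \<le> \<bar>Im z\<bar> - 1 / m" using zS half m0 by auto
    note K = cauchy_kernel_O_strip[OF m zm(1)]
    show "cauchy_kernel z \<in> O_strip m" by (rule K(1))
    show "O_strip_norm m (\<kappa> z) \<le> A"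
    proof (rule O_strip_norm_leI)
      fix w assume w: "\<bar>Im w\<bar> \<le> 1 / real m"
      have "cmod (cauchy_kernel z w) \<le> (exp ((\<bar>Im z\<bar> + 1)\<^sup>2 + 1) / (\<bar>Im z\<bar> - 1 / m) * exp (\<bar>Re z\<bar> / m)) * exp (- \<bar>Re w\<bar> / m)"
        by (rule order_trans[OF O_strip_norm_bound[OF K(1) w] mult_right_mono[OF K(2)]]) simp
      also have "\<dots> \<le> (A * exp (\<bar>Re z\<bar> / n)) * exp (- \<bar>Re w\<bar> / m)"
      proof (intro mult_right_mono mult_mono)
        have "(\<bar>Im z\<bar> + 1)\<^sup>2 \<le> (real n + 1)\<^sup>2" using zS by (intro power_mono) auto
        then show "exp ((\<bar>Im z\<bar> + 1)\<^sup>2 + 1) / (\<bar>Im z\<bar> - 1 / m) \<le> A"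
          unfolding A_def using zm m0 by (intro frac_le) auto
        have "\<bar>Re z\<bar> / m \<le> \<bar>Re z\<bar> / n" using n by (intro divide_left_mono) (auto simp: m_def)
        then show "exp (\<bar>Re z\<bar> / m) \<le> exp (\<bar>Re z\<bar> / n)" by simp
      qed (use m0 in \<open>auto simp: A_def\<close>)
      finally have "exp (- \<bar>Re z\<bar> / n) * cmod (cauchy_kernel z w) \<le> exp (- \<bar>Re z\<bar> / n) * ((A * exp (\<bar>Re z\<bar> / n)) * exp (- \<bar>Re w\<bar> / m))"
        by (rule mult_left_mono) simp
      also have "\<dots> = (exp (- \<bar>Re z\<bar> / n) * exp (\<bar>Re z\<bar> / n)) * (A * exp (- \<bar>Re w\<bar> / m))" by (simp only: mult_ac)
      also have "\<dots> = A * exp (- \<bar>Re w\<bar> / m)" by (simp flip: exp_add)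
      finally show "cmod (\<kappa> z w) \<le> A * exp (- \<bar>Re w\<bar> / m)" by (simp add: \<kappa>_def norm_mult)
    qed
  qed
  have \<kappa>: "\<kappa> z \<in> O_strip m" if "z \<in> S" for z
    unfolding \<kappa>_def by (rule O_strip_scale[OF K(1)[OF that]])
  have "tvs_bounded test_scale B"
    by (rule tvs_bounded_O_strip_ball[OF m, of _ A]) (use K(2) \<kappa> in \<open>auto simp: B_def\<close>)
  moreover have "B \<noteq> {}" using n by (auto simp: B_def S_def intro!: exI[of _ \<i>])
  ultimately have B: "tvs_bounded test_scale B" "B \<noteq> {}" by auto
  define c where "c = cmod (\<i> / (2 * pi))"
  have "q (cauchy_transform T' - cauchy_transform T) \<le> c * (SUP \<Phi>\<in>B. p \<alpha> ((T' - T) \<Phi>))"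
    if T: "T \<in> continuous_linear_maps test_scale sc" and T': "T' \<in> continuous_linear_maps test_scale sc" for T T'
    unfolding q
  proof (rule Oexp_norm_leI[OF n])
    define U where "U = (\<lambda>\<Phi>. T' \<Phi> - T \<Phi>)"
    have U: "U \<in> continuous_linear_maps test_scale sc" unfolding U_def by (rule continuous_linear_diff[OF T' T])
    interpret U: Vector_Spaces.linear test_scale sc U using U by (simp add: continuous_linear_maps_def)
    have UT: "T' - T = U" by (simp add: U_def fun_eq_iff)
    fix z assume z: "1 / real n < \<bar>Im z\<bar>" "\<bar>Im z\<bar> < n"
    then have zS: "z \<in> S" by (simp add: S_def)
    have "Im z \<noteq> 0" using z by auto
    have "U (abs_test (\<kappa> z)) = sc (of_real (exp (- \<bar>Re z\<bar> / n))) (U (abs_test (cauchy_kernel z)))"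
      unfolding \<kappa>_def by (simp only: abs_test_scale[OF m K(1)[OF zS], symmetric] U.scale)
    then have "p \<alpha> (U (abs_test (\<kappa> z))) = exp (- \<bar>Re z\<bar> / n) * p \<alpha> (U (abs_test (cauchy_kernel z)))"
      by (simp add: p.homogeneous)
    moreover have "p \<alpha> (U (abs_test (\<kappa> z))) \<le> (SUP \<Phi>\<in>B. p \<alpha> (U \<Phi>))"
      by (rule cSUP_upper[OF _ continuous_linear_bounded[OF U B(1)]]) (use zS in \<open>simp add: B_def\<close>)
    ultimately have "exp (\<bar>Re z\<bar> / n) * (exp (- \<bar>Re z\<bar> / n) * p \<alpha> (U (abs_test (cauchy_kernel z)))) \<le>
        exp (\<bar>Re z\<bar> / n) * (SUP \<Phi>\<in>B. p \<alpha> (U \<Phi>))"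
      by (intro mult_left_mono) simp_all
    note scaled = this
    have cancel: "exp (\<bar>Re z\<bar> / n) * (exp (- \<bar>Re z\<bar> / n) * X) = X" for X :: real
      unfolding mult.assoc[symmetric] by (simp flip: exp_add)
    have "p \<alpha> (U (abs_test (cauchy_kernel z))) \<le> (SUP \<Phi>\<in>B. p \<alpha> (U \<Phi>)) * exp (\<bar>Re z\<bar> / n)"
      using scaled unfolding cancel by (subst mult.commute)
    then have "c * p \<alpha> (U (abs_test (cauchy_kernel z))) \<le> c * ((SUP \<Phi>\<in>B. p \<alpha> (U \<Phi>)) * exp (\<bar>Re z\<bar> / n))"
      by (rule mult_left_mono) (simp add: c_def)
    moreover have "(cauchy_transform T' - cauchy_transform T) z = sc (\<i> / (2 * pi)) (U (abs_test (cauchy_kernel z)))"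
      using \<open>Im z \<noteq> 0\<close> cauchy_transform_diff[of T' T z] by (simp add: U_def[symmetric]) (simp add: cauchy_transform_def)
    ultimately show "p \<alpha> ((cauchy_transform T' - cauchy_transform T) z) \<le> c * (SUP \<Phi>\<in>B. p \<alpha> ((T' - T) \<Phi>)) * exp (\<bar>Re z\<bar> / n)"
      by (simp add: UT p.homogeneous c_def mult.assoc)
  qed
  then show "\<exists>r\<in>{\<lambda>T. SUP x\<in>B. p \<alpha> (T x) | B \<alpha>. tvs_bounded test_scale B \<and> B \<noteq> {}}. \<exists>C\<ge>0.
      \<forall>T\<in>continuous_linear_maps test_scale sc. \<forall>T'\<in>continuous_linear_maps test_scale sc.
      q (cauchy_transform T' - cauchy_transform T) \<le> C * r (T' - T)"
    using B by (intro bexI[of _ "\<lambda>T. SUP \<Phi>\<in>B. p \<alpha> (T \<Phi>)"] exI[of _ c]) (auto simp: c_def)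
qed

text \<open>
  The inverse of the induced map is the class of the Cauchy transform. Surjectivity makes it a right
  inverse; it is a left inverse since \<open>cauchy_transform (R_map sc f) - f\<close> has the boundary value \<open>0\<close>.
\<close>

theorem homeomorphic_R_quotient:
  "homeomorphic_map (Oexp_quotient_topology sc p) (Lb_topology test_scale sc p) (R_quotient sc)"
proof (rule homeomorphic_maps_imp_map)
  have top: "topspace (Oexp_topology sc p) = Oexp_slit sc p" "topspace (Lb_topology test_scale sc p) = continuous_linear_maps test_scale sc"
    by (simp_all add: Oexp_topology_def Lb_topology_def)
  have quot: "quotient_map (Oexp_topology sc p) (Oexp_quotient_topology sc p) (Oexp_class sc p)"
    unfolding Oexp_quotient_topology_def by (rule quotient_map_quotient_topology)
  have topq: "topspace (Oexp_quotient_topology sc p) = Oexp_class sc p ` Oexp_slit sc p"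
    using quotient_imp_surjective_map[OF quot] top by simp
  have "continuous_map (Oexp_topology sc p) (Lb_topology test_scale sc p) (R_quotient sc \<circ> Oexp_class sc p)"
    by (rule continuous_map_eq[OF continuous_R_map]) (simp add: top R_quotient_class)
  then have 1: "continuous_map (Oexp_quotient_topology sc p) (Lb_topology test_scale sc p) (R_quotient sc)"
    using continuous_compose_quotient_map_eq[OF quot] by blast
  have 2: "continuous_map (Lb_topology test_scale sc p) (Oexp_quotient_topology sc p) (Oexp_class sc p \<circ> cauchy_transform)"
    by (rule continuous_map_compose[OF continuous_cauchy_transform quotient_imp_continuous_map[OF quot]])
  show "homeomorphic_maps (Oexp_quotient_topology sc p) (Lb_topology test_scale sc p) (R_quotient sc) (Oexp_class sc p \<circ> cauchy_transform)"
    unfolding homeomorphic_maps_def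
  proof (intro conjI ballI 1 2)
    fix A assume "A \<in> topspace (Oexp_quotient_topology sc p)"
    then obtain f where f: "f \<in> Oexp_slit sc p" and A: "A = Oexp_class sc p f" unfolding topq by blast
    have R: "R_map sc f \<in> continuous_linear_maps test_scale sc" by (rule limitin_Rtt(2)[OF f])
    note g = cauchy_transform_slit[OF R]
    have "R_map sc (\<lambda>z. cauchy_transform (R_map sc f) z - f z) = 0"
      by (simp add: R_map_diff[OF g f] R_map_cauchy_transform[OF R])
    then have "Oexp_class sc p (cauchy_transform (R_map sc f)) = Oexp_class sc p f"
      by (intro Oexp_class_eqI R_map_zero_imp_null Oexp_slit_diff g f)
    then show "(Oexp_class sc p \<circ> cauchy_transform) (R_quotient sc A) = A"
      by (simp add: A R_quotient_class[OF f])
  next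
    fix T assume "T \<in> topspace (Lb_topology test_scale sc p)"
    then have T: "T \<in> continuous_linear_maps test_scale sc" by (simp add: top)
    show "R_quotient sc ((Oexp_class sc p \<circ> cauchy_transform) T) = T"
      by (simp add: R_quotient_class[OF cauchy_transform_slit[OF T]] R_map_cauchy_transform[OF T])
  qed
qed

end

theorem theorem3p9:
  fixes sc :: "complex \<Rightarrow> 'e \<Rightarrow> 'e::{ab_group_add,t2_space}"
    and p :: "'i \<Rightarrow> 'e \<Rightarrow> real"
  assumes "vector_space sc"
    and "directed_fundamental_system sc p"
    and "sequentially_complete TYPE('e)"
  shows
    "(\<forall>f \<in> Oexp_slit sc p.
        (\<forall>\<phi> t t'. 0 < t \<and> 0 < t' \<longrightarrow>
           pettis_integrable sc (Rtt_integrand sc t t' f \<phi>) \<and>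
           pettis_integrable sc (Rplus_integrand sc t f \<phi>) \<and>
           pettis_integrable sc (Rminus_integrand sc t f \<phi>)) \<and>
        (\<forall>t t'. 0 < t \<and> 0 < t' \<longrightarrow>
           Rtt sc t t' f \<in> continuous_linear_maps test_scale sc \<and>
           Rplus_t sc t f \<in> continuous_linear_maps test_scale sc \<and>
           Rminus_t sc t f \<in> continuous_linear_maps test_scale sc) \<and>
        limitin (Lb_topology test_scale sc p) (\<lambda>(t, t'). Rtt sc t t' f) (R_map sc f)
          (at_right 0 \<times>\<^sub>F at_right 0) \<and>
        limitin (Lb_topology test_scale sc p) (\<lambda>t. Rplus_t sc t f) (Rplus sc f) (at_right 0) \<and>
        limitin (Lb_topology test_scale sc p) (\<lambda>t. Rminus_t sc t f) (Rminus sc f) (at_right 0) \<and>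
        (\<forall>n\<ge>1. \<forall>\<phi>\<in>O_strip n. \<forall>t. 0 < t \<and> t < 1 / n \<longrightarrow>
           pettis_integrable sc (path_integrand sc (- t) f \<phi>) \<and>
           pettis_integrable sc (path_integrand sc t f \<phi>) \<and>
           H_map sc (Oexp_class sc p f) (abs_test \<phi>) = path_integral_gamma sc t f \<phi>) \<and>
        R_map sc f = Rplus sc f - Rminus sc f \<and>
        R_map sc f = - H_map sc (Oexp_class sc p f)) \<and>
     (\<forall>f \<in> Oexp_slit sc p. R_quotient sc (Oexp_class sc p f) = R_map sc f) \<and>
     (\<forall>A \<in> Oexp_quotient sc p. \<forall>B \<in> Oexp_quotient sc p.
        R_quotient sc (A + B) = R_quotient sc A + R_quotient sc B) \<and>
     (\<forall>c. \<forall>A \<in> Oexp_quotient sc p.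
        R_quotient sc (Oexp_quotient_scale sc p c A) = (\<lambda>\<phi>. sc c (R_quotient sc A \<phi>))) \<and>
     homeomorphic_map (Oexp_quotient_topology sc p) (Lb_topology test_scale sc p) (R_quotient sc)"
proof -
  interpret vector_space sc by fact
  interpret sc_lcs sc p by unfold_locales (rule assms)+
  have minus_integrand: "Rminus_integrand sc t f = Rplus_integrand sc (- t) f" for t f
    by (simp add: fun_eq_iff Rminus_integrand_def Rplus_integrand_def)
  have minus_t: "Rminus_t sc t f = Rplus_t sc (-1 * t) f" for t f
    by (simp add: fun_eq_iff Rminus_t_def Rplus_t_def minus_integrand)
  have bv_plus: "Rplus sc f = boundary_value 1 f" for f
    by (simp add: fun_eq_iff Rplus_def boundary_value_def)
  have bv_minus: "Rminus sc f = boundary_value (-1) f" for f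
    by (simp add: fun_eq_iff Rminus_def boundary_value_def minus_t)
  show ?thesis
  proof (intro conjI ballI allI impI)
    fix f assume f: "f \<in> Oexp_slit sc p"
    show "pettis_integrable sc (Rtt_integrand sc t t' f \<Phi>)" if "0 < t \<and> 0 < t'" for \<Phi> t t'
      using Rtt_has_integral(1)[OF f, of t t' \<Phi>] that unfolding pettis_integrable_def by blast
    show "pettis_integrable sc (Rplus_integrand sc t f \<Phi>)" if "0 < t \<and> 0 < t'" for \<Phi> and t t' :: real
      using Rplus_has_integral[OF f, of t \<Phi>] that unfolding pettis_integrable_def by blast
    show "pettis_integrable sc (Rminus_integrand sc t f \<Phi>)" if "0 < t \<and> 0 < t'" for \<Phi> and t t' :: real
      using Rplus_has_integral[OF f, of "- t" \<Phi>] that unfolding pettis_integrable_def minus_integrand by auto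
    show "Rtt sc t t' f \<in> continuous_linear_maps test_scale sc" if "0 < t \<and> 0 < t'" for t t'
      using limitin_Rtt(4)[OF f] that by blast
    show "Rplus_t sc t f \<in> continuous_linear_maps test_scale sc" if "0 < t \<and> 0 < t'" for t t' :: real
      using that by (intro continuous_Rplus_t f) auto
    show "Rminus_t sc t f \<in> continuous_linear_maps test_scale sc" if "0 < t \<and> 0 < t'" for t t' :: real
      unfolding minus_t using that by (intro continuous_Rplus_t f) auto
    show "limitin (Lb_topology test_scale sc p) (\<lambda>(t, t'). Rtt sc t t' f) (R_map sc f) (at_right 0 \<times>\<^sub>F at_right 0)"
      by (rule limitin_Rtt(3)[OF f])
    show "limitin (Lb_topology test_scale sc p) (\<lambda>t. Rplus_t sc t f) (Rplus sc f) (at_right 0)"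
      using limitin_Rplus_t[OF f, of 1] by (simp add: bv_plus)
    show "limitin (Lb_topology test_scale sc p) (\<lambda>t. Rminus_t sc t f) (Rminus sc f) (at_right 0)"
      unfolding minus_t bv_minus by (rule limitin_Rplus_t[OF f]) simp
    show "R_map sc f = Rplus sc f - Rminus sc f"
      unfolding bv_plus bv_minus by (rule limitin_Rtt(1)[OF f])
    show "R_map sc f = - H_map sc (Oexp_class sc p f)"
      by (simp add: fun_eq_iff H_map_class[OF f])
    show "R_quotient sc (Oexp_class sc p f) = R_map sc f" by (rule R_quotient_class[OF f])
    fix n :: nat and \<phi> t assume n: "1 \<le> n" and \<phi>: "\<phi> \<in> O_strip n" and t: "0 < t \<and> t < 1 / n"
    note I = line_integral_independent(2)[OF f n \<phi> _ _ _ conjunct1[OF t] conjunct2[OF t]]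
    show "pettis_integrable sc (path_integrand sc (- t) f \<phi>)" "pettis_integrable sc (path_integrand sc t f \<phi>)"
      using I[of "-1" t] I[of 1 t] t unfolding pettis_integrable_def by auto
    show "H_map sc (Oexp_class sc p f) (abs_test \<phi>) = path_integral_gamma sc t f \<phi>"
      using path_integral_gamma_eq[OF f n \<phi>] t by (simp add: H_map_class[OF f])
  next
    fix A B assume "A \<in> Oexp_quotient sc p" "B \<in> Oexp_quotient sc p"
    then obtain f g where fg: "f \<in> Oexp_slit sc p" "g \<in> Oexp_slit sc p" "A = Oexp_class sc p f" "B = Oexp_class sc p g"
      unfolding Oexp_quotient_def by blast
    then show "R_quotient sc (A + B) = R_quotient sc A + R_quotient sc B"
      by (simp add: Oexp_class_add R_quotient_class Oexp_slit_add R_map_add)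
  next
    fix c A assume "A \<in> Oexp_quotient sc p"
    then obtain f where f: "f \<in> Oexp_slit sc p" "A = Oexp_class sc p f"
      unfolding Oexp_quotient_def by blast
    then show "R_quotient sc (Oexp_quotient_scale sc p c A) = (\<lambda>\<phi>. sc c (R_quotient sc A \<phi>))"
      by (simp add: Oexp_quotient_scale_class R_quotient_class Oexp_slit_scale R_map_scale)
  next
    show "homeomorphic_map (Oexp_quotient_topology sc p) (Lb_topology test_scale sc p) (R_quotient sc)"
      by (rule homeomorphic_R_quotient)
  qed
qed

end
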